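(* Let $f:X\to Y$ be a finite flat map of smooth projective curves over $\mathbb{C}$, with ramification locus $R_f\subset X$. Let $D_X=(x_1,\dots,x_m)$ be distinct points of $X$, $D_Y=(y_1,\dots,y_n)$ distinct points of $Y$, and let $\mathbf r=(r_1,\dots,r_m)\in\mathbb{N}^m$, $\mathbf s=(s_1,\dots,s_n)\in\mathbb{N}^n$ be tuples of positive integers. Assume that $f^{-1}(\{y_1,\dots,y_n\})=R_f\cup\{x_1,\dots,x_m\}$ as sets, and that $s_j=r_pe_p$ for every $j$ and every $p\in f^{-1}(y_j)$, where $e_p$ is the ramification index of $f$ at $p$, and $r_p=r_i$ if $p=x_i$, $r_p=1$ if $p\notin D_X$. Let $\mathscr X=\sqrt[\mathbf r]{D_X/X}$ and $\mathscr Y=\sqrt[\mathbf s]{D_Y/Y}$ be the root stacks, with projections $\pi_X,\pi_Y$, and let $\widetilde f:\mathscr X\to\mathscr Y$ be an étale morphism with $\pi_Y\circ\widetilde f\cong f\circ\pi_X$. Let $L_*$ be a parabolic line bundle of parabolic degree zero in $\mathrm{Par}_{\frac1{\mathbf s}}(Y,D_Y)$, with corresponding line bundle $\mathcal L$ on $\mathscr Y$. Let $\mathcal E$ be a vector bundle on $\mathscr X$ with corresponding parabolic bundle $E_*=\widehat{\mathcal E}$, let $\widehat\psi:E_*\otimes E_*\to f^*L_*$ be an $f^*L_*$-valued parabolic symplectic (respectively, orthogonal) structure, let $\widehat{\psi'}:E_*\xrightarrow{\sim}E_*^\vee\otimes f^*L_*$ be the induced isomorphism, and let $\psi':\mathcal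 E\xrightarrow{\sim}\mathcal E^\vee\otimes\widetilde f^*\mathcal L$ be the corresponding isomorphism on $\mathscr X$. Then the parabolic symplectic (respectively, orthogonal) bundle $(f_*E_*,f_*\widehat{\psi'})$ on $(Y,D_Y)$ is isomorphic to the parabolic symplectic (respectively, orthogonal) bundle $(\widehat{\widetilde f_*\mathcal E},\widehat{\widetilde f_*\psi'})$.
   Context: **Parabolic bundles.** For a point $x$ of a curve $X$, $\varpi_x$ denotes a generator of the maximal ideal of $\mathcal O_{X,x}$, and $E_{X,x}$ the stalk of $E$ at $x$. A parabolic vector bundle $E_*$ on $(X,D_X)$ with weights in $\frac1{\mathbf r}\mathbb Z^m=\prod_i\frac1{r_i}\mathbb Z$ is a vector bundle $E$ on $X$ (the underlying bundle) together with, for each $i$, a decreasing filtration by $\mathcal O_{X,x_i}$-submodules $E_{X,x_i}=E_i^0\supset E_i^1\supset\cdots\supset E_i^{r_i}=\varpi_{x_i}E_{X,x_i}$. A morphism $E_*\to F_*$ is a morphism $\alpha:E\to F$ with $\alpha(E_i^j)\subset F_i^j$ for all $i,j$. The category is $\mathrm{Par}_{\frac1{\mathbf r}}(X,D_X)$. A parabolic line bundle has a single weight $\alpha\in\frac1{r_i}\mathbb Z\cap[0,1)$ at $x_i$: $E_i^j=E_{X,x_i}$ for $j\le r_i\alpha$ and $E_i^j=\varpi_{x_i}E_{X,x_i}$ for $r_i\alpha<j\le r_i$; its parabolic degree is the degree of the underlying line bundle plus the sum of its weights at the points of $D_X$. At a point $p\notin D_X$ put $r_p=1$ and use the trivial filtration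 $E_{X,p}\supset\varpi_pE_{X,p}$. Extend filtrations to $j\in\mathbb Z$ by $E_i^{j+r_i}=\varpi_{x_i}E_i^j$. The parabolic tensor product $E_*\otimes F_*$ agrees with $E\otimes F$ away from $D_X$, and at $x_i$ has filtration $(E\otimes F)_i^j=\sum_{a+b=j}E_i^a\otimes F_i^b$ inside the generic stalk (its underlying stalk being the step $j=0$). The parabolic dual $E_*^\vee$ agrees with $E^\vee$ away from $D_X$, with $(E^\vee)_i^j=\{\lambda\in E_\eta^\vee:\lambda(E_i^a)\subset\varpi_{x_i}^{\lceil(a+j)/r_i\rceil}\mathcal O_{X,x_i}\ \forall a\in\mathbb Z\}$. **Parabolic symplectic/orthogonal bundles.** For a parabolic line bundle $L_*$ of parabolic degree zero, an $L_*$-valued parabolic symplectic (respectively, orthogonal) bundle is a parabolic bundle $F_*$ with a morphism $\widehat\phi:F_*\otimes F_*\to L_*$ that is antisymmetric (respectively, symmetric) and whose induced map $F_*\to F_*^\vee\otimes L_*$ is an isomorphism; the structure may equivalently be recorded by this induced isomorphism. Isomorphisms are isomorphisms of parabolic bundles compatible with the forms. **Root stacks.** $\sqrt[\mathbf r]{D_X/X}$ is the stack whose objects over a scheme $S$ are a morphism $g:S\to X$ and, for each $i$, a line bundle $\mathcal L_i$ on $S$ with a section $P_i$ and an isomorphism $\mathcal L_i^{\otimes r_i}\cong g^*\mathcal O_X(x_i)$ carrying $P_i^{\otimes r_i}$ to the pullback of the canonical section of $\mathcal O_X(x_i)$. Over $\operatorname{Spec}\mathcal O_{X,x_i}$ it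 is $\left[\operatorname{Spec}\frac{\mathcal O_{X,x_i}[T]}{(T^{r_i}-\varpi_{x_i})}/\mu_{r_i}\right]$. $\mathrm{Vect}(\mathscr X)$ is the category of vector bundles on $\mathscr X$. **Borne's equivalence** $\mathrm{Vect}(\mathscr X)\xrightarrow{\sim}\mathrm{Par}_{\frac1{\mathbf r}}(X,D_X)$, $\mathcal E\mapsto\widehat{\mathcal E}$ (compatible with tensor products and duals). The underlying bundle is $\pi_{X*}\mathcal E$. At $x_i$, the restriction of $\mathcal E$ is a $\mathbb Z/r_i$-graded module $M=\bigoplus_{j=0}^{r_i-1}M_j$ over $\frac{\mathcal O_{X,x_i}[T]}{(T^{r_i}-\varpi_{x_i})}$, where $M_j$ is the part on which $\exp(2\pi\sqrt{-1}/r_i)\in\mu_{r_i}$ acts by $\exp(2\pi\sqrt{-1}j/r_i)$ and $T$ has degree $1$; the stalk of the underlying bundle is $M_0$ and its filtration is $M^j:=T^jM_{r_i-j}\subset M_0$ (indices mod $r_i$), $0\le j\le r_i$. The same definition applies to $(Y,D_Y,\mathbf s)$. **Parabolic pullback of a line bundle.** If $L_*$ is a parabolic line bundle on $(Y,D_Y)$ with weight $\alpha_y$ at $y\in D_Y$, then $f^*L_*$ has underlying line bundle $f^*L\otimes\mathcal O_X\big(\sum_{y\in D_Y}\sum_{x\in f^{-1}(y)}\lfloor\alpha_ye_x\rfloor x\big)$ and weight $\{\alpha_ye_x\}$ (fractional part) at $x\in f^{-1}(y)$. It corresponds to $\widetilde f^*\mathcal L$ under Borne's equivalence. **Parabolic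 direct image.** $f_*E_*$ has underlying bundle $f_*E$. For $y=y_j$, $s=s_j$, we have $(f_*E)_{Y,y}=\bigcap_{p\in f^{-1}(y)}E_{X,p}$ inside the generic stalk $E_{\eta_X}$. For each $p\in f^{-1}(y)$, let $E_p^0\supset\cdots\supset E_p^{r_p}=\varpi_pE_{X,p}$ be the filtration at $p$. Since $s=r_pe_p$ for all such $p$, the $a$-th filtration step of $f_*E_*$ at $y$ ($0\le a\le s$) is $\bigcap_{p\in f^{-1}(y)}\varpi_p^{l_p}E_p^{k_p}$, where $a=r_pl_p+k_p$ with $0\le k_p\le r_p-1$. **Direct image of the form.** $f_*\widehat{\psi'}$ denotes the isomorphism $f_*E_*\xrightarrow{\sim}f_*(E_*^\vee\otimes f^*L_* )\cong f_*(E_*^\vee)\otimes L_*\cong(f_*E_* )^\vee\otimes L_*$ given by the direct image of $\widehat{\psi'}$, the projection formula and the duality identification $f_*(E_*^\vee)\cong(f_*E_* )^\vee$ induced by the trace; equivalently the form is the composite $f_*E_*\otimes f_*E_*\to f_*f^*L_*\to L_*$ of $f_*\widehat\psi$ with the trace. It makes $f_*E_*$ an $L_*$-valued parabolic symplectic (respectively, orthogonal) bundle. Similarly $\widetilde f_*\psi':\widetilde f_*\mathcal E\xrightarrow{\sim}(\widetilde f_*\mathcal E)^\vee\otimes\mathcal L$ is defined by the direct image, projection formula and trace duality for the finite étale morphism $\widetilde f$, and $\widehat{\widetilde f_*\psi'}$ is the corresponding isomorphism of parabolic bundles. *)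

theory Defs
  imports Complex_Main "HOL-Library.Function_Algebras" "HOL-Computational_Algebra.Polynomial"
begin

section \<open>Curves\<close>

text \<open>
  A smooth projective (irreducible) curve over the complex numbers is given as the complete
  abstract nonsingular curve of its function field: the type \<^term>\<open>UNIV :: 'k set\<close> is the stalk
  \<open>K\<close> of the structure sheaf at the generic point, \<open>emb\<close> is the embedding of the constants, and
  the closed points are the discrete valuation rings of \<open>K\<close> that contain the constants; a closed
  point \<open>p\<close> is identified with its local ring \<open>O\<^sub>p\<close>.  The record also carries the tuple \<open>marks\<close> of marked
  points and the tuple \<open>mults\<close> of root orders.
\<close>

record 'k curve =
  emb :: "complex \<Rightarrow> 'k"
  marks :: "'k set list"
  mults :: "nat list"

definition ring_map :: "('a::field \<Rightarrow> 'b::field) \<Rightarrow> bool" where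
  "ring_map h \<longleftrightarrow> h 1 = 1 \<and> (\<forall>a b. h (a + b) = h a + h b) \<and> (\<forall>a b. h (a * b) = h a * h b)"

definition simple_subfield :: "(complex \<Rightarrow> 'k::field) \<Rightarrow> 'k \<Rightarrow> 'k set" where
  "simple_subfield c t = {poly (map_poly c P) t / poly (map_poly c Q) t | P Q. True}"

definition function_field :: "(complex \<Rightarrow> 'k::field) \<Rightarrow> bool" where
  "function_field c \<longleftrightarrow> ring_map c \<and>
    (\<exists>t. (\<forall>P. poly (map_poly c P) t = 0 \<longrightarrow> P = 0) \<and>
         (\<exists>B. finite B \<and>
            (\<forall>x. \<exists>a. (\<forall>b\<in>B. a b \<in> simple_subfield c t) \<and> x = (\<Sum>b\<in>B. a b * b))))"

definition unit_of :: "'k::field set \<Rightarrow> 'k \<Rightarrow> bool" where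
  "unit_of p u \<longleftrightarrow> u \<in> p \<and> u \<noteq> 0 \<and> inverse u \<in> p"

definition subring_of :: "'k::field set \<Rightarrow> bool" where
  "subring_of p \<longleftrightarrow> 1 \<in> p \<and> (\<forall>a\<in>p. \<forall>b\<in>p. a - b \<in> p \<and> a * b \<in> p)"

definition uniformizer :: "'k::field set \<Rightarrow> 'k \<Rightarrow> bool" where
  "uniformizer p w \<longleftrightarrow> w \<in> p \<and> w \<noteq> 0 \<and> inverse w \<notin> p \<and>
    (\<forall>x. x \<noteq> 0 \<longrightarrow> (\<exists>u n. unit_of p u \<and> x = u * w powi n))"

definition points :: "('k::field, 'z) curve_scheme \<Rightarrow> 'k set set" where
  "points X = {p. subring_of p \<and> range (emb X) \<subseteq> p \<and> (\<exists>w. uniformizer p w)}"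

definition unif :: "'k::field set \<Rightarrow> 'k" where
  "unif p = (SOME w. uniformizer p w)"

text \<open>The fractional ideal generated by the \<open>n\<close>-th power of a uniformizer.\<close>

definition max_ideal_power :: "'k::field set \<Rightarrow> int \<Rightarrow> 'k set" where
  "max_ideal_power p n = {unif p powi n * u | u. u \<in> p}"

definition root_order :: "('k, 'z) curve_scheme \<Rightarrow> 'k set \<Rightarrow> nat" where
  "root_order X p = (case map_of (zip (marks X) (mults X)) p of Some n \<Rightarrow> n | None \<Rightarrow> 1)"

definition marked_curve :: "('k::field, 'z) curve_scheme \<Rightarrow> bool" where
  "marked_curve X \<longleftrightarrow> function_field (emb X) \<and>
     distinct (marks X) \<and> set (marks X) \<subseteq> points X \<and>
     length (mults X) = length (marks X) \<and> (\<forall>n\<in>set (mults X). 0 < n)"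

text \<open>
  A finite morphism \<open>f : X \<rightarrow> Y\<close> of smooth projective curves (necessarily surjective and flat, the
  local rings of \<open>X\<close> being torsion-free over the discrete valuation rings of \<open>Y\<close>) is given by its
  comorphism \<open>\<phi>\<close> from the function field of \<open>Y\<close> to that of \<open>X\<close>; the image of a closed point \<open>p\<close> is
  the point with local ring \<open>\<phi> -` p\<close>.
\<close>

definition finite_map ::
  "('k::field, 'z) curve_scheme \<Rightarrow> ('l::field, 'y) curve_scheme \<Rightarrow> ('l \<Rightarrow> 'k) \<Rightarrow> bool" where
  "finite_map X Y \<phi> \<longleftrightarrow> ring_map \<phi> \<and> (\<forall>c. \<phi> (emb Y c) = emb X c) \<and>
     (\<exists>B. finite B \<and> module.span (\<lambda>a x. \<phi> a * x) B = UNIV)"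

definition fiber ::
  "('k::field, 'z) curve_scheme \<Rightarrow> ('l \<Rightarrow> 'k) \<Rightarrow> 'l set \<Rightarrow> 'k set set" where
  "fiber X \<phi> y = {p \<in> points X. \<phi> -` p = y}"

definition ram_index :: "('l::field \<Rightarrow> 'k::field) \<Rightarrow> 'k set \<Rightarrow> nat" where
  "ram_index \<phi> p = (THE e. \<exists>u. unit_of p u \<and> \<phi> (unif (\<phi> -` p)) = u * unif p ^ e)"

definition ram_locus :: "('k::field, 'z) curve_scheme \<Rightarrow> ('l::field \<Rightarrow> 'k) \<Rightarrow> 'k set set" where
  "ram_locus X \<phi> = {p \<in> points X. 1 < ram_index \<phi> p}"

definition field_trace :: "('l::field \<Rightarrow> 'k::field) \<Rightarrow> 'k \<Rightarrow> 'l" where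
  "field_trace \<phi> c =
    (let B = (SOME B. \<not> module.dependent (\<lambda>a x. \<phi> a * x) B \<and>
                      module.span (\<lambda>a x. \<phi> a * x) B = UNIV)
     in \<Sum>b\<in>B. module.representation (\<lambda>a x. \<phi> a * x) B (c * b) b)"


section \<open>Linear algebra at the generic point\<close>

text \<open>
  A vector space over \<open>K\<close> is a subspace \<open>V\<close> of an ambient type with scalar multiplication.
  Linear duals, tensor products and base changes live in function types with pointwise
  operations.
\<close>

definition fscale :: "'k::times \<Rightarrow> ('a \<Rightarrow> 'k) \<Rightarrow> 'a \<Rightarrow> 'k" where
  "fscale c g = (\<lambda>x. c * g x)"

definition linear_on ::
  "('k \<Rightarrow> 'a \<Rightarrow> 'a::plus) \<Rightarrow> 'a set \<Rightarrow> ('k \<Rightarrow> 'b \<Rightarrow> 'b::plus) \<Rightarrow> ('a \<Rightarrow> 'b) \<Rightarrow> bool" where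
  "linear_on s1 V s2 g \<longleftrightarrow> (\<forall>u\<in>V. \<forall>v\<in>V. g (u + v) = g u + g v) \<and>
     (\<forall>a. \<forall>v\<in>V. g (s1 a v) = s2 a (g v))"

definition basis_of ::
  "('k::field \<Rightarrow> 'a \<Rightarrow> 'a::ab_group_add) \<Rightarrow> 'a set \<Rightarrow> 'a set \<Rightarrow> bool" where
  "basis_of s V B \<longleftrightarrow> finite B \<and> \<not> module.dependent s B \<and> module.span s B = V"

definition dual_space ::
  "('k::field \<Rightarrow> 'a \<Rightarrow> 'a::ab_group_add) \<Rightarrow> 'a set \<Rightarrow> ('a \<Rightarrow> 'k) set" where
  "dual_space s V = {g. linear_on s V (*) g \<and> (\<forall>v. v \<notin> V \<longrightarrow> g v = 0)}"

definition bilinear_form ::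
  "('k::field \<Rightarrow> 'a \<Rightarrow> 'a::ab_group_add) \<Rightarrow> ('k \<Rightarrow> 'b \<Rightarrow> 'b::ab_group_add) \<Rightarrow>
     ('a \<Rightarrow> 'b \<Rightarrow> 'k) \<Rightarrow> bool" where
  "bilinear_form s1 s2 b \<longleftrightarrow> (\<forall>w. Vector_Spaces.linear s1 (*) (\<lambda>v. b v w)) \<and>
     (\<forall>v. Vector_Spaces.linear s2 (*) (b v))"

text \<open>
  The pure tensor of \<open>v\<close> and \<open>w\<close> is evaluation of bilinear forms at \<open>(v, w)\<close>: over a field, the
  canonical map from the tensor product to the dual of the space of bilinear forms is injective.
\<close>

definition tens ::
  "('k::field \<Rightarrow> 'a \<Rightarrow> 'a::ab_group_add) \<Rightarrow> ('k \<Rightarrow> 'b \<Rightarrow> 'b::ab_group_add) \<Rightarrow>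
     'a \<Rightarrow> 'b \<Rightarrow> ('a \<Rightarrow> 'b \<Rightarrow> 'k) \<Rightarrow> 'k" where
  "tens s1 s2 v w = (\<lambda>b. if bilinear_form s1 s2 b then b v w else 0)"

definition tensor_space ::
  "('k::field \<Rightarrow> 'a \<Rightarrow> 'a::ab_group_add) \<Rightarrow> 'a set \<Rightarrow>
   ('k \<Rightarrow> 'b \<Rightarrow> 'b::ab_group_add) \<Rightarrow> 'b set \<Rightarrow> (('a \<Rightarrow> 'b \<Rightarrow> 'k) \<Rightarrow> 'k) set" where
  "tensor_space s1 V s2 W = module.span fscale {tens s1 s2 v w | v w. v \<in> V \<and> w \<in> W}"

text \<open>
  Base change \<open>K \<otimes> W\<close> along \<open>\<phi> : K' \<rightarrow> K\<close>, in the same style: \<open>c \<otimes> w\<close> is evaluation at \<open>w\<close> of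
  \<open>\<phi>\<close>-semilinear functionals with values in \<open>K\<close>, multiplied by \<open>c\<close>.
\<close>

definition bctens ::
  "('l::field \<Rightarrow> 'k::field) \<Rightarrow> ('l \<Rightarrow> 'a \<Rightarrow> 'a::ab_group_add) \<Rightarrow>
     'k \<Rightarrow> 'a \<Rightarrow> ('a \<Rightarrow> 'k) \<Rightarrow> 'k" where
  "bctens \<phi> s c w =
     (\<lambda>g. if Vector_Spaces.linear s (\<lambda>a x. \<phi> a * x) g then c * g w else 0)"

definition base_change ::
  "('l::field \<Rightarrow> 'k::field) \<Rightarrow> ('l \<Rightarrow> 'a \<Rightarrow> 'a::ab_group_add) \<Rightarrow> 'a set \<Rightarrow>
     (('a \<Rightarrow> 'k) \<Rightarrow> 'k) set" where
  "base_change \<phi> s W = module.span fscale {bctens \<phi> s 1 w | w. w \<in> W}"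

text \<open>
  \<open>contract s W t v\<close> is the value at \<open>v\<close> of the linear map \<open>V \<rightarrow> W\<close> that corresponds to an element
  \<open>t\<close> of \<open>V\<^sup>\<or> \<otimes> W\<close>; on pure tensors \<open>g \<otimes> w\<close> it is \<open>g(v) w\<close>.
\<close>

definition contract ::
  "('k::field \<Rightarrow> 'b \<Rightarrow> 'b::ab_group_add) \<Rightarrow> 'b set \<Rightarrow>
     ((('a \<Rightarrow> 'k) \<Rightarrow> 'b \<Rightarrow> 'k) \<Rightarrow> 'k) \<Rightarrow> 'a \<Rightarrow> 'b" where
  "contract s W t v = (THE w. w \<in> W \<and>
     (\<forall>\<mu>. Vector_Spaces.linear s (*) \<mu> \<longrightarrow> \<mu> w = t (\<lambda>g x. g v * \<mu> x)))"

inductive_set addspan :: "'a::comm_monoid_add set \<Rightarrow> 'a set" for S where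
  zero: "0 \<in> addspan S"
| add: "x \<in> S \<Longrightarrow> y \<in> addspan S \<Longrightarrow> x + y \<in> addspan S"

definition submodule_gen ::
  "('k \<Rightarrow> 'a \<Rightarrow> 'a::comm_monoid_add) \<Rightarrow> 'k set \<Rightarrow> 'a set \<Rightarrow> 'a set" where
  "submodule_gen s p S = addspan {s a v | a v. a \<in> p \<and> v \<in> S}"

definition submodule_of ::
  "('k \<Rightarrow> 'a \<Rightarrow> 'a::comm_monoid_add) \<Rightarrow> 'k set \<Rightarrow> 'a set \<Rightarrow> bool" where
  "submodule_of s p M \<longleftrightarrow> 0 \<in> M \<and> (\<forall>u\<in>M. \<forall>v\<in>M. u + v \<in> M) \<and> (\<forall>a\<in>p. \<forall>v\<in>M. s a v \<in> M)"

text \<open>Multiplication of a lattice by the \<open>n\<close>-th power of the maximal ideal.\<close>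

definition twist :: "('k::field \<Rightarrow> 'a \<Rightarrow> 'a) \<Rightarrow> 'k set \<Rightarrow> int \<Rightarrow> 'a set \<Rightarrow> 'a set" where
  "twist s p n M = s (unif p powi n) ` M"


section \<open>Parabolic bundles\<close>

text \<open>
  A locally free sheaf of finite rank is given by its stalk \<open>gen\<close> at the generic point and its
  stalks at the closed points, free submodules of \<open>gen\<close> that agree with the span of one fixed
  basis at almost all points.  \<open>fil p j\<close> is the \<open>j\<close>-th filtration step, \<open>0 \<le> j \<le> r\<^sub>p\<close>, where
  \<open>r\<^sub>p = 1\<close> away from the marked points; \<open>fil p 0\<close> is the stalk of the underlying bundle.
  Morphisms of bundles are the linear maps of generic stalks that respect the stalks.
\<close>

record ('k, 'v) generic_bundle =
  scal :: "'k \<Rightarrow> 'v \<Rightarrow> 'v"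
  gen :: "'v set"

record ('k, 'v) par_bundle = "('k, 'v) generic_bundle" +
  fil :: "'k set \<Rightarrow> nat \<Rightarrow> 'v set"

definition vector_bundle ::
  "('k::field, 'z) curve_scheme \<Rightarrow> ('k \<Rightarrow> 'v \<Rightarrow> 'v::ab_group_add) \<Rightarrow> 'v set \<Rightarrow>
     ('k set \<Rightarrow> 'v set) \<Rightarrow> bool" where
  "vector_bundle X s V St \<longleftrightarrow> vector_space s \<and>
     (\<forall>p\<in>points X. \<exists>C. basis_of s V C \<and> St p = submodule_gen s p C) \<and>
     (\<exists>B. basis_of s V B \<and> finite {p\<in>points X. St p \<noteq> submodule_gen s p B})"

definition parabolic_bundle ::
  "('k::field, 'z) curve_scheme \<Rightarrow> ('k, 'v::ab_group_add) par_bundle \<Rightarrow> bool" where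
  "parabolic_bundle X E \<longleftrightarrow> vector_bundle X (scal E) (gen E) (\<lambda>p. fil E p 0) \<and>
     (\<forall>p\<in>points X.
        (\<forall>j\<le>root_order X p. submodule_of (scal E) p (fil E p j)) \<and>
        (\<forall>j<root_order X p. fil E p (Suc j) \<subseteq> fil E p j) \<and>
        fil E p (root_order X p) = twist (scal E) p 1 (fil E p 0))"

definition par_morphism ::
  "('k::field, 'z) curve_scheme \<Rightarrow> ('k, 'v::ab_group_add) par_bundle \<Rightarrow>
     ('k, 'w::ab_group_add) par_bundle \<Rightarrow> ('v \<Rightarrow> 'w) \<Rightarrow> bool" where
  "par_morphism X E F \<alpha> \<longleftrightarrow> linear_on (scal E) (gen E) (scal F) \<alpha> \<and> \<alpha> ` gen E \<subseteq> gen F \<and>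
     (\<forall>p\<in>points X. \<forall>j\<le>root_order X p. \<alpha> ` fil E p j \<subseteq> fil F p j)"

definition par_iso ::
  "('k::field, 'z) curve_scheme \<Rightarrow> ('k, 'v::ab_group_add) par_bundle \<Rightarrow>
     ('k, 'w::ab_group_add) par_bundle \<Rightarrow> ('v \<Rightarrow> 'w) \<Rightarrow> bool" where
  "par_iso X E F \<alpha> \<longleftrightarrow> par_morphism X E F \<alpha> \<and>
     (\<exists>\<beta>. par_morphism X F E \<beta> \<and> (\<forall>v\<in>gen E. \<beta> (\<alpha> v) = v) \<and> (\<forall>w\<in>gen F. \<alpha> (\<beta> w) = w))"

text \<open>The filtration extended to all integers by \<open>E\<^sup>n\<^sup>+\<^sup>r = \<varpi> E\<^sup>n\<close>.\<close>

definition filZ ::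
  "('k::field, 'z) curve_scheme \<Rightarrow> ('k, 'v) par_bundle \<Rightarrow> 'k set \<Rightarrow> int \<Rightarrow> 'v set" where
  "filZ X E p n = twist (scal E) p (n div int (root_order X p))
                    (fil E p (nat (n mod int (root_order X p))))"

definition par_tensor ::
  "('k::field, 'z) curve_scheme \<Rightarrow> ('k, 'v::ab_group_add) par_bundle \<Rightarrow>
     ('k, 'w::ab_group_add) par_bundle \<Rightarrow> ('k, ('v \<Rightarrow> 'w \<Rightarrow> 'k) \<Rightarrow> 'k) par_bundle" where
  "par_tensor X E F =
     \<lparr>scal = fscale,
      gen = tensor_space (scal E) (gen E) (scal F) (gen F),
      fil = (\<lambda>p j. addspan {tens (scal E) (scal F) v w | v w a b.
               a + b = int j \<and> v \<in> filZ X E p a \<and> w \<in> filZ X F p b})\<rparr>"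

definition par_dual ::
  "('k::field, 'z) curve_scheme \<Rightarrow> ('k, 'v::ab_group_add) par_bundle \<Rightarrow>
     ('k, 'v \<Rightarrow> 'k) par_bundle" where
  "par_dual X E =
     \<lparr>scal = fscale,
      gen = dual_space (scal E) (gen E),
      fil = (\<lambda>p j. {g \<in> dual_space (scal E) (gen E). \<forall>a. \<forall>v \<in> filZ X E p a.
               g v \<in> max_ideal_power p \<lceil>real_of_int (a + int j) / real (root_order X p)\<rceil>})\<rparr>"

definition par_line_bundle ::
  "('k::field, 'z) curve_scheme \<Rightarrow> ('k, 'v::ab_group_add) par_bundle \<Rightarrow> bool" where
  "par_line_bundle X L \<longleftrightarrow> parabolic_bundle X L \<and> vector_space.dim (scal L) (gen L) = 1 \<and>
     (\<forall>p\<in>points X. \<exists>k<root_order X p.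
        (\<forall>j\<le>k. fil L p j = fil L p 0) \<and>
        (\<forall>j. k < j \<and> j \<le> root_order X p \<longrightarrow> fil L p j = twist (scal L) p 1 (fil L p 0)))"

definition weight ::
  "('k::field, 'z) curve_scheme \<Rightarrow> ('k, 'v) par_bundle \<Rightarrow> 'k set \<Rightarrow> real" where
  "weight X L p =
     real (GREATEST k. k < root_order X p \<and> fil L p k = fil L p 0) / real (root_order X p)"

definition order_at ::
  "('k::field, 'v) par_bundle \<Rightarrow> 'v \<Rightarrow> 'k set \<Rightarrow> int" where
  "order_at L g p = (THE n. fil L p 0 = {scal L (a * unif p powi (- n)) g | a. a \<in> p})"

text \<open>Degree of the divisor of a nonzero rational section.\<close>

definition line_degree ::
  "('k::field, 'z) curve_scheme \<Rightarrow> ('k, 'v::ab_group_add) par_bundle \<Rightarrow> int" where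
  "line_degree X L =
     (let g = (SOME g. g \<in> gen L \<and> g \<noteq> 0)
      in \<Sum>p | p \<in> points X \<and> order_at L g p \<noteq> 0. order_at L g p)"

definition par_degree ::
  "('k::field, 'z) curve_scheme \<Rightarrow> ('k, 'v::ab_group_add) par_bundle \<Rightarrow> real" where
  "par_degree X L = of_int (line_degree X L) + (\<Sum>p\<in>set (marks X). weight X L p)"

text \<open>
  Outside the marked points of \<open>Y\<close> the weight \<open>\<alpha>\<close> is zero, so that the formula gives the trivial
  filtration on the pullback there.
\<close>

definition par_pullback ::
  "('k::field, 'z) curve_scheme \<Rightarrow> ('l::field, 'y) curve_scheme \<Rightarrow> ('l \<Rightarrow> 'k) \<Rightarrow>
     ('l, 'w::ab_group_add) par_bundle \<Rightarrow> ('k, ('w \<Rightarrow> 'k) \<Rightarrow> 'k) par_bundle" where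
  "par_pullback X Y \<phi> L =
     \<lparr>scal = fscale,
      gen = base_change \<phi> (scal L) (gen L),
      fil = (\<lambda>p j.
        let \<alpha>e = weight Y L (\<phi> -` p) * real (ram_index \<phi> p);
            pb = submodule_gen fscale p (bctens \<phi> (scal L) 1 ` fil L (\<phi> -` p) 0);
            St = twist fscale p (- \<lfloor>\<alpha>e\<rfloor>) pb
        in if real j \<le> real (root_order X p) * frac \<alpha>e then St else twist fscale p 1 St)\<rparr>"

definition par_direct_image ::
  "('k::field, 'z) curve_scheme \<Rightarrow> ('l::field \<Rightarrow> 'k) \<Rightarrow>
     ('k, 'v) par_bundle \<Rightarrow> ('l, 'v) par_bundle" where
  "par_direct_image X \<phi> E =
     \<lparr>scal = (\<lambda>a. scal E (\<phi> a)),
      gen = gen E,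
      fil = (\<lambda>y a. \<Inter>p\<in>fiber X \<phi> y.
               twist (scal E) p (int (a div root_order X p)) (fil E p (a mod root_order X p)))\<rparr>"


section \<open>Parabolic symplectic and orthogonal bundles\<close>

datatype form_kind = Symplectic | Orthogonal

fun form_sign :: "form_kind \<Rightarrow> 'a::ab_group_add \<Rightarrow> 'a" where
  "form_sign Symplectic w = - w"
| "form_sign Orthogonal w = w"

definition induced_map ::
  "('k::field, 'v::ab_group_add, 'z) generic_bundle_scheme \<Rightarrow>
   ('k, 'w::ab_group_add, 'y) generic_bundle_scheme \<Rightarrow>
   ((('v \<Rightarrow> 'v \<Rightarrow> 'k) \<Rightarrow> 'k) \<Rightarrow> 'w) \<Rightarrow> 'v \<Rightarrow> (('v \<Rightarrow> 'k) \<Rightarrow> 'w \<Rightarrow> 'k) \<Rightarrow> 'k" where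
  "induced_map F L \<beta> v =
     (THE t. t \<in> tensor_space fscale (dual_space (scal F) (gen F)) (scal L) (gen L) \<and>
        (\<forall>w\<in>gen F. contract (scal L) (gen L) t w = \<beta> (tens (scal F) (scal F) v w)))"

definition par_form ::
  "('k::field, 'z) curve_scheme \<Rightarrow> form_kind \<Rightarrow> ('k, 'w::ab_group_add) par_bundle \<Rightarrow>
   ('k, 'v::ab_group_add) par_bundle \<Rightarrow> ((('v \<Rightarrow> 'v \<Rightarrow> 'k) \<Rightarrow> 'k) \<Rightarrow> 'w) \<Rightarrow> bool" where
  "par_form X \<kappa> L F \<beta> \<longleftrightarrow> parabolic_bundle X F \<and>
     par_morphism X (par_tensor X F F) L \<beta> \<and>
     (\<forall>v\<in>gen F. \<forall>w\<in>gen F.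
        \<beta> (tens (scal F) (scal F) v w) = form_sign \<kappa> (\<beta> (tens (scal F) (scal F) w v))) \<and>
     par_iso X F (par_tensor X (par_dual X F) L) (induced_map F L \<beta>)"

text \<open>The same structure recorded by the induced isomorphism \<open>\<theta> : F \<rightarrow> F\<^sup>\<or> \<otimes> L\<close>.\<close>

definition par_form_bundle ::
  "('k::field, 'z) curve_scheme \<Rightarrow> form_kind \<Rightarrow> ('k, 'w::ab_group_add) par_bundle \<Rightarrow>
   ('k, 'v::ab_group_add) par_bundle \<Rightarrow> ('v \<Rightarrow> (('v \<Rightarrow> 'k) \<Rightarrow> 'w \<Rightarrow> 'k) \<Rightarrow> 'k) \<Rightarrow> bool" where
  "par_form_bundle X \<kappa> L F \<theta> \<longleftrightarrow>
     (\<exists>\<beta>. par_form X \<kappa> L F \<beta> \<and> (\<forall>v\<in>gen F. \<theta> v = induced_map F L \<beta> v))"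

definition par_form_iso ::
  "('k::field, 'z) curve_scheme \<Rightarrow> ('k, 'w::ab_group_add) par_bundle \<Rightarrow>
   ('k, 'v::ab_group_add) par_bundle \<Rightarrow> ('v \<Rightarrow> (('v \<Rightarrow> 'k) \<Rightarrow> 'w \<Rightarrow> 'k) \<Rightarrow> 'k) \<Rightarrow>
   ('k, 'u::ab_group_add) par_bundle \<Rightarrow> ('u \<Rightarrow> (('u \<Rightarrow> 'k) \<Rightarrow> 'w \<Rightarrow> 'k) \<Rightarrow> 'k) \<Rightarrow>
   ('v \<Rightarrow> 'u) \<Rightarrow> bool" where
  "par_form_iso X L F \<theta> G \<eta> \<alpha> \<longleftrightarrow> par_iso X F G \<alpha> \<and>
     (\<forall>v\<in>gen F. \<forall>w\<in>gen F.
        contract (scal L) (gen L) (\<eta> (\<alpha> v)) (\<alpha> w) = contract (scal L) (gen L) (\<theta> v) w)"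

text \<open>
  Direct image of \<open>\<theta> : V \<rightarrow> V\<^sup>\<or> \<otimes> f\<^sup>*W\<close> on generic stalks: \<open>\<theta>\<close> followed by the projection formula
  \<open>g \<otimes> (c \<otimes> w) \<mapsto> (c g) \<otimes> w\<close> and by \<open>tr \<otimes> id\<close>, where \<open>tr\<close> is the trace duality \<open>g \<mapsto> Tr \<circ> g\<close>.
  The same map is the direct image of a form on a root stack, because the generic fibre of the
  morphism of root stacks is the generic fibre of \<open>f\<close> and morphisms are maps of generic stalks.
\<close>

definition projection_formula ::
  "('l::field \<Rightarrow> 'k::field) \<Rightarrow> ('k, 'v::ab_group_add, 'z) generic_bundle_scheme \<Rightarrow>
   ('l, 'w::ab_group_add, 'y) generic_bundle_scheme \<Rightarrow>
   ((('v \<Rightarrow> 'k) \<Rightarrow> (('w \<Rightarrow> 'k) \<Rightarrow> 'k) \<Rightarrow> 'k) \<Rightarrow> 'k) \<Rightarrow> (('v \<Rightarrow> 'k) \<Rightarrow> 'w \<Rightarrow> 'l) \<Rightarrow> 'l" where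
  "projection_formula \<phi> E L = (SOME h.
     linear_on (\<lambda>a. fscale (\<phi> a))
       (tensor_space fscale (dual_space (scal E) (gen E))
                     fscale (base_change \<phi> (scal L) (gen L)))
       fscale h \<and>
     (\<forall>g\<in>dual_space (scal E) (gen E). \<forall>c. \<forall>w\<in>gen L.
        h (tens fscale fscale g (bctens \<phi> (scal L) c w)) =
        tens (\<lambda>a. fscale (\<phi> a)) (scal L) (fscale c g) w))"

definition trace_dual ::
  "('l::field \<Rightarrow> 'k::field) \<Rightarrow> ('v \<Rightarrow> 'k) \<Rightarrow> 'v \<Rightarrow> 'l" where
  "trace_dual \<phi> g = (\<lambda>v. field_trace \<phi> (g v))"

definition trace_dual_tensor ::
  "('l::field \<Rightarrow> 'k::field) \<Rightarrow> ('l, 'w::ab_group_add, 'y) generic_bundle_scheme \<Rightarrow>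
   ((('v \<Rightarrow> 'k) \<Rightarrow> 'w \<Rightarrow> 'l) \<Rightarrow> 'l) \<Rightarrow> (('v \<Rightarrow> 'l) \<Rightarrow> 'w \<Rightarrow> 'l) \<Rightarrow> 'l" where
  "trace_dual_tensor \<phi> L t =
     (\<lambda>b. if bilinear_form fscale (scal L) b then t (\<lambda>g w. b (trace_dual \<phi> g) w) else 0)"

definition direct_image_form ::
  "('l::field \<Rightarrow> 'k::field) \<Rightarrow> ('k, 'v::ab_group_add, 'z) generic_bundle_scheme \<Rightarrow>
   ('l, 'w::ab_group_add, 'y) generic_bundle_scheme \<Rightarrow>
   ('v \<Rightarrow> (('v \<Rightarrow> 'k) \<Rightarrow> (('w \<Rightarrow> 'k) \<Rightarrow> 'k) \<Rightarrow> 'k) \<Rightarrow> 'k) \<Rightarrow>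
   'v \<Rightarrow> (('v \<Rightarrow> 'l) \<Rightarrow> 'w \<Rightarrow> 'l) \<Rightarrow> 'l" where
  "direct_image_form \<phi> E L \<theta> v = trace_dual_tensor \<phi> L (projection_formula \<phi> E L (\<theta> v))"


section \<open>Vector bundles on root stacks\<close>

text \<open>
  Over a point \<open>p\<close> with root order \<open>r\<close> the root stack is the quotient by \<open>\<mu>\<^sub>r\<close> of the spectrum of
  \<open>A\<^sub>p = O\<^sub>p[T]/(T\<^sup>r - \<varpi>\<^sub>p)\<close>.  Elements of \<open>V[T]/(T\<^sup>r - \<varpi>\<^sub>p)\<close> are represented by their coefficients in
  degrees below \<open>r\<close>; \<open>trunc r V\<close> is the set of all of them, and \<open>A\<^sub>p\<close> is \<open>trunc r p\<close>.
  \<open>gprod p r s B\<close> is the product of two such elements that extends the product \<open>B\<close> of coefficients.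
\<close>

definition trunc :: "nat \<Rightarrow> 'a::zero set \<Rightarrow> (nat \<Rightarrow> 'a) set" where
  "trunc r V = {m. (\<forall>j<r. m j \<in> V) \<and> (\<forall>j\<ge>r. m j = 0)}"

definition gprod ::
  "'k::field set \<Rightarrow> nat \<Rightarrow> ('k \<Rightarrow> 'c \<Rightarrow> 'c::comm_monoid_add) \<Rightarrow> ('a \<Rightarrow> 'b \<Rightarrow> 'c) \<Rightarrow>
     (nat \<Rightarrow> 'a) \<Rightarrow> (nat \<Rightarrow> 'b) \<Rightarrow> nat \<Rightarrow> 'c" where
  "gprod p r s B a m = (\<lambda>j. if j < r then
     (\<Sum>i<r. \<Sum>k<r. if (i + k) mod r = j then s (unif p ^ ((i + k) div r)) (B (a i) (m k)) else 0)
     else 0)"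

definition Tpow :: "'k::field set \<Rightarrow> nat \<Rightarrow> nat \<Rightarrow> nat \<Rightarrow> 'k" where
  "Tpow p r n = (\<lambda>j. if j = n mod r then unif p ^ (n div r) else 0)"

definition deg_zero :: "'a::zero \<Rightarrow> nat \<Rightarrow> 'a" where
  "deg_zero v = (\<lambda>j. if j = 0 then v else 0)"

text \<open>The action of the generator \<open>exp(2\<pi>i/r)\<close> of \<open>\<mu>\<^sub>r\<close>, which fixes \<open>V\<close> and sends \<open>T\<close> to \<open>exp(2\<pi>i/r) T\<close>.\<close>

definition zeta :: "nat \<Rightarrow> complex" where
  "zeta r = exp (2 * of_real pi * \<i> / of_nat r)"

definition mu_action ::
  "('k, 'z) curve_scheme \<Rightarrow> nat \<Rightarrow> ('k \<Rightarrow> 'v \<Rightarrow> 'v) \<Rightarrow> (nat \<Rightarrow> 'v) \<Rightarrow> nat \<Rightarrow> 'v" where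
  "mu_action X r s m = (\<lambda>i. s (emb X (zeta r ^ i)) (m i))"

text \<open>
  A vector bundle on the root stack: a generic stalk, and at every point a \<open>\<mu>\<^sub>r\<close>-stable \<open>A\<^sub>p\<close>-submodule
  \<open>atl p\<close> of \<open>V[T]/(T\<^sup>r - \<varpi>\<^sub>p)\<close> with an \<open>A\<^sub>p\<close>-basis that is also a basis over the fraction field; at
  almost all points it is the lattice of one fixed basis of \<open>V\<close>.
\<close>

record ('k, 'v) root_bundle = "('k, 'v) generic_bundle" +
  atl :: "'k set \<Rightarrow> (nat \<Rightarrow> 'v) set"

definition frame_sum ::
  "'k::field set \<Rightarrow> nat \<Rightarrow> ('k \<Rightarrow> 'v \<Rightarrow> 'v::ab_group_add) \<Rightarrow> nat \<Rightarrow> (nat \<Rightarrow> nat \<Rightarrow> 'v) \<Rightarrow>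
     (nat \<Rightarrow> nat \<Rightarrow> 'k) \<Rightarrow> nat \<Rightarrow> 'v" where
  "frame_sum p r s n e c = (\<Sum>i<n. gprod p r s s (c i) (e i))"

definition atlas_lattice ::
  "'k::field set \<Rightarrow> nat \<Rightarrow> ('k \<Rightarrow> 'v \<Rightarrow> 'v::ab_group_add) \<Rightarrow> 'v set \<Rightarrow> (nat \<Rightarrow> 'v) set \<Rightarrow> bool"
where
  "atlas_lattice p r s V M \<longleftrightarrow>
     (\<exists>n e. bij_betw (frame_sum p r s n e) (trunc n (trunc r UNIV)) (trunc r V) \<and>
            M = frame_sum p r s n e ` trunc n (trunc r p))"

definition root_vector_bundle ::
  "('k::field, 'z) curve_scheme \<Rightarrow> ('k, 'v::ab_group_add) root_bundle \<Rightarrow> bool" where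
  "root_vector_bundle X E \<longleftrightarrow> vector_space (scal E) \<and>
     (\<forall>p\<in>points X.
        atlas_lattice p (root_order X p) (scal E) (gen E) (atl E p) \<and>
        (\<forall>m\<in>atl E p. mu_action X (root_order X p) (scal E) m \<in> atl E p)) \<and>
     (\<exists>B. basis_of (scal E) (gen E) B \<and>
        finite {p\<in>points X. atl E p \<noteq> trunc (root_order X p) (submodule_gen (scal E) p B)})"

definition root_morphism ::
  "('k::field, 'z) curve_scheme \<Rightarrow> ('k, 'v::ab_group_add) root_bundle \<Rightarrow>
     ('k, 'w::ab_group_add) root_bundle \<Rightarrow> ('v \<Rightarrow> 'w) \<Rightarrow> bool" where
  "root_morphism X E F \<alpha> \<longleftrightarrow> linear_on (scal E) (gen E) (scal F) \<alpha> \<and> \<alpha> ` gen E \<subseteq> gen F \<and>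
     (\<forall>p\<in>points X. \<forall>m\<in>atl E p. (\<lambda>j. \<alpha> (m j)) \<in> atl F p)"

definition root_iso ::
  "('k::field, 'z) curve_scheme \<Rightarrow> ('k, 'v::ab_group_add) root_bundle \<Rightarrow>
     ('k, 'w::ab_group_add) root_bundle \<Rightarrow> ('v \<Rightarrow> 'w) \<Rightarrow> bool" where
  "root_iso X E F \<alpha> \<longleftrightarrow> root_morphism X E F \<alpha> \<and>
     (\<exists>\<beta>. root_morphism X F E \<beta> \<and> (\<forall>v\<in>gen E. \<beta> (\<alpha> v) = v) \<and> (\<forall>w\<in>gen F. \<alpha> (\<beta> w) = w))"

definition root_tensor ::
  "('k::field, 'z) curve_scheme \<Rightarrow> ('k, 'v::ab_group_add) root_bundle \<Rightarrow>
     ('k, 'w::ab_group_add) root_bundle \<Rightarrow> ('k, ('v \<Rightarrow> 'w \<Rightarrow> 'k) \<Rightarrow> 'k) root_bundle" where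
  "root_tensor X E F =
     \<lparr>scal = fscale,
      gen = tensor_space (scal E) (gen E) (scal F) (gen F),
      atl = (\<lambda>p. addspan {gprod p (root_order X p) fscale (tens (scal E) (scal F)) m n | m n.
               m \<in> atl E p \<and> n \<in> atl F p})\<rparr>"

definition root_dual ::
  "('k::field, 'z) curve_scheme \<Rightarrow> ('k, 'v::ab_group_add) root_bundle \<Rightarrow>
     ('k, 'v \<Rightarrow> 'k) root_bundle" where
  "root_dual X E =
     \<lparr>scal = fscale,
      gen = dual_space (scal E) (gen E),
      atl = (\<lambda>p. {g \<in> trunc (root_order X p) (dual_space (scal E) (gen E)).
               \<forall>m\<in>atl E p. gprod p (root_order X p) (*) (\<lambda>g v. g v) g m
                             \<in> trunc (root_order X p) p})\<rparr>"

text \<open>The part \<open>M\<^sub>j\<close> of a graded module, and Borne's functor.\<close>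

definition piece ::
  "('k::field, 'z) curve_scheme \<Rightarrow> ('k, 'v) root_bundle \<Rightarrow> 'k set \<Rightarrow> nat \<Rightarrow> (nat \<Rightarrow> 'v) set" where
  "piece X E p j = {m \<in> atl E p. mu_action X (root_order X p) (scal E) m =
                       (\<lambda>i. scal E (emb X (zeta (root_order X p) ^ j)) (m i))}"

definition borne ::
  "('k::field, 'z) curve_scheme \<Rightarrow> ('k, 'v::ab_group_add) root_bundle \<Rightarrow> ('k, 'v) par_bundle" where
  "borne X E =
     \<lparr>scal = scal E,
      gen = gen E,
      fil = (\<lambda>p j. let r = root_order X p in
        {gprod p r (scal E) (scal E) (Tpow p r j) m 0 | m. m \<in> piece X E p ((r - j) mod r)})\<rparr>"

text \<open>
  The parabolic bundle \<open>F\<close> corresponds to \<open>E\<close>; the equality is required only for the points of the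
  curve and for the filtration steps \<open>0 \<le> j \<le> r\<^sub>p\<close>.  On morphisms Borne's functor leaves the map of
  generic stalks unchanged.
\<close>

definition borne_corresponds ::
  "('k::field, 'z) curve_scheme \<Rightarrow> ('k, 'v::ab_group_add) root_bundle \<Rightarrow>
     ('k, 'v) par_bundle \<Rightarrow> bool" where
  "borne_corresponds X E F \<longleftrightarrow> scal F = scal E \<and> gen F = gen E \<and>
     (\<forall>p\<in>points X. \<forall>j\<le>root_order X p. fil F p j = fil (borne X E) p j)"


section \<open>Morphisms of root stacks\<close>

text \<open>
  By the definition of the root stack of \<open>Y\<close>, a morphism from the root stack of \<open>X\<close> over
  \<open>f \<circ> \<pi>\<close> consists, for every marked point \<open>y\<close> of \<open>Y\<close>, of a line bundle \<open>N\<^sub>y\<close> on the root stack of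
  \<open>X\<close>, a section \<open>P\<^sub>y\<close> and an isomorphism from \<open>N\<^sub>y\<^sup>s\<close> to the pullback of \<open>O(y)\<close> that carries the
  \<open>s\<close>-th power of \<open>P\<^sub>y\<close> to the canonical section \<open>1\<close>.  After the choice of a basis of its generic
  stalk, \<open>N\<^sub>y\<close> is a bundle of fractional ideals in the function field \<open>K\<close>, its tensor powers are
  powers of fractional ideals, and the isomorphism is multiplication by an element of \<open>K\<close>.
\<close>

definition atlas_power ::
  "('k::field, 'z) curve_scheme \<Rightarrow> ('k, 'k) root_bundle \<Rightarrow> 'k set \<Rightarrow> nat \<Rightarrow> (nat \<Rightarrow> 'k) set" where
  "atlas_power X N p a =
     ((\<lambda>I. addspan {gprod p (root_order X p) (*) (*) n c | n c. n \<in> atl N p \<and> c \<in> I}) ^^ a)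
       (trunc (root_order X p) p)"

definition atlas_inverse ::
  "('k::field, 'z) curve_scheme \<Rightarrow> 'k set \<Rightarrow> (nat \<Rightarrow> 'k) set \<Rightarrow> (nat \<Rightarrow> 'k) set" where
  "atlas_inverse X p I = {c \<in> trunc (root_order X p) UNIV.
     \<forall>n\<in>I. gprod p (root_order X p) (*) (*) c n \<in> trunc (root_order X p) p}"

text \<open>The stalk on the atlas at \<open>p\<close> of the pullback of \<open>O(y)\<close>.\<close>

definition pullback_point_bundle ::
  "('k::field, 'z) curve_scheme \<Rightarrow> ('l::field \<Rightarrow> 'k) \<Rightarrow> 'l set \<Rightarrow> 'k set \<Rightarrow> (nat \<Rightarrow> 'k) set" where
  "pullback_point_bundle X \<phi> y p =
     {gprod p (root_order X p) (*) (*) a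
        (deg_zero (if \<phi> -` p = y then inverse (\<phi> (unif y)) else 1)) | a.
      a \<in> trunc (root_order X p) p}"

record ('l, 'k) root_map =
  rline :: "'l set \<Rightarrow> ('k, 'k) root_bundle"
  rsec :: "'l set \<Rightarrow> 'k"
  riso :: "'l set \<Rightarrow> 'k"

definition root_stack_map ::
  "('k::field, 'z) curve_scheme \<Rightarrow> ('l::field, 'y) curve_scheme \<Rightarrow> ('l \<Rightarrow> 'k) \<Rightarrow>
     ('l, 'k) root_map \<Rightarrow> bool" where
  "root_stack_map X Y \<phi> F \<longleftrightarrow> (\<forall>y\<in>set (marks Y).
     root_vector_bundle X (rline F y) \<and> scal (rline F y) = (*) \<and> gen (rline F y) = UNIV \<and>
     (\<forall>p\<in>points X. deg_zero (rsec F y) \<in> atl (rline F y) p) \<and>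
     (\<forall>p\<in>points X. {\<lambda>j. riso F y * n j | n. n \<in> atlas_power X (rline F y) p (root_order Y y)}
                     = pullback_point_bundle X \<phi> y p) \<and>
     riso F y * rsec F y ^ root_order Y y = 1)"

text \<open>
  The local rings of the atlases are discrete valuation rings with residue field \<open>\<complex>\<close> and the
  morphism is dominant, hence flat, so it is etale exactly if it is unramified, that is, if the
  pullback of a uniformizer of the atlas of the target generates the maximal ideal \<open>T A\<^sub>p\<close>.  Over a marked
  point \<open>y\<close> that pullback is \<open>P\<^sub>y\<close> divided by a local generator of \<open>N\<^sub>y\<close>.
\<close>

definition root_map_etale ::
  "('k::field, 'z) curve_scheme \<Rightarrow> ('l::field, 'y) curve_scheme \<Rightarrow> ('l \<Rightarrow> 'k) \<Rightarrow>
     ('l, 'k) root_map \<Rightarrow> bool" where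
  "root_map_etale X Y \<phi> F \<longleftrightarrow> (\<forall>p\<in>points X.
     let r = root_order X p; y = \<phi> -` p; A = trunc r p in
     if y \<in> set (marks Y)
     then {gprod p r (*) (*) a (deg_zero (rsec F y)) | a. a \<in> A}
            = gprod p r (*) (*) (Tpow p r 1) ` atl (rline F y) p
     else {gprod p r (*) (*) a (deg_zero (\<phi> (unif y))) | a. a \<in> A}
            = gprod p r (*) (*) (Tpow p r 1) ` A)"

text \<open>
  Direct image.  Let \<open>B = O\<^sub>y[S]/(S\<^sup>s - \<varpi>\<^sub>y)\<close> be the atlas at \<open>y\<close>.  Its base change to the root stack of \<open>X\<close>
  is the \<open>\<mu>\<^sub>s\<close>-torsor of isomorphisms \<open>\<tau>\<close> from the trivial line bundle to \<open>N\<^sub>y\<close> whose \<open>s\<close>-th power is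
  the given one, that is, the relative spectrum of the sum of the \<open>N\<^sub>y\<^sup>a \<tau>\<^sup>-\<^sup>a\<close>, \<open>0 \<le> a < s\<close>, with
  \<open>S = P\<^sub>y \<tau>\<^sup>-\<^sup>1\<close>.  So the direct image is the \<open>B\<close>-module whose part of degree \<open>a\<close> consists of
  the global sections, over the fibre of \<open>y\<close>, of the tensor product of \<open>E\<close> and \<open>N\<^sub>y\<^sup>a\<close>; a section is a
  \<open>\<mu>\<^sub>r\<close>-invariant (that is, degree zero) element of the atlas modules.
  Generically \<open>v S\<^sup>a\<close> is the section \<open>v P\<^sub>y\<^sup>a\<close>.
\<close>

definition root_direct_image ::
  "('k::field, 'z) curve_scheme \<Rightarrow> ('l::field, 'y) curve_scheme \<Rightarrow> ('l \<Rightarrow> 'k) \<Rightarrow>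
     ('l, 'k) root_map \<Rightarrow> ('k, 'v::ab_group_add) root_bundle \<Rightarrow> ('l, 'v) root_bundle" where
  "root_direct_image X Y \<phi> F E =
     \<lparr>scal = (\<lambda>a. scal E (\<phi> a)),
      gen = gen E,
      atl = (\<lambda>y. {m \<in> trunc (root_order Y y) (gen E).
        \<forall>a<root_order Y y. \<forall>p\<in>fiber X \<phi> y.
          deg_zero (scal E (rsec F y ^ a) (m a)) \<in>
            addspan {gprod p (root_order X p) (scal E) (scal E) n e | n e.
              n \<in> atlas_power X (rline F y) p a \<and> e \<in> atl E p}})\<rparr>"

text \<open>
  Pullback.  On the torsor above \<open>S\<^sup>a\<close> is \<open>P\<^sub>y\<^sup>a \<tau>\<^sup>-\<^sup>a\<close>, so a homogeneous element \<open>l S\<^sup>a\<close> of the module over \<open>B\<close>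
  contributes the \<open>\<mu>\<^sub>s\<close>-invariant elements \<open>c P\<^sub>y\<^sup>a l\<close> with \<open>c\<close> in the inverse of \<open>N\<^sub>y\<^sup>a\<close>.
\<close>

definition root_pullback ::
  "('k::field, 'z) curve_scheme \<Rightarrow> ('l::field, 'y) curve_scheme \<Rightarrow> ('l \<Rightarrow> 'k) \<Rightarrow>
     ('l, 'k) root_map \<Rightarrow> ('l, 'w::ab_group_add) root_bundle \<Rightarrow>
     ('k, ('w \<Rightarrow> 'k) \<Rightarrow> 'k) root_bundle" where
  "root_pullback X Y \<phi> F L =
     \<lparr>scal = fscale,
      gen = base_change \<phi> (scal L) (gen L),
      atl = (\<lambda>p. let y = \<phi> -` p in
        addspan {(\<lambda>i. bctens \<phi> (scal L) (c i * rsec F y ^ a) (l a)) | a c l.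
          a < root_order Y y \<and> l \<in> piece Y L y a \<and>
          c \<in> atlas_inverse X p (atlas_power X (rline F y) p a)})\<rparr>"

end

theory Submission
  imports Defs "HOL-Computational_Algebra.Fundamental_Theorem_Algebra"
begin

text \<open>
  The two bundles on \<open>Y\<close> have the same generic stalk, the one of \<open>E\<close>, and their filtrations coincide, so
  that the identity is the isomorphism sought.  Let \<open>M\<^sub>p\<close> be the module of the bundle on the root stack of \<open>X\<close> over the atlas at
  \<open>p\<close>.  Borne's functor gives \<open>E\<^sub>p\<^sup>n = {v. T\<^sup>-\<^sup>n v \<in> M\<^sub>p}\<close> for all integers \<open>n\<close> (\<open>borne_fil\<close>, \<open>filZ_atlas\<close>), because \<open>T\<^sup>r = \<varpi>\<^sub>p\<close>.
  The morphism of root stacks being etale, the section \<open>P\<close> generates \<open>T N\<^sub>y\<close>, hence \<open>N\<^sub>y = T\<^sup>-\<^sup>1 P A\<^sub>p\<close> (\<open>etale_line\<close>), and a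
  homogeneous element \<open>v S\<^sup>a\<close> lies in the direct image over the atlas at \<open>y\<close> if and only if \<open>T\<^sup>a v \<in> M\<^sub>p\<close> for all \<open>p\<close> above
  \<open>y\<close> (\<open>atl_direct_image\<close>).  As \<open>S\<^sup>s = \<varpi>\<^sub>y\<close> is a unit times \<open>\<varpi>\<^sub>p\<^sup>e = T\<^sup>s\<close>, this remains true for all integers \<open>a\<close>, and a second
  application of Borne's functor yields the filtration steps \<open>\<Inter>p. E\<^sub>p\<^sup>j\<close>, which are those of the parabolic direct image
  (\<open>fil_borne_direct_image\<close>).  The two forms are computed by the same formula from the same map of generic stalks.

  It remains to show that this form is a parabolic form.  Choose a generator \<open>l\<close> of the generic stalk of the line bundle; the form
  on \<open>E\<close> is \<open>b(v, w) (1 \<otimes> l)\<close> and the one on the direct image is \<open>Tr b(v, w) l\<close>.  A form is parabolic, with an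
  isomorphism as induced map, if and only if it is nondegenerate and each step of the filtration is the annihilator of the filtration
  with respect to it, up to the integer \<open>k\<close> that describes the line bundle at the point (\<open>par_form_perp\<close>, \<open>par_form_intro\<close>).  On a line
  bundle pulled back from \<open>Y\<close> this integer is the same at \<open>y\<close> and at all points above \<open>y\<close> (\<open>line_fil_pullback\<close>).  So the claim is
  that the trace transports the annihilator condition from \<open>E\<close> to its direct image (\<open>FZ_perp\<close>).  One direction says that the trace is
  integral on elements with poles of order at most \<open>e\<^sub>p - 1\<close> (\<open>trace_inverse_different\<close>), the other one uses elements that are
  concentrated at one point of the fibre and have an invertible trace (\<open>trace_unit\<close>); both are expressions of tame ramification.  They are
  read off from a basis of the integral closure of the local ring at \<open>y\<close> that is adapted to the points above \<open>y\<close>.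

  These local arguments rest on facts on the valuations of a function field \<open>K\<close>: weak approximation, finiteness of the
  fibres and of the set of poles of a function, the residue field \<open>\<complex>\<close> at every point, the description of the integral closure as an
  intersection of valuation rings (\<open>integral_of_regular\<close>), and the freeness of lattices (\<open>lattice_free\<close>).
\<close>

section \<open>Discrete valuations\<close>

definition dvr :: "'k::field set \<Rightarrow> bool" where
  "dvr p \<longleftrightarrow> subring_of p \<and> (\<exists>w. uniformizer p w)"

definition val :: "'k::field set \<Rightarrow> 'k \<Rightarrow> int" where
  "val p x = (THE n. \<exists>u. unit_of p u \<and> x = u * unif p powi n)"

abbreviation mm :: "'k::field set \<Rightarrow> int \<Rightarrow> 'k set" ("\<mm>") where
  "\<mm> \<equiv> max_ideal_power"

lemma points_dvr: "p \<in> points X \<Longrightarrow> dvr p"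
  by (simp add: points_def dvr_def)

lemma subring_0: "subring_of p \<Longrightarrow> 0 \<in> p"
  unfolding subring_of_def by (metis diff_self)
lemma subring_1: "subring_of p \<Longrightarrow> 1 \<in> p"
  unfolding subring_of_def by blast
lemma subring_diff: "subring_of p \<Longrightarrow> a \<in> p \<Longrightarrow> b \<in> p \<Longrightarrow> a - b \<in> p"
  unfolding subring_of_def by blast
lemma subring_mult: "subring_of p \<Longrightarrow> a \<in> p \<Longrightarrow> b \<in> p \<Longrightarrow> a * b \<in> p"
  unfolding subring_of_def by blast
lemma subring_minus: "subring_of p \<Longrightarrow> a \<in> p \<Longrightarrow> - a \<in> p"
  using subring_diff[of p 0 a] subring_0 by auto
lemma subring_add: "subring_of p \<Longrightarrow> a \<in> p \<Longrightarrow> b \<in> p \<Longrightarrow> a + b \<in> p"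
  using subring_diff[of p a "- b"] subring_minus by auto
lemma subring_power: "subring_of p \<Longrightarrow> a \<in> p \<Longrightarrow> a ^ n \<in> p"
  by (induction n) (auto simp: subring_1 subring_mult)
lemma subring_sum: "subring_of p \<Longrightarrow> (\<And>i. i \<in> I \<Longrightarrow> f i \<in> p) \<Longrightarrow> sum f I \<in> p"
  by (induction I rule: infinite_finite_induct) (auto simp: subring_0 subring_add)

lemma dvr_subring: "dvr p \<Longrightarrow> subring_of p" by (simp add: dvr_def)

lemma dvr_unif: "dvr p \<Longrightarrow> uniformizer p (unif p)"
  unfolding dvr_def unif_def by (metis someI_ex)

lemma unif_nonzero: "dvr p \<Longrightarrow> unif p \<noteq> 0"
  using dvr_unif uniformizer_def by blast

lemma unit_of_mult: "subring_of p \<Longrightarrow> unit_of p u \<Longrightarrow> unit_of p v \<Longrightarrow> unit_of p (u * v)"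
  by (simp add: unit_of_def subring_mult)
lemma unit_of_inverse: "unit_of p u \<Longrightarrow> unit_of p (inverse u)"
  by (simp add: unit_of_def)
lemma unit_of_1: "subring_of p \<Longrightarrow> unit_of p 1"
  by (simp add: unit_of_def subring_1)

lemma unif_powi_not_unit:
  assumes "dvr p" "unit_of p (unif p powi n)" shows "n = 0"
proof (rule ccontr)
  note R = dvr_subring[OF assms(1)]
  have w: "unif p \<in> p" "unif p \<noteq> 0" "inverse (unif p) \<notin> p"
    using dvr_unif[OF assms(1)] by (auto simp: uniformizer_def)
  \<comment> \<open>a positive power of the uniformizer that is a unit would make the uniformizer a unit\<close>
  have pos: False if "inverse (unif p ^ Suc m) \<in> p" for m
  proof -
    have "inverse (unif p ^ Suc m) * unif p ^ m \<in> p"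
      using that subring_power[OF R w(1)] subring_mult[OF R] by blast
    also have "inverse (unif p ^ Suc m) * unif p ^ m = inverse (unif p)"
      using w(2) by (simp add: field_simps)
    finally show False using w(3) by simp
  qed
  assume "n \<noteq> 0"
  then consider m where "n = int (Suc m)" | m where "n = - int (Suc m)"
    by (metis int_cases2 not0_implies_Suc of_nat_0 minus_zero)
  then show False
  proof cases
    case 1
    then have "unif p powi n = unif p ^ Suc m" by (simp only: power_int_of_nat)
    then show False using assms(2) pos[of m] by (simp add: unit_of_def)
  next
    case 2
    then have "unif p powi n = inverse (unif p ^ Suc m)"
      by (simp only: power_int_minus power_int_of_nat)
    then show False using assms(2) pos[of m] by (simp add: unit_of_def)
  qed
qed

lemma val_unit_powi:
  assumes "dvr p" "unit_of p u" shows "val p (u * unif p powi n) = n"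
  unfolding val_def
proof (rule the_equality)
  show "\<exists>v. unit_of p v \<and> u * unif p powi n = v * unif p powi n" using assms by blast
  fix m assume "\<exists>v. unit_of p v \<and> u * unif p powi n = v * unif p powi m"
  then obtain v where v: "unit_of p v" "u * unif p powi n = v * unif p powi m" by blast
  have w: "unif p \<noteq> 0" by (rule unif_nonzero[OF assms(1)])
  have nz: "u \<noteq> 0" "v \<noteq> 0" using assms(2) v(1) by (auto simp: unit_of_def)
  have "unif p powi (m - n) = u * inverse v"
    using v(2) w nz by (simp add: power_int_diff field_simps)
  then have "unit_of p (unif p powi (m - n))"
    using unit_of_mult[OF dvr_subring[OF assms(1)] assms(2) unit_of_inverse[OF v(1)]] by simp
  then show "m = n" using unif_powi_not_unit[OF assms(1)] by fastforce
qed

lemma val_decomp: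
  assumes "dvr p" "x \<noteq> 0" shows "\<exists>u. unit_of p u \<and> x = u * unif p powi val p x"
proof -
  obtain u n where "unit_of p u" "x = u * unif p powi n"
    using dvr_unif[OF assms(1)] assms(2) unfolding uniformizer_def by blast
  then show ?thesis using val_unit_powi[OF assms(1), of u n] by auto
qed

lemma val_mult:
  assumes "dvr p" "x \<noteq> 0" "y \<noteq> 0" shows "val p (x * y) = val p x + val p y"
proof -
  obtain u v where u: "unit_of p u" "x = u * unif p powi val p x"
    and v: "unit_of p v" "y = v * unif p powi val p y"
    using val_decomp[OF assms(1)] assms by blast
  have "x * y = (u * v) * unif p powi (val p x + val p y)"
    using u(2) v(2) unif_nonzero[OF assms(1)]
    by (metis (no_types, lifting) mult.assoc mult.commute power_int_add)
  then show ?thesis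
    using val_unit_powi[OF assms(1) unit_of_mult[OF dvr_subring[OF assms(1)] u(1) v(1)]] by metis
qed

lemma val_1: "dvr p \<Longrightarrow> val p 1 = 0"
  using val_unit_powi[of p 1 0] unit_of_1 dvr_subring by fastforce

lemma val_unif: "dvr p \<Longrightarrow> val p (unif p) = 1"
  using val_unit_powi[of p 1 1] unit_of_1 dvr_subring by fastforce

lemma val_inverse: "dvr p \<Longrightarrow> x \<noteq> 0 \<Longrightarrow> val p (inverse x) = - val p x"
  using val_mult[of p x "inverse x"] val_1[of p] by simp

lemma val_divide: "dvr p \<Longrightarrow> x \<noteq> 0 \<Longrightarrow> y \<noteq> 0 \<Longrightarrow> val p (x / y) = val p x - val p y"
  by (simp add: divide_inverse val_mult val_inverse)

lemma val_power: "dvr p \<Longrightarrow> x \<noteq> 0 \<Longrightarrow> val p (x ^ n) = int n * val p x"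
  by (induction n) (auto simp: val_1 val_mult algebra_simps)

lemma val_powi: "dvr p \<Longrightarrow> x \<noteq> 0 \<Longrightarrow> val p (x powi n) = n * val p x"
  by (cases n rule: int_cases2) (auto simp: power_int_minus val_power val_inverse)

lemma mem_iff_val:
  assumes "dvr p" shows "x \<in> p \<longleftrightarrow> x = 0 \<or> 0 \<le> val p x"
proof (cases "x = 0")
  case True then show ?thesis using subring_0 dvr_subring assms by auto
next
  case False
  note R = dvr_subring[OF assms]
  obtain u where u: "unit_of p u" "x = u * unif p powi val p x" using val_decomp[OF assms False] by blast
  have w: "unif p \<in> p" using dvr_unif[OF assms] by (simp add: uniformizer_def)
  \<comment> \<open>stated for all elements because the converse inclusion uses it for the inverse\<close>
  have pos: "y \<in> p" if y: "y \<noteq> 0" "0 \<le> val p y" for y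
  proof -
    obtain v where v: "unit_of p v" "y = v * unif p powi val p y" using val_decomp[OF assms y(1)] by blast
    have "unif p powi val p y = unif p ^ nat (val p y)" using y(2) by (simp add: power_int_def)
    then show ?thesis using v subring_mult[OF R] subring_power[OF R w] by (metis unit_of_def)
  qed
  moreover have "0 \<le> val p x" if "x \<in> p"
  proof (rule ccontr)
    assume "\<not> 0 \<le> val p x"
    then have "inverse x \<in> p" using pos[of "inverse x"] False val_inverse[OF assms False] by simp
    then have "unit_of p x" using that False by (simp add: unit_of_def)
    then have "val p x = 0" using val_unit_powi[OF assms, of x 0] by simp
    then show False using \<open>\<not> 0 \<le> val p x\<close> by simp
  qed
  ultimately show ?thesis using False by blast
qed

lemma unit_of_iff_val: "dvr p \<Longrightarrow> unit_of p u \<longleftrightarrow> u \<noteq> 0 \<and> val p u = 0"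
  unfolding unit_of_def using mem_iff_val[of p u] mem_iff_val[of p "inverse u"] val_inverse[of p u] by auto

lemma mm_iff:
  assumes "dvr p" shows "x \<in> \<mm> p n \<longleftrightarrow> x = 0 \<or> n \<le> val p x"
proof
  have w: "unif p powi n \<noteq> 0" using unif_nonzero[OF assms] by simp
  assume "x \<in> \<mm> p n"
  then obtain u where u: "u \<in> p" "x = unif p powi n * u" unfolding max_ideal_power_def by blast
  show "x = 0 \<or> n \<le> val p x"
    using u mem_iff_val[OF assms, of u] val_mult[OF assms w, of u] w
    by (cases "u = 0") (auto simp: val_powi[OF assms unif_nonzero[OF assms]] val_unif[OF assms])
next
  have w: "unif p powi n \<noteq> 0" using unif_nonzero[OF assms] by simp
  assume a: "x = 0 \<or> n \<le> val p x"
  have "x / unif p powi n \<in> p"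
    using a w mem_iff_val[OF assms, of "x / unif p powi n"] val_divide[OF assms _ w, of x]
    by (cases "x = 0") (auto simp: val_powi[OF assms unif_nonzero[OF assms]] val_unif[OF assms])
  then show "x \<in> \<mm> p n" unfolding max_ideal_power_def using w by (auto intro!: exI[of _ "x / unif p powi n"])
qed

lemma mm_0: "dvr p \<Longrightarrow> \<mm> p 0 = p"
  using mm_iff mem_iff_val by blast

lemma zero_mm: "dvr p \<Longrightarrow> 0 \<in> \<mm> p n" by (simp add: mm_iff)

lemma mm_antimono: "dvr p \<Longrightarrow> x \<in> \<mm> p n \<Longrightarrow> m \<le> n \<Longrightarrow> x \<in> \<mm> p m"
  by (auto simp: mm_iff)

lemma mm_mult: "dvr p \<Longrightarrow> x \<in> \<mm> p m \<Longrightarrow> y \<in> \<mm> p n \<Longrightarrow> x * y \<in> \<mm> p (m + n)"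
  by (cases "x = 0 \<or> y = 0") (auto simp: mm_iff val_mult)

lemma mm_mult_ring: "dvr p \<Longrightarrow> a \<in> p \<Longrightarrow> y \<in> \<mm> p n \<Longrightarrow> a * y \<in> \<mm> p n"
  using mm_mult[of p a 0 y n] by (simp add: mm_0)

lemma mm_scale_iff: "dvr p \<Longrightarrow> c \<noteq> 0 \<Longrightarrow> c * x \<in> \<mm> p n \<longleftrightarrow> x \<in> \<mm> p (n - val p c)"
  by (cases "x = 0") (auto simp: mm_iff val_mult)

lemma mm_add:
  assumes "dvr p" "x \<in> \<mm> p n" "y \<in> \<mm> p n" shows "x + y \<in> \<mm> p n"
proof -
  obtain a b where "a \<in> p" "x = unif p powi n * a" "b \<in> p" "y = unif p powi n * b"
    using assms unfolding max_ideal_power_def by blast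
  then have "a + b \<in> p" "x + y = unif p powi n * (a + b)"
    using subring_add[OF dvr_subring[OF assms(1)]] by (auto simp: algebra_simps)
  then show ?thesis unfolding max_ideal_power_def by blast
qed

lemma mm_minus: "dvr p \<Longrightarrow> - x \<in> \<mm> p n \<longleftrightarrow> x \<in> \<mm> p n"
  using mm_scale_iff[of p "- 1" x n] mm_mult_ring[of p "-1"] subring_minus[of p 1] subring_1[of p] dvr_subring[of p]
  by (metis add.inverse_inverse mult_minus1)

lemma mm_diff: "dvr p \<Longrightarrow> x \<in> \<mm> p n \<Longrightarrow> y \<in> \<mm> p n \<Longrightarrow> x - y \<in> \<mm> p n"
  using mm_add[of p x n "- y"] mm_minus[of p y n] by simp

lemma mm_sum: "dvr p \<Longrightarrow> (\<And>i. i \<in> I \<Longrightarrow> f i \<in> \<mm> p n) \<Longrightarrow> sum f I \<in> \<mm> p n"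
  by (induction I rule: infinite_finite_induct) (auto simp: zero_mm mm_add)

lemma mm_1_subset: "dvr p \<Longrightarrow> x \<in> \<mm> p 1 \<Longrightarrow> x \<in> p"
  using mm_antimono[of p x 1 0] mm_0 by auto

lemma one_notin_mm1: "dvr p \<Longrightarrow> 1 \<notin> \<mm> p 1"
  by (simp add: mm_iff val_1)

lemma inverse_mm: "dvr p \<Longrightarrow> x \<notin> p \<Longrightarrow> inverse x \<in> \<mm> p 1"
  by (auto simp: mem_iff_val mm_iff val_inverse)

lemma unit_add_mm:
  assumes "dvr p" "unit_of p u" "x \<in> \<mm> p 1" shows "unit_of p (u + x)"
proof -
  have "u + x \<in> p"
    using assms(2) mm_1_subset[OF assms(1,3)] subring_add[OF dvr_subring[OF assms(1)]] by (simp add: unit_of_def)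
  moreover have "u + x \<notin> \<mm> p 1"
    using mm_diff[OF assms(1) _ assms(3), of "u + x"] assms(2)
    by (auto simp: unit_of_iff_val[OF assms(1)] mm_iff[OF assms(1)])
  ultimately show ?thesis
    using assms(1) by (auto simp: unit_of_iff_val mem_iff_val mm_iff)
qed

text \<open>The quotient of the sum by \<open>x\<close> is the sum of \<open>1\<close> and an element of the maximal ideal.\<close>

lemma val_add_less:
  assumes "dvr p" "x \<noteq> 0" "y \<in> \<mm> p (val p x + 1)"
  shows "x + y \<noteq> 0 \<and> val p (x + y) = val p x"
proof -
  have "y / x \<in> \<mm> p 1"
    using assms mm_scale_iff[of p "inverse x" y 1] val_inverse[of p x] by (simp add: field_simps add.commute)
  then have "unit_of p (1 + y / x)" using unit_add_mm[OF assms(1) unit_of_1] dvr_subring assms(1) by blast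
  then have "1 + y / x \<noteq> 0" "val p (1 + y / x) = 0" using unit_of_iff_val assms(1) by auto
  moreover have "x + y = x * (1 + y / x)" using assms(2) by (simp add: field_simps)
  ultimately show ?thesis using val_mult[OF assms(1,2)] assms(2) by simp
qed

text \<open>As \<open>x\<close> has a pole, every element of the field becomes integral after division by a power of \<open>x\<close>.\<close>

lemma dvr_maximal:
  assumes "dvr p" "subring_of R" "p \<subseteq> R" "x \<in> R" "x \<notin> p" shows "R = UNIV"
proof -
  have x: "x \<noteq> 0" "val p x < 0" using assms(5) mem_iff_val[OF assms(1)] by auto
  have "z \<in> R" for z
  proof (cases "z = 0")
    case True then show ?thesis using subring_0[OF assms(2)] by simp
  next
    case False
    define n where "n = nat \<bar>val p z\<bar>"
    have "val p (z / x ^ n) = val p z - int n * val p x"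
      using False x by (simp add: val_divide[OF assms(1)] val_power[OF assms(1)])
    also have "\<dots> \<ge> val p z + int n" using mult_left_mono[of "val p x" "-1" "int n"] x(2) by simp
    then have "0 \<le> val p z - int n * val p x" unfolding n_def by linarith
    finally have "z / x ^ n \<in> p" using mem_iff_val[OF assms(1)] by blast
    then have "z / x ^ n * x ^ n \<in> R"
      using assms(3) subring_mult[OF assms(2)] subring_power[OF assms(2,4)] by blast
    then show ?thesis using x by simp
  qed
  then show ?thesis by blast
qed

lemma dvr_ne_UNIV: "dvr p \<Longrightarrow> p \<noteq> UNIV"
  using dvr_unif uniformizer_def by blast

lemma dvr_subset_eq: "dvr p \<Longrightarrow> dvr q \<Longrightarrow> p \<subseteq> q \<Longrightarrow> p = q"
  using dvr_maximal[of p q] dvr_subring[of q] dvr_ne_UNIV[of q] by blast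

text \<open>If \<open>x\<close> had a pole, then \<open>x\<^sup>n\<close> would have a smaller order than all other terms of its equation.\<close>

lemma dvr_integrally_closed:
  assumes "dvr p" "\<And>i. i < n \<Longrightarrow> a i \<in> p" "x ^ n = (\<Sum>i<n. a i * x ^ i)"
  shows "x \<in> p"
proof (rule ccontr)
  assume "x \<notin> p"
  then have x: "x \<noteq> 0" "val p x < 0" using mem_iff_val[OF assms(1)] by auto
  have "a i * x ^ i \<in> \<mm> p (int n * val p x + 1)" if "i < n" for i
  proof -
    have "x ^ i \<in> \<mm> p (int i * val p x)" using x by (simp add: mm_iff[OF assms(1)] val_power[OF assms(1)])
    moreover have "(int n - int i) * val p x \<le> 1 * val p x"
      using that x(2) by (intro mult_right_mono_neg) auto
    then have "int n * val p x + 1 \<le> int i * val p x" using x(2) by (simp add: left_diff_distrib)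
    ultimately show ?thesis using mm_mult_ring[OF assms(1) assms(2)[OF that]] mm_antimono[OF assms(1)] by blast
  qed
  then have "x ^ n \<in> \<mm> p (int n * val p x + 1)" using assms(3) mm_sum[OF assms(1), of "{..<n}"] by auto
  then show False using x by (simp add: mm_iff[OF assms(1)] val_power[OF assms(1)])
qed

section \<open>Approximation\<close>

text \<open>
  For a new point \<open>q\<close>, let \<open>y\<close> have a pole at \<open>p\<close> and a zero at \<open>q\<close>.  If the element \<open>z\<close> obtained for \<open>S\<close> has no pole at \<open>q\<close>, a
  high power of \<open>z\<close>, multiplied by \<open>y\<close> if necessary, works.  Otherwise this power is first replaced by \<open>z\<^sup>n/(1 + z\<^sup>n)\<close>, which is a unit at \<open>p\<close>
  and \<open>q\<close> and keeps the zeros of \<open>z\<^sup>n\<close> at \<open>S\<close>.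
\<close>

lemma separating_element:
  assumes "finite S" "\<And>q. q \<in> S \<Longrightarrow> dvr q \<and> q \<noteq> p" "dvr p"
  shows "\<exists>z. z \<noteq> 0 \<and> val p z < 0 \<and> (\<forall>q\<in>S. 0 < val q z)"
  using assms(1,2)
proof (induction S rule: finite_induct)
  case empty
  have "inverse (unif p) \<noteq> 0" "val p (inverse (unif p)) < 0"
    using unif_nonzero[OF assms(3)] by (auto simp: val_inverse[OF assms(3)] val_unif[OF assms(3)])
  then show ?case by blast
next
  case (insert q S)
  obtain z where z: "z \<noteq> 0" "val p z < 0" "\<forall>q\<in>S. 0 < val q z" using insert by auto
  have q: "dvr q" "q \<noteq> p" using insert.prems by auto
  obtain a b where "a \<in> p" "a \<notin> q" "b \<in> q" "b \<notin> p"
    using dvr_subset_eq q assms(3) by blast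
  then have a: "a \<noteq> 0" "0 \<le> val p a" "val q a < 0" and b: "b \<noteq> 0" "0 \<le> val q b" "val p b < 0"
    by (auto simp: mem_iff_val[OF q(1)] mem_iff_val[OF assms(3)])
  define y where "y = b / a"
  have y: "y \<noteq> 0" "val p y < 0" "0 < val q y"
    using a b by (auto simp: y_def val_divide[OF q(1)] val_divide[OF assms(3)])
  \<comment> \<open>a power of \<open>z\<close> large enough to outweigh \<open>y\<close> at all points of \<open>S\<close>\<close>
  obtain n :: nat where n: "0 < n" "\<forall>s\<in>S. \<bar>val s y\<bar> < int n"
  proof -
    have "finite ((\<lambda>s. nat \<bar>val s y\<bar>) ` S)" using insert.hyps by simp
    then obtain m where "\<forall>k\<in>(\<lambda>s. nat \<bar>val s y\<bar>) ` S. k < m" using finite_nat_set_iff_bounded by blast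
    then have "\<forall>s\<in>S. \<bar>val s y\<bar> < int (Suc m)" by fastforce
    then show thesis using that by blast
  qed
  have big: "int n \<le> int n * val s z" if "s \<in> S" for s
    using z(3) that mult_left_mono[of 1 "val s z" "int n"] by auto
  have S: "dvr s" if "s \<in> S" for s using insert.prems that by auto
  consider "0 < val q z" | "val q z = 0" | "val q z < 0" by linarith
  then show ?case
  proof cases
    case 1 then show ?thesis using z by blast
  next
    case 2
    have "int n * val p z < 0" using n(1) z(2) by (simp add: mult_pos_neg)
    moreover have "val s (z ^ n * y) = int n * val s z + val s y" if "dvr s" for s
      using z(1) y(1) by (simp add: val_mult[OF that] val_power[OF that])
    moreover have "0 < int n * val s z + val s y" if "s \<in> S" for s
      using big[OF that] n(2) that by fastforce
    ultimately have "z ^ n * y \<noteq> 0 \<and> val p (z ^ n * y) < 0 \<and> (\<forall>s\<in>insert q S. 0 < val s (z ^ n * y))"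
      using z(1) y 2 S assms(3) q(1) by simp
    then show ?thesis by blast
  next
    case 3
    \<comment> \<open>\<open>z\<^sup>n/(1 + z\<^sup>n)\<close> is a unit where \<open>z\<close> has a pole\<close>
    have pole: "1 + z ^ n \<noteq> 0 \<and> val s (1 + z ^ n) = int n * val s z" if "dvr s" "val s z < 0" for s
    proof -
      have "int n * val s z < 0" using n(1) that(2) by (simp add: mult_pos_neg)
      then have "1 \<in> \<mm> s (val s (z ^ n) + 1)" using that(1) z(1) by (simp add: mm_iff val_1 val_power)
      then show ?thesis using val_add_less[OF that(1), of "z ^ n" 1] z(1) val_power[OF that(1)] by (simp add: add.commute)
    qed
    have zero: "val s (1 + z ^ n) = 0" if "s \<in> S" for s
    proof -
      have "1 \<le> int n" using n(1) by simp
      then have "1 \<le> int n * val s z" using big[OF that] by linarith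
      then have "z ^ n \<in> \<mm> s 1" using S[OF that] z(1) by (simp add: mm_iff val_power)
      then show ?thesis
        using val_add_less[OF S[OF that], of 1 "z ^ n"] by (simp add: val_1[OF S[OF that]])
    qed
    define x where "x = z ^ n / (1 + z ^ n) * y"
    have nz: "1 + z ^ n \<noteq> 0" using pole[OF q(1) 3] by simp
    have "x \<noteq> 0" using nz z(1) y(1) by (simp add: x_def)
    moreover have "val s x = int n * val s z - val s (1 + z ^ n) + val s y" if "dvr s" for s
      using nz z(1) y(1) by (simp add: x_def val_mult[OF that] val_divide[OF that] val_power[OF that] del: times_divide_eq_left)
    moreover have "0 < int n * val s z + val s y" if "s \<in> S" for s
      using big[OF that] n(2) that by fastforce
    ultimately have "x \<noteq> 0 \<and> val p x < 0 \<and> (\<forall>s\<in>insert q S. 0 < val s x)"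
      using pole[OF assms(3) z(2)] pole[OF q(1) 3] zero y S assms(3) q(1) by simp
    then show ?thesis by blast
  qed
qed

text \<open>
  Weak approximation.  For \<open>z\<close> as in \<open>separating_element\<close>, the quotient \<open>z\<^sup>n/(1 + z\<^sup>n)\<close> tends to \<open>1\<close> where \<open>z\<close> has a pole and to \<open>0\<close> where
  \<open>z\<close> has a zero.
\<close>

lemma approximate_idempotent:
  assumes "finite S" "\<And>q. q \<in> S \<Longrightarrow> dvr q \<and> q \<noteq> p" "dvr p"
  shows "\<exists>x. x - 1 \<in> \<mm> p (int N) \<and> (\<forall>q\<in>S. x \<in> \<mm> q (int N))"
proof -
  obtain z where z: "z \<noteq> 0" "val p z < 0" "\<forall>q\<in>S. 0 < val q z"
    using separating_element[OF assms] by blast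
  define n where "n = Suc N"
  have "int n * val p z < 0" using z(2) by (simp add: n_def mult_pos_neg)
  then have "1 \<in> \<mm> p (val p (z ^ n) + 1)" using assms(3) z(1) by (simp add: mm_iff val_1 val_power)
  then have p: "1 + z ^ n \<noteq> 0" "val p (1 + z ^ n) = int n * val p z"
    using val_add_less[OF assms(3), of "z ^ n" 1] z(1) val_power[OF assms(3)] by (simp_all add: add.commute)
  define x where "x = z ^ n / (1 + z ^ n)"
  have "x - 1 = - (1 / (1 + z ^ n))" using p(1) by (simp add: x_def field_simps)
  moreover have "val p (1 / (1 + z ^ n)) = - (int n * val p z)"
    using p by (simp add: val_divide[OF assms(3)] val_1[OF assms(3)])
  moreover have "int N \<le> - (int n * val p z)"
    using mult_left_mono[of "val p z" "-1" "int n"] z(2) by (simp add: n_def)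
  ultimately have "x - 1 \<in> \<mm> p (int N)" by (simp only: mm_minus[OF assms(3)]) (simp add: mm_iff[OF assms(3)])
  moreover have "x \<in> \<mm> q (int N)" if "q \<in> S" for q
  proof -
    have q: "dvr q" using assms(2) that by blast
    have big: "int n \<le> int n * val q z" using z(3) that mult_left_mono[of 1 "val q z" "int n"] by auto
    moreover have "1 \<le> int n" by (simp add: n_def)
    ultimately have "1 \<le> int n * val q z" by linarith
    then have "z ^ n \<in> \<mm> q 1" using q z(1) by (simp add: mm_iff val_power)
    then have "val q (1 + z ^ n) = 0" using val_add_less[OF q, of 1 "z ^ n"] by (simp add: val_1[OF q])
    then have "val q x = int n * val q z" using p(1) z(1) by (simp add: x_def val_divide[OF q] val_power[OF q])
    moreover have "int N \<le> int n" by (simp add: n_def)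
    ultimately have "int N \<le> val q x" using big by linarith
    then show ?thesis by (simp add: mm_iff[OF q])
  qed
  ultimately show ?thesis by blast
qed

lemma approximate_element:
  assumes "finite S" "\<And>q. q \<in> S \<Longrightarrow> dvr q \<and> q \<noteq> p" "dvr p" "c \<noteq> 0"
  shows "\<exists>x. x \<noteq> 0 \<and> val p x = val p c \<and> (\<forall>q\<in>S. x \<in> \<mm> q N)"
proof -
  \<comment> \<open>large enough to cancel the poles of \<open>c\<close> at \<open>S\<close>\<close>
  define M where "M = Suc (Max (insert 0 ((\<lambda>q. nat (N - val q c)) ` S)))"
  obtain x where x: "x - 1 \<in> \<mm> p (int M)" "\<forall>q\<in>S. x \<in> \<mm> q (int M)"
    using approximate_idempotent[OF assms(1-3)] by blast
  have "unit_of p (1 + (x - 1))"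
    using x(1) assms(3) mm_antimono[of p "x - 1" "int M" 1]
    by (intro unit_add_mm unit_of_1 dvr_subring) (auto simp: M_def)
  then have "x \<noteq> 0" "val p x = 0" using unit_of_iff_val[OF assms(3)] by auto
  moreover have "x * c \<in> \<mm> q N" if "q \<in> S" for q
  proof -
    have "nat (N - val q c) \<le> M" using assms(1) that by (auto simp: M_def intro!: le_SucI Max_ge)
    moreover have "x * c \<in> \<mm> q (int M + val q c)"
      using mm_mult[of q x "int M" c "val q c"] x(2) that assms(2)[OF that] mm_iff[of q c "val q c"] by blast
    ultimately show ?thesis using assms(2) that mm_antimono by (smt (verit) nat_le_iff of_nat_le_iff)
  qed
  ultimately show ?thesis using assms(4) val_mult[OF assms(3)] by (intro exI[of _ "x * c"]) auto
qed

section \<open>Linear dependence over subfields\<close>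

definition subfield :: "'k::field set \<Rightarrow> bool" where
  "subfield F \<longleftrightarrow> subring_of F \<and> (\<forall>a\<in>F. inverse a \<in> F)"

definition spans_over :: "'k::field set \<Rightarrow> 'k set \<Rightarrow> bool" where
  "spans_over F B \<longleftrightarrow> finite B \<and> (\<forall>x. \<exists>a. (\<forall>b\<in>B. a b \<in> F) \<and> x = (\<Sum>b\<in>B. a b * b))"

lemma subfield_subring: "subfield F \<Longrightarrow> subring_of F" by (simp add: subfield_def)

lemma subfield_divide: "subfield F \<Longrightarrow> a \<in> F \<Longrightarrow> b \<in> F \<Longrightarrow> a / b \<in> F"
  by (simp add: subfield_def divide_inverse subring_mult)

text \<open>Gaussian elimination: an unknown \<open>i0\<close> that occurs in the equation \<open>b0\<close> is eliminated from the other equations.\<close>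

lemma homogeneous_system:
  assumes "subfield F" "finite B"
  shows "finite I \<Longrightarrow> card B < card I \<Longrightarrow> (\<And>i b. i \<in> I \<Longrightarrow> b \<in> B \<Longrightarrow> a i b \<in> F) \<Longrightarrow>
    \<exists>c. (\<forall>i\<in>I. c i \<in> F) \<and> (\<exists>i\<in>I. c i \<noteq> 0) \<and> (\<forall>b\<in>B. (\<Sum>i\<in>I. c i * a i b) = 0)"
  using assms(2)
proof (induction B arbitrary: I a rule: finite_induct)
  case empty
  then obtain i where "i \<in> I" by fastforce
  then show ?case using subring_1[OF subfield_subring[OF assms(1)]] by (intro exI[of _ "\<lambda>_. 1"]) auto
next
  case (insert b0 B)
  note R = subfield_subring[OF assms(1)]
  show ?case
  proof (cases "\<forall>i\<in>I. a i b0 = 0")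
    case True
    obtain c where c: "\<forall>i\<in>I. c i \<in> F" "\<exists>i\<in>I. c i \<noteq> 0" "\<forall>b\<in>B. (\<Sum>i\<in>I. c i * a i b) = 0"
      using insert.IH[of I a] insert.prems insert.hyps by auto
    have "(\<Sum>i\<in>I. c i * a i b0) = 0" using True by (intro sum.neutral) auto
    then show ?thesis using c by (intro exI[of _ c]) auto
  next
    case False
    then obtain i0 where i0: "i0 \<in> I" "a i0 b0 \<noteq> 0" by blast
    define J where "J = I - {i0}"
    define r where "r i = a i b0 / a i0 b0" for i
    have J: "finite J" "card B < card J" "I = insert i0 J" "i0 \<notin> J"
      using insert i0 by (auto simp: J_def)
    have r: "r i \<in> F" if "i \<in> I" for i
      unfolding r_def using insert.prems(3)[of _ b0] that i0(1) subfield_divide[OF assms(1)] by blast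
    have "\<exists>c. (\<forall>i\<in>J. c i \<in> F) \<and> (\<exists>i\<in>J. c i \<noteq> 0) \<and>
       (\<forall>b\<in>B. (\<Sum>i\<in>J. c i * (a i b - r i * a i0 b)) = 0)"
      using r insert.prems(3) i0(1) J
      by (intro insert.IH[of J "\<lambda>i b. a i b - r i * a i0 b"]) (auto intro!: subring_diff[OF R] subring_mult[OF R])
    then obtain c where c: "\<forall>i\<in>J. c i \<in> F" "\<exists>i\<in>J. c i \<noteq> 0"
      "\<And>b. b \<in> B \<Longrightarrow> (\<Sum>i\<in>J. c i * (a i b - r i * a i0 b)) = 0" by blast
    define d where "d i = (if i = i0 then - (\<Sum>j\<in>J. c j * r j) else c i)" for i
    have sum_d: "(\<Sum>i\<in>I. d i * a i b) = (\<Sum>i\<in>J. c i * (a i b - r i * a i0 b))" for b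
    proof -
      have "(\<Sum>i\<in>I. d i * a i b) = d i0 * a i0 b + (\<Sum>i\<in>J. d i * a i b)"
        using J by simp
      also have "(\<Sum>i\<in>J. d i * a i b) = (\<Sum>i\<in>J. c i * a i b)"
        using J(4) by (intro sum.cong) (auto simp: d_def)
      finally show ?thesis
        by (simp add: d_def sum_subtractf sum_distrib_right right_diff_distrib mult.assoc)
    qed
    have "(\<Sum>i\<in>I. d i * a i b0) = 0"
      unfolding sum_d using i0(2) by (intro sum.neutral) (auto simp: r_def)
    moreover have "\<forall>i\<in>I. d i \<in> F"
      using c(1) r J(3) by (auto simp: d_def intro!: subring_minus[OF R] subring_sum[OF R] subring_mult[OF R])
    moreover have "\<exists>i\<in>I. d i \<noteq> 0" using c(2) J by (auto simp: d_def)
    ultimately show ?thesis using c(3) sum_d by (intro exI[of _ d]) auto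
  qed
qed

lemma dependent_over_subfield:
  assumes "subfield F" "spans_over F B" "finite I" "card B < card I"
  shows "\<exists>c. (\<forall>i\<in>I. c i \<in> F) \<and> (\<exists>i\<in>I. c i \<noteq> 0) \<and> (\<Sum>i\<in>I. c i * x i) = 0"
proof -
  have "\<forall>i. \<exists>a. (\<forall>b\<in>B. a b \<in> F) \<and> x i = (\<Sum>b\<in>B. a b * b)"
    using assms(2) unfolding spans_over_def by blast
  then obtain a where a: "\<And>i. (\<forall>b\<in>B. a i b \<in> F) \<and> x i = (\<Sum>b\<in>B. a i b * b)" by metis
  have "finite B" using assms(2) by (simp add: spans_over_def)
  then obtain c where c: "\<forall>i\<in>I. c i \<in> F" "\<exists>i\<in>I. c i \<noteq> 0" "\<forall>b\<in>B. (\<Sum>i\<in>I. c i * a i b) = 0"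
    using homogeneous_system[OF assms(1) _ assms(3,4), of a] a by blast
  have "(\<Sum>i\<in>I. c i * x i) = (\<Sum>i\<in>I. \<Sum>b\<in>B. c i * a i b * b)"
    by (intro sum.cong refl) (simp add: a sum_distrib_left mult.assoc)
  also have "\<dots> = (\<Sum>b\<in>B. (\<Sum>i\<in>I. c i * a i b) * b)"
    by (subst sum.swap) (simp add: sum_distrib_right)
  also have "\<dots> = 0" using c(3) by (intro sum.neutral) auto
  finally show ?thesis using c by blast
qed

lemma algebraic_over_subfield:
  assumes "subfield F" "spans_over F B"
  shows "\<exists>n a. (\<forall>i<n. a i \<in> F) \<and> x ^ n = (\<Sum>i<n. a i * x ^ i)"
proof -
  obtain c where c: "\<forall>i\<in>{..card B}. c i \<in> F" "\<exists>i\<in>{..card B}. c i \<noteq> 0"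
     "(\<Sum>i\<in>{..card B}. c i * x ^ i) = 0"
    using dependent_over_subfield[OF assms, of "{..card B}" "\<lambda>i. x ^ i"] by auto
  define S where "S = {i\<in>{..card B}. c i \<noteq> 0}"
  define n where "n = Max S"
  have S: "finite S" "S \<noteq> {}" using c(2) by (auto simp: S_def)
  then have "n \<in> S" using Max_in by (simp add: n_def)
  then have n: "n \<in> {..card B}" "c n \<noteq> 0" by (auto simp: S_def)
  have "c i = 0" if "i \<in> {..card B}" "n < i" for i
    using Max_ge[OF S(1), of i] that by (fastforce simp: n_def S_def)
  then have "(\<Sum>i\<in>{..card B}. c i * x ^ i) = (\<Sum>i\<in>{..n}. c i * x ^ i)"
    using n(1) by (intro sum.mono_neutral_right) (auto simp: not_le)
  also have "\<dots> = (\<Sum>i<n. c i * x ^ i) + c n * x ^ n" by (simp add: lessThan_Suc_atMost[symmetric])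
  finally have "c n * x ^ n = - (\<Sum>i<n. c i * x ^ i)" using c(3) by (simp add: eq_neg_iff_add_eq_0 add.commute)
  then have "x ^ n = (\<Sum>i<n. - c i / c n * x ^ i)"
    using n(2) by (simp add: field_simps sum_divide_distrib[symmetric] sum_negf)
  moreover have "\<forall>i<n. - c i / c n \<in> F"
    using c(1) n subfield_divide[OF assms(1)] subring_minus[OF subfield_subring[OF assms(1)]] by simp
  ultimately show ?thesis by (intro exI[of _ n] exI[of _ "\<lambda>i. - c i / c n"]) auto
qed

text \<open>
  \<open>common_parameter F w S\<close>: the valuation rings in \<open>S\<close> induce on the subfield \<open>F\<close> one and the same discrete
  valuation, with uniformizer \<open>w\<close>.
\<close>

definition common_parameter :: "'k::field set \<Rightarrow> 'k \<Rightarrow> 'k set set \<Rightarrow> bool" where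
  "common_parameter F w S \<longleftrightarrow> w \<in> F \<and> w \<noteq> 0 \<and> (\<forall>p\<in>S. dvr p \<and> w \<in> \<mm> p 1) \<and>
     (\<forall>a\<in>F. a \<noteq> 0 \<longrightarrow> (\<exists>n u. (\<forall>p\<in>S. unit_of p u) \<and> a = u * w powi n))"

text \<open>Multiplication by a power of \<open>w\<close> makes the least order of a coefficient zero.\<close>

lemma normalize_coefficients:
  assumes "common_parameter F w S" "finite I" "\<And>i. i \<in> I \<Longrightarrow> c i \<in> F" "\<exists>i\<in>I. c i \<noteq> 0"
  shows "\<exists>k. (\<forall>i\<in>I. \<forall>p\<in>S. w powi k * c i \<in> p) \<and> (\<exists>i\<in>I. \<forall>p\<in>S. unit_of p (w powi k * c i))"
proof -
  have w: "w \<noteq> 0" using assms(1) by (simp add: common_parameter_def)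
  define J where "J = {i\<in>I. c i \<noteq> 0}"
  have "\<forall>i\<in>J. \<exists>n u. (\<forall>p\<in>S. unit_of p u) \<and> c i = u * w powi n"
    using assms(1,3) unfolding common_parameter_def J_def by blast
  then obtain n u where nu: "\<And>i. i \<in> J \<Longrightarrow> (\<forall>p\<in>S. unit_of p (u i)) \<and> c i = u i * w powi (n i)"
    by metis
  have J: "finite J" "J \<noteq> {}" using assms(2,4) by (auto simp: J_def)
  define k where "k = Min (n ` J)"
  have "k \<in> n ` J" unfolding k_def using J by (intro Min_in) auto
  then obtain i0 where i0: "i0 \<in> J" "n i0 = k" by auto
  have eq: "w powi (- k) * c i = u i * w powi (n i - k)" if "i \<in> J" for i
    using nu[OF that] w by (simp add: power_int_diff power_int_minus field_simps)
  have "w powi (- k) * c i \<in> p" if "i \<in> I" "p \<in> S" for i p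
  proof (cases "i \<in> J")
    case True
    have p: "dvr p" "w \<in> p" using assms(1) that(2) mm_1_subset by (auto simp: common_parameter_def)
    have "k \<le> n i" using True J by (auto simp: k_def)
    then have "w powi (n i - k) = w ^ nat (n i - k)" by (simp add: power_int_def)
    then have "w powi (- k) * c i = u i * w ^ nat (n i - k)" using eq[OF True] by simp
    moreover have "u i \<in> p" using nu[OF True] that(2) by (simp add: unit_of_def)
    ultimately show ?thesis
      using subring_mult[OF dvr_subring[OF p(1)]] subring_power[OF dvr_subring[OF p(1)] p(2)] by simp
  next
    case False
    then have "c i = 0" using that(1) by (simp add: J_def)
    moreover have "dvr p" using assms(1) that(2) by (simp add: common_parameter_def)
    ultimately show ?thesis using subring_0[OF dvr_subring, of p] by simp
  qed
  moreover have "w powi (- k) * c i0 = u i0" using eq[OF i0(1)] i0(2) by simp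
  then have "\<forall>p\<in>S. unit_of p (w powi (- k) * c i0)" using nu[OF i0(1)] by (simp only:) blast
  ultimately show ?thesis using i0(1) unfolding J_def by blast
qed

text \<open>
  Elements \<open>x p\<close> that are congruent to \<open>1\<close> at \<open>p\<close> and to \<open>0\<close> at the other valuations are linearly independent over \<open>F\<close>: in a relation with
  coefficients that are integral and not all in the maximal ideal, a single term is a unit at a suitable \<open>p\<close>.  So their number is at most
  the degree.
\<close>

lemma finitely_many_extensions:
  assumes "subfield F" "spans_over F B" "common_parameter F w T"
  shows "finite T"
proof (rule ccontr)
  assume "infinite T"
  then obtain S where S: "S \<subseteq> T" "finite S" "card S = Suc (card B)" by (meson infinite_arbitrarily_large)
  have cp: "common_parameter F w S" using assms(3) S(1) unfolding common_parameter_def by blast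
  then have dvr: "dvr p" if "p \<in> S" for p using that by (simp add: common_parameter_def)
  have "\<exists>x. x - 1 \<in> \<mm> p 1 \<and> (\<forall>q\<in>S - {p}. x \<in> \<mm> q 1)" if "p \<in> S" for p
    using approximate_idempotent[of "S - {p}" p 1] S(2) dvr that by auto
  then obtain x where x: "\<And>p. p \<in> S \<Longrightarrow> x p - 1 \<in> \<mm> p 1 \<and> (\<forall>q\<in>S - {p}. x p \<in> \<mm> q 1)" by metis
  obtain c where c: "\<forall>p\<in>S. c p \<in> F" "\<exists>p\<in>S. c p \<noteq> 0" "(\<Sum>p\<in>S. c p * x p) = 0"
    using dependent_over_subfield[OF assms(1,2) S(2), of x] S(3) by auto
  obtain k p0 where k: "\<forall>i\<in>S. \<forall>p\<in>S. w powi k * c i \<in> p" "p0 \<in> S" "\<forall>p\<in>S. unit_of p (w powi k * c p0)"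
    using normalize_coefficients[OF cp S(2), of c] c(1,2) by blast
  have "unit_of p0 (1 + (x p0 - 1))"
    using x k(2) dvr by (intro unit_add_mm unit_of_1 dvr_subring) auto
  then have unit: "unit_of p0 (w powi k * c p0 * x p0)"
    using k unit_of_mult[OF dvr_subring[OF dvr[OF k(2)]]] by simp
  have "(\<Sum>p\<in>S - {p0}. w powi k * c p * x p) \<in> \<mm> p0 1"
    using x k(1,2) by (intro mm_sum mm_mult_ring dvr) auto
  then have "unit_of p0 (w powi k * c p0 * x p0 + (\<Sum>p\<in>S - {p0}. w powi k * c p * x p))"
    using unit_add_mm[OF dvr[OF k(2)] unit] by blast
  also have "w powi k * c p0 * x p0 + (\<Sum>p\<in>S - {p0}. w powi k * c p * x p) = (\<Sum>p\<in>S. w powi k * c p * x p)"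
    using sum.remove[OF S(2) k(2), of "\<lambda>p. w powi k * c p * x p"] by simp
  also have "\<dots> = w powi k * (\<Sum>p\<in>S. c p * x p)" by (simp add: sum_distrib_left mult.assoc)
  finally show False using c(3) by (simp add: unit_of_def)
qed

section \<open>Function fields over the complex numbers\<close>

lemma ring_map_simps:
  assumes "ring_map h"
  shows ring_map_0: "h 0 = 0" and ring_map_1: "h 1 = 1" and ring_map_add: "h (a + b) = h a + h b"
    and ring_map_mult: "h (a * b) = h a * h b" and ring_map_minus: "h (- a) = - h a"
    and ring_map_diff: "h (a - b) = h a - h b"
proof -
  have *: "h 1 = 1" "\<And>a b. h (a + b) = h a + h b" "\<And>a b. h (a * b) = h a * h b"
    using assms unfolding ring_map_def by auto
  have 0: "h 0 = 0" using *(2)[of 0 0] by (metis add_0 add_cancel_right_right)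
  have m: "h (- a) = - h a" for a using *(2)[of a "- a"] 0 by (simp add: eq_neg_iff_add_eq_0 add.commute)
  show "h 0 = 0" "h 1 = 1" "h (a + b) = h a + h b" "h (a * b) = h a * h b" "h (- a) = - h a" by (fact | rule)+
  show "h (a - b) = h a - h b" using *(2)[of a "- b"] m by simp
qed

lemma ring_map_eq_0: "ring_map h \<Longrightarrow> h a = 0 \<longleftrightarrow> a = 0"
  using ring_map_mult[of h a "inverse a"] ring_map_0[of h] ring_map_1[of h] by (cases "a = 0") auto

lemma ring_map_eq: "ring_map h \<Longrightarrow> h a = h b \<longleftrightarrow> a = b"
  using ring_map_eq_0[of h "a - b"] ring_map_diff[of h a b] by auto

lemma ring_map_inverse: "ring_map h \<Longrightarrow> h (inverse a) = inverse (h a)"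
  using ring_map_mult[of h a "inverse a"] ring_map_0[of h] ring_map_1[of h] ring_map_eq_0[of h a]
  by (cases "a = 0") (auto simp: inverse_unique)

lemma ring_map_power: "ring_map h \<Longrightarrow> h (a ^ n) = h a ^ n"
  by (induction n) (auto simp: ring_map_1 ring_map_mult)

lemma ring_map_powi: "ring_map h \<Longrightarrow> h (a powi n) = h a powi n"
  by (cases n rule: int_cases2) (auto simp: power_int_minus ring_map_power ring_map_inverse)

lemma ring_map_sum: "ring_map h \<Longrightarrow> h (sum f I) = (\<Sum>i\<in>I. h (f i))"
  by (induction I rule: infinite_finite_induct) (auto simp: ring_map_0 ring_map_add)

definition eval_at :: "(complex \<Rightarrow> 'k::field) \<Rightarrow> 'k \<Rightarrow> complex poly \<Rightarrow> 'k" where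
  "eval_at c t P = poly (map_poly c P) t"

lemma eval_at_pCons: "ring_map c \<Longrightarrow> eval_at c t (pCons a P) = c a + t * eval_at c t P"
  by (simp add: eval_at_def map_poly_pCons ring_map_0)

lemma eval_at_0: "eval_at c t 0 = 0"
  by (simp add: eval_at_def)

lemma eval_at_add: "ring_map c \<Longrightarrow> eval_at c t (P + Q) = eval_at c t P + eval_at c t Q"
  by (induction P Q rule: poly_induct2) (auto simp: eval_at_pCons eval_at_0 ring_map_add algebra_simps)

lemma eval_at_smult: "ring_map c \<Longrightarrow> eval_at c t (smult a P) = c a * eval_at c t P"
  by (induction P) (auto simp: eval_at_pCons eval_at_0 ring_map_mult algebra_simps)

lemma eval_at_mult: "ring_map c \<Longrightarrow> eval_at c t (P * Q) = eval_at c t P * eval_at c t Q"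
  by (induction P)
    (auto simp: eval_at_pCons eval_at_0 eval_at_add eval_at_smult ring_map_0 algebra_simps)

lemma eval_at_1: "ring_map c \<Longrightarrow> eval_at c t 1 = 1"
  using eval_at_pCons[of c t 1 0] by (simp add: one_pCons ring_map_1 eval_at_0)

lemma eval_at_monom: "ring_map c \<Longrightarrow> eval_at c t (monom a n) = c a * t ^ n"
  by (induction n) (auto simp: monom_0 monom_Suc eval_at_pCons eval_at_0 ring_map_0)

lemma eval_at_sum: "ring_map c \<Longrightarrow> eval_at c t (sum f I) = (\<Sum>i\<in>I. eval_at c t (f i))"
  by (induction I rule: infinite_finite_induct) (auto simp: eval_at_0 eval_at_add)

lemma simple_subfield_eval: "simple_subfield c t = {eval_at c t P / eval_at c t Q | P Q. True}"
  by (simp add: simple_subfield_def eval_at_def)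

lemma subfield_simple_subfield:
  assumes "ring_map c" shows "subfield (simple_subfield c t)"
proof -
  have "1 \<in> simple_subfield c t"
    unfolding simple_subfield_eval using eval_at_1[OF assms, of t] by (auto intro!: exI[of _ 1])
  moreover have "a - b \<in> simple_subfield c t \<and> a * b \<in> simple_subfield c t"
    if ab: "a \<in> simple_subfield c t" "b \<in> simple_subfield c t" for a b
  proof -
    \<comment> \<open>a quotient with denominator \<open>0\<close> is \<open>0\<close>, so all denominators may be taken nonzero\<close>
    have nz: "\<exists>P Q. z = eval_at c t P / eval_at c t Q \<and> eval_at c t Q \<noteq> 0"
      if z: "z \<in> simple_subfield c t" for z
    proof -
      obtain P Q where "z = eval_at c t P / eval_at c t Q" using z unfolding simple_subfield_eval by blast
      then show ?thesis using eval_at_0[of c t] eval_at_1[OF assms, of t]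
        by (metis div_by_0 div_0 one_neq_zero)
    qed
    obtain P Q P' Q' where PQ: "a = eval_at c t P / eval_at c t Q" "eval_at c t Q \<noteq> 0"
      "b = eval_at c t P' / eval_at c t Q'" "eval_at c t Q' \<noteq> 0"
      using nz[OF ab(1)] nz[OF ab(2)] by blast
    have "a - b = eval_at c t (P * Q' + smult (- 1) (P' * Q)) / eval_at c t (Q * Q')"
      unfolding PQ(1,3) diff_frac_eq[OF PQ(2,4)] eval_at_add[OF assms] eval_at_smult[OF assms] eval_at_mult[OF assms]
        ring_map_minus[OF assms] ring_map_1[OF assms] by simp
    moreover have "a * b = eval_at c t (P * P') / eval_at c t (Q * Q')"
      using PQ by (simp add: eval_at_mult[OF assms])
    ultimately show ?thesis unfolding simple_subfield_eval by blast
  qed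
  moreover have "inverse a \<in> simple_subfield c t" if a: "a \<in> simple_subfield c t" for a
  proof -
    obtain P Q where "a = eval_at c t P / eval_at c t Q" using a unfolding simple_subfield_eval by blast
    then have "inverse a = eval_at c t Q / eval_at c t P" by simp
    then show ?thesis unfolding simple_subfield_eval by blast
  qed
  ultimately show ?thesis unfolding subfield_def subring_of_def by blast
qed

lemma const_simple_subfield: "ring_map c \<Longrightarrow> c a \<in> simple_subfield c t"
  unfolding simple_subfield_eval mem_Collect_eq using eval_at_pCons[of c t a 0] eval_at_1[of c t] eval_at_0[of c t]
  by (intro exI[of _ "[:a:]"] exI[of _ 1]) simp

lemma gen_simple_subfield: "ring_map c \<Longrightarrow> t \<in> simple_subfield c t"
  unfolding simple_subfield_eval mem_Collect_eq using eval_at_pCons[of c t 0 1] eval_at_1[of c t] ring_map_0[of c]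
  by (intro exI[of _ "[:0, 1:]"] exI[of _ 1]) (simp add: one_pCons)

lemma simple_subfield_least:
  assumes "ring_map c" "subfield F" "range c \<subseteq> F" "t \<in> F" shows "simple_subfield c t \<subseteq> F"
proof -
  note R = subfield_subring[OF assms(2)]
  have "eval_at c t P \<in> F" for P
    using assms(3,4) by (induction P)
      (auto simp: eval_at_0 eval_at_pCons[OF assms(1)] intro!: subring_0[OF R] subring_add[OF R] subring_mult[OF R])
  then show ?thesis unfolding simple_subfield_eval using subfield_divide[OF assms(2)] by blast
qed

lemma spans_over_mono: "spans_over F B \<Longrightarrow> F \<subseteq> G \<Longrightarrow> spans_over G B"
  unfolding spans_over_def by (meson in_mono)

lemma const_unit:
  assumes "ring_map c" "range c \<subseteq> p" "a \<noteq> 0" shows "unit_of p (c a)"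
proof -
  have "c a \<in> p" "c (inverse a) \<in> p" using assms(2) by auto
  then show ?thesis using assms(3) by (simp add: unit_of_def ring_map_inverse[OF assms(1)] ring_map_eq_0[OF assms(1)])
qed

text \<open>Every nonzero polynomial over \<open>\<complex>\<close> is a constant times a product of factors \<open>t - a\<close>.\<close>

lemma eval_at_unit:
  assumes "ring_map c" "dvr p" "range c \<subseteq> p" "\<And>a. poly P a = 0 \<Longrightarrow> unit_of p (t - c a)" "P \<noteq> 0"
  shows "unit_of p (eval_at c t P)"
  using assms(4,5)
proof (induction "degree P" arbitrary: P)
  case 0
  then obtain a where "P = [:a:]" by (metis degree_eq_zeroE)
  moreover from this have "a \<noteq> 0" using 0 by auto
  ultimately show ?case using const_unit[OF assms(1,3)] by (simp add: eval_at_pCons[OF assms(1)] eval_at_0)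
next
  case (Suc n)
  then obtain a where a: "poly P a = 0"
    using fundamental_theorem_of_algebra[of P] constant_degree[of P] by force
  then obtain Q where Q: "P = [:- a, 1:] * Q" by (metis poly_eq_0_iff_dvd dvd_def)
  have "Q \<noteq> 0" using Suc.prems Q by auto
  then have "degree P = degree [:- a, 1:] + degree Q" unfolding Q by (intro degree_mult_eq) auto
  then have "degree P = Suc (degree Q)" by simp
  then have "unit_of p (eval_at c t Q)" using Suc Q \<open>Q \<noteq> 0\<close> by (intro Suc.hyps(1)) auto
  moreover have "eval_at c t [:- a, 1:] = t - c a"
    by (simp add: eval_at_pCons[OF assms(1)] eval_at_0 ring_map_minus[OF assms(1)] ring_map_1[OF assms(1)])
  ultimately show ?case
    using Suc.prems(1)[OF a] unit_of_mult[OF dvr_subring[OF assms(2)]]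
    unfolding Q eval_at_mult[OF assms(1)] by simp
qed

lemma eval_at_parameter:
  assumes "ring_map c" "dvr p" "range c \<subseteq> p" "w \<in> \<mm> p 1" "P \<noteq> 0"
  shows "\<exists>n a R. a \<noteq> 0 \<and> eval_at c w P = w ^ n * eval_at c w R \<and> poly R 0 = a"
  using assms(5)
proof (induction P)
  case 0 then show ?case by simp
next
  case (pCons a Q)
  show ?case
  proof (cases "a = 0")
    case True
    then obtain n b R where "b \<noteq> 0 \<and> eval_at c w Q = w ^ n * eval_at c w R \<and> poly R 0 = b"
      using pCons by auto
    then show ?thesis using True
      by (intro exI[of _ "Suc n"] exI[of _ b] exI[of _ R])
        (auto simp: eval_at_pCons[OF assms(1)] ring_map_0[OF assms(1)])
  next
    case False
    then show ?thesis by (intro exI[of _ 0] exI[of _ a] exI[of _ "pCons a Q"]) auto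
  qed
qed

lemma eval_at_mem: "ring_map c \<Longrightarrow> subring_of p \<Longrightarrow> range c \<subseteq> p \<Longrightarrow> t \<in> p \<Longrightarrow> eval_at c t P \<in> p"
  by (induction P)
    (auto simp: eval_at_0 eval_at_pCons subring_0 intro!: subring_add[of p] subring_mult[of p])

lemma eval_at_residue:
  assumes "ring_map c" "dvr p" "range c \<subseteq> p" "w \<in> \<mm> p 1"
  shows "eval_at c w R - c (poly R 0) \<in> \<mm> p 1"
proof (cases R)
  case (pCons a Q)
  have "w * eval_at c w Q \<in> \<mm> p 1"
    using mm_mult_ring[OF assms(2) eval_at_mem[OF assms(1) dvr_subring[OF assms(2)] assms(3)] assms(4)]
      mm_1_subset[OF assms(2,4)] by (simp add: mult.commute)
  then show ?thesis using pCons by (simp add: eval_at_pCons[OF assms(1)])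
qed

lemma residue_unit:
  assumes "ring_map c" "dvr p" "range c \<subseteq> p" "a \<noteq> 0" "u - c a \<in> \<mm> p 1" shows "unit_of p u"
  using unit_add_mm[OF assms(2) const_unit[OF assms(1,3,4)] assms(5)] by simp

text \<open>
  A polynomial in \<open>w\<close> is a power of \<open>w\<close> times a polynomial with nonzero constant term, and the latter is a unit wherever \<open>w\<close> vanishes.
\<close>

lemma common_parameter_simple_subfield:
  assumes "ring_map c" "\<And>p. p \<in> S \<Longrightarrow> dvr p \<and> range c \<subseteq> p \<and> w \<in> \<mm> p 1" "w \<noteq> 0" "S \<noteq> {}"
  shows "common_parameter (simple_subfield c w) w S"
proof -
  obtain p0 where p0: "p0 \<in> S" using assms(4) by blast
  have dec: "\<exists>n u. (\<forall>p\<in>S. unit_of p u) \<and> eval_at c w P = u * w powi n" if P: "P \<noteq> 0" for P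
  proof -
    obtain n R where R: "poly R 0 \<noteq> 0" "eval_at c w P = w ^ n * eval_at c w R"
      using eval_at_parameter[OF assms(1) _ _ _ P, of p0 w] assms(2)[OF p0] by blast
    have "unit_of p (eval_at c w R)" if "p \<in> S" for p
      using residue_unit[OF assms(1) _ _ R(1) eval_at_residue[OF assms(1)]] assms(2)[OF that] by blast
    then show ?thesis using R(2) by (intro exI[of _ "int n"] exI[of _ "eval_at c w R"]) auto
  qed
  have "\<exists>n u. (\<forall>p\<in>S. unit_of p u) \<and> a = u * w powi n" if a: "a \<in> simple_subfield c w" "a \<noteq> 0" for a
  proof -
    obtain P Q where PQ: "a = eval_at c w P / eval_at c w Q" using a(1) unfolding simple_subfield_eval by blast
    then have "P \<noteq> 0" "Q \<noteq> 0" using a(2) eval_at_0[of c w] by auto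
    then obtain n u m v where nu: "\<forall>p\<in>S. unit_of p u" "eval_at c w P = u * w powi n"
      "\<forall>p\<in>S. unit_of p v" "eval_at c w Q = v * w powi m" using dec by meson
    have "a = (u * inverse v) * w powi (n - m)"
      using PQ nu(2,4) assms(3) by (simp add: power_int_diff divide_inverse)
    moreover have "\<forall>p\<in>S. unit_of p (u * inverse v)"
      using nu(1,3) unit_of_mult[OF dvr_subring] unit_of_inverse assms(2) by blast
    ultimately show ?thesis by blast
  qed
  then show ?thesis unfolding common_parameter_def using gen_simple_subfield[OF assms(1)] assms(2,3) by blast
qed

text \<open>The residue of an integral element is its value, as a rational function of \<open>w\<close>, at \<open>w = 0\<close>.\<close>

lemma simple_subfield_residue:
  assumes "ring_map c" "dvr p" "range c \<subseteq> p" "w \<in> \<mm> p 1" "w \<noteq> 0" "x \<in> simple_subfield c w" "x \<in> p"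
  shows "\<exists>a. x - c a \<in> \<mm> p 1"
proof (cases "x = 0")
  case True then show ?thesis using zero_mm[OF assms(2)] ring_map_0[OF assms(1)] by (auto intro!: exI[of _ 0])
next
  case False
  obtain P Q where PQ: "x = eval_at c w P / eval_at c w Q" using assms(6) unfolding simple_subfield_eval by blast
  then have "P \<noteq> 0" "Q \<noteq> 0" using False eval_at_0[of c w] by auto
  then obtain n R m T where R: "poly R 0 \<noteq> 0" "eval_at c w P = w ^ n * eval_at c w R"
    and T: "poly T 0 \<noteq> 0" "eval_at c w Q = w ^ m * eval_at c w T"
    using eval_at_parameter[OF assms(1-4)] by metis
  define r s where "r = eval_at c w R" and "s = eval_at c w T"
  have r: "r - c (poly R 0) \<in> \<mm> p 1" and s: "s - c (poly T 0) \<in> \<mm> p 1"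
    unfolding r_def s_def using eval_at_residue[OF assms(1-4)] by auto
  have ru: "unit_of p r" and su: "unit_of p s" using residue_unit[OF assms(1-3)] R(1) T(1) r s by blast+
  then have nz: "r \<noteq> 0" "s \<noteq> 0" "val p r = 0" "val p s = 0" using unit_of_iff_val[OF assms(2)] by auto
  have x: "x = w ^ n * r / (w ^ m * s)" using PQ R(2) T(2) by (simp add: r_def s_def)
  have valx: "val p x = (int n - int m) * val p w"
    using x nz assms(5) by (simp add: val_divide[OF assms(2)] val_mult[OF assms(2)] val_power[OF assms(2)] algebra_simps)
  have w: "1 \<le> val p w" using assms(4,5) mm_iff[OF assms(2)] by auto
  show ?thesis
  proof (cases "1 \<le> val p x")
    case True
    then show ?thesis using mm_iff[OF assms(2), of x 1] ring_map_0[OF assms(1)] by (intro exI[of _ 0]) simp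
  next
    case False
    then have "n = m" using valx w assms(7) \<open>x \<noteq> 0\<close> mem_iff_val[OF assms(2), of x]
      by (smt (verit) mult_eq_0_iff of_nat_eq_iff)
    then have xrs: "x = r / s" using x assms(5) by simp
    define a where "a = poly R 0 / poly T 0"
    have "c a * c (poly T 0) = c (poly R 0)" using ring_map_mult[OF assms(1), of a "poly T 0"] T(1) by (simp add: a_def)
    then have "x - c a = inverse s * ((r - c (poly R 0)) - c a * (s - c (poly T 0)))"
      using xrs nz by (simp add: field_simps)
    moreover have "c a \<in> p" using assms(3) by auto
    ultimately have "x - c a \<in> \<mm> p 1"
      using mm_mult_ring[OF assms(2)] mm_diff[OF assms(2) r] s su by (simp add: unit_of_def)
    then show ?thesis by blast
  qed
qed

text \<open>
  At every point one of the functions \<open>1/t\<close> and \<open>t - a\<close> vanishes: otherwise all rational functions of \<open>t\<close> would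
  be regular at the point, and so would be the functions integral over them, which are all functions.
\<close>

lemma exists_parameter:
  assumes "ring_map c" "\<And>P. eval_at c t P = 0 \<Longrightarrow> P = 0" "spans_over (simple_subfield c t) B"
    "dvr p" "range c \<subseteq> p"
  shows "\<exists>w \<in> insert (1 / t) (range (\<lambda>a. t - c a)). w \<noteq> 0 \<and> w \<in> \<mm> p 1"
proof (cases "t \<in> p")
  case False
  then have "1 / t \<in> \<mm> p 1" "t \<noteq> 0"
    using inverse_mm[OF assms(4) False] subring_0[OF dvr_subring[OF assms(4)]] by (auto simp: inverse_eq_divide)
  then show ?thesis by auto
next
  case True
  have "\<exists>a. \<not> unit_of p (t - c a)"
  proof (rule ccontr)
    assume no: "\<nexists>a. \<not> unit_of p (t - c a)"
    then have u: "unit_of p (eval_at c t P)" if "P \<noteq> 0" for P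
      using eval_at_unit[OF assms(1,4,5) _ that] by blast
    have sub: "simple_subfield c t \<subseteq> p"
    proof
      fix x assume "x \<in> simple_subfield c t"
      then obtain P Q where x: "x = eval_at c t P / eval_at c t Q" unfolding simple_subfield_eval by blast
      show "x \<in> p"
      proof (cases "Q = 0")
        case True then show ?thesis using x eval_at_0[of c t] subring_0[OF dvr_subring[OF assms(4)]] by simp
      next
        case False
        then show ?thesis
          using x u[OF False] subring_mult[OF dvr_subring[OF assms(4)]]
            eval_at_mem[OF assms(1) dvr_subring[OF assms(4)] assms(5) True]
          by (simp add: divide_inverse unit_of_def)
      qed
    qed
    have "x \<in> p" for x
      using algebraic_over_subfield[OF subfield_simple_subfield[OF assms(1)] assms(3), of x] sub
        dvr_integrally_closed[OF assms(4)] by blast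
    then show False using dvr_ne_UNIV[OF assms(4)] by blast
  qed
  then obtain a where a: "\<not> unit_of p (t - c a)" by blast
  have "t - c a \<in> p" using True assms(5) subring_diff[OF dvr_subring[OF assms(4)]] by blast
  moreover have "t - c a \<noteq> 0"
    using assms(2)[of "[:- a, 1:]"]
    by (auto simp: eval_at_pCons[OF assms(1)] eval_at_0 ring_map_minus[OF assms(1)] ring_map_1[OF assms(1)])
  ultimately have "t - c a \<in> \<mm> p 1" "t - c a \<noteq> 0"
    using a by (auto simp: unit_of_iff_val[OF assms(4)] mem_iff_val[OF assms(4)] mm_iff[OF assms(4)])
  then show ?thesis by blast
qed

lemma function_field_generator:
  assumes "function_field c"
  obtains t B where "\<And>P. eval_at c t P = 0 \<Longrightarrow> P = 0" "spans_over (simple_subfield c t) B"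
  using assms unfolding function_field_def eval_at_def spans_over_def by blast

lemma spans_over_parameter:
  assumes "ring_map c" "spans_over (simple_subfield c t) B" "w \<in> insert (1 / t) (range (\<lambda>a. t - c a))"
  shows "spans_over (simple_subfield c w) B"
proof -
  note F = subfield_simple_subfield[OF assms(1), of w]
  note R = subfield_subring[OF F]
  have w: "w \<in> simple_subfield c w" "range c \<subseteq> simple_subfield c w"
    using gen_simple_subfield const_simple_subfield assms(1) by blast+
  from assms(3) have "t \<in> simple_subfield c w"
  proof
    assume "w = 1 / t"
    then have "t = inverse w" by (simp add: inverse_eq_divide)
    then show ?thesis using w(1) F by (simp add: subfield_def)
  next
    assume "w \<in> range (\<lambda>a. t - c a)"
    then obtain a where "t = w + c a" by (auto simp: algebra_simps)
    then show ?thesis using w subring_add[OF R w(1)] by blast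
  qed
  then show ?thesis using simple_subfield_least[OF assms(1) F w(2)] spans_over_mono[OF assms(2)] by blast
qed

text \<open>
  The function field is finite over \<open>\<complex>(w)\<close> for a parameter \<open>w\<close> at \<open>p\<close>.  Reduction of a linear relation between the powers of \<open>x\<close>
  gives a nonzero polynomial over \<open>\<complex>\<close> that has no unit as value at \<open>x\<close>; so one of its linear factors \<open>x - a\<close> is not a unit.
\<close>

lemma residue_constant:
  assumes "function_field (emb X)" "p \<in> points X" "x \<in> p"
  shows "\<exists>a. x - emb X a \<in> \<mm> p 1"
proof (rule ccontr)
  assume no: "\<nexists>a. x - emb X a \<in> \<mm> p 1"
  define c where "c = emb X"
  have c: "ring_map c" using assms(1) by (simp add: function_field_def c_def)
  have p: "dvr p" "range c \<subseteq> p" using assms(2) points_dvr by (auto simp: points_def c_def)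
  note R = dvr_subring[OF p(1)]
  obtain t B where t: "\<And>P. eval_at c t P = 0 \<Longrightarrow> P = 0" "spans_over (simple_subfield c t) B"
    using function_field_generator assms(1) unfolding c_def by blast
  obtain w where w: "w \<in> insert (1 / t) (range (\<lambda>a. t - c a))" "w \<noteq> 0" "w \<in> \<mm> p 1"
    using exists_parameter[OF c t p] by blast
  note span = spans_over_parameter[OF c t(2) w(1)]
  have cp: "common_parameter (simple_subfield c w) w {p}"
    using common_parameter_simple_subfield[OF c, of "{p}" w] p w by simp
  obtain b where b: "\<forall>i\<in>{..card B}. b i \<in> simple_subfield c w" "\<exists>i\<in>{..card B}. b i \<noteq> 0"
     "(\<Sum>i\<in>{..card B}. b i * x ^ i) = 0"
    using dependent_over_subfield[OF subfield_simple_subfield[OF c] span, of "{..card B}" "\<lambda>i. x ^ i"] by auto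
  obtain k i0 where k: "\<forall>i\<in>{..card B}. w powi k * b i \<in> p" "i0 \<in> {..card B}" "unit_of p (w powi k * b i0)"
    using normalize_coefficients[OF cp _ _ b(2)] b(1) by auto
  have F: "w powi k * b i \<in> simple_subfield c w" if "i \<in> {..card B}" for i
  proof -
    have "w powi k \<in> simple_subfield c w"
      using gen_simple_subfield[OF c, of w] subfield_simple_subfield[OF c, of w]
        subring_power[OF subfield_subring[OF subfield_simple_subfield[OF c]]]
      by (cases k rule: int_cases2) (auto simp: power_int_minus subfield_def)
    then show ?thesis using that b(1) subring_mult[OF subfield_subring[OF subfield_simple_subfield[OF c]]] by blast
  qed
  have "\<exists>a. w powi k * b i - c a \<in> \<mm> p 1" if "i \<in> {..card B}" for i
    using simple_subfield_residue[OF c p w(3,2) F[OF that]] k(1) that by blast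
  then obtain a where a: "\<And>i. i \<in> {..card B} \<Longrightarrow> w powi k * b i - c (a i) \<in> \<mm> p 1" by metis
  define Q where "Q = (\<Sum>i\<in>{..card B}. monom (a i) i)"
  have "a i0 \<noteq> 0"
  proof
    assume "a i0 = 0"
    then have "w powi k * b i0 \<in> \<mm> p 1" using a[OF k(2)] ring_map_0[OF c] by simp
    then show False using k(3) by (auto simp: unit_of_iff_val[OF p(1)] mm_iff[OF p(1)])
  qed
  moreover have "coeff Q i0 = a i0" using k(2) by (simp add: Q_def coeff_sum)
  ultimately have "Q \<noteq> 0" by auto
  moreover have "unit_of p (x - c d)" for d
  proof -
    have "x - c d \<in> p" using subring_diff[OF R assms(3), of "c d"] p(2) by blast
    then show ?thesis using no
      by (fastforce simp: unit_of_iff_val[OF p(1)] mem_iff_val[OF p(1)] mm_iff[OF p(1)] c_def)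
  qed
  ultimately have u: "unit_of p (eval_at c x Q)" using eval_at_unit[OF c p] by blast
  have "eval_at c x Q = (\<Sum>i\<in>{..card B}. c (a i) * x ^ i)"
    by (simp add: Q_def eval_at_sum[OF c] eval_at_monom[OF c])
  also have "\<dots> = (\<Sum>i\<in>{..card B}. w powi k * b i * x ^ i) - (\<Sum>i\<in>{..card B}. x ^ i * (w powi k * b i - c (a i)))"
    by (simp add: sum_subtractf[symmetric] algebra_simps)
  also have "(\<Sum>i\<in>{..card B}. w powi k * b i * x ^ i) = w powi k * (\<Sum>i\<in>{..card B}. b i * x ^ i)"
    by (simp add: sum_distrib_left mult.assoc)
  finally have "eval_at c x Q = - (\<Sum>i\<in>{..card B}. x ^ i * (w powi k * b i - c (a i)))" using b(3) by simp
  moreover have "(\<Sum>i\<in>{..card B}. x ^ i * (w powi k * b i - c (a i))) \<in> \<mm> p 1"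
    using a subring_power[OF R assms(3)] by (intro mm_sum[OF p(1)] mm_mult_ring[OF p(1)]) auto
  ultimately have "eval_at c x Q \<in> \<mm> p 1" using mm_minus[OF p(1)] by simp
  then show False using u by (auto simp: unit_of_iff_val[OF p(1)] mm_iff[OF p(1)])
qed

lemma finite_zeros:
  assumes "ring_map (emb X)" "spans_over (simple_subfield (emb X) w) B" "w \<noteq> 0"
  shows "finite {p\<in>points X. w \<in> \<mm> p 1}"
proof (cases "{p\<in>points X. w \<in> \<mm> p 1} = {}")
  case nonempty: False
  have "common_parameter (simple_subfield (emb X) w) w {p\<in>points X. w \<in> \<mm> p 1}"
    using nonempty points_dvr assms
    by (intro common_parameter_simple_subfield) (auto simp: points_def)
  then show ?thesis using finitely_many_extensions[OF subfield_simple_subfield[OF assms(1)] assms(2)] by blast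
next
  case True then show ?thesis by (simp only: finite.emptyI)
qed

text \<open>
  The coefficients of an integral equation for \<open>x\<close> over \<open>\<complex>(t)\<close> have poles only where \<open>1/t\<close> or one of finitely
  many functions \<open>t - a\<close> vanishes.
\<close>

lemma finite_poles:
  assumes "function_field (emb X)"
  shows "finite {p\<in>points X. x \<notin> p}"
proof -
  define c where "c = emb X"
  have c: "ring_map c" using assms(1) by (simp add: function_field_def c_def)
  obtain t B where t: "\<And>P. eval_at c t P = 0 \<Longrightarrow> P = 0" "spans_over (simple_subfield c t) B"
    using function_field_generator assms(1) unfolding c_def by blast
  obtain n a where a: "\<forall>i<n. a i \<in> simple_subfield c t" "x ^ n = (\<Sum>i<n. a i * x ^ i)"
    using algebraic_over_subfield[OF subfield_simple_subfield[OF c] t(2)] by blast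
  define Z where "Z w = {p\<in>points X. w \<noteq> 0 \<and> w \<in> \<mm> p 1}" for w
  have Z: "finite (Z w)" if "w \<in> insert (1 / t) (range (\<lambda>a. t - c a))" for w
    using finite_zeros[of X w B] spans_over_parameter[OF c t(2) that] c unfolding Z_def c_def
    by (cases "w = 0") auto
  have fin: "finite {p\<in>points X. b \<notin> p}" if bF: "b \<in> simple_subfield c t" for b
  proof -
    obtain P Q where b: "b = eval_at c t P / eval_at c t Q" using bF unfolding simple_subfield_eval by blast
    have "{p\<in>points X. b \<notin> p} \<subseteq> Z (1 / t) \<union> (if Q = 0 then {} else \<Union>r\<in>{r. poly Q r = 0}. Z (t - c r))"
    proof
      fix p assume "p \<in> {p\<in>points X. b \<notin> p}"
      then have p: "p \<in> points X" "b \<notin> p" "dvr p" "range c \<subseteq> p"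
        using points_dvr by (auto simp: points_def c_def)
      note R = dvr_subring[OF p(3)]
      have "Q \<noteq> 0" using p(2) b subring_0[OF R] by (auto simp: eval_at_0)
      show "p \<in> Z (1 / t) \<union> (if Q = 0 then {} else \<Union>r\<in>{r. poly Q r = 0}. Z (t - c r))"
      proof (cases "t \<in> p")
        case False
        then have "1 / t \<in> \<mm> p 1" "t \<noteq> 0"
          using inverse_mm[OF p(3) False] subring_0[OF R] by (auto simp: inverse_eq_divide)
        then show ?thesis using p(1) by (simp add: Z_def)
      next
        case True
        have "\<not> unit_of p (eval_at c t Q)"
          using p(2) b subring_mult[OF R eval_at_mem[OF c R p(4) True]] by (auto simp: unit_of_def divide_inverse)
        then obtain r where r: "poly Q r = 0" "\<not> unit_of p (t - c r)"
          using eval_at_unit[OF c p(3,4) _ \<open>Q \<noteq> 0\<close>] by blast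
        have "t - c r \<noteq> 0"
          using t(1)[of "[:- r, 1:]"]
          by (auto simp: eval_at_pCons[OF c] eval_at_0 ring_map_minus[OF c] ring_map_1[OF c])
        moreover have "t - c r \<in> p" using True p(4) subring_diff[OF R] by blast
        ultimately have "p \<in> Z (t - c r)"
          using r(2) p(1) by (auto simp: Z_def unit_of_iff_val[OF p(3)] mem_iff_val[OF p(3)] mm_iff[OF p(3)])
        then show ?thesis using r(1) \<open>Q \<noteq> 0\<close> by auto
      qed
    qed
    moreover have "finite (Z (1 / t) \<union> (if Q = 0 then {} else \<Union>r\<in>{r. poly Q r = 0}. Z (t - c r)))"
      using Z poly_roots_finite[of Q] by auto
    ultimately show ?thesis by (rule finite_subset)
  qed
  have "{p\<in>points X. x \<notin> p} \<subseteq> (\<Union>i<n. {p\<in>points X. a i \<notin> p})"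
    using dvr_integrally_closed[OF points_dvr _ a(2)] by blast
  moreover have "finite (\<Union>i<n. {p\<in>points X. a i \<notin> p})" using fin a(1) by auto
  ultimately show ?thesis by (rule finite_subset)
qed

section \<open>Existence of discrete valuations above a given one\<close>

definition adjoin :: "'k::field set \<Rightarrow> 'k \<Rightarrow> 'k set" where
  "adjoin R w = {poly P w | P. \<forall>i. coeff P i \<in> R}"

lemma adjoinI: "(\<And>i. coeff P i \<in> R) \<Longrightarrow> poly P w = a \<Longrightarrow> a \<in> adjoin R w"
  unfolding adjoin_def by auto

lemma subring_adjoin:
  assumes "subring_of R" shows "subring_of (adjoin R w)"
  unfolding subring_of_def
proof (intro conjI ballI)
  show "1 \<in> adjoin R w"
    using subring_0[OF assms] subring_1[OF assms] by (intro adjoinI[of 1]) (simp_all add: coeff_1)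
  fix a b assume "a \<in> adjoin R w" "b \<in> adjoin R w"
  then obtain P Q where P: "a = poly P w" "\<forall>i. coeff P i \<in> R" and Q: "b = poly Q w" "\<forall>i. coeff Q i \<in> R"
    unfolding adjoin_def by blast
  show "a - b \<in> adjoin R w"
    using P Q by (intro adjoinI[of "P - Q"]) (simp_all add: subring_diff[OF assms])
  show "a * b \<in> adjoin R w"
    unfolding P(1) Q(1) poly_mult[symmetric]
    by (rule adjoinI[OF _ refl]) (use P Q in \<open>simp add: coeff_mult subring_sum[OF assms] subring_mult[OF assms]\<close>)
qed

lemma subset_adjoin: "subring_of R \<Longrightarrow> R \<subseteq> adjoin R w"
  by (rule subsetI, rule_tac P = "[:x:]" in adjoinI)
    (simp_all add: coeff_pCons subring_0 split: nat.split)

lemma mem_adjoin: "subring_of R \<Longrightarrow> w \<in> adjoin R w"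
  by (rule adjoinI[of "[:0, 1:]"])
    (simp_all add: coeff_pCons subring_0 subring_1 split: nat.split)

definition ideal_of :: "'k::field \<Rightarrow> 'k \<Rightarrow> 'k set \<Rightarrow> 'k set" where
  "ideal_of v s R = {v * a + s * b | a b. a \<in> R \<and> b \<in> R}"

lemma ideal_of_add:
  assumes "subring_of R" "x \<in> ideal_of v s R" "y \<in> ideal_of v s R" shows "x + y \<in> ideal_of v s R"
proof -
  obtain a b c d where "a \<in> R" "b \<in> R" "x = v * a + s * b" "c \<in> R" "d \<in> R" "y = v * c + s * d"
    using assms(2,3) unfolding ideal_of_def by blast
  then have "x + y = v * (a + c) + s * (b + d)" "a + c \<in> R" "b + d \<in> R"
    using subring_add[OF assms(1)] by (auto simp: algebra_simps)
  then show ?thesis unfolding ideal_of_def by blast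
qed

lemma ideal_of_mult:
  assumes "subring_of R" "r \<in> R" "x \<in> ideal_of v s R" shows "r * x \<in> ideal_of v s R"
proof -
  obtain a b where "a \<in> R" "b \<in> R" "x = v * a + s * b" using assms(3) unfolding ideal_of_def by blast
  then have "r * x = v * (r * a) + s * (r * b)" "r * a \<in> R" "r * b \<in> R"
    using subring_mult[OF assms(1,2)] by (auto simp: algebra_simps)
  then show ?thesis unfolding ideal_of_def by blast
qed

lemma ideal_of_zero: "subring_of R \<Longrightarrow> 0 \<in> ideal_of v s R"
  unfolding ideal_of_def using subring_0 by force

lemma ideal_of_sum:
  "subring_of R \<Longrightarrow> (\<And>i. i \<in> I \<Longrightarrow> f i \<in> ideal_of v s R) \<Longrightarrow> sum f I \<in> ideal_of v s R"
  by (induction I rule: infinite_finite_induct) (auto simp: ideal_of_zero ideal_of_add)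

text \<open>
  A ring that is maximal among those in which two given elements generate a proper ideal is a valuation ring
  (Chevalley): if neither \<open>z\<close> nor its inverse belonged to it, the ideal would contain \<open>1\<close> in both extensions, and the two
  resulting equations could be used to lower each other's degrees.
\<close>

locale maximal_ring =
  fixes v s :: "'k::field" and R :: "'k set"
  assumes subring: "subring_of R" and vs: "v \<in> R" "s \<in> R" and proper: "1 \<notin> ideal_of v s R"
    and maximal: "\<And>R'. subring_of R' \<Longrightarrow> R \<subseteq> R' \<Longrightarrow> 1 \<notin> ideal_of v s R' \<Longrightarrow> R' = R"
begin

abbreviation "I \<equiv> ideal_of v s R"

lemma ideal_subset: "i \<in> I \<Longrightarrow> i \<in> R"
  using subring vs unfolding ideal_of_def by (auto intro!: subring_add subring_mult)

lemma equation_of_nonmember: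
  assumes "w \<notin> R" shows "\<exists>G. (\<forall>i. coeff G i \<in> I) \<and> poly G w = 1"
proof -
  have "adjoin R w \<noteq> R" using mem_adjoin[OF subring, of w] assms by blast
  then have "1 \<in> ideal_of v s (adjoin R w)"
    using maximal[OF subring_adjoin[OF subring] subset_adjoin[OF subring]] by blast
  then obtain P Q where PQ: "\<forall>i. coeff P i \<in> R" "\<forall>i. coeff Q i \<in> R" "v * poly P w + s * poly Q w = 1"
    unfolding ideal_of_def adjoin_def by force
  have "coeff (smult v P + smult s Q) i \<in> I" for i using PQ unfolding ideal_of_def by auto
  moreover have "poly (smult v P + smult s Q) w = 1" using PQ by simp
  ultimately show ?thesis by blast
qed

lemma one_minus_power:
  assumes "i \<in> I" shows "1 - (1 - i) ^ n \<in> I"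
proof (induction n)
  case 0 then show ?case by (simp add: ideal_of_zero[OF subring])
next
  case (Suc n)
  have "1 - (1 - i) ^ Suc n = (1 - (1 - i) ^ n) + (1 - i) ^ n * i" by (simp add: algebra_simps)
  moreover have "(1 - i) ^ n \<in> R"
    using subring_power[OF subring subring_diff[OF subring subring_1[OF subring] ideal_subset[OF assms]]] .
  ultimately show ?case using Suc ideal_of_add[OF subring] ideal_of_mult[OF subring _ assms] by (simp only:)
qed

text \<open>
  Otherwise there would be an equation with coefficients in the ideal for the inverse of \<open>1 - i\<close>; multiplied by a power of \<open>1 - i\<close> it
  shows that this power is in the ideal, although it is congruent to \<open>1\<close>.
\<close>

lemma one_minus_unit:
  assumes "i \<in> I" shows "i \<noteq> 1 \<and> inverse (1 - i) \<in> R"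
proof (rule ccontr)
  assume no: "\<not> ?thesis"
  have i: "i \<noteq> 1" using assms proper by blast
  then obtain G where G: "\<forall>i. coeff G i \<in> I" "poly G (inverse (1 - i)) = 1"
    using no equation_of_nonmember[of "inverse (1 - i)"] by blast
  define n where "n = degree G"
  have eq: "inverse (1 - i) ^ k * (1 - i) ^ n = (1 - i) ^ (n - k)" if "k \<le> n" for k
    using i that by (simp add: power_diff power_inverse divide_inverse mult.commute)
  have "(1 - i) ^ n = poly G (inverse (1 - i)) * (1 - i) ^ n" using G(2) by simp
  also have "\<dots> = (\<Sum>k\<le>n. coeff G k * (inverse (1 - i) ^ k * (1 - i) ^ n))"
    by (simp add: poly_altdef n_def sum_distrib_right mult.assoc)
  also have "\<dots> = (\<Sum>k\<le>n. (1 - i) ^ (n - k) * coeff G k)"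
    by (intro sum.cong) (simp_all add: eq)
  also have "\<dots> \<in> I"
    using G(1) subring_power[OF subring] subring_diff[OF subring subring_1[OF subring] ideal_subset[OF assms]]
    by (intro ideal_of_sum[OF subring] ideal_of_mult[OF subring]) auto
  finally have "1 - (1 - i) ^ n + (1 - i) ^ n \<in> I" using one_minus_power[OF assms] ideal_of_add[OF subring] by blast
  then show False using proper by simp
qed

text \<open>
  The equation \<open>H(1/z) = 1\<close>, multiplied by \<open>z\<^sup>n\<close>, expresses \<open>z\<^sup>n\<close> by lower powers of \<open>z\<close> because \<open>1 - H(0)\<close> is a unit; this is substituted in
  the leading term of \<open>G\<close>.
\<close>

lemma lower_degree:
  assumes z: "z \<noteq> 0" and G: "\<forall>i. coeff G i \<in> I" "poly G z = 1"
    and H: "\<forall>i. coeff H i \<in> I" "poly H (inverse z) = 1" and le: "degree H \<le> degree G"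
  shows "\<exists>G'. (\<forall>i. coeff G' i \<in> I) \<and> poly G' z = 1 \<and> degree G' < degree G"
proof -
  define n m where "n = degree G" and "m = degree H"
  define u where "u = inverse (1 - coeff H 0)"
  have u: "u \<in> R" "coeff H 0 \<noteq> 1" using one_minus_unit[of "coeff H 0"] H(1) by (auto simp: u_def)
  have "n \<noteq> 0"
  proof
    assume "n = 0"
    then obtain g where "G = [:g:]" unfolding n_def by (metis degree_eq_zeroE)
    then show False using G proper by (metis coeff_pCons_0 poly_const_conv)
  qed
  have eq: "inverse z ^ k * z ^ n = z ^ (n - k)" if "k \<le> m" for k
    using z that le by (simp add: power_diff power_inverse divide_inverse mult.commute n_def m_def)
  have "z ^ n = poly H (inverse z) * z ^ n" using H(2) by simp
  also have "\<dots> = (\<Sum>k\<le>m. coeff H k * (inverse z ^ k * z ^ n))"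
    by (simp add: poly_altdef m_def sum_distrib_right mult.assoc)
  also have "\<dots> = (\<Sum>k\<le>m. coeff H k * z ^ (n - k))"
    by (intro sum.cong) (simp_all add: eq)
  also have "{..m} = insert 0 {1..m}" by auto
  also have "(\<Sum>k\<in>insert 0 {1..m}. coeff H k * z ^ (n - k)) = coeff H 0 * z ^ n + (\<Sum>k=1..m. coeff H k * z ^ (n - k))"
    by simp
  finally have "(1 - coeff H 0) * z ^ n = (\<Sum>k=1..m. coeff H k * z ^ (n - k))"
    by (simp add: algebra_simps)
  then have zn: "z ^ n = u * (\<Sum>k=1..m. coeff H k * z ^ (n - k))"
    using u(2) by (simp add: u_def field_simps)
  define G' where "G' = G - monom (coeff G n) n + (\<Sum>k=1..m. monom (coeff G n * u * coeff H k) (n - k))"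
  have "poly G' z = 1 - coeff G n * z ^ n + coeff G n * (u * (\<Sum>k=1..m. coeff H k * z ^ (n - k)))"
    using G(2) by (simp add: G'_def poly_sum poly_monom sum_distrib_left mult.assoc)
  then have "poly G' z = 1" unfolding zn[symmetric] by simp
  moreover have "coeff G' i \<in> I" for i
  proof -
    have "coeff G n * u \<in> R" using G(1) u(1) ideal_subset subring_mult[OF subring] by simp
    then have "coeff G n * u * coeff H k \<in> I" for k using ideal_of_mult[OF subring] H(1) by simp
    moreover have "coeff G i - coeff (monom (coeff G n) n) i \<in> I"
      using G(1) ideal_of_zero[OF subring] by simp
    ultimately show ?thesis
      by (auto simp: G'_def coeff_sum intro!: ideal_of_add[OF subring] ideal_of_sum[OF subring] ideal_of_zero[OF subring])
  qed
  moreover have "coeff G' i = 0" if "n - 1 < i" for i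
  proof -
    have "coeff (monom (coeff G n * u * coeff H k) (n - k)) i = 0" if "k \<in> {1..m}" for k
      using that \<open>n - 1 < i\<close> by auto
    moreover have "coeff G i - coeff (monom (coeff G n) n) i = 0"
      using that \<open>n \<noteq> 0\<close> by (cases "i = n") (auto simp: coeff_eq_0 n_def)
    ultimately show ?thesis by (simp add: G'_def coeff_sum)
  qed
  then have "degree G' \<le> n - 1" by (intro degree_le) auto
  ultimately show ?thesis using \<open>n \<noteq> 0\<close> by (intro exI[of _ G']) (auto simp: n_def)
qed

lemma valuation_ring: "z \<in> R \<or> inverse z \<in> R"
proof (rule ccontr)
  assume "\<not> (z \<in> R \<or> inverse z \<in> R)"
  then have no: "z \<notin> R" "inverse z \<notin> R" by auto
  have z: "z \<noteq> 0" using no subring_0[OF subring] by auto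
  have False if "\<forall>i. coeff G i \<in> I" "poly G z = 1" "\<forall>i. coeff H i \<in> I" "poly H (inverse z) = 1" for G H
    using that
  proof (induction "degree G + degree H" arbitrary: G H rule: less_induct)
    case less
    show False
    proof (cases "degree H \<le> degree G")
      case True
      then obtain G' where "\<forall>i. coeff G' i \<in> I" "poly G' z = 1" "degree G' < degree G"
        using lower_degree[OF z] less.prems by blast
      then show False using less.hyps[of G' H] less.prems by auto
    next
      case False
      then obtain H' where "\<forall>i. coeff H' i \<in> I" "poly H' (inverse z) = 1" "degree H' < degree H"
        using lower_degree[of "inverse z" H G] z less.prems by auto
      then show False using less.hyps[of G H'] less.prems by auto
    qed
  qed
  then show False using equation_of_nonmember[OF no(1)] equation_of_nonmember[OF no(2)] by blast
qed

end

lemma exists_maximal_ring: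
  assumes "subring_of R0" "v \<in> R0" "s \<in> R0" "1 \<notin> ideal_of v s R0"
  shows "\<exists>R. R0 \<subseteq> R \<and> maximal_ring v s R"
proof -
  define A where "A = {R. subring_of R \<and> R0 \<subseteq> R \<and> 1 \<notin> ideal_of v s R}"
  have "\<exists>M\<in>A. \<forall>X\<in>A. M \<subseteq> X \<longrightarrow> X = M"
  proof (rule subset_Zorn_nonempty)
    show "A \<noteq> {}" using assms by (auto simp: A_def)
    fix C assume C: "C \<noteq> {}" "subset.chain A C"
    have CA: "R \<in> A" if "R \<in> C" for R using C(2) that unfolding subset.chain_def by blast
    have two: "\<exists>R\<in>C. a \<in> R \<and> b \<in> R" if ab: "a \<in> \<Union>C" "b \<in> \<Union>C" for a b
    proof -
      obtain S T where ST: "S \<in> C" "a \<in> S" "T \<in> C" "b \<in> T" using ab by blast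
      then have "S \<subseteq> T \<or> T \<subseteq> S" using C(2) unfolding subset.chain_def by blast
      then show ?thesis using ST by blast
    qed
    have "1 \<in> \<Union>C" using C(1) CA subring_1 by (auto simp: A_def)
    moreover have "a - b \<in> \<Union>C \<and> a * b \<in> \<Union>C" if "a \<in> \<Union>C" "b \<in> \<Union>C" for a b
      using two[OF that] CA subring_diff subring_mult unfolding A_def by blast
    moreover have "1 \<notin> ideal_of v s (\<Union>C)"
    proof
      assume "1 \<in> ideal_of v s (\<Union>C)"
      then obtain a b where "a \<in> \<Union>C" "b \<in> \<Union>C" "1 = v * a + s * b" unfolding ideal_of_def by blast
      then obtain R where "R \<in> C" "1 \<in> ideal_of v s R" using two unfolding ideal_of_def by blast
      then show False using CA by (auto simp: A_def)
    qed
    moreover have "R0 \<subseteq> \<Union>C" using C(1) CA by (auto simp: A_def)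
    ultimately show "\<Union>C \<in> A" unfolding A_def subring_of_def by blast
  qed
  then obtain R where R: "R \<in> A" "\<And>X. X \<in> A \<Longrightarrow> R \<subseteq> X \<Longrightarrow> X = R" by blast
  then have "maximal_ring v s R"
    using assms unfolding maximal_ring_def A_def by blast
  then show ?thesis using R(1) by (auto simp: A_def)
qed

text \<open>
  In a finite extension some positive power of every element agrees, up to units of a valuation ring, with an element of the
  base field: among more powers than the degree two terms of a linear relation have the same value.
\<close>

lemma power_comparable:
  assumes R: "subring_of R" "\<And>z. z \<in> R \<or> inverse z \<in> R"
    and F: "subfield F" "spans_over F B" "\<And>a. a \<in> F \<Longrightarrow> a \<noteq> 0 \<Longrightarrow> \<exists>n u. unit_of R u \<and> a = u * w powi n"
    and z: "z \<noteq> 0"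
  shows "\<exists>N m u. 0 < N \<and> N \<le> card B \<and> unit_of R u \<and> z ^ N = u * w powi m"
proof -
  obtain c where c: "\<forall>i\<in>{..card B}. c i \<in> F" "\<exists>i\<in>{..card B}. c i \<noteq> 0" "(\<Sum>i\<in>{..card B}. c i * z ^ i) = 0"
    using dependent_over_subfield[OF F(1,2), of "{..card B}" "\<lambda>i. z ^ i"] by auto
  define J where "J = {i\<in>{..card B}. c i \<noteq> 0}"
  define t where "t i = c i * z ^ i" for i
  have J: "finite J" "J \<noteq> {}" "\<And>i. i \<in> J \<Longrightarrow> t i \<noteq> 0" using c(2) z by (auto simp: J_def t_def)
  have sum0: "(\<Sum>i\<in>J. t i) = 0"
  proof -
    have "(\<Sum>i\<in>J. t i) = (\<Sum>i\<in>{..card B}. c i * z ^ i)"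
      unfolding t_def J_def by (intro sum.mono_neutral_left) auto
    then show ?thesis using c(3) by simp
  qed
  \<comment> \<open>the maximal ideal of \<open>R\<close>; a term of least value cannot be cancelled by terms of larger value\<close>
  define M where "M = {a\<in>R. a = 0 \<or> inverse a \<notin> R}"
  have M_add: "a + b \<in> M" if ab: "a \<in> M" "b \<in> M" for a b
  proof -
    have *: "x + y \<in> M" if xy: "x \<in> M" "y \<in> M" "y \<noteq> 0" "x / y \<in> R" for x y
    proof -
      have "x + y = y * (x / y + 1)" using xy(3) by (simp add: field_simps)
      moreover have "inverse y \<in> R" if i: "inverse (x + y) \<in> R" "x + y \<noteq> 0"
      proof -
        have "inverse y = inverse (x + y) * (x / y + 1)"
          using i(2) xy(3) by (simp add: field_simps)
        then show ?thesis using subring_mult[OF R(1) i(1)] subring_add[OF R(1) xy(4) subring_1[OF R(1)]] by simp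
      qed
      moreover have "x + y \<in> R" using xy subring_add[OF R(1)] by (simp add: M_def)
      ultimately show ?thesis using xy(2,3) unfolding M_def by blast
    qed
    show ?thesis
    proof (cases "a = 0 \<or> b = 0")
      case True then show ?thesis using ab by auto
    next
      case False
      then show ?thesis using *[of a b] *[of b a] ab R(2)[of "a / b"] by (auto simp: add.commute)
    qed
  qed
  have M_0: "0 \<in> M" using subring_0[OF R(1)] by (simp add: M_def)
  have M_sum: "sum f S \<in> M" if "\<And>i. i \<in> S \<Longrightarrow> f i \<in> M" for f :: "nat \<Rightarrow> 'a" and S
    using that by (induction S rule: infinite_finite_induct) (auto simp: M_add M_0)
  have min: "\<exists>i0\<in>S. \<forall>j\<in>S. t j / t i0 \<in> R" if "finite S" "S \<noteq> {}" "S \<subseteq> J" for S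
    using that
  proof (induction S rule: finite_ne_induct)
    case (singleton x) then show ?case using J(3) subring_1[OF R(1)] by simp
  next
    case (insert x S)
    then obtain i0 where i0: "i0 \<in> S" "\<forall>j\<in>S. t j / t i0 \<in> R" by auto
    have nz: "t i0 \<noteq> 0" "t x \<noteq> 0" using J(3) insert i0 by auto
    show ?case
    proof (cases "t x / t i0 \<in> R")
      case True then show ?thesis using i0 by auto
    next
      case False
      then have d: "t i0 / t x \<in> R" using R(2)[of "t x / t i0"] by simp
      have "t j / t x \<in> R" if "j \<in> S" for j
        using subring_mult[OF R(1) i0(2)[rule_format, OF that] d] nz by simp
      then show ?thesis using nz subring_1[OF R(1)] by auto
    qed
  qed
  obtain i0 where i0: "i0 \<in> J" "\<forall>j\<in>J. t j / t i0 \<in> R" using min[OF J(1,2)] by blast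
  have "\<exists>j\<in>J - {i0}. unit_of R (t j / t i0)"
  proof (rule ccontr)
    assume "\<not> ?thesis"
    then have "t j / t i0 \<in> M" if "j \<in> J - {i0}" for j using that i0 by (auto simp: M_def unit_of_def)
    then have "(\<Sum>j\<in>J - {i0}. t j / t i0) \<in> M" by (rule M_sum)
    moreover have "(\<Sum>j\<in>J - {i0}. t j / t i0) = -1"
    proof -
      have "(\<Sum>j\<in>J - {i0}. t j) = - t i0" using sum.remove[OF J(1) i0(1), of t] sum0
        by (simp add: eq_neg_iff_add_eq_0 add.commute)
      then show ?thesis using J(3)[OF i0(1)] by (simp add: sum_divide_distrib[symmetric])
    qed
    ultimately show False using subring_minus[OF R(1) subring_1[OF R(1)]] by (simp add: M_def)
  qed
  then obtain j where j: "j \<in> J" "j \<noteq> i0" "unit_of R (t j / t i0)" by blast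
  obtain a b where ab: "a \<in> J" "b \<in> J" "b < a" "unit_of R (t a / t b)"
  proof (cases "i0 < j")
    case True then show thesis using that j i0(1) by blast
  next
    case False
    then show thesis using that[of i0 j] j i0(1) unit_of_inverse[OF j(3)] by (simp add: inverse_divide)
  qed
  have "c a / c b \<in> F" "c a / c b \<noteq> 0" using ab c(1) subfield_divide[OF F(1)] by (auto simp: J_def)
  then obtain n u where u: "unit_of R u" "c a / c b = u * w powi n" using F(3) by blast
  have wn: "w powi n \<noteq> 0" using u \<open>c a / c b \<noteq> 0\<close> by auto
  have u0: "u \<noteq> 0" using u(1) by (simp add: unit_of_def)
  have "t a / t b = (c a / c b) * z ^ (a - b)" using z ab(3) by (simp add: t_def power_diff)
  then have "z ^ (a - b) = (t a / t b * inverse u) * w powi (- n)"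
    using u(2) wn u0 by (simp add: power_int_minus field_simps)
  moreover have "unit_of R (t a / t b * inverse u)"
    using unit_of_mult[OF R(1) ab(4) unit_of_inverse[OF u(1)]] .
  moreover have "a - b \<le> card B" using ab(1) by (auto simp: J_def)
  ultimately show ?thesis using ab(3)
    by (intro exI[of _ "a - b"] exI[of _ "- n"] exI[of _ "t a / t b * inverse u"]) auto
qed

text \<open>
  With \<open>N = card B!\<close> the exponent \<open>m\<close> in \<open>z\<^sup>N = u w\<^sup>m\<close> is an integral valuation with valuation ring \<open>R\<close>; an element of least
  positive value is a uniformizer.
\<close>

lemma valuation_ring_uniformizer:
  assumes R: "subring_of R" "\<And>z. z \<in> R \<or> inverse z \<in> R"
    and F: "subfield F" "spans_over F B" "\<And>a. a \<in> F \<Longrightarrow> a \<noteq> 0 \<Longrightarrow> \<exists>n u. unit_of R u \<and> a = u * w powi n"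
    and w: "w \<in> R" "w \<noteq> 0" "inverse w \<notin> R"
  shows "\<exists>x. uniformizer R x"
proof -
  define N where "N = (fact (card B) :: nat)"
  have "0 < N" by (simp add: N_def)
  have ex: "\<exists>m u. unit_of R u \<and> z ^ N = u * w powi m" if z: "z \<noteq> 0" for z
  proof -
    obtain k m u where k: "0 < k" "k \<le> card B" "unit_of R u" "z ^ k = u * w powi m"
      using power_comparable[OF R F z] by blast
    then have "k dvd N" unfolding N_def using dvd_fact by simp
    then obtain l where l: "N = k * l" by blast
    have "z ^ N = u ^ l * w powi (m * int l)" using k(4) by (simp add: l power_mult power_mult_distrib power_int_mult)
    moreover have "unit_of R (u ^ l)"
      by (induction l) (simp_all add: unit_of_1[OF R(1)] unit_of_mult[OF R(1) k(3)])
    ultimately show ?thesis by blast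
  qed
  have root: "z \<in> R" if z: "z ^ N \<in> R" for z
  proof (cases "z = 0")
    case True then show ?thesis using subring_0[OF R(1)] by simp
  next
    case False
    show ?thesis
    proof (cases "inverse z \<in> R")
      case True
      have "z = z ^ N * inverse z ^ (N - 1)" using False \<open>0 < N\<close>
        by (simp add: power_eq_if[of z N] power_inverse)
      then show ?thesis using subring_mult[OF R(1) z] subring_power[OF R(1) True] by metis
    next
      case False then show ?thesis using R(2)[of z] by blast
    qed
  qed
  have unit_root: "unit_of R z" if "unit_of R (z ^ N)" for z
    using that root[of z] root[of "inverse z"] \<open>0 < N\<close> by (auto simp: unit_of_def power_inverse power_0_left)
  have wpos: "m \<le> 0" if "inverse (w powi m) \<in> R" for m
  proof (rule ccontr)
    assume "\<not> m \<le> 0"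
    then have m: "w powi m = w * w ^ (nat m - 1)" by (simp add: power_int_def power_eq_if)
    have "inverse (w powi m) * w ^ (nat m - 1) \<in> R" using subring_mult[OF R(1) that] subring_power[OF R(1) w(1)] by blast
    moreover have "inverse (w powi m) * w ^ (nat m - 1) = inverse w" using w(2) by (simp add: m)
    ultimately show False using w(3) by simp
  qed
  \<comment> \<open>\<open>P m\<close>: the valuation takes the positive value \<open>m\<close>\<close>
  define P where "P m \<longleftrightarrow> 0 < m \<and> (\<exists>z u. z \<noteq> 0 \<and> unit_of R u \<and> z ^ N = u * w powi (int m))" for m
  have "P N" unfolding P_def using \<open>0 < N\<close> w(2) unit_of_1[OF R(1)] by (intro conjI exI[of _ w] exI[of _ 1]) auto
  define m where "m = (LEAST m. P m)"
  have "P m" unfolding m_def using \<open>P N\<close> by (rule LeastI)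
  then obtain x u where x: "0 < m" "x \<noteq> 0" "unit_of R u" "x ^ N = u * w powi (int m)" unfolding P_def by blast
  have u0: "u \<noteq> 0" "u \<in> R" "inverse u \<in> R" using x(3) by (auto simp: unit_of_def)
  have "x ^ N \<in> R" using x(4) u0(2) subring_mult[OF R(1)] subring_power[OF R(1) w(1)] by simp
  then have "x \<in> R" by (rule root)
  moreover have "inverse x \<notin> R"
  proof
    assume "inverse x \<in> R"
    then have "u * inverse x ^ N \<in> R" using u0(2) subring_mult[OF R(1)] subring_power[OF R(1)] by blast
    also have "u * inverse x ^ N = inverse (w powi (int m))" using x(2,4) u0(1) w(2) by (simp add: power_inverse field_simps)
    finally show False using wpos[of "int m"] x(1) by simp
  qed
  moreover have "\<exists>v n. unit_of R v \<and> z = v * x powi n" if z: "z \<noteq> 0" for z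
  proof -
    obtain k v where k: "unit_of R v" "z ^ N = v * w powi k" using ex[OF z] by blast
    define q where "q = k div int m"
    \<comment> \<open>division with remainder by the least positive value: the remainder is the value of \<open>y\<close>, hence zero\<close>
    define y where "y = z * x powi (- q)"
    have y0: "y \<noteq> 0" using z x(2) by (simp add: y_def)
    have "y ^ N = z ^ N * (x ^ N) powi (- q)"
    proof -
      have "(x powi (- q)) ^ N = (x ^ N) powi (- q)" by (simp add: power_int_power power_int_power' mult.commute)
      then show ?thesis by (simp add: y_def power_mult_distrib)
    qed
    also have "\<dots> = (v * u powi (- q)) * (w powi k * w powi (int m * - q))"
      unfolding k(2) x(4) power_int_mult_distrib power_int_mult by (simp only: ac_simps)
    also have "w powi k * w powi (int m * - q) = w powi (k - int m * q)"
      using w(2) by (simp add: power_int_add[symmetric])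
    also have "k - int m * q = k mod int m" by (simp add: q_def minus_mult_div_eq_mod)
    finally have yN: "y ^ N = (v * u powi (- q)) * w powi (k mod int m)" .
    have "unit_of R (u ^ j)" for j
      by (induction j) (simp_all add: unit_of_1[OF R(1)] unit_of_mult[OF R(1) x(3)])
    then have "unit_of R (u powi (- q))"
      using unit_of_inverse by (cases "- q" rule: int_cases2) (auto simp: power_int_minus)
    then have unit: "unit_of R (v * u powi (- q))" using unit_of_mult[OF R(1) k(1)] by blast
    have "k mod int m = 0"
    proof (rule ccontr)
      assume "k mod int m \<noteq> 0"
      then have "P (nat (k mod int m))" unfolding P_def using yN unit y0 x(1)
        by (intro conjI exI[of _ y] exI[of _ "v * u powi (- q)"]) (auto simp: order.not_eq_order_implies_strict)
      then have "m \<le> nat (k mod int m)" unfolding m_def by (rule Least_le)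
      then show False using x(1) pos_mod_bound[of "int m" k] by linarith
    qed
    then have "unit_of R y" using yN unit unit_root[of y] by simp
    moreover have "z = y * x powi q" using x(2) by (simp add: y_def power_int_minus)
    ultimately show ?thesis by blast
  qed
  ultimately have "uniformizer R x" using x(2) unfolding uniformizer_def by blast
  then show ?thesis by blast
qed

section \<open>Lattices over a discrete valuation ring\<close>

lemma addspan_base: "x \<in> S \<Longrightarrow> x \<in> addspan S"
  using addspan.add[OF _ addspan.zero, of x S] by simp

lemma addspan_plus: "x \<in> addspan S \<Longrightarrow> y \<in> addspan S \<Longrightarrow> x + y \<in> addspan S"
  by (induction x rule: addspan.induct) (auto simp: add.assoc intro: addspan.add)

lemma addspan_least: "S \<subseteq> M \<Longrightarrow> 0 \<in> M \<Longrightarrow> (\<And>x y. x \<in> M \<Longrightarrow> y \<in> M \<Longrightarrow> x + y \<in> M) \<Longrightarrow> addspan S \<subseteq> M"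
proof
  fix x assume M: "S \<subseteq> M" "0 \<in> M" "\<And>x y. x \<in> M \<Longrightarrow> y \<in> M \<Longrightarrow> x + y \<in> M" and x: "x \<in> addspan S"
  show "x \<in> M" using x by (induction x rule: addspan.induct) (use M in auto)
qed

lemma submodule_gen_least:
  assumes "submodule_of s p M" "C \<subseteq> M" shows "submodule_gen s p C \<subseteq> M"
  unfolding submodule_gen_def using assms by (intro addspan_least) (auto simp: submodule_of_def)

lemma submodule_sum: "submodule_of s p M \<Longrightarrow> (\<And>i. i \<in> I \<Longrightarrow> f i \<in> M) \<Longrightarrow> sum f I \<in> M"
  by (induction I rule: infinite_finite_induct) (auto simp: submodule_of_def)

context vector_space
begin

lemma representation_sum_basis:
  assumes "finite C" "independent C" "c0 \<in> C"
  shows "representation C (\<Sum>c\<in>C. g c *s c) c0 = g c0"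
proof -
  have "representation C (\<Sum>c\<in>C. g c *s c) c0 = (\<Sum>c\<in>C. g c * representation C c c0)"
    using assms(2) by (simp add: representation_sum representation_scale span_base span_scale)
  also have "\<dots> = (\<Sum>c\<in>C. if c = c0 then g c else 0)"
    using assms(2) by (intro sum.cong) (auto simp: representation_basis)
  also have "\<dots> = g c0" using assms(1,3) by simp
  finally show ?thesis .
qed

lemma submodule_gen_submodule:
  assumes "subring_of p" shows "submodule_of scale p (submodule_gen scale p C)"
  unfolding submodule_of_def
proof (intro conjI ballI)
  show "0 \<in> submodule_gen scale p C" unfolding submodule_gen_def by (rule addspan.zero)
  fix u v assume "u \<in> submodule_gen scale p C" "v \<in> submodule_gen scale p C"
  then show "u + v \<in> submodule_gen scale p C" unfolding submodule_gen_def by (rule addspan_plus)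
next
  fix a v assume a: "a \<in> p" and v: "v \<in> submodule_gen scale p C"
  from v show "scale a v \<in> submodule_gen scale p C" unfolding submodule_gen_def
  proof (induction v rule: addspan.induct)
    case zero then show ?case by (simp add: addspan.zero)
  next
    case (add x y)
    then obtain b c where b: "b \<in> p" "c \<in> C" "x = scale b c" by blast
    then have "scale a x = scale (a * b) c" "a * b \<in> p" using subring_mult[OF assms a] by auto
    then have "scale a x \<in> addspan {scale a v |a v. a \<in> p \<and> v \<in> C}" using b(2) by (intro addspan_base) blast
    then show ?case using add.IH addspan_plus by (auto simp: scale_right_distrib)
  qed
qed

lemma submodule_gen_base: "subring_of p \<Longrightarrow> c \<in> C \<Longrightarrow> c \<in> submodule_gen scale p C"
  unfolding submodule_gen_def
  using subring_1[of p] by (intro addspan_base) (auto intro!: exI[of _ 1] exI[of _ c])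

lemma submodule_gen_span: "submodule_gen scale p C \<subseteq> span C"
  by (rule submodule_gen_least) (auto simp: submodule_of_def span_zero span_add span_scale span_base)

lemma submodule_gen_iff:
  assumes p: "subring_of p" and C: "finite C" "independent C"
  shows "v \<in> submodule_gen scale p C \<longleftrightarrow> v \<in> span C \<and> (\<forall>c\<in>C. representation C v c \<in> p)"
proof
  define M where "M = {v\<in>span C. \<forall>c\<in>C. representation C v c \<in> p}"
  have "submodule_of scale p M"
    unfolding submodule_of_def M_def
    by (auto simp: span_zero span_add span_scale representation_zero representation_add[OF C(2)]
        representation_scale[OF C(2)] subring_0[OF p] intro!: subring_add[OF p] subring_mult[OF p])
  moreover have "C \<subseteq> M"
    by (auto simp: M_def span_base representation_basis[OF C(2)] subring_0[OF p] subring_1[OF p])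
  ultimately show "v \<in> span C \<and> (\<forall>c\<in>C. representation C v c \<in> p)" if "v \<in> submodule_gen scale p C"
    using submodule_gen_least[of scale p M C] that by (auto simp: M_def)
next
  assume v: "v \<in> span C \<and> (\<forall>c\<in>C. representation C v c \<in> p)"
  note S = submodule_gen_submodule[OF p, of C]
  have "(\<Sum>c\<in>C. representation C v c *s c) \<in> submodule_gen scale p C"
    using v S submodule_gen_base[OF p] by (intro submodule_sum[OF S]) (auto simp: submodule_of_def)
  then show "v \<in> submodule_gen scale p C"
    using sum_representation_eq[OF C(2) _ C(1), of v] v by simp
qed

lemma representation_eq_0_span:
  assumes "finite C" "independent (insert c C)" "v \<in> span (insert c C)" "c \<notin> C" "representation (insert c C) v c = 0"
  shows "v \<in> span C"
proof -
  have "v = (\<Sum>b\<in>insert c C. representation (insert c C) v b *s b)"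
    using sum_representation_eq[OF assms(2,3), of "insert c C"] assms(1) by simp
  also have "\<dots> = (\<Sum>b\<in>C. representation (insert c C) v b *s b)" using assms(1,4,5) by simp
  also have "\<dots> \<in> span C" by (intro span_sum span_scale span_base)
  finally show ?thesis .
qed

text \<open>
  Lattices are free: an element of least order in its last coordinate, together with a basis of the part of the lattice where
  that coordinate vanishes, is a basis.
\<close>

lemma lattice_free:
  assumes p: "dvr p"
  shows "finite C0 \<Longrightarrow> independent C0 \<Longrightarrow> submodule_of scale p M \<Longrightarrow> M \<subseteq> span C0 \<Longrightarrow>
    (\<And>v. v \<in> span C0 \<Longrightarrow> \<exists>a. a \<noteq> 0 \<and> a *s v \<in> M) \<Longrightarrow>
    (\<And>v c. v \<in> M \<Longrightarrow> c \<in> C0 \<Longrightarrow> representation C0 v c \<in> \<mm> p N) \<Longrightarrow>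
    \<exists>C. basis_of scale (span C0) C \<and> M = submodule_gen scale p C"
proof (induction C0 arbitrary: M rule: finite_induct)
  case empty
  then have "M = {0}" by (auto simp: submodule_of_def)
  moreover have "submodule_gen scale p {} = {0}"
    using submodule_gen_span[of p "{}"] submodule_gen_submodule[OF dvr_subring[OF p], of "{}"]
    by (auto simp: submodule_of_def)
  ultimately show ?case by (intro exI[of _ "{}"]) (auto simp: basis_of_def independent_empty)
next
  case (insert c C1)
  note R = dvr_subring[OF p]
  let ?C = "insert c C1"
  have ind: "independent C1" using insert.prems(1) by (rule independent_mono) blast
  have M: "0 \<in> M" "\<And>u v. u \<in> M \<Longrightarrow> v \<in> M \<Longrightarrow> u + v \<in> M" "\<And>a v. a \<in> p \<Longrightarrow> v \<in> M \<Longrightarrow> a *s v \<in> M"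
    using insert.prems(2) by (auto simp: submodule_of_def)
  define l where "l v = representation ?C v c" for v
  have "\<exists>C. basis_of scale (span C1) C \<and> M \<inter> span C1 = submodule_gen scale p C"
  proof (rule insert.IH[OF ind])
    show "submodule_of scale p (M \<inter> span C1)"
      using insert.prems(2) by (auto simp: submodule_of_def span_zero span_add span_scale)
    show "\<exists>a. a \<noteq> 0 \<and> a *s v \<in> M \<inter> span C1" if "v \<in> span C1" for v
      using insert.prems(4)[of v] that span_mono[OF subset_insertI, of C1 c] by (auto intro: span_scale)
    show "representation C1 v d \<in> \<mm> p N" if "v \<in> M \<inter> span C1" "d \<in> C1" for v d
    proof -
      have "representation ?C v = representation C1 v"
        using that(1) by (intro representation_extend[OF insert.prems(1)]) auto
      then show ?thesis using insert.prems(5)[of v d] that by simp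
    qed
  qed blast
  then obtain C' where C': "basis_of scale (span C1) C'" "M \<inter> span C1 = submodule_gen scale p C'" by blast
  then have C'f: "finite C'" "independent C'" "span C' = span C1" by (auto simp: basis_of_def)
  obtain a0 where a0: "a0 \<noteq> 0" "a0 *s c \<in> M" using insert.prems(4)[OF span_base[OF insertI1]] by blast
  have "l (a0 *s c) = a0"
    using insert.prems(1) by (simp add: l_def representation_scale span_base representation_basis)
  \<comment> \<open>an element whose last coordinate has least order; the order is bounded below by \<open>N\<close>\<close>
  then obtain m0 where m0: "m0 \<in> M" "l m0 \<noteq> 0"
    and least: "\<And>v. v \<in> M \<Longrightarrow> l v \<noteq> 0 \<Longrightarrow> nat (val p (l m0) - N) \<le> nat (val p (l v) - N)"
    using ex_has_least_nat[of "\<lambda>v. v \<in> M \<and> l v \<noteq> 0" "a0 *s c" "\<lambda>v. nat (val p (l v) - N)"] a0 by auto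
  have bound: "N \<le> val p (l v)" if "v \<in> M" "l v \<noteq> 0" for v
    using insert.prems(5)[of v c] that by (simp add: l_def mm_iff[OF p])
  have quot: "l v / l m0 \<in> p" if "v \<in> M" for v
  proof (cases "l v = 0")
    case True then show ?thesis using subring_0[OF R] by simp
  next
    case False
    then have "val p (l m0) \<le> val p (l v)" using least[OF that False] bound[OF that False] bound[OF m0] by linarith
    then show ?thesis using False m0(2) by (simp add: mem_iff_val[OF p] val_divide[OF p])
  qed
  have decomp: "\<exists>a\<in>p. v - a *s m0 \<in> M \<inter> span C1" if v: "v \<in> M" for v
  proof -
    define a where "a = l v / l m0"
    have a: "a \<in> p" unfolding a_def by (rule quot[OF v])
    have "v - a *s m0 = v + (- a) *s m0" by simp
    then have inM: "v - a *s m0 \<in> M" using M(2)[OF v M(3)[OF subring_minus[OF R a] m0(1)]] by simp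
    have sp: "v \<in> span ?C" "m0 \<in> span ?C" using insert.prems(3) v m0(1) by auto
    have "representation ?C (v - a *s m0) c = l v - a * l m0"
      using insert.prems(1) sp by (simp add: l_def representation_diff representation_scale span_scale)
    then have "representation ?C (v - a *s m0) c = 0" using m0(2) by (simp add: a_def)
    then have "v - a *s m0 \<in> span C1"
      using representation_eq_0_span[OF insert.hyps(1) insert.prems(1) _ insert.hyps(2)] inM insert.prems(3) by blast
    then show ?thesis using a inM by blast
  qed
  have l0: "l v = 0" if "v \<in> span C1" for v
  proof -
    have "representation ?C v = representation C1 v"
      using representation_extend[OF insert.prems(1) that] by blast
    then show ?thesis using insert.hyps(2) representation_ne_zero[of C1 v c] by (auto simp: l_def)
  qed
  have m0C: "m0 \<notin> span C'" using l0[of m0] m0(2) C'f(3) by auto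
  define C where "C = insert m0 C'"
  have "independent C" unfolding C_def using independent_insertI[OF m0C C'f(2)] .
  moreover have "span C = span ?C"
  proof -
    have "C' \<subseteq> span ?C" using C'f(3) span_superset[of C'] span_mono[OF subset_insertI, of C1 c] by blast
    then have "C \<subseteq> span ?C" using m0(1) insert.prems(3) by (auto simp: C_def)
    moreover have "C1 \<subseteq> span C"
      using C'f(3) span_superset[of C1] span_mono[OF subset_insertI, of C' m0] by (auto simp: C_def)
    moreover have "c \<in> span C"
    proof -
      obtain a where "a0 *s c - a *s m0 \<in> span C1" using decomp[OF a0(2)] by blast
      then have "a0 *s c - a *s m0 \<in> span C"
        using C'f(3) span_mono[OF subset_insertI, of C' m0] by (auto simp: C_def)
      moreover have "a *s m0 \<in> span C" by (rule span_scale, rule span_base) (simp add: C_def)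
      ultimately have "(a0 *s c - a *s m0) + a *s m0 \<in> span C" by (rule span_add)
      then have "a0 *s c \<in> span C" by simp
      from span_scale[OF this, of "inverse a0"] show ?thesis using a0(1) by simp
    qed
    ultimately show ?thesis unfolding span_eq by blast
  qed
  moreover have "M = submodule_gen scale p C"
  proof
    show "submodule_gen scale p C \<subseteq> M"
    proof (rule submodule_gen_least[OF insert.prems(2)])
      have "C' \<subseteq> M" using C'(2) submodule_gen_base[OF R, of _ C'] by blast
      then show "C \<subseteq> M" using m0(1) by (simp add: C_def)
    qed
    show "M \<subseteq> submodule_gen scale p C"
    proof
      fix v assume "v \<in> M"
      then obtain a where a: "a \<in> p" "v - a *s m0 \<in> M \<inter> span C1" using decomp by blast
      note S = submodule_gen_submodule[OF R, of C]
      have "submodule_gen scale p C' \<subseteq> submodule_gen scale p C"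
        using submodule_gen_base[OF R, of _ C] by (intro submodule_gen_least[OF S]) (auto simp: C_def)
      then have "v - a *s m0 \<in> submodule_gen scale p C" using a(2) C'(2) by blast
      moreover have "a *s m0 \<in> submodule_gen scale p C"
        using S a(1) submodule_gen_base[OF R, of m0 C] by (simp add: submodule_of_def C_def)
      ultimately have "(v - a *s m0) + a *s m0 \<in> submodule_gen scale p C" using S by (simp only: submodule_of_def)
      then show "v \<in> submodule_gen scale p C" by simp
    qed
  qed
  ultimately show ?case using C'f(1) by (intro exI[of _ C]) (auto simp: basis_of_def C_def)
qed

lemma functional_separating:
  assumes "independent B" "x \<notin> span B"
  shows "\<exists>f. Vector_Spaces.linear scale (*) f \<and> (\<forall>v\<in>span B. f v = 0) \<and> f x = 1"
proof -
  have ind: "independent (insert x B)" using independent_insertI assms by blast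
  define E where "E = extend_basis (insert x B)"
  have E: "independent E" "insert x B \<subseteq> E" "span E = UNIV"
    unfolding E_def using independent_extend_basis[OF ind] extend_basis_superset[OF ind] span_extend_basis[OF ind] by auto
  define f where "f v = representation E v x" for v
  have "f v = 0" if "v \<in> span B" for v
  proof -
    have "representation E v = representation B v"
      using representation_extend[OF E(1) that] E(2) by blast
    moreover have "x \<notin> B" using assms(2) span_base by blast
    ultimately show ?thesis using representation_ne_zero[of B v x] by (auto simp: f_def)
  qed
  moreover have "f x = 1" using E by (simp add: f_def representation_basis)
  moreover have "Vector_Spaces.linear scale (*) f"
    unfolding f_def by (rule linear_representation[OF E(1,3)])
  ultimately show ?thesis by blast
qed

end

lemma vector_space_field: "vector_space ((*) :: 'a::field \<Rightarrow> 'a \<Rightarrow> 'a)"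
  by unfold_locales (auto simp: algebra_simps)

section \<open>Finite field extensions and the trace\<close>

locale finite_extension =
  fixes \<phi> :: "'l::field \<Rightarrow> 'k::field" and cst :: "complex \<Rightarrow> 'l"
  assumes hom: "ring_map \<phi>" and cst: "ring_map cst"
    and finite_degree: "\<exists>B. finite B \<and> module.span (\<lambda>a x. \<phi> a * x) B = UNIV"
begin

lemmas phi_simps = ring_map_0[OF hom] ring_map_1[OF hom] ring_map_add[OF hom] ring_map_mult[OF hom]
  ring_map_minus[OF hom] ring_map_diff[OF hom] ring_map_eq_0[OF hom] ring_map_inverse[OF hom]
  ring_map_sum[OF hom] ring_map_powi[OF hom] ring_map_power[OF hom] ring_map_eq[OF hom]

abbreviation sc :: "'l \<Rightarrow> 'k \<Rightarrow> 'k" where "sc \<equiv> (\<lambda>a x. \<phi> a * x)"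

sublocale L: vector_space sc
  by unfold_locales (auto simp: phi_simps algebra_simps)

declare L.scale_scale [simp del]

lemma exists_basis: "\<exists>D. finite D \<and> L.independent D \<and> L.span D = UNIV"
proof -
  obtain B where B: "finite B" "L.span B = UNIV" using finite_degree by blast
  obtain D where D: "D \<subseteq> B" "L.independent D" "B \<subseteq> L.span D" using L.maximal_independent_subset by blast
  have "L.span B \<subseteq> L.span D" by (rule L.span_minimal[OF D(3) L.subspace_span])
  then have "L.span D = UNIV" using B(2) by blast
  moreover have "finite D" by (rule finite_subset[OF D(1) B(1)])
  ultimately show ?thesis using D(2) by (intro exI[of _ D]) simp
qed

lemma finite_basis:
  assumes "L.independent B" shows "finite B"
proof -
  obtain D where D: "finite D" "L.span D = UNIV" using exists_basis by (elim exE conjE)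
  show ?thesis using L.independent_span_bound[OF D(1) assms] D(2) by simp
qed

lemma trace_in_two_bases:
  assumes B: "L.independent B" "L.span B = UNIV" and C: "L.independent C" "L.span C = UNIV"
  shows "(\<Sum>b\<in>B. L.representation B (x * b) b) = (\<Sum>c\<in>C. L.representation C (x * c) c)"
proof -
  note fB = finite_basis[OF B(1)] and fC = finite_basis[OF C(1)]
  have rB: "z = (\<Sum>b\<in>B. sc (L.representation B z b) b)" for z
    using L.sum_representation_eq[OF B(1) _ fB] B(2) by simp
  have rC: "z = (\<Sum>b\<in>C. sc (L.representation C z b) b)" for z
    using L.sum_representation_eq[OF C(1) _ fC] C(2) by simp
  have "(\<Sum>b\<in>B. L.representation B (x * b) b) = (\<Sum>b\<in>B. \<Sum>c\<in>C. L.representation C (x * b) c * L.representation B c b)"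
  proof (rule sum.cong[OF refl])
    fix b assume "b \<in> B"
    have "L.representation B (x * b) b = L.representation B (\<Sum>c\<in>C. sc (L.representation C (x * b) c) c) b"
      using rC[of "x * b"] by simp
    also have "\<dots> = (\<Sum>c\<in>C. L.representation C (x * b) c * L.representation B c b)"
      using B by (simp add: L.representation_sum L.representation_scale)
    finally show "L.representation B (x * b) b = \<dots>" .
  qed
  also have "\<dots> = (\<Sum>c\<in>C. \<Sum>b\<in>B. L.representation B c b * L.representation C (x * b) c)"
    by (subst sum.swap) (simp add: mult.commute)
  also have "\<dots> = (\<Sum>c\<in>C. L.representation C (x * c) c)"
  proof (rule sum.cong[OF refl])
    fix c assume "c \<in> C"
    have "x * c = (\<Sum>b\<in>B. sc (L.representation B c b) (x * b))"
      by (subst rB[of c]) (simp add: sum_distrib_left mult.left_commute)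
    then have "L.representation C (x * c) c = L.representation C (\<Sum>b\<in>B. sc (L.representation B c b) (x * b)) c" by simp
    also have "\<dots> = (\<Sum>b\<in>B. L.representation B c b * L.representation C (x * b) c)"
      using C by (simp add: L.representation_sum L.representation_scale)
    finally show "\<dots> = L.representation C (x * c) c" ..
  qed
  finally show ?thesis .
qed

lemma trace_eq:
  assumes "L.independent B" "L.span B = UNIV"
  shows "field_trace \<phi> x = (\<Sum>b\<in>B. L.representation B (x * b) b)"
proof -
  define C where "C = (SOME B. L.independent B \<and> L.span B = UNIV)"
  have C: "L.independent C" "L.span C = UNIV"
    unfolding C_def using someI_ex[of "\<lambda>B. L.independent B \<and> L.span B = UNIV"] exists_basis by blast+
  have "field_trace \<phi> x = (\<Sum>b\<in>C. L.representation C (x * b) b)"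
    unfolding field_trace_def Let_def C_def[symmetric] ..
  then show ?thesis using trace_in_two_bases[OF C assms] by simp
qed

lemma trace_add: "field_trace \<phi> (x + z) = field_trace \<phi> x + field_trace \<phi> z"
proof -
  obtain D where D: "L.independent D" "L.span D = UNIV" using exists_basis by (elim exE conjE)
  show ?thesis unfolding trace_eq[OF D] using D
    by (simp add: distrib_right L.representation_add sum.distrib)
qed

lemma trace_scale: "field_trace \<phi> (\<phi> a * x) = a * field_trace \<phi> x"
proof -
  obtain D where D: "L.independent D" "L.span D = UNIV" using exists_basis by (elim exE conjE)
  show ?thesis unfolding trace_eq[OF D] using D
    by (simp add: mult.assoc L.representation_scale sum_distrib_left)
qed

lemma trace_0: "field_trace \<phi> 0 = 0"
  using trace_scale[of 0 0] by (simp add: phi_simps)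

lemma trace_sum: "field_trace \<phi> (sum f I) = (\<Sum>i\<in>I. field_trace \<phi> (f i))"
  by (induction I rule: infinite_finite_induct) (auto simp: trace_0 trace_add)

lemma trace_minus: "field_trace \<phi> (- x) = - field_trace \<phi> x"
  using trace_scale[of "- 1" x] by (simp add: phi_simps)

lemma cst_of_nat: "cst (of_nat n) = of_nat n"
  by (induction n) (auto simp: ring_map_0[OF cst] ring_map_1[OF cst] ring_map_add[OF cst])

lemma of_nat_eq_0: "(of_nat n :: 'l) = 0 \<longleftrightarrow> n = 0"
  using ring_map_eq_0[OF cst, of "of_nat n"] by (simp add: cst_of_nat)

lemma trace_1: "field_trace \<phi> 1 \<noteq> 0"
proof -
  obtain D where D: "finite D" "L.independent D" "L.span D = UNIV" using exists_basis by (elim exE conjE)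
  have "field_trace \<phi> 1 = of_nat (card D)"
    unfolding trace_eq[OF D(2,3)] using D by (simp add: L.representation_basis)
  moreover have "D \<noteq> {}"
  proof
    assume "D = {}"
    then have "(1 :: 'k) \<in> {0}" using D(3) by (metis L.span_empty UNIV_I)
    then show False by simp
  qed
  ultimately show ?thesis using D(1) by (simp add: of_nat_eq_0)
qed

text \<open>
  The trace of \<open>1\<close> is the degree, which is not zero in characteristic zero.  So the trace form is nondegenerate and the map \<open>f\<close> below, from
  an element to its traces against the basis, is bijective.
\<close>

lemma dual_basis:
  assumes D: "L.independent D" "L.span D = UNIV"
  shows "\<exists>D'. \<forall>z. z = (\<Sum>b\<in>D. sc (field_trace \<phi> (D' b * z)) b)"
proof -
  note fD = finite_basis[OF D(1)]
  interpret FD: finite_dimensional_vector_space sc D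
    by unfold_locales (use D fD in auto)
  define f where "f z = (\<Sum>b\<in>D. sc (field_trace \<phi> (z * b)) b)" for z
  have lin: "Vector_Spaces.linear sc sc f"
    unfolding Vector_Spaces.linear_iff
  proof (intro conjI allI)
    show "vector_space sc" by (rule L.vector_space_axioms)
    then show "vector_space sc" .
    show "f (x + y) = f x + f y" for x y
      by (simp add: f_def distrib_right trace_add ring_map_add[OF hom] sum.distrib)
    show "f (\<phi> a * x) = \<phi> a * f x" for a x
      by (simp add: f_def mult.assoc trace_scale ring_map_mult[OF hom] sum_distrib_left del: L.scale_scale)
  qed
  have rD: "z = (\<Sum>b\<in>D. sc (L.representation D z b) b)" for z
    using L.sum_representation_eq[OF D(1) _ fD] D(2) by simp
  note coef = L.representation_sum_basis[OF fD D(1)]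
  have f0: "z = 0" if "f z = 0" for z
  proof (rule ccontr)
    assume z: "z \<noteq> 0"
    have t: "field_trace \<phi> (z * b) = 0" if "b \<in> D" for b
      using coef[OF that, of "\<lambda>b. field_trace \<phi> (z * b)"] \<open>f z = 0\<close> by (simp add: f_def L.representation_zero)
    have "field_trace \<phi> (z * x) = 0" for x
    proof -
      have "z * x = (\<Sum>b\<in>D. sc (L.representation D x b) (z * b))"
        by (subst rD[of x]) (simp add: sum_distrib_left mult.left_commute)
      then show ?thesis by (simp add: trace_sum trace_scale t)
    qed
    from this[of "inverse z"] show False using z trace_1 by simp
  qed
  have "inj f"
  proof (rule injI)
    fix u v assume "f u = f v"
    moreover have "f (u - v) + f v = f u" using lin unfolding Vector_Spaces.linear_iff by (metis diff_add_cancel)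
    ultimately show "u = v" using f0[of "u - v"] by simp
  qed
  interpret FP: finite_dimensional_vector_space_pair sc D sc D ..
  have "surj f" using FP.linear_injective_imp_surjective[OF lin \<open>inj f\<close>] by simp
  then obtain D' where D': "\<And>b. f (D' b) = b" by (metis surjD)
  have dual: "field_trace \<phi> (D' b * d) = (if d = b then 1 else 0)" if "b \<in> D" "d \<in> D" for b d
    using coef[OF that(2), of "\<lambda>d. field_trace \<phi> (D' b * d)"] D'[of b] that(1) D(1)
    by (simp add: f_def L.representation_basis)
  have "field_trace \<phi> (D' b * z) = L.representation D z b" if "b \<in> D" for b z
  proof -
    have "D' b * z = (\<Sum>d\<in>D. sc (L.representation D z d) (D' b * d))"
      by (subst rD[of z]) (simp add: sum_distrib_left mult.left_commute)
    then have "field_trace \<phi> (D' b * z) = (\<Sum>d\<in>D. if d = b then L.representation D z d else 0)"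
      using dual[OF that] by (simp add: trace_sum trace_scale) (intro sum.cong, auto)
    then show ?thesis using fD that by simp
  qed
  then have "\<forall>z. z = (\<Sum>b\<in>D. sc (field_trace \<phi> (D' b * z)) b)" using rD by simp
  then show ?thesis by blast
qed

lemma functional_eq_trace:
  assumes "\<And>u v. f (u + v) = f u + f v" "\<And>a v. f (\<phi> a * v) = a * f v"
  shows "\<exists>c. \<forall>z. f z = field_trace \<phi> (c * z)"
proof -
  obtain D where D: "L.independent D" "L.span D = UNIV" using exists_basis by (elim exE conjE)
  obtain D' where D': "\<And>z. z = (\<Sum>b\<in>D. sc (field_trace \<phi> (D' b * z)) b)" using dual_basis[OF D] by blast
  have f0: "f 0 = 0" using assms(2)[of 0 0] by (simp add: phi_simps)
  have fsum: "f (sum g D) = (\<Sum>b\<in>D. f (g b))" for g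
    by (induction D rule: infinite_finite_induct) (auto simp: assms(1) f0)
  have "f z = field_trace \<phi> ((\<Sum>b\<in>D. sc (f b) (D' b)) * z)" for z
  proof -
    have "f z = f (\<Sum>b\<in>D. sc (field_trace \<phi> (D' b * z)) b)" using D'[of z] by simp
    also have "\<dots> = (\<Sum>b\<in>D. field_trace \<phi> (D' b * z) * f b)" by (simp add: fsum assms(2))
    also have "\<dots> = field_trace \<phi> (\<Sum>b\<in>D. sc (f b) (D' b * z))"
      by (simp add: trace_sum trace_scale mult.commute)
    finally show ?thesis by (simp add: sum_distrib_right mult.assoc)
  qed
  then show ?thesis by blast
qed

end

lemma common_bound:
  assumes "dvr p" "finite S" shows "\<exists>N. \<forall>z\<in>S. z \<in> \<mm> p N"
proof -
  have "\<forall>z\<in>S. z \<in> \<mm> p (Min (insert 0 (val p ` S)))"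
    using assms by (auto simp: mm_iff intro!: Min_le)
  then show ?thesis by blast
qed

lemma common_denominator:
  assumes "dvr p" "finite S" shows "\<exists>k::nat. \<forall>z\<in>S. unif p ^ k * z \<in> p"
proof -
  obtain N where N: "\<forall>z\<in>S. z \<in> \<mm> p N" using common_bound[OF assms] by blast
  have "unif p ^ nat (- N) * z \<in> p" if "z \<in> S" for z
  proof -
    have "unif p ^ nat (- N) \<in> \<mm> p (- N)"
      using unif_nonzero[OF assms(1)] by (simp add: mm_iff[OF assms(1)] val_power[OF assms(1)] val_unif[OF assms(1)])
    then have "unif p ^ nat (- N) * z \<in> \<mm> p (- N + N)" using N that mm_mult[OF assms(1)] by blast
    then show ?thesis using mm_0[OF assms(1)] by simp
  qed
  then show ?thesis by blast
qed

locale local_extension = finite_extension \<phi> cst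
  for \<phi> :: "'l::field \<Rightarrow> 'k::field" and cst :: "complex \<Rightarrow> 'l" +
  fixes y :: "'l set"
  assumes y: "dvr y" and cst_y: "range cst \<subseteq> y"
    and residue: "\<And>p x. dvr p \<Longrightarrow> \<phi> -` p = y \<Longrightarrow> x \<in> p \<Longrightarrow> \<exists>a. x - \<phi> (cst a) \<in> \<mm> p 1"
begin

declare L.scale_scale [simp del]

definition ext :: "'k set set" where "ext = {p. dvr p \<and> \<phi> -` p = y}"

abbreviation e :: "'k set \<Rightarrow> nat" where "e \<equiv> ram_index \<phi>"

lemma ext_dvr: "p \<in> ext \<Longrightarrow> dvr p" by (simp add: ext_def)

lemma phi_mem_ext: "p \<in> ext \<Longrightarrow> \<phi> a \<in> p \<longleftrightarrow> a \<in> y" by (auto simp: ext_def)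

lemma Ry: "subring_of y" using y by (rule dvr_subring)

lemma unif_y: "unif y \<in> y" "unif y \<noteq> 0" "inverse (unif y) \<notin> y"
  using dvr_unif[OF y] by (auto simp: uniformizer_def)

lemma subring_image:
  assumes S: "subring_of S" shows "subring_of (\<phi> ` S)"
  unfolding subring_of_def
proof (intro conjI ballI)
  show "1 \<in> \<phi> ` S" by (rule image_eqI[of _ _ 1]) (simp_all add: ring_map_1[OF hom] subring_1[OF S])
  fix a b assume "a \<in> \<phi> ` S" "b \<in> \<phi> ` S"
  then obtain a' b' where ab: "a = \<phi> a'" "a' \<in> S" "b = \<phi> b'" "b' \<in> S" by blast
  show "a - b \<in> \<phi> ` S" using ab subring_diff[OF S, of a' b'] by (simp add: ring_map_diff[OF hom, symmetric])
  show "a * b \<in> \<phi> ` S" using ab subring_mult[OF S, of a' b'] by (simp add: ring_map_mult[OF hom, symmetric])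
qed

lemma subfield_range: "subfield (range \<phi>)"
  unfolding subfield_def
  using subring_image[of UNIV] by (auto simp: subring_of_def ring_map_inverse[OF hom, symmetric])

lemma spans_range: "\<exists>B. spans_over (range \<phi>) B"
proof -
  obtain B where B: "finite B" "L.span B = UNIV" using finite_degree by (elim exE conjE)
  have "\<exists>a. (\<forall>b\<in>B. a b \<in> range \<phi>) \<and> x = (\<Sum>b\<in>B. a b * b)" for x
  proof -
    have "x \<in> range (\<lambda>u. \<Sum>v\<in>B. \<phi> (u v) * v)" using L.span_finite[OF B(1)] B(2) by blast
    then obtain u where "x = (\<Sum>v\<in>B. \<phi> (u v) * v)" by blast
    then show ?thesis by (intro exI[of _ "\<lambda>v. \<phi> (u v)"]) auto
  qed
  then show ?thesis using B(1) unfolding spans_over_def by blast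
qed

lemma phi_unit: "\<phi> -` R = y \<Longrightarrow> unit_of y u \<Longrightarrow> unit_of R (\<phi> u)"
  by (auto simp: unit_of_def ring_map_eq_0[OF hom] ring_map_inverse[OF hom, symmetric])

lemma base_decomposition:
  assumes "\<phi> -` R = y" "a \<in> range \<phi>" "a \<noteq> 0"
  shows "\<exists>n u. unit_of R u \<and> a = u * \<phi> (unif y) powi n"
proof -
  obtain b where b: "a = \<phi> b" using assms(2) by blast
  then have "b \<noteq> 0" using assms(3) by (auto simp: phi_simps)
  then obtain u where u: "unit_of y u" "b = u * unif y powi val y b" using val_decomp[OF y] by blast
  then have "a = \<phi> u * \<phi> (unif y) powi val y b" using b ring_map_mult[OF hom] ring_map_powi[OF hom] by metis
  then show ?thesis using phi_unit[OF assms(1) u(1)] by blast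
qed

lemma unif_y_ext: "p \<in> ext \<Longrightarrow> \<phi> (unif y) \<noteq> 0 \<and> 1 \<le> val p (\<phi> (unif y))"
proof -
  assume p: "p \<in> ext"
  have "\<phi> (unif y) \<noteq> 0" using unif_y(2) by (simp add: phi_simps)
  moreover have "inverse (\<phi> (unif y)) \<notin> p"
    using unif_y(3) phi_mem_ext[OF p, of "inverse (unif y)"] by (simp add: phi_simps)
  ultimately show ?thesis
    by (auto simp: mem_iff_val[OF ext_dvr[OF p]] val_inverse[OF ext_dvr[OF p]])
qed

lemma val_unif_y: "p \<in> ext \<Longrightarrow> val p (\<phi> (unif y)) = int (e p)"
proof -
  assume p: "p \<in> ext"
  note d = ext_dvr[OF p]
  define n where "n = nat (val p (\<phi> (unif y)))"
  have n: "val p (\<phi> (unif y)) = int n" using unif_y_ext[OF p] by (simp add: n_def)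
  have py: "\<phi> -` p = y" using p by (simp add: ext_def)
  have "ram_index \<phi> p = n" unfolding ram_index_def py
  proof (rule the_equality)
    show "\<exists>u. unit_of p u \<and> \<phi> (unif y) = u * unif p ^ n"
      using val_decomp[OF d, of "\<phi> (unif y)"] unif_y_ext[OF p] n by (simp add: power_int_of_nat)
    fix m assume "\<exists>u. unit_of p u \<and> \<phi> (unif y) = u * unif p ^ m"
    then obtain u where "unit_of p u" "\<phi> (unif y) = u * unif p powi int m" by (auto simp: power_int_of_nat)
    then show "m = n" using val_unit_powi[OF d, of u "int m"] n by simp
  qed
  then show ?thesis using n by simp
qed

lemma e_pos: "p \<in> ext \<Longrightarrow> 0 < e p"
  using unif_y_ext[of p] val_unif_y[of p] by simp

lemma val_phi:
  assumes p: "p \<in> ext" and a: "a \<noteq> 0" shows "val p (\<phi> a) = int (e p) * val y a"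
proof -
  obtain u where u: "unit_of y u" "a = u * unif y powi val y a" using val_decomp[OF y a] by blast
  have "\<phi> -` p = y" using p by (simp add: ext_def)
  then have un: "\<phi> u \<noteq> 0" "val p (\<phi> u) = 0"
    using phi_unit[OF _ u(1)] unit_of_iff_val[OF ext_dvr[OF p]] by auto
  have w: "\<phi> (unif y) \<noteq> 0" using unif_y_ext[OF p] by blast
  have "\<phi> a = \<phi> u * \<phi> (unif y) powi val y a" using u(2) ring_map_mult[OF hom] ring_map_powi[OF hom] by metis
  then have "val p (\<phi> a) = val p (\<phi> u * \<phi> (unif y) powi val y a)" by simp
  also have "\<dots> = int (e p) * val y a"
    using un w by (simp add: val_mult[OF ext_dvr[OF p]] val_powi[OF ext_dvr[OF p]] val_unif_y[OF p])
  finally show ?thesis .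
qed

lemma phi_mm: "p \<in> ext \<Longrightarrow> a \<in> \<mm> y n \<Longrightarrow> \<phi> a \<in> \<mm> p (int (e p) * n)"
  using val_phi[of p a] mult_left_mono[of n "val y a" "int (e p)"]
  by (cases "a = 0") (auto simp: mm_iff[OF y] mm_iff[OF ext_dvr] phi_simps)

lemma finite_ext: "finite ext"
proof -
  obtain B where B: "spans_over (range \<phi>) B" using spans_range by blast
  show ?thesis
  proof (cases "ext = {}")
    case True then show ?thesis by simp
  next
    case False
    have "common_parameter (range \<phi>) (\<phi> (unif y)) ext"
      unfolding common_parameter_def
    proof (intro conjI ballI impI)
      show "\<phi> (unif y) \<noteq> 0" using False unif_y_ext by blast
      show "dvr p" if "p \<in> ext" for p using that by (rule ext_dvr)
      show "\<phi> (unif y) \<in> \<mm> p 1" if "p \<in> ext" for p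
        using unif_y_ext[OF that] by (simp add: mm_iff[OF ext_dvr[OF that]])
      fix a assume "a \<in> range \<phi>" "a \<noteq> 0"
      then obtain b where b: "a = \<phi> b" "b \<noteq> 0" by (auto simp: phi_simps)
      then obtain u where u: "unit_of y u" "b = u * unif y powi val y b" using val_decomp[OF y] by blast
      have "a = \<phi> u * \<phi> (unif y) powi val y b" using b u(2) ring_map_mult[OF hom] ring_map_powi[OF hom] by metis
      moreover have "\<forall>p\<in>ext. unit_of p (\<phi> u)" using phi_unit[OF _ u(1)] by (simp add: ext_def)
      ultimately show "\<exists>n u. (\<forall>p\<in>ext. unit_of p u) \<and> a = u * \<phi> (unif y) powi n" by blast
    qed auto
    then show ?thesis using finitely_many_extensions[OF subfield_range B] by blast
  qed
qed

text \<open>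
  The integral closure of \<open>y\<close> is the intersection of the valuation rings above \<open>y\<close>: for an element \<open>x\<close> that is not integral,
  \<open>1/x\<close> and the uniformizer of \<open>y\<close> generate a proper ideal in the ring generated by \<open>1/x\<close>, and a maximal ring with this
  property is a valuation ring above \<open>y\<close> that does not contain \<open>x\<close>.
\<close>

lemma integral_of_regular:
  assumes x: "\<And>p. p \<in> ext \<Longrightarrow> x \<in> p"
  shows "\<exists>n a. (\<forall>i<n. a i \<in> y) \<and> x ^ n = (\<Sum>i<n. \<phi> (a i) * x ^ i)"
proof (rule ccontr)
  assume no: "\<not> ?thesis"
  have x0: "x \<noteq> 0"
  proof
    assume "x = 0"
    then have "\<exists>n a. (\<forall>i<n. a i \<in> y) \<and> x ^ n = (\<Sum>i<n. \<phi> (a i) * x ^ i)"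
      using subring_0[OF Ry] by (intro exI[of _ 1] exI[of _ "\<lambda>_. 0"]) (simp add: phi_simps)
    then show False using no by blast
  qed
  define s v where "s = inverse x" and "v = \<phi> (unif y)"
  have Ri: "subring_of (\<phi> ` y)" by (rule subring_image[OF Ry])
  define R0 where "R0 = adjoin (\<phi> ` y) s"
  have R0: "subring_of R0" "\<phi> ` y \<subseteq> R0" "s \<in> R0"
    unfolding R0_def by (rule subring_adjoin[OF Ri] subset_adjoin[OF Ri] mem_adjoin[OF Ri])+
  have vR0: "v \<in> R0" using R0(2) unif_y(1) by (auto simp: v_def)
  have "1 \<notin> ideal_of v s R0"
  proof
    assume "1 \<in> ideal_of v s R0"
    then obtain P Q where PQ: "\<forall>i. coeff P i \<in> \<phi> ` y" "\<forall>i. coeff Q i \<in> \<phi> ` y" "v * poly P s + s * poly Q s = 1"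
      unfolding ideal_of_def R0_def adjoin_def by force
    \<comment> \<open>\<open>H(1/x) = 0\<close>, read backwards, is an integral equation for \<open>x\<close> up to the unit \<open>H(0)\<close>\<close>
    define H where "H = 1 - smult v P - pCons 0 Q"
    have vi: "v \<in> \<phi> ` y" using unif_y(1) by (simp add: v_def)
    have "\<exists>k. k \<in> y \<and> coeff H i = \<phi> k" for i
    proof -
      have "coeff (1 :: 'k poly) i \<in> \<phi> ` y"
        using subring_0[OF Ri] subring_1[OF Ri] by (simp add: coeff_1)
      moreover have "coeff (smult v P) i \<in> \<phi> ` y"
        using subring_mult[OF Ri vi] PQ(1) by simp
      moreover have "coeff (pCons 0 Q) i \<in> \<phi> ` y"
        using PQ(2) subring_0[OF Ri] by (cases i) auto
      ultimately have "coeff H i \<in> \<phi> ` y"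
        unfolding H_def coeff_diff by (intro subring_diff[OF Ri])
      then show ?thesis by (elim imageE) auto
    qed
    then obtain k where "\<And>i. k i \<in> y \<and> coeff H i = \<phi> (k i)" by metis
    then have k: "\<And>i. k i \<in> y" "\<And>i. coeff H i = \<phi> (k i)" by simp_all
    \<comment> \<open>the constant term is congruent to \<open>1\<close>, hence a unit\<close>
    have k0: "unit_of y (k 0)"
    proof -
      obtain c where c: "c \<in> y" "coeff P 0 = \<phi> c" using PQ(1)[rule_format, of 0] by (elim imageE) auto
      have "\<phi> (k 0) = \<phi> (1 - unif y * c)" using k(2)[of 0] c by (simp add: H_def v_def phi_simps)
      then have "k 0 = 1 - unif y * c" by (simp only: ring_map_eq[OF hom])
      then have k0: "k 0 = 1 + (- (unif y * c))" by simp
      have "unif y \<in> \<mm> y 1" by (simp add: mm_iff[OF y] val_unif[OF y])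
      then have "unif y * c \<in> \<mm> y 1" using mm_mult_ring[OF y c(1)] by (simp only: mult.commute[of c])
      then have "- (unif y * c) \<in> \<mm> y 1" by (simp only: mm_minus[OF y])
      then show ?thesis unfolding k0 by (rule unit_add_mm[OF y unit_of_1[OF Ry]])
    qed
    define N where "N = degree H"
    define a where "a j = - (k (N - j) * inverse (k 0))" for j
    have "poly H s = 1 - (v * poly P s + s * poly Q s)" by (simp add: H_def)
    then have "poly H s = 0" using PQ(3) by simp
    then have "0 = poly H s * x ^ N" by simp
    also have "\<dots> = (\<Sum>i\<le>N. coeff H i * (s ^ i * x ^ N))" by (simp add: poly_altdef N_def sum_distrib_right mult.assoc)
    also have "\<dots> = (\<Sum>i\<le>N. \<phi> (k i) * x ^ (N - i))"
    proof (rule sum.cong[OF refl])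
      fix i assume "i \<in> {..N}"
      then have "s ^ i * x ^ N = x ^ (N - i)" using x0 by (simp add: s_def power_diff power_inverse field_simps)
      then show "coeff H i * (s ^ i * x ^ N) = \<phi> (k i) * x ^ (N - i)" by (simp only: k(2))
    qed
    also have "\<dots> = \<phi> (k 0) * x ^ N + (\<Sum>i<N. \<phi> (k (Suc i)) * x ^ (N - Suc i))"
      unfolding lessThan_Suc_atMost[symmetric] by (subst sum.lessThan_Suc_shift) simp
    also have "(\<Sum>i<N. \<phi> (k (Suc i)) * x ^ (N - Suc i)) = (\<Sum>j<N. \<phi> (k (N - j)) * x ^ j)"
      by (subst sum.nat_diff_reindex[symmetric]) (auto intro!: sum.cong simp: Suc_diff_Suc)
    finally have "\<phi> (k 0) * x ^ N = - (\<Sum>j<N. \<phi> (k (N - j)) * x ^ j)" by (simp add: eq_neg_iff_add_eq_0)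
    moreover have phi_k0: "\<phi> (k 0) \<noteq> 0" using k0 by (simp add: unit_of_def phi_simps)
    ultimately have "x ^ N = - (\<Sum>j<N. \<phi> (k (N - j)) * x ^ j) / \<phi> (k 0)"
      by (simp only: nonzero_eq_divide_eq[OF phi_k0] mult.commute[of "x ^ N"])
    also have "\<dots> = (\<Sum>j<N. \<phi> (a j) * x ^ j)"
      by (simp add: a_def ring_map_minus[OF hom] ring_map_mult[OF hom] ring_map_inverse[OF hom]
          sum_distrib_left sum_negf divide_inverse mult.commute mult.left_commute)
    finally have "x ^ N = (\<Sum>j<N. \<phi> (a j) * x ^ j)" .
    moreover have "\<forall>j<N. a j \<in> y"
    proof -
      have "inverse (k 0) \<in> y" using k0 by (simp add: unit_of_def)
      then show ?thesis unfolding a_def using subring_minus[OF Ry] subring_mult[OF Ry] k(1) by simp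
    qed
    ultimately show False using no by blast
  qed
  then obtain R where R: "R0 \<subseteq> R" "maximal_ring v s R" using exists_maximal_ring[OF R0(1) vR0 R0(3)] by blast
  interpret M: maximal_ring v s R by (rule R(2))
  have y_sub: "y \<subseteq> \<phi> -` R" using R0(2) R(1) by blast
  have inv: "inverse v \<notin> R"
  proof
    assume "inverse v \<in> R"
    moreover have "v \<noteq> 0" using unif_y(2) by (simp add: v_def phi_simps)
    ultimately have "1 = v * inverse v + s * 0" "inverse v \<in> R" by auto
    then show False using M.proper subring_0[OF M.subring] unfolding ideal_of_def by blast
  qed
  have over: "\<phi> -` R = y"
  proof (rule ccontr)
    assume "\<phi> -` R \<noteq> y"
    moreover have "subring_of (\<phi> -` R)"
      using M.subring unfolding subring_of_def by (auto simp: phi_simps)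
    ultimately have "\<phi> -` R = UNIV" using dvr_maximal[OF y] y_sub by blast
    then have "\<phi> (inverse (unif y)) \<in> R" by blast
    then show False using inv by (simp add: v_def phi_simps)
  qed
  obtain B where B: "spans_over (range \<phi>) B" using spans_range by blast
  have "\<exists>w. uniformizer R w"
    by (rule valuation_ring_uniformizer[OF M.subring M.valuation_ring subfield_range B, of v])
      (use base_decomposition[OF over] M.vs(1) inv unif_y(2) in \<open>auto simp: v_def phi_simps\<close>)
  then have "R \<in> ext" using M.subring over by (simp add: ext_def dvr_def)
  then have "x \<in> R" by (rule x)
  then have "1 = v * 0 + s * x" using x0 by (simp add: s_def)
  then show False using M.proper subring_0[OF M.subring] \<open>x \<in> R\<close> unfolding ideal_of_def by blast
qed

lemma ext_nonempty: "ext \<noteq> {}"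
proof
  assume "ext = {}"
  then obtain n a where a: "\<forall>i<n. a i \<in> y" "\<phi> (inverse (unif y)) ^ n = (\<Sum>i<n. \<phi> (a i) * \<phi> (inverse (unif y)) ^ i)"
    using integral_of_regular[of "\<phi> (inverse (unif y))"] by blast
  have "\<phi> (inverse (unif y) ^ n) = \<phi> (\<Sum>i<n. a i * inverse (unif y) ^ i)"
    using a(2) by (simp only: ring_map_power[OF hom] ring_map_sum[OF hom] ring_map_mult[OF hom])
  then have "inverse (unif y) ^ n = (\<Sum>i<n. a i * inverse (unif y) ^ i)" by (simp only: ring_map_eq[OF hom])
  then have "inverse (unif y) \<in> y" using dvr_integrally_closed[OF y _, of n a] a(1) by blast
  then show False using unif_y(3) by blast
qed

text \<open>
  The trace of an integral element is integral, because multiplication by this element preserves a lattice.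
\<close>

lemma trace_of_integral:
  assumes a: "\<And>i. i < n \<Longrightarrow> a i \<in> y" "x ^ n = (\<Sum>i<n. \<phi> (a i) * x ^ i)"
  shows "field_trace \<phi> x \<in> y"
proof -
  obtain D where D: "finite D" "L.independent D" "L.span D = UNIV" using exists_basis by (elim exE conjE)
  have n: "0 < n" using a(2) by (cases n) auto
  define G where "G = {x ^ i * d | i d. i < n \<and> d \<in> D}"
  have "G = (\<lambda>(i, d). x ^ i * d) ` ({..<n} \<times> D)" by (auto simp: G_def)
  then have G: "finite G" using D(1) by simp
  define M where "M = submodule_gen sc y G"
  have M: "submodule_of sc y M" unfolding M_def by (rule L.submodule_gen_submodule[OF Ry])
  have GM: "g \<in> M" if "g \<in> G" for g unfolding M_def using L.submodule_gen_base[OF Ry that] .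
  have rD: "z = (\<Sum>b\<in>D. \<phi> (L.representation D z b) * b)" for z
    using L.sum_representation_eq[OF D(2) _ D(1)] D(3) by simp
  have full: "\<exists>a. a \<noteq> 0 \<and> \<phi> a * v \<in> M" for v
  proof -
    obtain k where k: "\<forall>z\<in>L.representation D v ` D. unif y ^ k * z \<in> y"
      using common_denominator[OF y, of "L.representation D v ` D"] D(1) by blast
    have "\<phi> (unif y ^ k) * v = (\<Sum>b\<in>D. \<phi> (unif y ^ k * L.representation D v b) * b)"
      by (subst rD[of v]) (simp add: sum_distrib_left ring_map_mult[OF hom] mult.assoc)
    also have "\<dots> \<in> M"
    proof (rule submodule_sum[OF M])
      fix b assume "b \<in> D"
      then have "b \<in> G" using n unfolding G_def by (intro CollectI exI[of _ 0] exI[of _ b]) auto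
      then show "\<phi> (unif y ^ k * L.representation D v b) * b \<in> M"
        using GM k \<open>b \<in> D\<close> M unfolding submodule_of_def by blast
    qed
    finally show ?thesis using unif_y(2) by (intro exI[of _ "unif y ^ k"]) simp
  qed
  obtain N where N: "\<forall>z\<in>(\<lambda>(g, d). L.representation D g d) ` (G \<times> D). z \<in> \<mm> y N"
    using common_bound[OF y, of "(\<lambda>(g, d). L.representation D g d) ` (G \<times> D)"] G D(1) by blast
  define M' where "M' = {v. \<forall>d\<in>D. L.representation D v d \<in> \<mm> y N}"
  have "submodule_of sc y M'"
    unfolding submodule_of_def M'_def using D
    by (auto simp: L.representation_zero L.representation_add L.representation_scale zero_mm[OF y]
        intro!: mm_add[OF y] mm_mult_ring[OF y])
  moreover have "G \<subseteq> M'" using N by (auto simp: M'_def)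
  ultimately have "M \<subseteq> M'" unfolding M_def by (rule submodule_gen_least)
  then have bound: "L.representation D v d \<in> \<mm> y N" if "v \<in> M" "d \<in> D" for v d using that by (auto simp: M'_def)
  have "\<exists>C. basis_of sc (L.span D) C \<and> M = submodule_gen sc y C"
    by (rule L.lattice_free[OF y D(1,2) M]) (use D(3) full bound in auto)
  then obtain C where C: "finite C" "L.independent C" "L.span C = UNIV" "M = submodule_gen sc y C"
    unfolding basis_of_def D(3) by (elim exE conjE)
  have "submodule_of sc y {v. x * v \<in> M}"
    using M unfolding submodule_of_def by (auto simp: distrib_left mult.left_commute[of x])
  moreover have "G \<subseteq> {v. x * v \<in> M}"
  proof
    fix g assume "g \<in> G"
    then obtain i d where g: "g = x ^ i * d" "i < n" "d \<in> D" unfolding G_def by blast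
    have "x * g \<in> M"
    proof (cases "Suc i < n")
      case True
      then have "x ^ Suc i * d \<in> G" using g(3) unfolding G_def by blast
      then show ?thesis using GM g(1) by (simp add: mult.assoc)
    next
      case False
      then have "x * g = x ^ n * d" using g by (metis Suc_lessI mult.assoc power_Suc)
      also have "\<dots> = (\<Sum>i<n. \<phi> (a i) * (x ^ i * d))" by (subst a(2)) (simp add: sum_distrib_right mult.assoc)
      also have "\<dots> \<in> M"
      proof (rule submodule_sum[OF M])
        fix i assume "i \<in> {..<n}"
        then have "x ^ i * d \<in> M" "a i \<in> y" using GM g(3) a(1) unfolding G_def by auto
        then show "\<phi> (a i) * (x ^ i * d) \<in> M" using M unfolding submodule_of_def by blast
      qed
      finally show ?thesis .
    qed
    then show "g \<in> {v. x * v \<in> M}" by simp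
  qed
  ultimately have "M \<subseteq> {v. x * v \<in> M}" unfolding M_def by (rule submodule_gen_least)
  moreover have "C \<subseteq> M" using C(4) L.submodule_gen_base[OF Ry] by blast
  ultimately have "x * c \<in> M" if "c \<in> C" for c using that by blast
  then have "L.representation C (x * c) c \<in> y" if "c \<in> C" for c
    using L.submodule_gen_iff[OF Ry C(1,2)] C(4) that by blast
  then show ?thesis unfolding trace_eq[OF C(2,3)] by (rule subring_sum[OF Ry])
qed

definition regular :: "'k set" where "regular = {x. \<forall>p\<in>ext. x \<in> p}"

lemma trace_regular:
  assumes "x \<in> regular" shows "field_trace \<phi> x \<in> y"
proof -
  have "\<exists>n a. (\<forall>i<n. a i \<in> y) \<and> x ^ n = (\<Sum>i<n. \<phi> (a i) * x ^ i)"
    by (rule integral_of_regular) (use assms in \<open>simp add: regular_def\<close>)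
  then obtain n a where "\<forall>i<n. a i \<in> y" "x ^ n = (\<Sum>i<n. \<phi> (a i) * x ^ i)" by (elim exE conjE)
  then show ?thesis by (intro trace_of_integral[of n a]) simp_all
qed

lemma ext_power:
  "\<exists>k::nat. \<forall>p\<in>ext. \<phi> (unif y) ^ k \<in> \<mm> p (N p)"
proof -
  define k where "k = Max (insert 0 ((\<lambda>p. nat (N p)) ` ext))"
  have "\<phi> (unif y) ^ k \<in> \<mm> p (N p)" if p: "p \<in> ext" for p
  proof -
    note d = ext_dvr[OF p]
    have "nat (N p) \<le> k" using finite_ext p by (auto simp: k_def intro!: Max_ge)
    moreover have "int k * 1 \<le> int k * val p (\<phi> (unif y))" using unif_y_ext[OF p] by (intro mult_left_mono) auto
    ultimately have "N p \<le> int k * val p (\<phi> (unif y))" by linarith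
    then show ?thesis using unif_y_ext[OF p] by (simp add: mm_iff[OF d] val_power[OF d])
  qed
  then show ?thesis by blast
qed

lemma make_regular:
  assumes "finite Z" shows "\<exists>k::nat. \<forall>z\<in>Z. \<phi> (unif y) ^ k * z \<in> regular"
proof -
  have "\<forall>p\<in>ext. \<exists>N. \<forall>z\<in>Z. z \<in> \<mm> p N"
  proof
    fix p assume p: "p \<in> ext"
    show "\<exists>N. \<forall>z\<in>Z. z \<in> \<mm> p N" by (rule common_bound[OF ext_dvr[OF p] assms])
  qed
  from bchoice[OF this] obtain N where N0: "\<forall>p\<in>ext. \<forall>z\<in>Z. z \<in> \<mm> p (N p)" by (elim exE)
  have N: "z \<in> \<mm> p (N p)" if "p \<in> ext" "z \<in> Z" for p z using N0 that by simp
  obtain k where k: "\<forall>p\<in>ext. \<phi> (unif y) ^ k \<in> \<mm> p (- N p)" using ext_power[of "\<lambda>p. - N p"] by (elim exE)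
  have "\<phi> (unif y) ^ k * z \<in> p" if "p \<in> ext" "z \<in> Z" for p z
  proof -
    note d = ext_dvr[OF that(1)]
    have "\<phi> (unif y) ^ k \<in> \<mm> p (- N p)" using k that(1) by blast
    then have "\<phi> (unif y) ^ k * z \<in> \<mm> p (- N p + N p)" using N[OF that] mm_mult[OF d] by blast
    then show ?thesis using mm_0[OF d] by simp
  qed
  then show ?thesis unfolding regular_def by blast
qed

text \<open>The coordinates with respect to a basis are traces against the dual basis, so they are bounded on regular elements.\<close>

lemma regular_bounded:
  assumes D: "L.independent D" "L.span D = UNIV"
  shows "\<exists>N. \<forall>x\<in>regular. \<forall>d\<in>D. L.representation D x d \<in> \<mm> y N"
proof -
  note fD = finite_basis[OF D(1)]
  obtain D' where D': "\<forall>z. z = (\<Sum>b\<in>D. sc (field_trace \<phi> (D' b * z)) b)" using dual_basis[OF D] by (elim exE)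
  obtain k where k: "\<forall>z\<in>D' ` D. \<phi> (unif y) ^ k * z \<in> regular" using make_regular[of "D' ` D"] fD by blast
  have "L.representation D x d \<in> \<mm> y (- int k)" if x: "x \<in> regular" and d: "d \<in> D" for x d
  proof -
    have "L.representation D x d = L.representation D (\<Sum>b\<in>D. sc (field_trace \<phi> (D' b * x)) b) d"
      by (rule arg_cong[OF D'[rule_format]])
    also have "\<dots> = field_trace \<phi> (D' d * x)" by (rule L.representation_sum_basis[OF fD D(1) d])
    finally have r: "L.representation D x d = field_trace \<phi> (D' d * x)" .
    have "\<phi> (unif y) ^ k * D' d * x \<in> regular"
      using k d x subring_mult[OF dvr_subring[OF ext_dvr]] by (auto simp: regular_def)
    then have "field_trace \<phi> (\<phi> (unif y ^ k) * (D' d * x)) \<in> y"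
      using trace_regular by (simp add: phi_simps mult.assoc)
    then have "unif y ^ k * field_trace \<phi> (D' d * x) \<in> \<mm> y 0" by (simp add: trace_scale mm_0[OF y])
    then show ?thesis using unif_y(2) r
      by (simp add: mm_scale_iff[OF y] val_power[OF y] val_unif[OF y])
  qed
  then show ?thesis by blast
qed

end

section \<open>A basis adapted to the points of a fibre\<close>

context local_extension
begin

text \<open>
  Such elements turn out to be a basis of the integral closure of \<open>y\<close> in which traces can be read off modulo the maximal ideal.
\<close>

definition adapted :: "('k set \<Rightarrow> nat \<Rightarrow> 'k) \<Rightarrow> bool" where
  "adapted b \<longleftrightarrow> (\<forall>p\<in>ext. \<forall>i<e p. b p i \<noteq> 0 \<and> val p (b p i) = int i \<and>
     (\<forall>q\<in>ext - {p}. b p i \<in> \<mm> q (int (e q))))"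

definition comb :: "('k set \<Rightarrow> nat \<Rightarrow> 'k) \<Rightarrow> ('k set \<Rightarrow> nat \<Rightarrow> 'l) \<Rightarrow> 'k" where
  "comb b a = (\<Sum>p\<in>ext. \<Sum>i<e p. \<phi> (a p i) * b p i)"

lemma exists_element:
  assumes "p \<in> ext" "c \<noteq> 0"
  shows "\<exists>x. x \<noteq> 0 \<and> val p x = val p c \<and> (\<forall>q\<in>ext - {p}. x \<in> \<mm> q N)"
proof -
  have "dvr q \<and> q \<noteq> p" if "q \<in> ext - {p}" for q using that ext_dvr[of q] by simp
  then show ?thesis using approximate_element[OF _ _ ext_dvr[OF assms(1)] assms(2), of "ext - {p}"] finite_ext by simp
qed

lemma exists_adapted: "\<exists>b. adapted b"
proof -
  define N where "N = Max (insert 0 ((\<lambda>q. int (e q)) ` ext))"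
  have N: "int (e q) \<le> N" if "q \<in> ext" for q using that finite_ext by (auto simp: N_def intro!: Max_ge)
  have "\<exists>x. x \<noteq> 0 \<and> val p x = int i \<and> (\<forall>q\<in>ext - {p}. x \<in> \<mm> q (int (e q)))" if p: "p \<in> ext" for p i
  proof -
    note d = ext_dvr[OF p]
    obtain x where x: "x \<noteq> 0" "val p x = val p (unif p ^ i)" "\<forall>q\<in>ext - {p}. x \<in> \<mm> q N"
      using exists_element[OF p, of "unif p ^ i" N] unif_nonzero[OF d] by auto
    have "x \<in> \<mm> q (int (e q))" if "q \<in> ext - {p}" for q
      using mm_antimono[OF ext_dvr _ N, of q x] x(3) that by blast
    then show ?thesis using x unif_nonzero[OF d] by (auto simp: val_power[OF d] val_unif[OF d])
  qed
  then have "\<forall>p i. \<exists>x. p \<in> ext \<longrightarrow> x \<noteq> 0 \<and> val p x = int i \<and> (\<forall>q\<in>ext - {p}. x \<in> \<mm> q (int (e q)))" by simp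
  then obtain b where "\<And>p i. p \<in> ext \<longrightarrow> b p i \<noteq> 0 \<and> val p (b p i) = int i \<and> (\<forall>q\<in>ext - {p}. b p i \<in> \<mm> q (int (e q)))"
    by metis
  then have "adapted b" by (simp add: adapted_def)
  then show ?thesis by blast
qed

context
  fixes b assumes b: "adapted b"
begin

lemma adapted_other: "p \<in> ext \<Longrightarrow> i < e p \<Longrightarrow> q \<in> ext \<Longrightarrow> q \<noteq> p \<Longrightarrow> b p i \<in> \<mm> q (int (e q))"
  using b by (simp add: adapted_def)

lemma adapted_own: "p \<in> ext \<Longrightarrow> i < e p \<Longrightarrow> b p i \<noteq> 0 \<and> val p (b p i) = int i"
  using b by (simp add: adapted_def)

lemma adapted_own_mm: "p \<in> ext \<Longrightarrow> i < e p \<Longrightarrow> b p i \<in> \<mm> p (int i)"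
  using adapted_own[of p i] by (simp add: mm_iff[OF ext_dvr])

lemma adapted_regular:
  assumes "p \<in> ext" "i < e p" shows "b p i \<in> regular"
  unfolding regular_def
proof (intro CollectI ballI)
  fix q assume q: "q \<in> ext"
  show "b p i \<in> q"
  proof (cases "q = p")
    case True
    show ?thesis unfolding True mem_iff_val[OF ext_dvr[OF assms(1)]] using adapted_own[OF assms] by simp
  next
    case False
    then show ?thesis using mm_antimono[OF ext_dvr[OF q] adapted_other[OF assms q False], of 0] mm_0[OF ext_dvr[OF q]] by simp
  qed
qed

text \<open>At \<open>p\<close> the terms of index \<open>(p, i)\<close> with unit coefficient have the distinct orders \<open>i\<close>, and nothing else has order below
  \<open>e p\<close>.\<close>

lemma small_coefficients:
  assumes a: "\<And>p i. p \<in> ext \<Longrightarrow> i < e p \<Longrightarrow> a p i \<in> y" and p: "p \<in> ext" and k: "k \<le> e p"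
    and x: "comb b a \<in> \<mm> p (int k)" and i: "i < k"
  shows "a p i \<in> \<mm> y 1"
proof (rule ccontr)
  assume "a p i \<notin> \<mm> y 1"
  note d = ext_dvr[OF p]
  define m where "m = (LEAST j. j < k \<and> a p j \<notin> \<mm> y 1)"
  have m: "m < k \<and> a p m \<notin> \<mm> y 1" unfolding m_def by (rule LeastI[of _ i]) (use i \<open>a p i \<notin> \<mm> y 1\<close> in simp)
  have less: "a p j \<in> \<mm> y 1" if "j < m" for j
  proof (rule ccontr)
    assume "a p j \<notin> \<mm> y 1"
    then have "m \<le> j" unfolding m_def using that m by (intro Least_le) auto
    then show False using that by simp
  qed
  have me: "m < e p" using m k by simp
  have u: "unit_of y (a p m)" using m a[OF p me] by (auto simp: unit_of_iff_val[OF y] mem_iff_val[OF y] mm_iff[OF y])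
  have phi_u: "\<phi> (a p m) \<noteq> 0" "val p (\<phi> (a p m)) = 0"
    using u val_phi[OF p, of "a p m"] by (auto simp: unit_of_iff_val[OF y] phi_simps)
  define t where "t = \<phi> (a p m) * b p m"
  have t: "t \<noteq> 0" "val p t = int m"
    using phi_u adapted_own[OF p me] by (auto simp: t_def val_mult[OF d])
  have ringp: "\<phi> (a q j) \<in> p" if "q \<in> ext" "j < e q" for q j using a[OF that] phi_mem_ext[OF p] by simp
  have own: "\<phi> (a p j) * b p j \<in> \<mm> p (int m + 1)" if j: "j \<in> {..<e p} - {m}" for j
  proof (cases "j < m")
    case True
    have "\<phi> (a p j) \<in> \<mm> p (int (e p))" using phi_mm[OF p less[OF True]] by simp
    then have "\<phi> (a p j) * b p j \<in> \<mm> p (int (e p) + int j)" using mm_mult[OF d] adapted_own_mm[OF p] j by simp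
    then show ?thesis using me by (elim mm_antimono[OF d]) simp
  next
    case False
    then have "int m + 1 \<le> int j" using j by auto
    then have "b p j \<in> \<mm> p (int m + 1)" using adapted_own_mm[OF p, of j] j mm_antimono[OF d] by auto
    then show ?thesis using mm_mult_ring[OF d ringp[OF p]] j by simp
  qed
  have other: "\<phi> (a q j) * b q j \<in> \<mm> p (int m + 1)" if q: "q \<in> ext - {p}" and j: "j < e q" for q j
  proof -
    have "b q j \<in> \<mm> p (int (e p))" using adapted_other[of q j p] q j p by auto
    then have "b q j \<in> \<mm> p (int m + 1)" using me by (elim mm_antimono[OF d]) simp
    then show ?thesis using mm_mult_ring[OF d ringp] q j by simp
  qed
  define rest where "rest = (\<Sum>j\<in>{..<e p} - {m}. \<phi> (a p j) * b p j) + (\<Sum>q\<in>ext - {p}. \<Sum>j<e q. \<phi> (a q j) * b q j)"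
  have "rest \<in> \<mm> p (val p t + 1)"
    unfolding rest_def t(2) using own other by (intro mm_add[OF d] mm_sum[OF d]) auto
  then have "t + rest \<noteq> 0 \<and> val p (t + rest) = int m" using val_add_less[OF d t(1)] t(2) by simp
  moreover have "comb b a = t + rest"
  proof -
    have "comb b a = (\<Sum>i<e p. \<phi> (a p i) * b p i) + (\<Sum>q\<in>ext - {p}. \<Sum>j<e q. \<phi> (a q j) * b q j)"
      unfolding comb_def by (rule sum.remove[OF finite_ext p])
    also have "(\<Sum>i<e p. \<phi> (a p i) * b p i) = t + (\<Sum>j\<in>{..<e p} - {m}. \<phi> (a p j) * b p j)"
      unfolding t_def using me by (intro sum.remove) auto
    finally show ?thesis by (simp add: rest_def add.assoc)
  qed
  ultimately show False using x m by (simp add: mm_iff[OF d])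
qed

lemma comb_scale: "comb b (\<lambda>p i. c * a p i) = \<phi> c * comb b a"
  by (simp add: comb_def ring_map_mult[OF hom] sum_distrib_left mult.assoc)

lemma comb_diff: "comb b (\<lambda>p i. a p i - a' p i) = comb b a - comb b a'"
  by (simp add: comb_def ring_map_diff[OF hom] sum_subtractf left_diff_distrib)

text \<open>
  Nonzero coefficients can be scaled to be integral and not all in the maximal ideal; by \<open>small_coefficients\<close> the combination then does
  not vanish to order \<open>e p\<close> at every point \<open>p\<close>.
\<close>

lemma normalized_comb:
  assumes "p \<in> ext" "i < e p" "a p i \<noteq> 0"
  shows "\<exists>k. (\<forall>p\<in>ext. \<forall>i<e p. unif y powi k * a p i \<in> y) \<and>
    (\<exists>p\<in>ext. \<phi> (unif y powi k) * comb b a \<notin> \<mm> p (int (e p)))"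
proof -
  define I where "I = Sigma ext (\<lambda>p. {..<e p})"
  have "\<forall>a\<in>UNIV. a \<noteq> 0 \<longrightarrow> (\<exists>n u. (\<forall>p\<in>{y}. unit_of p u) \<and> a = u * unif y powi n)"
    using val_decomp[OF y] by blast
  then have cp: "common_parameter UNIV (unif y) {y}"
    unfolding common_parameter_def using unif_y y by (simp add: mm_iff[OF y] val_unif[OF y])
  have "finite I" using finite_ext by (simp add: I_def)
  moreover have "\<exists>j\<in>I. case_prod a j \<noteq> 0" using assms by (intro bexI[of _ "(p, i)"]) (auto simp: I_def)
  ultimately obtain k j where k: "\<forall>j\<in>I. unif y powi k * case_prod a j \<in> y" "j \<in> I" "unit_of y (unif y powi k * case_prod a j)"
    using normalize_coefficients[OF cp, of I "case_prod a"] by auto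
  have mem: "\<forall>p\<in>ext. \<forall>i<e p. unif y powi k * a p i \<in> y" using k(1) by (auto simp: I_def)
  obtain q m where q: "j = (q, m)" "q \<in> ext" "m < e q" using k(2) by (auto simp: I_def)
  have "comb b (\<lambda>p i. unif y powi k * a p i) \<notin> \<mm> q (int (e q))"
  proof
    assume "comb b (\<lambda>p i. unif y powi k * a p i) \<in> \<mm> q (int (e q))"
    then have "unif y powi k * a q m \<in> \<mm> y 1"
      using small_coefficients[of "\<lambda>p i. unif y powi k * a p i" q "e q" m] mem q by simp
    then show False using k(3) q(1) by (auto simp: unit_of_iff_val[OF y] mm_iff[OF y])
  qed
  then show ?thesis using mem q(2) unfolding comb_scale by blast
qed

lemma comb_zero:
  assumes "comb b a = 0" "p \<in> ext" "i < e p" shows "a p i = 0"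
proof (rule ccontr)
  assume "a p i \<noteq> 0"
  then obtain k q where "q \<in> ext" "\<phi> (unif y powi k) * comb b a \<notin> \<mm> q (int (e q))"
    using normalized_comb[of p i a] assms(2,3) by blast
  then show False using assms(1) zero_mm[OF ext_dvr] by simp
qed

lemma comb_regular:
  assumes "comb b a \<in> regular" "p \<in> ext" "i < e p" shows "a p i \<in> y"
proof (rule ccontr)
  assume no: "a p i \<notin> y"
  then have "a p i \<noteq> 0" using subring_0[OF Ry] by auto
  then obtain k q where k: "\<forall>p\<in>ext. \<forall>i<e p. unif y powi k * a p i \<in> y"
    and q: "q \<in> ext" "\<phi> (unif y powi k) * comb b a \<notin> \<mm> q (int (e q))"
    using normalized_comb[of p i a] assms(2,3) by blast
  have "0 < k"
  proof (rule ccontr)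
    assume "\<not> 0 < k"
    then have "unif y powi (- k) \<in> y" using subring_power[OF Ry unif_y(1)] by (simp add: power_int_def)
    then have "unif y powi (- k) * (unif y powi k * a p i) \<in> y" using k assms(2,3) subring_mult[OF Ry] by blast
    moreover have "unif y powi (- k) * (unif y powi k * a p i) = a p i"
      using unif_y(2) by (simp add: power_int_minus)
    ultimately show False using no by simp
  qed
  then have "unif y powi k \<in> \<mm> y 1" by (simp add: mm_iff[OF y] val_powi[OF y unif_y(2)] val_unif[OF y])
  then have "\<phi> (unif y powi k) \<in> \<mm> q (int (e q))" using phi_mm[OF q(1)] by fastforce
  moreover have "comb b a \<in> \<mm> q 0" using assms(1) q(1) by (simp add: regular_def mm_0[OF ext_dvr[OF q(1)]])
  ultimately have "\<phi> (unif y powi k) * comb b a \<in> \<mm> q (int (e q) + 0)" by (rule mm_mult[OF ext_dvr[OF q(1)]])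
  then show False using q(2) by simp
qed

text \<open>
  Successive approximation: the residue field being \<open>\<complex>\<close>, the term of order \<open>i\<close> is removed by a constant multiple of \<open>b p i\<close>.
\<close>

lemma expand_at_point:
  assumes p: "p \<in> ext" and x: "x \<in> p"
  shows "k \<le> e p \<Longrightarrow> \<exists>a. (\<forall>i. a i \<in> y) \<and> x - (\<Sum>i<k. \<phi> (a i) * b p i) \<in> \<mm> p (int k)"
proof (induction k)
  case 0
  then show ?case using x subring_0[OF Ry] by (intro exI[of _ "\<lambda>_. 0"]) (simp add: mm_0[OF ext_dvr[OF p]])
next
  case (Suc k)
  note d = ext_dvr[OF p]
  obtain a where a: "\<forall>i. a i \<in> y" "x - (\<Sum>i<k. \<phi> (a i) * b p i) \<in> \<mm> p (int k)" using Suc by auto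
  define r where "r = x - (\<Sum>i<k. \<phi> (a i) * b p i)"
  have bk: "b p k \<noteq> 0" "val p (b p k) = int k" using adapted_own[OF p, of k] Suc.prems by auto
  have "inverse (b p k) * r \<in> \<mm> p 0"
    using a(2) bk by (simp add: mm_scale_iff[OF d] val_inverse[OF d] r_def)
  then have "inverse (b p k) * r \<in> p" by (simp add: mm_0[OF d])
  moreover have "\<phi> -` p = y" using p by (simp add: ext_def)
  ultimately obtain c where c: "inverse (b p k) * r - \<phi> (cst c) \<in> \<mm> p 1" using residue[OF d] by blast
  have "b p k * (inverse (b p k) * r - \<phi> (cst c)) \<in> \<mm> p (int k + 1)"
    using mm_mult[OF d adapted_own_mm[OF p, of k] c] Suc.prems by simp
  moreover have "b p k * (inverse (b p k) * r - \<phi> (cst c)) = r - \<phi> (cst c) * b p k" using bk(1) by (simp add: right_diff_distrib)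
  ultimately have "r - \<phi> (cst c) * b p k \<in> \<mm> p (int (Suc k))" by (simp add: add.commute)
  moreover have "(\<Sum>i<Suc k. \<phi> ((a(k := cst c)) i) * b p i) = (\<Sum>i<k. \<phi> (a i) * b p i) + \<phi> (cst c) * b p k" by simp
  then have "x - (\<Sum>i<Suc k. \<phi> ((a(k := cst c)) i) * b p i) = r - \<phi> (cst c) * b p k" by (simp only: r_def diff_diff_add)
  moreover have "\<forall>i. (a(k := cst c)) i \<in> y" using a(1) cst_y by auto
  ultimately have "(\<forall>i. (a(k := cst c)) i \<in> y) \<and> x - (\<Sum>i<Suc k. \<phi> ((a(k := cst c)) i) * b p i) \<in> \<mm> p (int (Suc k))"
    by metis
  then show ?case by (intro exI[of _ "a(k := cst c)"])
qed

lemma regular_expansion: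
  assumes x: "x \<in> regular" shows "\<exists>a. \<exists>z\<in>regular. x = comb b a + \<phi> (unif y) * z"
proof -
  have "\<forall>p\<in>ext. \<exists>a. (\<forall>i. a i \<in> y) \<and> x - (\<Sum>i<e p. \<phi> (a i) * b p i) \<in> \<mm> p (int (e p))"
  proof
    fix p assume p: "p \<in> ext"
    then have "x \<in> p" using x by (simp add: regular_def)
    then show "\<exists>a. (\<forall>i. a i \<in> y) \<and> x - (\<Sum>i<e p. \<phi> (a i) * b p i) \<in> \<mm> p (int (e p))"
      by (rule expand_at_point[OF p]) simp
  qed
  from bchoice[OF this] obtain a where
    a: "\<forall>p\<in>ext. (\<forall>i. a p i \<in> y) \<and> x - (\<Sum>i<e p. \<phi> (a p i) * b p i) \<in> \<mm> p (int (e p))" by (elim exE)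
  define z where "z = inverse (\<phi> (unif y)) * (x - comb b a)"
  have nz: "\<phi> (unif y) \<noteq> 0" using unif_y(2) by (simp add: phi_simps)
  have "z \<in> p" if p: "p \<in> ext" for p
  proof -
    note d = ext_dvr[OF p]
    have "\<phi> (a q i) * b q i \<in> \<mm> p (int (e p))" if "q \<in> ext - {p}" "i < e q" for q i
      using that p a adapted_other[of q i p] phi_mem_ext[OF p] by (intro mm_mult_ring[OF d]) auto
    then have "(\<Sum>q\<in>ext - {p}. \<Sum>i<e q. \<phi> (a q i) * b q i) \<in> \<mm> p (int (e p))"
      by (intro mm_sum[OF d]) auto
    moreover have eq: "x - comb b a = (x - (\<Sum>i<e p. \<phi> (a p i) * b p i)) - (\<Sum>q\<in>ext - {p}. \<Sum>i<e q. \<phi> (a q i) * b q i)"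
      unfolding comb_def by (subst sum.remove[OF finite_ext p]) simp
    moreover have "x - (\<Sum>i<e p. \<phi> (a p i) * b p i) \<in> \<mm> p (int (e p))" using a p by blast
    ultimately have "x - comb b a \<in> \<mm> p (int (e p))" unfolding eq by (intro mm_diff[OF d, of "x - (\<Sum>i<e p. \<phi> (a p i) * b p i)"])
    then have "z \<in> \<mm> p 0" using nz by (simp add: z_def mm_scale_iff[OF d] val_inverse[OF d] val_unif_y[OF p])
    then show ?thesis by (simp add: mm_0[OF d])
  qed
  then have "z \<in> regular" by (simp add: regular_def)
  moreover have "x = comb b a + \<phi> (unif y) * z" using nz by (simp add: z_def mult.assoc[symmetric])
  ultimately show ?thesis by blast
qed

definition adapted_set :: "'k set" where "adapted_set = {b p i | p i. p \<in> ext \<and> i < e p}"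

lemma adapted_inj:
  assumes "p \<in> ext" "i < e p" "q \<in> ext" "j < e q" "b p i = b q j" shows "p = q \<and> i = j"
proof (rule ccontr)
  assume no: "\<not> (p = q \<and> i = j)"
  show False
  proof (cases "p = q")
    case True
    then show False using adapted_own[OF assms(1,2)] adapted_own[OF assms(3,4)] assms(5) no by simp
  next
    case False
    then have "b q j \<in> \<mm> p (int (e p))" using adapted_other[OF assms(3,4,1)] by simp
    then show False using adapted_own[OF assms(1,2)] assms(2,5) by (simp add: mm_iff[OF ext_dvr[OF assms(1)]])
  qed
qed

lemma sum_adapted_set: "(\<Sum>v\<in>adapted_set. f v) = (\<Sum>p\<in>ext. \<Sum>i<e p. f (b p i))"
proof -
  have set: "adapted_set = (\<lambda>(p, i). b p i) ` Sigma ext (\<lambda>p. {..<e p})" by (auto simp: adapted_set_def)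
  have "inj_on (\<lambda>(p, i). b p i) (Sigma ext (\<lambda>p. {..<e p}))"
    using adapted_inj by (auto simp: inj_on_def)
  then have "(\<Sum>v\<in>adapted_set. f v) = (\<Sum>(p, i)\<in>Sigma ext (\<lambda>p. {..<e p}). f (b p i))"
    unfolding set by (subst sum.reindex) (auto simp: case_prod_unfold)
  also have "\<dots> = (\<Sum>p\<in>ext. \<Sum>i<e p. f (b p i))" by (rule sum.Sigma[symmetric]) (use finite_ext in auto)
  finally show ?thesis .
qed

lemma finite_adapted_set: "finite adapted_set"
proof -
  have "adapted_set = (\<lambda>(p, i). b p i) ` Sigma ext (\<lambda>p. {..<e p})" by (auto simp: adapted_set_def)
  then show ?thesis using finite_ext by simp
qed

lemma adapted_independent: "L.independent adapted_set"
proof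
  assume "L.dependent adapted_set"
  then have "\<exists>u. (\<exists>v\<in>adapted_set. u v \<noteq> 0) \<and> (\<Sum>v\<in>adapted_set. \<phi> (u v) * v) = 0"
    unfolding L.dependent_finite[OF finite_adapted_set] .
  then obtain u v where u: "v \<in> adapted_set" "u v \<noteq> 0" "(\<Sum>v\<in>adapted_set. \<phi> (u v) * v) = 0" by (elim exE conjE bexE)
  obtain p i where p: "v = b p i" "p \<in> ext" "i < e p" using u(1) by (auto simp: adapted_set_def)
  have "comb b (\<lambda>p i. u (b p i)) = 0" using u(3) unfolding sum_adapted_set comb_def .
  then have "u (b p i) = 0" using comb_zero[of "\<lambda>p i. u (b p i)" p i] p by simp
  then show False using u(2) p(1) by simp
qed

lemma comb_in_span: "comb b a \<in> L.span adapted_set"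
  unfolding comb_def
proof (intro L.span_sum L.span_scale)
  fix p i assume "p \<in> ext" "i \<in> {..<e p}"
  then show "b p i \<in> L.span adapted_set" by (intro L.span_base) (auto simp: adapted_set_def)
qed

text \<open>
  The adapted elements generate: modulo their span every regular element is infinitely divisible by the uniformizer of \<open>y\<close>,
  while linear functionals are bounded on regular elements.
\<close>

lemma adapted_span: "L.span adapted_set = UNIV"
proof -
  obtain D where D: "finite D" "L.independent D" "L.span D = UNIV" using exists_basis by (elim exE conjE)
  have approx: "\<exists>w\<in>L.span adapted_set. \<exists>z\<in>regular. x = w + \<phi> (unif y ^ M) * z" if "x \<in> regular" for x M
  proof (induction M)
    case 0
    then show ?case using that by (intro bexI[of _ 0] bexI[of _ x]) (auto simp: phi_simps L.span_zero)
  next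
    case (Suc M)
    then obtain w z where w: "w \<in> L.span adapted_set" "z \<in> regular" "x = w + \<phi> (unif y ^ M) * z" by blast
    obtain a z' where z': "z' \<in> regular" "z = comb b a + \<phi> (unif y) * z'" using regular_expansion[OF w(2)] by blast
    have "x = (w + \<phi> (unif y ^ M) * comb b a) + \<phi> (unif y ^ Suc M) * z'"
      using w(3) z'(2) by (simp add: algebra_simps phi_simps)
    moreover have "w + \<phi> (unif y ^ M) * comb b a \<in> L.span adapted_set"
      by (intro L.span_add w(1) L.span_scale comb_in_span)
    ultimately show ?case using z'(1) by blast
  qed
  have reg: "x \<in> L.span adapted_set" if x: "x \<in> regular" for x
  proof (rule ccontr)
    assume "x \<notin> L.span adapted_set"
    then obtain f where f: "Vector_Spaces.linear sc (*) f" "\<forall>v\<in>L.span adapted_set. f v = 0" "f x = 1"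
      using L.functional_separating[OF adapted_independent] by blast
    have lin: "f (u + v) = f u + f v" "f (\<phi> c * v) = c * f v" for u v c
      using f(1) unfolding Vector_Spaces.linear_iff by auto
    have f0: "f 0 = 0" using lin(2)[of 0 0] by (simp add: phi_simps)
    have fsum: "f (sum g D) = (\<Sum>d\<in>D. f (g d))" for g
      using D(1) by (induction D rule: finite_induct) (simp_all add: f0 lin(1))
    obtain N where N: "\<forall>x\<in>regular. \<forall>d\<in>D. L.representation D x d \<in> \<mm> y N" using regular_bounded[OF D(2,3)] by (elim exE)
    have "finite (f ` D)" using D(1) by simp
    then obtain K where K: "\<forall>z\<in>f ` D. z \<in> \<mm> y K" using common_bound[OF y, of "f ` D"] by blast
    have bound: "f z \<in> \<mm> y (N + K)" if z: "z \<in> regular" for z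
    proof -
      have "z = (\<Sum>d\<in>D. \<phi> (L.representation D z d) * d)"
        using L.sum_representation_eq[OF D(2) _ D(1), of z] D(3) by simp
      then have "f z = f (\<Sum>d\<in>D. \<phi> (L.representation D z d) * d)" by (rule arg_cong)
      also have "\<dots> = (\<Sum>d\<in>D. L.representation D z d * f d)" by (simp add: fsum lin(2))
      also have "\<dots> \<in> \<mm> y (N + K)" using N z K by (intro mm_sum[OF y] mm_mult[OF y]) auto
      finally show ?thesis .
    qed
    define M where "M = nat (1 - (N + K))"
    obtain w z where w: "w \<in> L.span adapted_set" "z \<in> regular" "x = w + \<phi> (unif y ^ M) * z" using approx[OF x] by blast
    have "1 = unif y ^ M * f z" using f(2,3) w(1,3) lin by simp
    moreover have "unif y ^ M \<in> \<mm> y (int M)"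
      using unif_y(2) by (simp add: mm_iff[OF y] val_power[OF y] val_unif[OF y])
    then have "unif y ^ M * f z \<in> \<mm> y (int M + (N + K))" using bound[OF w(2)] by (rule mm_mult[OF y])
    ultimately have "1 \<in> \<mm> y (int M + (N + K))" by simp
    then have "1 \<in> \<mm> y 1" by (rule mm_antimono[OF y]) (simp add: M_def)
    then show False using one_notin_mm1[OF y] by simp
  qed
  have "x \<in> L.span adapted_set" for x
  proof -
    obtain k where "\<forall>z\<in>{x}. \<phi> (unif y) ^ k * z \<in> regular" using make_regular[of "{x}"] by auto
    then have "\<phi> (unif y ^ k) * x \<in> L.span adapted_set" using reg by (simp add: phi_simps)
    then have "\<phi> (inverse (unif y ^ k)) * (\<phi> (unif y ^ k) * x) \<in> L.span adapted_set" by (rule L.span_scale)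
    moreover have "\<phi> (inverse (unif y ^ k)) * (\<phi> (unif y ^ k) * x) = x"
      using unif_y(2) by (simp add: phi_simps mult.assoc[symmetric])
    ultimately show ?thesis by simp
  qed
  then show ?thesis by blast
qed

lemma comb_exists: "\<exists>a. x = comb b a"
proof -
  have "x = (\<Sum>v\<in>adapted_set. \<phi> (L.representation adapted_set x v) * v)"
    using L.sum_representation_eq[OF adapted_independent _ finite_adapted_set, of x] adapted_span by simp
  then show ?thesis unfolding sum_adapted_set by (intro exI[of _ "\<lambda>p i. L.representation adapted_set x (b p i)"]) (simp add: comb_def)
qed

lemma trace_comb:
  assumes A: "\<And>p i. p \<in> ext \<Longrightarrow> i < e p \<Longrightarrow> x * b p i = comb b (A p i)"
  shows "field_trace \<phi> x = (\<Sum>p\<in>ext. \<Sum>i<e p. A p i p i)"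
proof -
  have "L.representation adapted_set (x * b p i) (b p i) = A p i p i" if p: "p \<in> ext" "i < e p" for p i
  proof -
    have "x * b p i = (\<Sum>v\<in>adapted_set. \<phi> (L.representation adapted_set (x * b p i) v) * v)"
      using L.sum_representation_eq[OF adapted_independent _ finite_adapted_set, of "x * b p i"] adapted_span by simp
    then have "comb b (A p i) = comb b (\<lambda>q j. L.representation adapted_set (x * b p i) (b q j))"
      unfolding sum_adapted_set comb_def using A[OF p] by (simp add: comb_def)
    then have "comb b (\<lambda>q j. A p i q j - L.representation adapted_set (x * b p i) (b q j)) = 0"
      by (simp add: comb_diff)
    then have "A p i p i - L.representation adapted_set (x * b p i) (b p i) = 0"
      using comb_zero[of "\<lambda>q j. A p i q j - L.representation adapted_set (x * b p i) (b q j)" p i] p by simp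
    then show ?thesis by simp
  qed
  then show ?thesis unfolding trace_eq[OF adapted_independent adapted_span] sum_adapted_set
    by (intro sum.cong) auto
qed

text \<open>Multiplication by an element that vanishes at the whole fibre raises orders, so its matrix has diagonal entries in the
  maximal ideal.\<close>

lemma trace_of_vanishing:
  assumes x: "\<And>p. p \<in> ext \<Longrightarrow> x \<in> \<mm> p 1" shows "field_trace \<phi> x \<in> \<mm> y 1"
proof -
  have "\<forall>p i. \<exists>a. x * b p i = comb b a" using comb_exists by blast
  then obtain A where A: "\<And>p i. x * b p i = comb b (A p i)" by metis
  have "A p i p i \<in> \<mm> y 1" if p: "p \<in> ext" "i < e p" for p i
  proof (rule small_coefficients[of "A p i" p "Suc i"])
    have "x \<in> regular" using x mm_1_subset[OF ext_dvr] by (simp add: regular_def)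
    then have "x * b p i \<in> regular"
      using adapted_regular[OF p] subring_mult[OF dvr_subring[OF ext_dvr]] by (simp add: regular_def)
    then show "A p i q j \<in> y" if "q \<in> ext" "j < e q" for q j
      using comb_regular[OF _ that, of "A p i"] A by simp
    have "x * b p i \<in> \<mm> p (1 + int i)" by (rule mm_mult[OF ext_dvr[OF p(1)] x[OF p(1)] adapted_own_mm[OF p]])
    then show "comb b (A p i) \<in> \<mm> p (int (Suc i))" using A by simp
  qed (use p in auto)
  then show ?thesis unfolding trace_comb[of x A, OF A] by (intro mm_sum[OF y]) auto
qed

text \<open>An element close to \<open>1\<close> at \<open>p\<close> and to \<open>0\<close> at the other points acts modulo the maximal ideal as the projection to the
  basis elements at \<open>p\<close>, of which there are \<open>e p\<close>.\<close>

lemma trace_of_idempotent: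
  assumes p: "p \<in> ext" and x: "x - 1 \<in> \<mm> p (int (e p))" "\<And>q. q \<in> ext \<Longrightarrow> q \<noteq> p \<Longrightarrow> x \<in> \<mm> q (int (e q))"
  shows "field_trace \<phi> x - of_nat (e p) \<in> \<mm> y 1"
proof -
  have ring: "z \<in> q" if "q \<in> ext" "z \<in> \<mm> q (int n)" for z q n
    using mm_antimono[OF ext_dvr[OF that(1)] that(2), of 0] mm_0[OF ext_dvr[OF that(1)]] by simp
  have one: "1 \<in> q" if "q \<in> ext" for q using subring_1[OF dvr_subring[OF ext_dvr[OF that]]] .
  have xq: "x \<in> q \<and> x - 1 \<in> q" if q: "q \<in> ext" for q
  proof (cases "q = p")
    case True
    then have "x - 1 \<in> q" using ring[OF p x(1)] by simp
    then show ?thesis using subring_add[OF dvr_subring[OF ext_dvr[OF q]] _ one[OF q], of "x - 1"] by simp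
  next
    case False
    then have "x \<in> q" using ring[OF q x(2)[OF q]] by simp
    then show ?thesis using subring_diff[OF dvr_subring[OF ext_dvr[OF q]] _ one[OF q]] by simp
  qed
  have "\<forall>q i. \<exists>a. x * b q i = comb b a" using comb_exists by blast
  then obtain A where A: "\<And>q i. x * b q i = comb b (A q i)" by metis
  \<comment> \<open>the diagonal entries of the matrix of the projection\<close>
  define \<delta> where "\<delta> q = (if q = p then 1 else 0 :: 'l)" for q
  have close: "A q i q i - \<delta> q \<in> \<mm> y 1" if q: "q \<in> ext" "i < e q" for q i
  proof -
    define a where "a r j = A q i r j - (if r = q \<and> j = i then \<delta> q else 0)" for r j
    have "comb b (\<lambda>r j. if r = q \<and> j = i then \<delta> q else 0) = \<phi> (\<delta> q) * b q i"
    proof -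
      have "(\<Sum>j<e r. \<phi> (if r = q \<and> j = i then \<delta> q else 0) * b r j) = (if r = q then \<phi> (\<delta> q) * b q i else 0)" for r
      proof (cases "r = q")
        case True
        have "(\<Sum>j<e q. \<phi> (if q = q \<and> j = i then \<delta> q else 0) * b q j) = (\<Sum>j<e q. if j = i then \<phi> (\<delta> q) * b q i else 0)"
          by (intro sum.cong) (auto simp: ring_map_0[OF hom])
        then show ?thesis using True q(2) by (simp add: sum.delta)
      qed (simp add: ring_map_0[OF hom])
      then have "comb b (\<lambda>r j. if r = q \<and> j = i then \<delta> q else 0) = (\<Sum>r\<in>ext. if r = q then \<phi> (\<delta> q) * b q i else 0)"
        unfolding comb_def by simp
      also have "\<dots> = \<phi> (\<delta> q) * b q i" using q(1) finite_ext by simp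
      finally show ?thesis .
    qed
    then have comb_a: "comb b a = (x - \<phi> (\<delta> q)) * b q i"
      unfolding a_def comb_diff by (simp add: A[symmetric] left_diff_distrib)
    have vanish: "comb b a \<in> \<mm> r (int (e r))" if r: "r \<in> ext" for r
    proof (cases "r = q")
      case True
      have "x - \<phi> (\<delta> q) \<in> \<mm> r (int (e r))"
        using True x q by (cases "q = p") (auto simp: \<delta>_def phi_simps)
      moreover have "b q i \<in> r" using adapted_regular[OF q] r by (simp add: regular_def)
      ultimately show ?thesis unfolding comb_a using mm_mult_ring[OF ext_dvr[OF r]] by (simp add: mult.commute)
    next
      case False
      have "x - \<phi> (\<delta> q) \<in> r" using xq[OF r] by (simp add: \<delta>_def phi_simps)
      then show ?thesis unfolding comb_a using mm_mult_ring[OF ext_dvr[OF r]] adapted_other[OF q r False] by simp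
    qed
    have "comb b a \<in> regular" unfolding regular_def
    proof (intro CollectI ballI)
      fix r assume "r \<in> ext" then show "comb b a \<in> r" using ring vanish by blast
    qed
    then have "a r j \<in> y" if "r \<in> ext" "j < e r" for r j using comb_regular that by blast
    then have "a q i \<in> \<mm> y 1" using small_coefficients[of a q "e q" i] vanish q by simp
    then show ?thesis by (simp add: a_def)
  qed
  have "field_trace \<phi> x = (\<Sum>q\<in>ext. \<Sum>i<e q. A q i q i)" by (rule trace_comb) (rule A)
  moreover have "of_nat (e p) = (\<Sum>q\<in>ext. \<Sum>i<e q. \<delta> q)"
  proof -
    have "(\<Sum>q\<in>ext. \<Sum>i<e q. \<delta> q) = (\<Sum>q\<in>ext. if q = p then of_nat (e p) else 0)"
      by (intro sum.cong) (auto simp: \<delta>_def)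
    then show ?thesis using p finite_ext by simp
  qed
  ultimately have "field_trace \<phi> x - of_nat (e p) = (\<Sum>q\<in>ext. \<Sum>i<e q. A q i q i - \<delta> q)"
    by (simp add: sum_subtractf)
  also have "\<dots> \<in> \<mm> y 1" using close by (intro mm_sum[OF y]) auto
  finally show ?thesis .
qed

end

text \<open>The product of \<open>x\<close> with the uniformizer of \<open>y\<close>, which has order \<open>e p\<close> at \<open>p\<close>, vanishes at the whole fibre.\<close>

lemma trace_inverse_different:
  assumes x: "\<And>p. p \<in> ext \<Longrightarrow> x \<in> \<mm> p (1 - int (e p))" shows "field_trace \<phi> x \<in> y"
proof -
  obtain b where b: "adapted b" using exists_adapted by blast
  have "\<phi> (unif y) * x \<in> \<mm> p 1" if p: "p \<in> ext" for p
    using x[OF p] unif_y_ext[OF p] val_unif_y[OF p] by (simp add: mm_scale_iff[OF ext_dvr[OF p]])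
  then have "field_trace \<phi> (\<phi> (unif y) * x) \<in> \<mm> y 1" by (rule trace_of_vanishing[OF b])
  then have "unif y * field_trace \<phi> x \<in> \<mm> y 1" by (simp add: trace_scale)
  then show ?thesis using unif_y(2) by (simp add: mm_scale_iff[OF y] val_unif[OF y] mm_0[OF y])
qed

text \<open>
  Modulo the maximal ideal the trace of an element that is close to \<open>1\<close> at \<open>p\<close> and to \<open>0\<close> at the other points is \<open>e p\<close>, which is invertible in
  \<open>\<complex>\<close>.
\<close>

lemma trace_unit:
  assumes p: "p \<in> ext"
  shows "\<exists>x. x \<noteq> 0 \<and> val p x = 0 \<and> (\<forall>q\<in>ext - {p}. x \<in> \<mm> q N) \<and> unit_of y (field_trace \<phi> x)"
proof -
  obtain b where b: "adapted b" using exists_adapted by blast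
  define M where "M = Max (insert (nat N) (e ` ext))"
  have M: "e q \<le> M" if "q \<in> ext" for q using that finite_ext by (auto simp: M_def intro!: Max_ge)
  have MN: "N \<le> int M"
  proof -
    have "nat N \<le> M" using finite_ext by (auto simp: M_def intro!: Max_ge)
    then show ?thesis by simp
  qed
  note d = ext_dvr[OF p]
  obtain x where x: "x - 1 \<in> \<mm> p (int M)" "\<forall>q\<in>ext - {p}. x \<in> \<mm> q (int M)"
    using approximate_idempotent[of "ext - {p}" p M] finite_ext ext_dvr d by auto
  have xp: "x - 1 \<in> \<mm> p (int (e p))" using mm_antimono[OF d x(1)] M[OF p] by simp
  have xq: "x \<in> \<mm> q (int (e q))" if "q \<in> ext" "q \<noteq> p" for q
    using mm_antimono[OF ext_dvr[OF that(1)], of x "int M"] x(2) M[OF that(1)] that by simp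
  have "x - 1 \<in> \<mm> p 1" using mm_antimono[OF d xp] e_pos[OF p] by simp
  then have "unit_of p (1 + (x - 1))" by (rule unit_add_mm[OF d unit_of_1[OF dvr_subring[OF d]]])
  then have "x \<noteq> 0" "val p x = 0" by (simp_all add: unit_of_iff_val[OF d])
  moreover have "x \<in> \<mm> q N" if "q \<in> ext - {p}" for q
    using mm_antimono[OF ext_dvr, of q x "int M" N] x(2) MN that by simp
  moreover have "unit_of y (of_nat (e p) + (field_trace \<phi> x - of_nat (e p)))"
  proof (rule unit_add_mm[OF y])
    have "of_nat (e p) = cst (of_nat (e p))" by (rule cst_of_nat[symmetric])
    then show "unit_of y (of_nat (e p) :: 'l)" using const_unit[OF cst cst_y, of "of_nat (e p)"] e_pos[OF p] by simp
    show "field_trace \<phi> x - of_nat (e p) \<in> \<mm> y 1" by (rule trace_of_idempotent[OF b p xp xq])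
  qed
  ultimately show ?thesis by (intro exI[of _ x]) simp
qed

end

section \<open>Parabolic filtrations indexed by integers\<close>

definition ceil_div :: "int \<Rightarrow> nat \<Rightarrow> int" where
  "ceil_div n r = \<lceil>real_of_int n / real r\<rceil>"

lemma ceil_div_le_iff: "0 < r \<Longrightarrow> ceil_div n r \<le> m \<longleftrightarrow> n \<le> m * int r"
proof -
  assume r: "0 < r"
  have "ceil_div n r \<le> m \<longleftrightarrow> real_of_int n / real r \<le> real_of_int m"
    unfolding ceil_div_def by (rule ceiling_le_iff)
  also have "\<dots> \<longleftrightarrow> real_of_int n \<le> real_of_int (m * int r)" using r by (simp add: divide_le_eq)
  also have "\<dots> \<longleftrightarrow> n \<le> m * int r" by linarith
  finally show ?thesis .
qed

lemma ceil_div_add_multiple: "0 < r \<Longrightarrow> ceil_div (n + m * int r) r = ceil_div n r + m"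
  by (simp add: ceil_div_def add_divide_distrib)

lemma ceil_div_subadditive: "0 < r \<Longrightarrow> ceil_div (m + n) r \<le> ceil_div m r + ceil_div n r"
  using ceil_div_le_iff[of r m "ceil_div m r"] ceil_div_le_iff[of r n "ceil_div n r"]
  by (simp add: ceil_div_le_iff distrib_right)

lemma ceil_div_self: "0 < r \<Longrightarrow> ceil_div 0 r = 0"
  by (simp add: ceil_div_def)

lemma root_order_pos:
  assumes "marked_curve X" shows "0 < root_order X p"
proof (cases "map_of (zip (marks X) (mults X)) p")
  case None then show ?thesis by (simp add: root_order_def)
next
  case (Some n)
  then have "n \<in> set (mults X)" by (meson map_of_SomeD set_zip_rightD)
  then show ?thesis using assms Some by (auto simp: root_order_def marked_curve_def)
qed

lemma root_order_unmarked:
  assumes "p \<notin> set (marks X)" shows "root_order X p = 1"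
proof (cases "map_of (zip (marks X) (mults X)) p")
  case None then show ?thesis by (simp add: root_order_def)
next
  case (Some n)
  then have "p \<in> set (marks X)" by (meson map_of_SomeD set_zip_leftD)
  then show ?thesis using assms by simp
qed

context vector_space
begin

lemma mem_twist:
  assumes "dvr p" shows "v \<in> twist scale p n M \<longleftrightarrow> scale (unif p powi (- n)) v \<in> M"
proof -
  have nz: "unif p powi n \<noteq> 0" using unif_nonzero[OF assms] by simp
  have inv: "unif p powi (- n) = inverse (unif p powi n)" by (rule power_int_minus)
  show ?thesis
  proof
    assume "v \<in> twist scale p n M"
    then show "scale (unif p powi (- n)) v \<in> M" using nz by (auto simp: twist_def inv)
  next
    assume "scale (unif p powi (- n)) v \<in> M"
    then show "v \<in> twist scale p n M"
      unfolding twist_def using nz by (intro image_eqI[of _ _ "scale (unif p powi (- n)) v"]) (auto simp: inv)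
  qed
qed

lemma twist_twist:
  assumes "dvr p" shows "twist scale p m (twist scale p n M) = twist scale p (m + n) M"
  using unif_nonzero[OF assms] by (auto simp: mem_twist[OF assms] power_int_add[symmetric] algebra_simps)

lemma twist_0: "twist scale p 0 M = M"
  by (simp add: twist_def)

lemma twist_mono: "M \<subseteq> N \<Longrightarrow> twist scale p n M \<subseteq> twist scale p n N"
  by (auto simp: twist_def)

lemma twist_submodule:
  assumes "submodule_of scale p M" shows "submodule_of scale p (twist scale p n M)"
  unfolding submodule_of_def
proof (intro conjI ballI)
  have M: "0 \<in> M" "\<And>u v. u \<in> M \<Longrightarrow> v \<in> M \<Longrightarrow> u + v \<in> M" "\<And>a v. a \<in> p \<Longrightarrow> v \<in> M \<Longrightarrow> scale a v \<in> M"
    using assms by (auto simp: submodule_of_def)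
  show "0 \<in> twist scale p n M" using M(1) unfolding twist_def by (intro image_eqI[of _ _ 0]) auto
  fix u v assume "u \<in> twist scale p n M" "v \<in> twist scale p n M"
  then show "u + v \<in> twist scale p n M" using M(2) by (auto simp: twist_def scale_right_distrib[symmetric])
next
  fix a v assume a: "a \<in> p" "v \<in> twist scale p n M"
  then obtain u where u: "u \<in> M" "v = scale (unif p powi n) u" by (auto simp: twist_def)
  then have eq: "scale a v = scale (unif p powi n) (scale a u)" by (simp add: mult.commute)
  moreover have "scale a u \<in> M" using assms a(1) u(1) by (auto simp: submodule_of_def)
  ultimately show "scale a v \<in> twist scale p n M" unfolding twist_def by (rule image_eqI)
qed

lemma submodule_scale_unit:
  assumes "submodule_of scale p M" "unit_of p u" shows "scale u v \<in> M \<longleftrightarrow> v \<in> M"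
proof
  assume "scale u v \<in> M"
  then have "scale (inverse u) (scale u v) \<in> M" using assms unfolding submodule_of_def unit_of_def by blast
  then show "v \<in> M" using assms(2) by (simp add: unit_of_def)
next
  assume "v \<in> M" then show "scale u v \<in> M" using assms by (auto simp: submodule_of_def unit_of_def)
qed

text \<open>Elements of the same order differ by a unit, which preserves \<open>M\<close>.\<close>

lemma mem_twist_val:
  assumes "dvr p" "submodule_of scale p M" "c \<noteq> 0"
  shows "scale c v \<in> M \<longleftrightarrow> v \<in> twist scale p (- val p c) M"
proof -
  obtain u where u: "unit_of p u" "c = u * unif p powi val p c" using val_decomp[OF assms(1,3)] by blast
  then have eq: "scale c v = scale u (scale (unif p powi val p c) v)" by (metis scale_scale)
  show ?thesis unfolding eq submodule_scale_unit[OF assms(2) u(1)] mem_twist[OF assms(1)] by simp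
qed

end

lemma parabolic_vector_space: "parabolic_bundle X F \<Longrightarrow> vector_space (scal F)"
  by (simp add: parabolic_bundle_def vector_bundle_def)

locale parabolic_point =
  fixes X :: "('k::field, 'z) curve_scheme" and F :: "('k, 'v::ab_group_add) par_bundle" and p :: "'k set"
  assumes X: "marked_curve X" and F: "parabolic_bundle X F" and p: "p \<in> points X"
begin

abbreviation r :: nat where "r \<equiv> root_order X p"

sublocale V: vector_space "scal F"
  by (rule parabolic_vector_space[OF F])

lemma r_pos: "0 < r" by (rule root_order_pos[OF X])

lemma d: "dvr p" by (rule points_dvr[OF p])

lemma fil_submodule: "j \<le> r \<Longrightarrow> submodule_of (scal F) p (fil F p j)"
  using F p by (simp add: parabolic_bundle_def)

lemma fil_top: "fil F p r = twist (scal F) p 1 (fil F p 0)"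
  using F p by (simp add: parabolic_bundle_def)

lemma filZ_submodule: "submodule_of (scal F) p (filZ X F p n)"
proof -
  have "nat (n mod int r) \<le> r" using r_pos pos_mod_bound[of "int r" n] by linarith
  then show ?thesis unfolding filZ_def by (intro V.twist_submodule fil_submodule)
qed

lemma filZ_shift: "filZ X F p (n + m * int r) = twist (scal F) p m (filZ X F p n)"
  using r_pos by (simp add: filZ_def V.twist_twist[OF d] add.commute)

lemma filZ_fil: "j \<le> r \<Longrightarrow> filZ X F p (int j) = fil F p j"
proof (cases "j = r")
  case True
  then show ?thesis using r_pos by (simp add: filZ_def fil_top)
next
  case False
  assume "j \<le> r"
  then show ?thesis using False by (simp add: filZ_def V.twist_0 zdiv_int[symmetric] zmod_int[symmetric])
qed

lemma filZ_Suc: "filZ X F p (n + 1) \<subseteq> filZ X F p n"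
proof -
  define q j where "q = n div int r" and "j = nat (n mod int r)"
  have j: "j < r" "n = int j + q * int r"
    using r_pos pos_mod_bound[of "int r" n] by (auto simp: q_def j_def nat_less_iff)
  have "filZ X F p (n + 1) = twist (scal F) p q (fil F p (Suc j))"
    using filZ_shift[of "int (Suc j)" q] filZ_fil[of "Suc j"] j by (simp add: algebra_simps)
  moreover have "filZ X F p n = twist (scal F) p q (fil F p j)"
    using filZ_shift[of "int j" q] filZ_fil[of j] j by simp
  moreover have "fil F p (Suc j) \<subseteq> fil F p j" using F p j(1) by (simp add: parabolic_bundle_def)
  ultimately show ?thesis using V.twist_mono by simp
qed

lemma filZ_antimono: "a \<le> b \<Longrightarrow> filZ X F p b \<subseteq> filZ X F p a"
proof (induction b rule: int_ge_induct)
  case (step i) then show ?case using filZ_Suc[of i] by blast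
qed simp

lemma gen_subspace: "V.subspace (gen F)"
proof -
  obtain B where "basis_of (scal F) (gen F) B"
    using F unfolding parabolic_bundle_def vector_bundle_def by blast
  then have "V.span B = gen F" by (simp add: basis_of_def)
  then show ?thesis using V.subspace_span[of B] by simp
qed

lemma stalk_basis: obtains C where "finite C" "V.independent C" "V.span C = gen F" "fil F p 0 = submodule_gen (scal F) p C"
  using F p unfolding parabolic_bundle_def vector_bundle_def basis_of_def by blast

lemma stalk_subset: "fil F p 0 \<subseteq> gen F"
proof -
  obtain C where "V.span C = gen F" "fil F p 0 = submodule_gen (scal F) p C" by (rule stalk_basis)
  then show ?thesis using V.submodule_gen_span[of p C] by simp
qed

lemma filZ_gen: "v \<in> filZ X F p n \<Longrightarrow> v \<in> gen F"
proof -
  assume v: "v \<in> filZ X F p n"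
  define q where "q = n div int r"
  have "q * int r \<le> n" using r_pos pos_mod_sign[of "int r" n] by (simp add: q_def minus_mod_eq_div_mult[symmetric])
  then have "v \<in> twist (scal F) p q (filZ X F p 0)"
    using filZ_antimono[of "q * int r" n] filZ_shift[of 0 q] v by auto
  then obtain u where "u \<in> fil F p 0" "v = scal F (unif p powi q) u" using filZ_fil[of 0] by (auto simp: twist_def)
  then show "v \<in> gen F" using stalk_subset V.subspace_scale[OF gen_subspace] by blast
qed

lemma filZ_full:
  assumes "v \<in> gen F" shows "\<exists>N. \<forall>x\<in>\<mm> p N. scal F x v \<in> filZ X F p n"
proof -
  obtain C where C: "finite C" "V.independent C" "V.span C = gen F" "fil F p 0 = submodule_gen (scal F) p C"
    by (rule stalk_basis)
  obtain M where M: "\<forall>z\<in>V.representation C v ` C. z \<in> \<mm> p M"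
    using common_bound[OF d, of "V.representation C v ` C"] C(1) by blast
  define q where "q = n div int r + 1"
  have "n \<le> q * int r"
    using r_pos pos_mod_bound[of "int r" n] by (simp add: q_def minus_mod_eq_div_mult[symmetric] distrib_right order.strict_implies_order)
  then have sub: "twist (scal F) p q (fil F p 0) \<subseteq> filZ X F p n"
    using filZ_antimono[of n "q * int r"] filZ_shift[of 0 q] filZ_fil[of 0] by auto
  have "scal F x v \<in> filZ X F p n" if x: "x \<in> \<mm> p (q - M)" for x
  proof -
    define z where "z = unif p powi (- q) * x"
    have "z \<in> \<mm> p (- q + (q - M))"
      unfolding z_def by (rule mm_mult[OF d _ x]) (simp add: mm_iff[OF d] val_powi[OF d unif_nonzero[OF d]] val_unif[OF d])
    then have "z * V.representation C v c \<in> \<mm> p (- M + M)" if "c \<in> C" for c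
      using M that by (intro mm_mult[OF d]) auto
    then have "V.representation C (scal F z v) c \<in> p" if "c \<in> C" for c
      using that C(2,3) assms by (simp add: V.representation_scale mm_0[OF d])
    moreover have "scal F z v \<in> V.span C" using assms C(3) V.span_scale by blast
    ultimately have "scal F z v \<in> fil F p 0"
      unfolding C(4) using V.submodule_gen_iff[OF dvr_subring[OF d] C(1,2)] by blast
    then have "scal F x v \<in> twist (scal F) p q (fil F p 0)" by (simp add: V.mem_twist[OF d] z_def)
    then show ?thesis using sub by blast
  qed
  then show ?thesis by blast
qed

end

section \<open>Forms with values in a line\<close>

lemma vector_space_fscale: "vector_space (fscale :: 'k::field \<Rightarrow> ('a \<Rightarrow> 'k) \<Rightarrow> 'a \<Rightarrow> 'k)"
  by unfold_locales (auto simp: fscale_def fun_eq_iff algebra_simps)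

lemma linear_fscale_eval: "Vector_Spaces.linear fscale (*) (\<lambda>g. g v * c)"
  unfolding Vector_Spaces.linear_iff using vector_space_fscale vector_space_field
  by (auto simp: fscale_def algebra_simps)

lemma bilinear_eval:
  assumes "Vector_Spaces.linear t (*) m" shows "bilinear_form fscale t (\<lambda>g x. g v * m x)"
proof -
  have "Vector_Spaces.linear t (*) (\<lambda>x. c * m x)" for c
    using assms unfolding Vector_Spaces.linear_iff by (auto simp: algebra_simps)
  then show ?thesis unfolding bilinear_form_def by (intro conjI allI linear_fscale_eval)
qed

lemma bilinear_formD:
  assumes "bilinear_form s1 s2 b"
  shows "b (u + v) w = b u w + b v w" "b (s1 c v) w = c * b v w" "b v (w + x) = b v w + b v x" "b v (s2 c w) = c * b v w"
  using assms unfolding bilinear_form_def Vector_Spaces.linear_iff by auto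

lemma tens_add_left: "tens s1 s2 (u + v) w = tens s1 s2 u w + tens s1 s2 v w"
  by (rule ext) (simp add: tens_def bilinear_formD)

lemma tens_add_right: "tens s1 s2 v (w + x) = tens s1 s2 v w + tens s1 s2 v x"
  by (rule ext) (simp add: tens_def bilinear_formD)

lemma tens_scale_left: "tens s1 s2 (s1 c v) w = fscale c (tens s1 s2 v w)"
  by (rule ext) (simp add: tens_def fscale_def bilinear_formD)

lemma tens_scale_right: "tens s1 s2 v (s2 c w) = fscale c (tens s1 s2 v w)"
  by (rule ext) (simp add: tens_def fscale_def bilinear_formD)

lemma tens_in_tensor_space:
  assumes "v \<in> V" "w \<in> W" shows "tens s1 s2 v w \<in> tensor_space s1 V s2 W"
  unfolding tensor_space_def
  by (rule module.span_base[OF vector_space_fscale[folded module_iff_vector_space]]) (use assms in blast)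

lemma dual_space_add: "g \<in> dual_space s V \<Longrightarrow> h \<in> dual_space s V \<Longrightarrow> g + h \<in> dual_space s V"
  by (auto simp: dual_space_def linear_on_def algebra_simps)

lemma dual_space_scale: "g \<in> dual_space s V \<Longrightarrow> fscale c g \<in> dual_space s V"
  by (auto simp: dual_space_def linear_on_def fscale_def algebra_simps)

lemma dual_space_0: "0 \<in> dual_space s V"
  by (auto simp: dual_space_def linear_on_def)

definition line_generator :: "('k::field \<Rightarrow> 'w \<Rightarrow> 'w::ab_group_add) \<Rightarrow> 'w set \<Rightarrow> 'w \<Rightarrow> bool" where
  "line_generator t W l \<longleftrightarrow> vector_space t \<and> l \<noteq> 0 \<and> W = range (\<lambda>a. t a l)"

lemma line_functional:
  assumes "vector_space t" "l \<noteq> 0" shows "\<exists>m. Vector_Spaces.linear t (*) m \<and> m l = 1"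
proof -
  interpret vector_space t by fact
  have "l \<notin> span {}" using assms(2) by simp
  then show ?thesis using functional_separating[OF independent_empty] by blast
qed

text \<open>As \<open>W\<close> is a line, \<open>g \<otimes> a l = (a g) \<otimes> l\<close> describes all pure tensors, and sums of such tensors are again of this form.\<close>

lemma tensor_space_line:
  assumes W: "line_generator t W l"
    and D: "0 \<in> D" "\<And>g h. g \<in> D \<Longrightarrow> h \<in> D \<Longrightarrow> g + h \<in> D" "\<And>c g. g \<in> D \<Longrightarrow> s c g \<in> D"
      "\<And>c. s c 0 = 0" "\<And>v. s 0 v = 0"
  shows "tensor_space s D t W = {tens s t g l | g. g \<in> D}"
proof
  interpret T: vector_space "fscale :: 'a \<Rightarrow> (('c \<Rightarrow> 'b \<Rightarrow> 'a) \<Rightarrow> 'a) \<Rightarrow> _" by (rule vector_space_fscale)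
  interpret t: vector_space t using W by (simp add: line_generator_def)
  have l: "l \<in> W" using W by (auto simp: line_generator_def intro!: image_eqI[of _ _ 1])
  show "{tens s t g l | g. g \<in> D} \<subseteq> tensor_space s D t W" using tens_in_tensor_space l by blast
  have zero: "0 = tens s t 0 l"
    using tens_scale_left[of s t 0 0 l] D(5)[of 0] by (simp add: fscale_def zero_fun_def)
  have "T.subspace {tens s t g l | g. g \<in> D}"
    unfolding T.subspace_def
  proof (intro conjI ballI allI)
    show "0 \<in> {tens s t g l | g. g \<in> D}" using zero D(1) by blast
    fix x y assume "x \<in> {tens s t g l | g. g \<in> D}" "y \<in> {tens s t g l | g. g \<in> D}"
    then show "x + y \<in> {tens s t g l | g. g \<in> D}" using D(2) by (auto simp: tens_add_left[symmetric])
  next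
    fix c x assume "x \<in> {tens s t g l | g. g \<in> D}"
    then show "fscale c x \<in> {tens s t g l | g. g \<in> D}" using D(3) by (auto simp: tens_scale_left[symmetric])
  qed
  moreover have "tens s t g w \<in> {tens s t g l | g. g \<in> D}" if gw: "g \<in> D" "w \<in> W" for g w
  proof -
    obtain a where "w = t a l" using gw(2) W by (auto simp: line_generator_def)
    then have "tens s t g w = tens s t (s a g) l" by (simp add: tens_scale_right tens_scale_left)
    then show ?thesis using D(3)[OF gw(1)] by blast
  qed
  ultimately show "tensor_space s D t W \<subseteq> {tens s t g l | g. g \<in> D}"
    unfolding tensor_space_def by (intro T.span_minimal) auto
qed

lemma tensor_space_dual_line:
  assumes "line_generator t W l"
  shows "tensor_space fscale (dual_space s V) t W = {tens fscale t g l | g. g \<in> dual_space s V}"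
  by (rule tensor_space_line[OF assms dual_space_0 dual_space_add dual_space_scale])
    (auto simp: fscale_def zero_fun_def)

lemma tens_line_inj:
  assumes "vector_space t" "l \<noteq> 0" "tens fscale t g l = tens fscale t h l" shows "g = h"
proof
  fix v
  obtain m where m: "Vector_Spaces.linear t (*) m" "m l = 1" using line_functional[OF assms(1,2)] by blast
  show "g v = h v"
    using fun_cong[OF assms(3), of "\<lambda>g x. g v * m x"] bilinear_eval[OF m(1), of v] m(2) by (simp add: tens_def)
qed

lemma contract_line:
  assumes W: "line_generator t W l" shows "contract t W (tens fscale t g l) v = t (g v) l"
  unfolding contract_def
proof (rule the_equality)
  have eq: "tens fscale t g l (\<lambda>g x. g v * m x) = m (t (g v) l)" if "Vector_Spaces.linear t (*) m" for m
    using bilinear_eval[OF that, of v] that unfolding Vector_Spaces.linear_iff by (simp add: tens_def)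
  show "t (g v) l \<in> W \<and> (\<forall>m. Vector_Spaces.linear t (*) m \<longrightarrow> m (t (g v) l) = tens fscale t g l (\<lambda>g x. g v * m x))"
    using W eq by (auto simp: line_generator_def)
  fix w assume w: "w \<in> W \<and> (\<forall>m. Vector_Spaces.linear t (*) m \<longrightarrow> m w = tens fscale t g l (\<lambda>g x. g v * m x))"
  obtain a where a: "w = t a l" using w W by (auto simp: line_generator_def)
  obtain m where m: "Vector_Spaces.linear t (*) m" "m l = 1"
    using line_functional[of t l] W unfolding line_generator_def by blast
  have "m w = m (t (g v) l)" using w eq m(1) by simp
  then show "w = t (g v) l" using a m unfolding Vector_Spaces.linear_iff by simp
qed

definition restrict0 :: "'v set \<Rightarrow> ('v \<Rightarrow> 'k::zero) \<Rightarrow> 'v \<Rightarrow> 'k" where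
  "restrict0 V g = (\<lambda>w. if w \<in> V then g w else 0)"

text \<open>Contraction maps \<open>g \<otimes> l\<close> to \<open>w \<mapsto> g(w) l\<close>, so it determines \<open>g\<close>; here \<open>b\<close> stands for \<open>w \<mapsto> b(v, w)\<close>.\<close>

lemma induced_map_line:
  assumes W: "line_generator (scal L) (gen L) l"
    and b: "\<And>w. w \<in> gen F \<Longrightarrow> \<beta> (tens (scal F) (scal F) v w) = scal L (b w) l"
    and dual: "restrict0 (gen F) b \<in> dual_space (scal F) (gen F)"
  shows "induced_map F L \<beta> v = tens fscale (scal L) (restrict0 (gen F) b) l"
  unfolding induced_map_def
proof (rule the_equality)
  let ?T = "tensor_space fscale (dual_space (scal F) (gen F)) (scal L) (gen L)"
  note T = tensor_space_dual_line[OF W, of "scal F" "gen F"]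
  show "tens fscale (scal L) (restrict0 (gen F) b) l \<in> ?T \<and>
    (\<forall>w\<in>gen F. contract (scal L) (gen L) (tens fscale (scal L) (restrict0 (gen F) b) l) w =
       \<beta> (tens (scal F) (scal F) v w))"
    using T dual b by (auto simp: contract_line[OF W] restrict0_def)
  fix x assume x: "x \<in> ?T \<and> (\<forall>w\<in>gen F. contract (scal L) (gen L) x w = \<beta> (tens (scal F) (scal F) v w))"
  then obtain g where g: "x = tens fscale (scal L) g l" "g \<in> dual_space (scal F) (gen F)" using T by blast
  obtain m where m: "Vector_Spaces.linear (scal L) (*) m" "m l = 1"
    using line_functional[of "scal L" l] W unfolding line_generator_def by blast
  have "g w = b w" if w: "w \<in> gen F" for w
  proof -
    have "scal L (g w) l = scal L (b w) l" using x w b[OF w] g(1) by (simp add: contract_line[OF W])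
    then have "m (scal L (g w) l) = m (scal L (b w) l)" by simp
    then show ?thesis using m unfolding Vector_Spaces.linear_iff by simp
  qed
  then have "g = restrict0 (gen F) b" using g(2) by (auto simp: restrict0_def dual_space_def)
  then show "x = tens fscale (scal L) (restrict0 (gen F) b) l" using g(1) by simp
qed

context parabolic_point
begin

definition dual_fil :: "int \<Rightarrow> ('v \<Rightarrow> 'k) set" where
  "dual_fil n = {g \<in> dual_space (scal F) (gen F). \<forall>a. \<forall>v\<in>filZ X F p a. g v \<in> \<mm> p (ceil_div (a + n) r)}"

lemma filZ_par_dual: "filZ X (par_dual X F) p n = dual_fil n"
proof -
  interpret D: vector_space "fscale :: 'k \<Rightarrow> ('v \<Rightarrow> 'k) \<Rightarrow> _" by (rule vector_space_fscale)
  define q j where "q = n div int r" and "j = nat (n mod int r)"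
  have n: "n = int j + q * int r" using r_pos by (simp add: q_def j_def)
  have w: "unif p powi (- q) \<noteq> 0" "val p (unif p powi (- q)) = - q"
    using unif_nonzero[OF d] by (simp_all add: val_powi[OF d] val_unif[OF d])
  have "g \<in> filZ X (par_dual X F) p n \<longleftrightarrow> g \<in> dual_fil n" for g
  proof -
    have "g \<in> filZ X (par_dual X F) p n \<longleftrightarrow>
      fscale (unif p powi (- q)) g \<in> dual_space (scal F) (gen F) \<and>
      (\<forall>a. \<forall>v\<in>filZ X F p a. unif p powi (- q) * g v \<in> \<mm> p (ceil_div (a + int j) r))"
      unfolding filZ_def[of X "par_dual X F"] by (simp add: par_dual_def D.mem_twist[OF d] q_def[symmetric] j_def[symmetric] ceil_div_def fscale_def)
    moreover have "fscale (unif p powi (- q)) g \<in> dual_space (scal F) (gen F) \<longleftrightarrow> g \<in> dual_space (scal F) (gen F)"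
    proof
      assume "fscale (unif p powi (- q)) g \<in> dual_space (scal F) (gen F)"
      from dual_space_scale[OF this, of "inverse (unif p powi (- q))"]
      show "g \<in> dual_space (scal F) (gen F)" using w(1) by (simp add: fscale_def mult.assoc[symmetric])
    qed (rule dual_space_scale)
    moreover have "unif p powi (- q) * g v \<in> \<mm> p (ceil_div (a + int j) r) \<longleftrightarrow> g v \<in> \<mm> p (ceil_div (a + n) r)" for a v
    proof -
      have "ceil_div (a + n) r = ceil_div (a + int j) r + q"
        using ceil_div_add_multiple[OF r_pos, of "a + int j" q] by (simp add: n add.assoc)
      then show ?thesis by (simp add: mm_scale_iff[OF d w(1)] w(2))
    qed
    ultimately show ?thesis by (simp add: dual_fil_def)
  qed
  then show ?thesis by blast
qed

text \<open>
  \<open>line_fil L l k\<close>: near \<open>p\<close> the parabolic line bundle \<open>L\<close> with generic generator \<open>l\<close> has weight \<open>k/r\<close> relative to \<open>l\<close>; the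
  integer \<open>k\<close> accounts for both the weight and the order of \<open>l\<close>.
\<close>

definition line_fil :: "('k, 'w::ab_group_add) par_bundle \<Rightarrow> 'w \<Rightarrow> int \<Rightarrow> bool" where
  "line_fil L l k \<longleftrightarrow> line_generator (scal L) (gen L) l \<and>
     (\<forall>j\<le>r. fil L p j = {scal L a l | a. a \<in> \<mm> p (ceil_div (int j - k) r)})"

lemma filZ_line:
  assumes "line_fil L l k" shows "filZ X L p n = {scal L a l | a. a \<in> \<mm> p (ceil_div (n - k) r)}"
proof -
  interpret L: vector_space "scal L" using assms by (simp add: line_fil_def line_generator_def)
  define q j where "q = n div int r" and "j = nat (n mod int r)"
  have n: "n = int j + q * int r" and j: "j \<le> r"
    using r_pos pos_mod_bound[of "int r" n] by (auto simp: q_def j_def nat_le_iff order.strict_implies_order)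
  have "filZ X L p n = twist (scal L) p q {scal L a l | a. a \<in> \<mm> p (ceil_div (int j - k) r)}"
    using assms j unfolding filZ_def q_def[symmetric] j_def[symmetric] line_fil_def by simp
  also have "\<dots> = {scal L a l | a. a \<in> \<mm> p (ceil_div (n - k) r)}"
  proof -
    have c: "ceil_div (n - k) r = ceil_div (int j - k) r + q"
      using ceil_div_add_multiple[OF r_pos, of "int j - k" q] by (simp add: n diff_add_eq)
    have w: "unif p powi q \<noteq> 0" "val p (unif p powi q) = q"
      using unif_nonzero[OF d] by (simp_all add: val_powi[OF d] val_unif[OF d])
    have mem: "unif p powi q * a \<in> \<mm> p (ceil_div (n - k) r) \<longleftrightarrow> a \<in> \<mm> p (ceil_div (int j - k) r)" for a
      by (simp add: mm_scale_iff[OF d w(1)] w(2) c)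
    show ?thesis
    proof (intro set_eqI iffI)
      fix x assume "x \<in> twist (scal L) p q {scal L a l | a. a \<in> \<mm> p (ceil_div (int j - k) r)}"
      then obtain a where "a \<in> \<mm> p (ceil_div (int j - k) r)" "x = scal L (unif p powi q * a) l"
        by (auto simp: twist_def)
      then show "x \<in> {scal L a l | a. a \<in> \<mm> p (ceil_div (n - k) r)}" using mem by blast
    next
      fix x assume "x \<in> {scal L a l | a. a \<in> \<mm> p (ceil_div (n - k) r)}"
      then obtain a where a: "a \<in> \<mm> p (ceil_div (n - k) r)" "x = scal L a l" by blast
      define b where "b = inverse (unif p powi q) * a"
      have ab: "a = unif p powi q * b" using w(1) by (simp add: b_def mult.assoc[symmetric])
      then have "b \<in> \<mm> p (ceil_div (int j - k) r)" using a(1) mem by simp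
      moreover have "x = scal L (unif p powi q) (scal L b l)" by (simp add: a(2) ab)
      ultimately show "x \<in> twist (scal L) p q {scal L a l | a. a \<in> \<mm> p (ceil_div (int j - k) r)}"
        unfolding twist_def by blast
    qed
  qed
  finally show ?thesis .
qed

lemma fil_dual_tensor_line:
  assumes L: "line_fil L l k" and j: "j \<le> r"
  shows "fil (par_tensor X (par_dual X F) L) p j = {tens fscale (scal L) g l | g. g \<in> dual_fil (int j - k)}"
proof -
  interpret L: vector_space "scal L" using L by (simp add: line_fil_def line_generator_def)
  let ?R = "{tens fscale (scal L) g l | g. g \<in> dual_fil (int j - k)}"
  have add: "g + h \<in> dual_fil n" if "g \<in> dual_fil n" "h \<in> dual_fil n" for g h n
    using that dual_space_add mm_add[OF d] by (auto simp: dual_fil_def)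
  have zero: "0 \<in> dual_fil n" for n using dual_space_0 zero_mm[OF d] by (auto simp: dual_fil_def)
  have fil: "fil (par_tensor X (par_dual X F) L) p j =
    addspan {tens fscale (scal L) g w | g w a b. a + b = int j \<and> g \<in> dual_fil a \<and> w \<in> filZ X L p b}"
  proof -
    have "scal (par_dual X F) = fscale" by (simp add: par_dual_def)
    then show ?thesis unfolding par_tensor_def by (simp add: filZ_par_dual)
  qed
  have "tens fscale (scal L) g w \<in> ?R" if gw: "a + b = int j" "g \<in> dual_fil a" "w \<in> filZ X L p b" for g w a b
  proof -
    obtain c where c: "w = scal L c l" "c \<in> \<mm> p (ceil_div (b - k) r)" using gw(3) filZ_line[OF L] by blast
    have "fscale c g v \<in> \<mm> p (ceil_div (i + (int j - k)) r)" if v: "v \<in> filZ X F p i" for v i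
    proof -
      have "g v \<in> \<mm> p (ceil_div (i + a) r)" using gw(2) v by (simp add: dual_fil_def)
      then have "c * g v \<in> \<mm> p (ceil_div (b - k) r + ceil_div (i + a) r)" using c(2) mm_mult[OF d] by blast
      moreover have "ceil_div (i + (int j - k)) r \<le> ceil_div (b - k) r + ceil_div (i + a) r"
      proof -
        have "i + (int j - k) = (b - k) + (i + a)" using gw(1) by simp
        then show ?thesis using ceil_div_subadditive[OF r_pos, of "b - k" "i + a"] by metis
      qed
      ultimately show ?thesis using mm_antimono[OF d] by (simp add: fscale_def)
    qed
    then have "fscale c g \<in> dual_fil (int j - k)" using gw(2) dual_space_scale by (auto simp: dual_fil_def)
    moreover have "tens fscale (scal L) g w = tens fscale (scal L) (fscale c g) l"
      by (simp add: c(1) tens_scale_right tens_scale_left)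
    ultimately show ?thesis by blast
  qed
  moreover have "0 \<in> ?R"
  proof -
    have "tens fscale (scal L) 0 l = 0"
      using tens_scale_left[of fscale "scal L" 0 0 l] by (simp add: fscale_def zero_fun_def)
    then have "0 = tens fscale (scal L) 0 l" by (rule sym)
    then show ?thesis using zero by blast
  qed
  moreover have "x + y \<in> ?R" if "x \<in> ?R" "y \<in> ?R" for x y
    using that add by (auto simp: tens_add_left[symmetric])
  ultimately have "addspan {tens fscale (scal L) g w | g w a b. a + b = int j \<and> g \<in> dual_fil a \<and> w \<in> filZ X L p b} \<subseteq> ?R"
    by (intro addspan_least) auto
  moreover have "?R \<subseteq> addspan {tens fscale (scal L) g w | g w a b. a + b = int j \<and> g \<in> dual_fil a \<and> w \<in> filZ X L p b}"
  proof
    fix x assume "x \<in> ?R"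
    then obtain g where g: "x = tens fscale (scal L) g l" "g \<in> dual_fil (int j - k)" by blast
    have "l \<in> filZ X L p k"
      unfolding filZ_line[OF L] using ceil_div_self[OF r_pos] subring_1[OF dvr_subring[OF d]]
      by (auto simp: mm_0[OF d] intro!: exI[of _ 1])
    then have "x \<in> {tens fscale (scal L) g w | g w a b. a + b = int j \<and> g \<in> dual_fil a \<and> w \<in> filZ X L p b}"
      using g by (intro CollectI exI[of _ g] exI[of _ l] exI[of _ "int j - k"] exI[of _ k]) auto
    then show "x \<in> addspan {tens fscale (scal L) g w | g w a b. a + b = int j \<and> g \<in> dual_fil a \<and> w \<in> filZ X L p b}"
      by (rule addspan_base)
  qed
  ultimately show ?thesis unfolding fil by blast
qed


text \<open>Passing from \<open>n\<close> to \<open>n + q r\<close> multiplies the set of vectors on either side by the \<open>q\<close>-th power of a uniformizer.\<close>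

lemma filZ_perp:
  assumes b: "\<And>c v w. v \<in> gen F \<Longrightarrow> w \<in> gen F \<Longrightarrow> b (scal F c v) w = c * b v w"
    and perp: "\<And>j v. j \<le> r \<Longrightarrow> v \<in> gen F \<Longrightarrow>
      v \<in> fil F p j \<longleftrightarrow> (\<forall>a. \<forall>w\<in>filZ X F p a. b v w \<in> \<mm> p (ceil_div (a + int j - k) r))"
    and v: "v \<in> gen F"
  shows "v \<in> filZ X F p n \<longleftrightarrow> (\<forall>a. \<forall>w\<in>filZ X F p a. b v w \<in> \<mm> p (ceil_div (a + n - k) r))"
proof -
  define q j where "q = n div int r" and "j = nat (n mod int r)"
  have n: "n = int j + q * int r" and j: "j \<le> r"
    using r_pos pos_mod_bound[of "int r" n] by (auto simp: q_def j_def nat_le_iff order.strict_implies_order)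
  have w: "unif p powi (- q) \<noteq> 0" "val p (unif p powi (- q)) = - q"
    using unif_nonzero[OF d] by (simp_all add: val_powi[OF d] val_unif[OF d])
  let ?u = "scal F (unif p powi (- q)) v"
  have u: "?u \<in> gen F" using V.subspace_scale[OF gen_subspace v] .
  have "v \<in> filZ X F p n \<longleftrightarrow> ?u \<in> fil F p j"
    using filZ_shift[of "int j" q] filZ_fil[OF j] by (simp add: n V.mem_twist[OF d])
  also have "\<dots> \<longleftrightarrow> (\<forall>a. \<forall>w\<in>filZ X F p a. b ?u w \<in> \<mm> p (ceil_div (a + int j - k) r))"
    by (rule perp[OF j u])
  also have "\<dots> \<longleftrightarrow> (\<forall>a. \<forall>w\<in>filZ X F p a. b v w \<in> \<mm> p (ceil_div (a + n - k) r))"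
  proof -
    have "b ?u z \<in> \<mm> p (ceil_div (a + int j - k) r) \<longleftrightarrow> b v z \<in> \<mm> p (ceil_div (a + n - k) r)"
      if z: "z \<in> filZ X F p a" for a z
    proof -
      have "a + n - k = (a + int j - k) + q * int r" by (simp add: n)
      then have "ceil_div (a + n - k) r = ceil_div (a + int j - k) r + q" by (simp only: ceil_div_add_multiple[OF r_pos])
      then show ?thesis by (simp add: b[OF v filZ_gen[OF z]] mm_scale_iff[OF d w(1)] w(2))
    qed
    then show ?thesis by blast
  qed
  finally show ?thesis .
qed

end

definition bilinear_on :: "('k::field \<Rightarrow> 'v \<Rightarrow> 'v::ab_group_add) \<Rightarrow> 'v set \<Rightarrow> ('v \<Rightarrow> 'v \<Rightarrow> 'k) \<Rightarrow> bool" where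
  "bilinear_on s V b \<longleftrightarrow>
     (\<forall>u\<in>V. \<forall>v\<in>V. \<forall>w\<in>V. b (u + v) w = b u w + b v w \<and> b w (u + v) = b w u + b w v) \<and>
     (\<forall>c. \<forall>v\<in>V. \<forall>w\<in>V. b (s c v) w = c * b v w \<and> b v (s c w) = c * b v w)"

lemma restrict0_dual:
  assumes "bilinear_on s V b" "v \<in> V" "\<And>u w. u \<in> V \<Longrightarrow> w \<in> V \<Longrightarrow> u + w \<in> V" "\<And>c w. w \<in> V \<Longrightarrow> s c w \<in> V"
  shows "restrict0 V (b v) \<in> dual_space s V"
  using assms by (auto simp: dual_space_def linear_on_def restrict0_def bilinear_on_def)

lemma par_form_coefficients:
  assumes form: "par_form X \<kappa> L F \<beta>" and vs: "vector_space (scal F)" "vector_space (scal L)"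
    and sub: "module.subspace (scal F) (gen F)" and L: "line_generator (scal L) (gen L) l"
  obtains b where "\<And>v w. v \<in> gen F \<Longrightarrow> w \<in> gen F \<Longrightarrow> \<beta> (tens (scal F) (scal F) v w) = scal L (b v w) l"
    "bilinear_on (scal F) (gen F) b"
    "\<And>v w. v \<in> gen F \<Longrightarrow> w \<in> gen F \<Longrightarrow> b v w = form_sign \<kappa> (b w v)"
proof -
  interpret V: vector_space "scal F" by fact
  interpret L: vector_space "scal L" by fact
  let ?T = "tensor_space (scal F) (gen F) (scal F) (gen F)"
  have morph: "par_morphism X (par_tensor X F F) L \<beta>" using form by (simp add: par_form_def)
  then have lin: "linear_on fscale ?T (scal L) \<beta>" and img: "\<beta> ` ?T \<subseteq> gen L"
    by (auto simp: par_morphism_def par_tensor_def)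
  have T: "tens (scal F) (scal F) v w \<in> ?T" if "v \<in> gen F" "w \<in> gen F" for v w
    by (rule tens_in_tensor_space[OF that])
  have "\<exists>a. \<beta> (tens (scal F) (scal F) v w) = scal L a l" if "v \<in> gen F" "w \<in> gen F" for v w
    using img T[OF that] L by (auto simp: line_generator_def)
  then obtain b where b: "\<And>v w. v \<in> gen F \<Longrightarrow> w \<in> gen F \<Longrightarrow> \<beta> (tens (scal F) (scal F) v w) = scal L (b v w) l"
    by metis
  have l0: "l \<noteq> 0" using L by (simp add: line_generator_def)
  have inj: "x = y" if "scal L x l = scal L y l" for x y
    using that l0 L.scale_right_imp_eq by blast
  have add: "\<beta> (s + t) = \<beta> s + \<beta> t" and scl: "\<beta> (fscale c s) = scal L c (\<beta> s)" if "s \<in> ?T" "t \<in> ?T" for s t c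
    using lin that by (auto simp: linear_on_def)
  have closed: "u + v \<in> gen F" "scal F c u \<in> gen F" if "u \<in> gen F" "v \<in> gen F" for u v c
    using sub that V.subspace_add V.subspace_scale by blast+
  have "bilinear_on (scal F) (gen F) b"
    unfolding bilinear_on_def
  proof (intro conjI ballI allI)
    fix u v w assume g: "u \<in> gen F" "v \<in> gen F" "w \<in> gen F"
    show "b (u + v) w = b u w + b v w"
      by (rule inj) (simp add: L.scale_left_distrib b[symmetric] closed g tens_add_left add T)
    show "b w (u + v) = b w u + b w v"
      by (rule inj) (simp add: L.scale_left_distrib b[symmetric] closed g tens_add_right add T)
  next
    fix c v w assume g: "v \<in> gen F" "w \<in> gen F"
    have e: "\<beta> (fscale c (tens (scal F) (scal F) v w)) = scal L (c * b v w) l"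
      using scl[OF T[OF g] T[OF g]] b[OF g] by simp
    show "b (scal F c v) w = c * b v w"
      by (rule inj) (simp only: b[OF closed(2)[OF g(1) g(1)] g(2), symmetric] tens_scale_left e)
    show "b v (scal F c w) = c * b v w"
      by (rule inj) (simp only: b[OF g(1) closed(2)[OF g(2) g(2)], symmetric] tens_scale_right e)
  qed
  moreover have "b v w = form_sign \<kappa> (b w v)" if "v \<in> gen F" "w \<in> gen F" for v w
  proof (rule inj)
    have "\<beta> (tens (scal F) (scal F) v w) = form_sign \<kappa> (\<beta> (tens (scal F) (scal F) w v))"
      using form that unfolding par_form_def by blast
    then show "scal L (b v w) l = scal L (form_sign \<kappa> (b w v)) l"
      unfolding b[OF that] b[OF that(2,1)] by (cases \<kappa>) simp_all
  qed
  ultimately show thesis using that b by blast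
qed

lemma par_form_map:
  assumes form: "par_form X \<kappa> L F \<beta>" and line: "line_generator (scal L) (gen L) l"
    and b: "\<And>v w. v \<in> gen F \<Longrightarrow> w \<in> gen F \<Longrightarrow> \<beta> (tens (scal F) (scal F) v w) = scal L (b v w) l"
    and bil: "bilinear_on (scal F) (gen F) b" and sub: "module.subspace (scal F) (gen F)" and v: "v \<in> gen F"
  shows "induced_map F L \<beta> v = tens fscale (scal L) (restrict0 (gen F) (b v)) l"
    and "restrict0 (gen F) (b v) \<in> dual_space (scal F) (gen F)"
proof -
  interpret V: vector_space "scal F" using form parabolic_vector_space unfolding par_form_def by blast
  show dual: "restrict0 (gen F) (b v) \<in> dual_space (scal F) (gen F)"
    by (rule restrict0_dual[OF bil v V.subspace_add[OF sub] V.subspace_scale[OF sub]])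
  show "induced_map F L \<beta> v = tens fscale (scal L) (restrict0 (gen F) (b v)) l"
    by (rule induced_map_line[OF line b[OF v] dual])
qed

lemma par_form_nondegenerate:
  assumes form: "par_form X \<kappa> L F \<beta>" and line: "line_generator (scal L) (gen L) l"
    and b: "\<And>v w. v \<in> gen F \<Longrightarrow> w \<in> gen F \<Longrightarrow> \<beta> (tens (scal F) (scal F) v w) = scal L (b v w) l"
    and bil: "bilinear_on (scal F) (gen F) b" and sub: "module.subspace (scal F) (gen F)"
  shows "g \<in> dual_space (scal F) (gen F) \<Longrightarrow> \<exists>v\<in>gen F. \<forall>w\<in>gen F. g w = b v w"
    and "v \<in> gen F \<Longrightarrow> (\<And>w. w \<in> gen F \<Longrightarrow> b v w = 0) \<Longrightarrow> v = 0"
proof -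
  interpret V: vector_space "scal F" using form parabolic_vector_space unfolding par_form_def by blast
  have l: "vector_space (scal L)" "l \<noteq> 0" using line by (auto simp: line_generator_def)
  let ?G = "par_tensor X (par_dual X F) L"
  define \<theta> where "\<theta> = induced_map F L \<beta>"
  have \<theta>: "\<theta> v = tens fscale (scal L) (restrict0 (gen F) (b v)) l" if "v \<in> gen F" for v
    unfolding \<theta>_def by (rule par_form_map(1)[OF form line b bil sub that])
  obtain \<gamma> where m: "par_morphism X ?G F \<gamma>"
    and inv: "\<And>v. v \<in> gen F \<Longrightarrow> \<gamma> (\<theta> v) = v" "\<And>w. w \<in> gen ?G \<Longrightarrow> \<theta> (\<gamma> w) = w"
    using form unfolding par_form_def par_iso_def \<theta>_def by blast
  have genG: "gen ?G = {tens fscale (scal L) g l | g. g \<in> dual_space (scal F) (gen F)}"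
    using tensor_space_dual_line[OF line] by (simp add: par_tensor_def par_dual_def)
  show "\<exists>v\<in>gen F. \<forall>w\<in>gen F. g w = b v w" if g: "g \<in> dual_space (scal F) (gen F)"
  proof -
    define t where "t = tens fscale (scal L) g l"
    have t: "t \<in> gen ?G" using g genG by (auto simp: t_def)
    have v: "\<gamma> t \<in> gen F" using m t by (auto simp: par_morphism_def)
    have "tens fscale (scal L) (restrict0 (gen F) (b (\<gamma> t))) l = tens fscale (scal L) g l"
      using inv(2)[OF t] \<theta>[OF v] by (simp add: t_def)
    then have "restrict0 (gen F) (b (\<gamma> t)) = g" using tens_line_inj[OF l] by blast
    then have "g w = b (\<gamma> t) w" if "w \<in> gen F" for w using that by (auto simp: restrict0_def)
    then show ?thesis using v by blast
  qed
  show "v = 0" if v: "v \<in> gen F" and z: "\<And>w. w \<in> gen F \<Longrightarrow> b v w = 0"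
  proof -
    have zero: "0 \<in> gen F" using sub V.subspace_0 by blast
    have "restrict0 (gen F) (b v) = restrict0 (gen F) (b 0)"
    proof
      fix w
      have "b (scal F 0 0) w = 0 * b 0 w" if "w \<in> gen F"
        using bil zero that unfolding bilinear_on_def by blast
      then show "restrict0 (gen F) (b v) w = restrict0 (gen F) (b 0) w" using z by (simp add: restrict0_def)
    qed
    then have "\<theta> v = \<theta> 0" using \<theta>[OF v] \<theta>[OF zero] by simp
    then have "\<gamma> (\<theta> v) = \<gamma> (\<theta> 0)" by (rule arg_cong)
    then show "v = 0" using inv(1)[OF v] inv(1)[OF zero] by simp
  qed
qed

text \<open>
  The induced map \<open>v \<mapsto> b(v, -) \<otimes> l\<close> is an isomorphism of parabolic bundles, so it preserves and reflects the filtrations, and the \<open>j\<close>-th step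
  of the target consists of the \<open>g \<otimes> l\<close> with \<open>g\<close> in the step \<open>j - k\<close> of the dual.
\<close>

lemma par_form_perp:
  assumes form: "par_form X \<kappa> L F \<beta>" and X: "marked_curve X" and p: "p \<in> points X"
    and L: "parabolic_point.line_fil X p L l k"
    and b: "\<And>v w. v \<in> gen F \<Longrightarrow> w \<in> gen F \<Longrightarrow> \<beta> (tens (scal F) (scal F) v w) = scal L (b v w) l"
    and bil: "bilinear_on (scal F) (gen F) b"
    and j: "j \<le> root_order X p" and v: "v \<in> gen F"
  shows "v \<in> fil F p j \<longleftrightarrow> (\<forall>a. \<forall>w\<in>filZ X F p a. b v w \<in> \<mm> p (ceil_div (a + int j - k) (root_order X p)))"
proof -
  have F: "parabolic_bundle X F" using form by (simp add: par_form_def)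
  interpret parabolic_point X F p by unfold_locales fact+
  have line: "line_generator (scal L) (gen L) l" using L by (simp add: line_fil_def)
  have l: "vector_space (scal L)" "l \<noteq> 0" using line by (auto simp: line_generator_def)
  let ?G = "par_tensor X (par_dual X F) L"
  define \<theta> where "\<theta> = induced_map F L \<beta>"
  have \<theta>: "\<theta> v = tens fscale (scal L) (restrict0 (gen F) (b v)) l"
    and dual: "restrict0 (gen F) (b v) \<in> dual_space (scal F) (gen F)"
    unfolding \<theta>_def using par_form_map[OF form line b bil gen_subspace v] by blast+
  obtain \<gamma> where m: "par_morphism X F ?G \<theta>" "par_morphism X ?G F \<gamma>" "\<gamma> (\<theta> v) = v"
    using form v unfolding par_form_def par_iso_def \<theta>_def by blast
  have "v \<in> fil F p j \<longleftrightarrow> \<theta> v \<in> fil ?G p j"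
  proof
    have "\<theta> ` fil F p j \<subseteq> fil ?G p j" using m(1) p j by (simp add: par_morphism_def)
    then show "v \<in> fil F p j \<Longrightarrow> \<theta> v \<in> fil ?G p j" by blast
    assume "\<theta> v \<in> fil ?G p j"
    moreover have "\<gamma> ` fil ?G p j \<subseteq> fil F p j" using m(2) p j by (simp add: par_morphism_def)
    ultimately have "\<gamma> (\<theta> v) \<in> fil F p j" by blast
    then show "v \<in> fil F p j" using m(3) by simp
  qed
  also have "\<dots> \<longleftrightarrow> restrict0 (gen F) (b v) \<in> dual_fil (int j - k)"
  proof
    assume "\<theta> v \<in> fil ?G p j"
    then obtain g where "tens fscale (scal L) (restrict0 (gen F) (b v)) l = tens fscale (scal L) g l" "g \<in> dual_fil (int j - k)"
      unfolding fil_dual_tensor_line[OF L j] \<theta> by blast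
    then show "restrict0 (gen F) (b v) \<in> dual_fil (int j - k)" using tens_line_inj[OF l] by blast
  qed (auto simp: fil_dual_tensor_line[OF L j] \<theta>)
  also have "\<dots> \<longleftrightarrow> (\<forall>a. \<forall>w\<in>filZ X F p a. b v w \<in> \<mm> p (ceil_div (a + int j - k) r))"
    using dual filZ_gen by (auto simp: dual_fil_def restrict0_def add_diff_eq)
  finally show ?thesis .
qed

text \<open>The form \<open>b\<close> is composed with a projection of the ambient space onto \<open>V\<close>.\<close>

lemma extend_bilinear:
  assumes vs: "vector_space s" and V: "basis_of s V B" and b: "bilinear_on s V b"
  shows "\<exists>b'. bilinear_form s s b' \<and> (\<forall>v\<in>V. \<forall>w\<in>V. b' v w = b v w)"
proof -
  interpret vector_space s by fact
  have B: "finite B" "independent B" "span B = V" using V by (auto simp: basis_of_def)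
  define E where "E = extend_basis B"
  have E: "independent E" "B \<subseteq> E" "span E = UNIV"
    unfolding E_def using independent_extend_basis[OF B(2)] extend_basis_superset[OF B(2)] span_extend_basis[OF B(2)] by auto
  define P where "P v = (\<Sum>c\<in>B. s (representation E v c) c)" for v
  have PV: "P v \<in> V" for v unfolding P_def B(3)[symmetric] by (intro span_sum span_scale span_base)
  have Padd: "P (u + v) = P u + P v" for u v
    using E by (simp add: P_def representation_add scale_left_distrib sum.distrib)
  have Pscale: "P (s c v) = s c (P v)" for c v
    using E by (simp add: P_def representation_scale scale_sum_right)
  have Pid: "P v = v" if v: "v \<in> V" for v
  proof -
    have "representation E v = representation B v"
      using v B(3) by (intro representation_extend[OF E(1) _ E(2)]) simp
    then show ?thesis using sum_representation_eq[OF B(2) _ B(1), of v] v B(3) by (simp add: P_def)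
  qed
  have "bilinear_form s s (\<lambda>v w. b (P v) (P w))"
    unfolding bilinear_form_def Vector_Spaces.linear_iff
    using vector_space_axioms vector_space_field b PV by (auto simp: Padd Pscale bilinear_on_def)
  then show ?thesis using Pid by (intro exI[of _ "\<lambda>v w. b (P v) (P w)"]) simp
qed

text \<open>
  The converse of \<open>par_form_perp\<close> and \<open>par_form_nondegenerate\<close>: by the annihilator condition the bijective map \<open>v \<mapsto> b(v, -) \<otimes> l\<close> and its
  inverse respect the filtrations, and the form maps \<open>E\<^sup>a \<otimes> E\<^sup>c\<close> to the step \<open>a + c\<close> of the line bundle.
\<close>

lemma par_form_intro:
  assumes X: "marked_curve X" and F: "parabolic_bundle X F" and line: "line_generator (scal L) (gen L) l"
    and L: "\<And>p. p \<in> points X \<Longrightarrow> parabolic_point.line_fil X p L l (k p)"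
    and bil: "bilinear_on (scal F) (gen F) b"
    and sign: "\<And>v w. v \<in> gen F \<Longrightarrow> w \<in> gen F \<Longrightarrow> b v w = form_sign \<kappa> (b w v)"
    and perp: "\<And>p j v. p \<in> points X \<Longrightarrow> j \<le> root_order X p \<Longrightarrow> v \<in> gen F \<Longrightarrow>
      v \<in> fil F p j \<longleftrightarrow> (\<forall>a. \<forall>w\<in>filZ X F p a. b v w \<in> \<mm> p (ceil_div (a + int j - k p) (root_order X p)))"
    and surj: "\<And>g. g \<in> dual_space (scal F) (gen F) \<Longrightarrow> \<exists>v\<in>gen F. \<forall>w\<in>gen F. g w = b v w"
    and inj: "\<And>v. v \<in> gen F \<Longrightarrow> (\<And>w. w \<in> gen F \<Longrightarrow> b v w = 0) \<Longrightarrow> v = 0"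
  shows "\<exists>\<beta>. par_form X \<kappa> L F \<beta> \<and>
    (\<forall>v\<in>gen F. induced_map F L \<beta> v = tens fscale (scal L) (restrict0 (gen F) (b v)) l)"
proof -
  interpret V: vector_space "scal F" by (rule parabolic_vector_space[OF F])
  interpret L: vector_space "scal L" using line by (simp add: line_generator_def)
  have l0: "l \<noteq> 0" using line by (simp add: line_generator_def)
  obtain B where B: "basis_of (scal F) (gen F) B" using F unfolding parabolic_bundle_def vector_bundle_def by blast
  then have genF: "V.subspace (gen F)" using V.subspace_span[of B] by (simp add: basis_of_def)
  have closed: "u + v \<in> gen F" "scal F c u \<in> gen F" if "u \<in> gen F" "v \<in> gen F" for u v c
    using genF that V.subspace_add V.subspace_scale by blast+
  \<comment> \<open>tensors are functionals on the bilinear forms on the whole ambient space\<close>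
  obtain b' where b': "bilinear_form (scal F) (scal F) b'" "\<And>v w. v \<in> gen F \<Longrightarrow> w \<in> gen F \<Longrightarrow> b' v w = b v w"
    using extend_bilinear[OF V.vector_space_axioms B bil] by blast
  define \<beta> where "\<beta> t = scal L (t b') l" for t
  have \<beta>_tens: "\<beta> (tens (scal F) (scal F) v w) = scal L (b v w) l" if "v \<in> gen F" "w \<in> gen F" for v w
    using b' that by (simp add: \<beta>_def tens_def)
  have \<beta>_add: "\<beta> (s + t) = \<beta> s + \<beta> t" for s t by (simp add: \<beta>_def L.scale_left_distrib)
  have \<beta>_scale: "\<beta> (fscale c t) = scal L c (\<beta> t)" for c t by (simp add: \<beta>_def fscale_def)
  have \<beta>_0: "\<beta> 0 = 0" by (simp add: \<beta>_def)
  have dual: "restrict0 (gen F) (b v) \<in> dual_space (scal F) (gen F)" if "v \<in> gen F" for v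
    by (rule restrict0_dual[OF bil that]) (use closed in auto)
  define \<theta> where "\<theta> = induced_map F L \<beta>"
  have \<theta>: "\<theta> v = tens fscale (scal L) (restrict0 (gen F) (b v)) l" if v: "v \<in> gen F" for v
    unfolding \<theta>_def by (rule induced_map_line[OF line \<beta>_tens[OF v] dual[OF v]])
  let ?G = "par_tensor X (par_dual X F) L"
  have genG: "gen ?G = {tens fscale (scal L) g l | g. g \<in> dual_space (scal F) (gen F)}"
    using tensor_space_dual_line[OF line] by (simp add: par_tensor_def par_dual_def)
  have scalG: "scal ?G = fscale" by (simp add: par_tensor_def)
  have restr_add: "restrict0 (gen F) (b (u + v)) = restrict0 (gen F) (b u) + restrict0 (gen F) (b v)"
    if "u \<in> gen F" "v \<in> gen F" for u v
    using bil that by (auto simp: restrict0_def bilinear_on_def fun_eq_iff)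
  have restr_scale: "restrict0 (gen F) (b (scal F c v)) = fscale c (restrict0 (gen F) (b v))" if "v \<in> gen F" for c v
    using bil that by (auto simp: restrict0_def bilinear_on_def fun_eq_iff fscale_def)
  have fil_iff: "v \<in> fil F p j \<longleftrightarrow> \<theta> v \<in> fil ?G p j" if p: "p \<in> points X" and j: "j \<le> root_order X p" and v: "v \<in> gen F" for v p j
  proof -
    interpret P: parabolic_point X F p by unfold_locales fact+
    have "\<theta> v \<in> fil ?G p j \<longleftrightarrow> restrict0 (gen F) (b v) \<in> P.dual_fil (int j - k p)"
    proof
      assume "\<theta> v \<in> fil ?G p j"
      then obtain g where "tens fscale (scal L) (restrict0 (gen F) (b v)) l = tens fscale (scal L) g l" "g \<in> P.dual_fil (int j - k p)"
        unfolding P.fil_dual_tensor_line[OF L[OF p] j] \<theta>[OF v] by blast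
      then show "restrict0 (gen F) (b v) \<in> P.dual_fil (int j - k p)" using tens_line_inj[OF L.vector_space_axioms l0] by blast
    qed (auto simp: P.fil_dual_tensor_line[OF L[OF p] j] \<theta>[OF v])
    also have "\<dots> \<longleftrightarrow> (\<forall>a. \<forall>w\<in>filZ X F p a. b v w \<in> \<mm> p (ceil_div (a + int j - k p) (root_order X p)))"
      using dual[OF v] P.filZ_gen by (auto simp: P.dual_fil_def restrict0_def add_diff_eq)
    finally show ?thesis using perp[OF p j v] by blast
  qed
  have fil_gen: "fil F p j \<subseteq> gen F" if p: "p \<in> points X" and j: "j \<le> root_order X p" for p j
  proof -
    interpret P: parabolic_point X F p by unfold_locales fact+
    show ?thesis using P.filZ_fil[OF j] P.filZ_gen by blast
  qed
  have morph: "par_morphism X F ?G \<theta>"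
    unfolding par_morphism_def linear_on_def scalG
  proof (intro conjI ballI allI impI)
    fix u v assume "u \<in> gen F" "v \<in> gen F"
    then show "\<theta> (u + v) = \<theta> u + \<theta> v" by (simp add: \<theta> closed restr_add tens_add_left)
  next
    fix c v assume v: "v \<in> gen F"
    then show "\<theta> (scal F c v) = fscale c (\<theta> v)" by (simp add: \<theta> closed(2)[OF v v] restr_scale tens_scale_left)
  next
    show "\<theta> ` gen F \<subseteq> gen ?G" unfolding genG using \<theta> dual by blast
  next
    fix p j assume "p \<in> points X" "j \<le> root_order X p"
    then show "\<theta> ` fil F p j \<subseteq> fil ?G p j" using fil_iff fil_gen by blast
  qed
  have \<theta>_add: "\<theta> (u + v) = \<theta> u + \<theta> v" if "u \<in> gen F" "v \<in> gen F" for u v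
    using morph that by (simp add: par_morphism_def linear_on_def)
  have \<theta>_scale: "\<theta> (scal F c v) = fscale c (\<theta> v)" if "v \<in> gen F" for c v
    using morph that by (simp add: par_morphism_def linear_on_def scalG)
  have \<theta>_inj: "u = v" if uv: "u \<in> gen F" "v \<in> gen F" "\<theta> u = \<theta> v" for u v
  proof -
    have eq: "restrict0 (gen F) (b u) = restrict0 (gen F) (b v)"
      using tens_line_inj[OF L.vector_space_axioms l0] \<theta>[OF uv(1)] \<theta>[OF uv(2)] uv(3) by metis
    have neg: "scal F (- 1) v \<in> gen F" using closed(2)[OF uv(2) uv(2)] .
    have "b (u + scal F (- 1) v) w = 0" if w: "w \<in> gen F" for w
    proof -
      have "b u w = b v w" using fun_cong[OF eq, of w] w by (simp add: restrict0_def)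
      moreover have "b (u + scal F (- 1) v) w = b u w + b (scal F (- 1) v) w" "b (scal F (- 1) v) w = (- 1) * b v w"
        using bil uv(1,2) neg w unfolding bilinear_on_def by blast+
      ultimately show ?thesis by simp
    qed
    then have "u + scal F (- 1) v = 0" using inj closed(1)[OF uv(1) neg] by blast
    then show "u = v" by (simp add: V.scale_minus_left)
  qed
  have \<theta>_surj: "\<exists>v\<in>gen F. \<theta> v = t" if t: "t \<in> gen ?G" for t
  proof -
    obtain g where g: "t = tens fscale (scal L) g l" "g \<in> dual_space (scal F) (gen F)" using t genG by blast
    obtain v where v: "v \<in> gen F" "\<forall>w\<in>gen F. g w = b v w" using surj[OF g(2)] by blast
    have "restrict0 (gen F) (b v) = g" using v(2) g(2) by (auto simp: restrict0_def dual_space_def fun_eq_iff)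
    then show ?thesis using v(1) g(1) \<theta> by auto
  qed
  then obtain \<gamma> where \<gamma>: "\<And>t. t \<in> gen ?G \<Longrightarrow> \<gamma> t \<in> gen F \<and> \<theta> (\<gamma> t) = t" by metis
  have inv: "\<gamma> (\<theta> v) = v" if "v \<in> gen F" for v
    using \<theta>_inj[of "\<gamma> (\<theta> v)" v] \<gamma>[of "\<theta> v"] that morph by (auto simp: par_morphism_def)
  have \<gamma>_eq: "\<gamma> t = v" if "v \<in> gen F" "\<theta> v = t" for t v using inv that by blast
  have "par_morphism X ?G F \<gamma>"
    unfolding par_morphism_def linear_on_def scalG
  proof (intro conjI ballI allI impI)
    fix s t assume "s \<in> gen ?G" "t \<in> gen ?G"
    then show "\<gamma> (s + t) = \<gamma> s + \<gamma> t" using \<gamma> by (intro \<gamma>_eq closed) (auto simp: \<theta>_add)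
  next
    fix c t assume "t \<in> gen ?G"
    then show "\<gamma> (fscale c t) = scal F c (\<gamma> t)" using \<gamma> by (intro \<gamma>_eq closed) (auto simp: \<theta>_scale)
  next
    show "\<gamma> ` gen ?G \<subseteq> gen F" using \<gamma> by blast
  next
    fix p j assume pj: "p \<in> points X" "j \<le> root_order X p"
    show "\<gamma> ` fil ?G p j \<subseteq> fil F p j"
    proof
      fix v assume "v \<in> \<gamma> ` fil ?G p j"
      then obtain t where t: "t \<in> fil ?G p j" "v = \<gamma> t" by blast
      interpret P: parabolic_point X F p by unfold_locales fact+
      have "t \<in> gen ?G" using t(1) unfolding P.fil_dual_tensor_line[OF L[OF pj(1)] pj(2)] genG by (auto simp: P.dual_fil_def)
      then show "v \<in> fil F p j" using fil_iff[OF pj, of "\<gamma> t"] \<gamma> t by auto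
    qed
  qed
  then have iso: "par_iso X F ?G \<theta>" unfolding par_iso_def using morph inv \<gamma> by blast
  have "par_morphism X (par_tensor X F F) L \<beta>"
    unfolding par_morphism_def linear_on_def
  proof (intro conjI ballI allI impI)
    show "\<beta> (scal (par_tensor X F F) c t) = scal L c (\<beta> t)" for c t by (simp add: par_tensor_def \<beta>_scale)
    show "\<beta> ` gen (par_tensor X F F) \<subseteq> gen L" using line by (auto simp: \<beta>_def line_generator_def)
    fix p j assume p: "p \<in> points X" and j: "j \<le> root_order X p"
    interpret P: parabolic_point X F p by unfold_locales fact+
    have "addspan {tens (scal F) (scal F) v w | v w a c. a + c = int j \<and> v \<in> filZ X F p a \<and> w \<in> filZ X F p c}
        \<subseteq> {t. \<beta> t \<in> fil L p j}"
    proof (rule addspan_least)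
      have fil: "fil L p j = {scal L a l | a. a \<in> \<mm> p (ceil_div (int j - k p) P.r)}"
        using L[OF p] j by (simp add: P.line_fil_def)
      have L_add: "x + y \<in> fil L p j" if "x \<in> fil L p j" "y \<in> fil L p j" for x y
        using that unfolding fil by (auto simp: L.scale_left_distrib[symmetric] intro!: mm_add[OF P.d])
      have L_0: "0 \<in> fil L p j" unfolding fil using zero_mm[OF P.d] by (auto intro!: exI[of _ 0])
      show "0 \<in> {t. \<beta> t \<in> fil L p j}" using L_0 by (simp add: \<beta>_0)
      show "x + y \<in> {t. \<beta> t \<in> fil L p j}" if "x \<in> {t. \<beta> t \<in> fil L p j}" "y \<in> {t. \<beta> t \<in> fil L p j}" for x y
        using that L_add by (simp add: \<beta>_add)
      show "{tens (scal F) (scal F) v w | v w a c. a + c = int j \<and> v \<in> filZ X F p a \<and> w \<in> filZ X F p c} \<subseteq> {t. \<beta> t \<in> fil L p j}"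
      proof
        fix t assume "t \<in> {tens (scal F) (scal F) v w | v w a c. a + c = int j \<and> v \<in> filZ X F p a \<and> w \<in> filZ X F p c}"
        then obtain v w a c where t: "t = tens (scal F) (scal F) v w" "a + c = int j" "v \<in> filZ X F p a" "w \<in> filZ X F p c" by blast
        have v: "v \<in> gen F" and w: "w \<in> gen F" using P.filZ_gen t(3,4) by blast+
        have "\<forall>a'. \<forall>w\<in>filZ X F p a'. b v w \<in> \<mm> p (ceil_div (a' + a - k p) P.r)"
          using P.filZ_perp[of b "k p" v a] perp[OF p] bil v t(3) by (simp add: bilinear_on_def)
        then have "b v w \<in> \<mm> p (ceil_div (int j - k p) P.r)" using t(2,4) by (metis add.commute)
        then show "t \<in> {t. \<beta> t \<in> fil L p j}" unfolding fil using \<beta>_tens[OF v w] t(1) by auto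
      qed
    qed
    then show "\<beta> ` fil (par_tensor X F F) p j \<subseteq> fil L p j" by (auto simp: par_tensor_def)
  qed (simp add: \<beta>_add)
  moreover have "\<beta> (tens (scal F) (scal F) v w) = form_sign \<kappa> (\<beta> (tens (scal F) (scal F) w v))"
    if "v \<in> gen F" "w \<in> gen F" for v w
    unfolding \<beta>_tens[OF that] \<beta>_tens[OF that(2,1)] sign[OF that] by (cases \<kappa>) simp_all
  ultimately have "par_form X \<kappa> L F \<beta>" using F iso unfolding par_form_def \<theta>_def by blast
  then show ?thesis using \<theta> unfolding \<theta>_def by blast
qed

section \<open>The direct image of a parabolic bundle\<close>

locale tower = finite_extension \<phi> cst + V: vector_space s
  for \<phi> :: "'l::field \<Rightarrow> 'k::field" and cst :: "complex \<Rightarrow> 'l" and s :: "'k \<Rightarrow> 'v \<Rightarrow> 'v::ab_group_add" +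
  fixes C :: "'v set" and D :: "'k set"
  assumes C: "finite C" "V.independent C" and D: "finite D" "L.independent D" "L.span D = UNIV"
begin

declare L.scale_scale [simp del]

sublocale W: vector_space "\<lambda>a. s (\<phi> a)"
  by unfold_locales (auto simp: V.scale_right_distrib V.scale_left_distrib ring_map_add[OF hom] ring_map_mult[OF hom] ring_map_1[OF hom])

definition prods :: "'v set" where "prods = {s d c | d c. d \<in> D \<and> c \<in> C}"

lemma prods_inj:
  assumes "d \<in> D" "c \<in> C" "d' \<in> D" "c' \<in> C" "s d c = s d' c'" shows "d = d' \<and> c = c'"
proof -
  have r: "V.representation C (s x b) = (\<lambda>z. if z = b then x else 0)" if "b \<in> C" for x b
    using C(2) that by (auto simp: V.representation_scale V.representation_basis V.span_base)
  have "d \<noteq> 0" using assms(1) D(2) L.dependent_zero by blast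
  have "V.representation C (s d c) c = V.representation C (s d' c') c" using assms(5) by simp
  then show ?thesis using r assms(2,4) \<open>d \<noteq> 0\<close> by (auto split: if_splits)
qed

lemma sum_prods: "(\<Sum>v\<in>prods. f v) = (\<Sum>c\<in>C. \<Sum>d\<in>D. f (s d c))"
proof -
  have "prods = (\<lambda>(c, d). s d c) ` (C \<times> D)" by (auto simp: prods_def)
  moreover have "inj_on (\<lambda>(c, d). s d c) (C \<times> D)" using prods_inj by (auto simp: inj_on_def)
  ultimately have "(\<Sum>v\<in>prods. f v) = (\<Sum>(c, d)\<in>C \<times> D. f (s d c))"
    by (simp add: sum.reindex case_prod_unfold)
  then show ?thesis by (simp add: sum.cartesian_product)
qed

lemma finite_prods: "finite prods"
proof -
  have "prods = (\<lambda>(c, d). s d c) ` (C \<times> D)" by (auto simp: prods_def)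
  then show ?thesis using C(1) D(1) by simp
qed

lemma sum_prods_scale: "(\<Sum>v\<in>prods. s (\<phi> (u v)) v) = (\<Sum>c\<in>C. s (\<Sum>d\<in>D. \<phi> (u (s d c)) * d) c)"
  by (simp add: sum_prods V.scale_sum_left)

lemma independent_prods: "W.independent prods"
proof
  assume "W.dependent prods"
  then obtain u v where u: "v \<in> prods" "u v \<noteq> 0" "(\<Sum>v\<in>prods. s (\<phi> (u v)) v) = 0"
    unfolding W.dependent_finite[OF finite_prods] by blast
  obtain d c where v: "v = s d c" "d \<in> D" "c \<in> C" using u(1) by (auto simp: prods_def)
  define g where "g c = (\<Sum>d\<in>D. \<phi> (u (s d c)) * d)" for c
  have "(\<Sum>c\<in>C. s (g c) c) = 0" using u(3) by (simp add: sum_prods_scale g_def)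
  then have "g c = 0" using V.representation_sum_basis[OF C v(3), of g] by (simp add: V.representation_zero)
  then have "u (s d c) = 0"
    using L.representation_sum_basis[OF D(1,2) v(2), of "\<lambda>d. u (s d c)"] by (simp add: g_def L.representation_zero)
  then show False using u(2) v(1) by simp
qed

lemma span_prods: "W.span prods = V.span C"
proof
  have "W.subspace (V.span C)"
    by (auto simp: W.subspace_def V.span_zero V.span_add V.span_scale)
  moreover have "prods \<subseteq> V.span C" by (auto simp: prods_def intro: V.span_scale V.span_base)
  ultimately show "W.span prods \<subseteq> V.span C" by (intro W.span_minimal)
  show "V.span C \<subseteq> W.span prods"
  proof
    fix v assume v: "v \<in> V.span C"
    have "v = (\<Sum>c\<in>C. s (V.representation C v c) c)" using V.sum_representation_eq[OF C(2) v C(1)] by simp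
    also have "\<dots> = (\<Sum>c\<in>C. s (\<Sum>d\<in>D. \<phi> (L.representation D (V.representation C v c) d) * d) c)"
      using L.sum_representation_eq[OF D(2) _ D(1)] D(3) by simp
    also have "\<dots> = (\<Sum>c\<in>C. \<Sum>d\<in>D. s (\<phi> (L.representation D (V.representation C v c) d)) (s d c))"
      by (simp add: V.scale_sum_left)
    also have "\<dots> \<in> W.span prods"
    proof (intro W.span_sum W.span_scale W.span_base)
      show "s d c \<in> prods" if "c \<in> C" "d \<in> D" for c d using that by (auto simp: prods_def)
    qed
    finally show "v \<in> W.span prods" .
  qed
qed

lemma basis_prods: "basis_of (\<lambda>a. s (\<phi> a)) (V.span C) prods"
  by (simp add: basis_of_def finite_prods independent_prods span_prods)

lemma representation_prods:
  assumes "v \<in> V.span C" "c \<in> C" "d \<in> D"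
  shows "W.representation prods v (s d c) = L.representation D (V.representation C v c) d"
proof -
  define u where "u = W.representation prods v"
  have "v = (\<Sum>w\<in>prods. s (\<phi> (u w)) w)"
    using W.sum_representation_eq[OF independent_prods _ finite_prods, of v] assms(1) by (simp add: span_prods u_def)
  also have "\<dots> = (\<Sum>c\<in>C. s (\<Sum>d\<in>D. \<phi> (u (s d c)) * d) c)" by (rule sum_prods_scale)
  finally have "V.representation C v c = (\<Sum>d\<in>D. \<phi> (u (s d c)) * d)"
    using V.representation_sum_basis[OF C assms(2), of "\<lambda>c. \<Sum>d\<in>D. \<phi> (u (s d c)) * d"] by simp
  then show ?thesis
    using L.representation_sum_basis[OF D(1,2) assms(3), of "\<lambda>d. u (s d c)"] by (simp add: u_def)
qed

lemma submodule_gen_prods: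
  assumes R: "subring_of R"
  shows "v \<in> submodule_gen (\<lambda>a. s (\<phi> a)) R prods \<longleftrightarrow>
    v \<in> V.span C \<and> (\<forall>c\<in>C. V.representation C v c \<in> submodule_gen sc R D)"
proof -
  have "(\<forall>w\<in>prods. W.representation prods v w \<in> R) \<longleftrightarrow>
      (\<forall>c\<in>C. \<forall>d\<in>D. L.representation D (V.representation C v c) d \<in> R)" if "v \<in> V.span C"
  proof -
    have "(\<forall>w\<in>prods. W.representation prods v w \<in> R) \<longleftrightarrow>
        (\<forall>c\<in>C. \<forall>d\<in>D. W.representation prods v (s d c) \<in> R)"
      unfolding prods_def by blast
    then show ?thesis using representation_prods[OF that] by simp
  qed
  then show ?thesis
    unfolding W.submodule_gen_iff[OF R finite_prods independent_prods] L.submodule_gen_iff[OF R D(1,2)]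
    using D(3) by (auto simp: span_prods)
qed

end

locale finite_cover =
  fixes X :: "('k::field, 'z) curve_scheme" and Y :: "('l::field, 'u) curve_scheme" and \<phi> :: "'l \<Rightarrow> 'k"
  assumes X: "marked_curve X" and Y: "marked_curve Y" and f: "finite_map X Y \<phi>"

sublocale finite_cover \<subseteq> finite_extension \<phi> "emb Y"
  using f Y by unfold_locales (auto simp: finite_map_def marked_curve_def function_field_def)

context finite_cover
begin

declare L.scale_scale [simp del]

lemma emb_X: "\<phi> (emb Y c) = emb X c" using f by (simp add: finite_map_def)

lemma local_extension:
  assumes y: "y \<in> points Y" shows "local_extension \<phi> (emb Y) y"
proof unfold_locales
  show "dvr y" "range (emb Y) \<subseteq> y" using y points_dvr by (auto simp: points_def)
  fix p x assume p: "dvr p" "\<phi> -` p = y" "x \<in> p"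
  then have "p \<in> points X" using \<open>range (emb Y) \<subseteq> y\<close> by (auto simp: points_def dvr_def emb_X[symmetric])
  then show "\<exists>a. x - \<phi> (emb Y a) \<in> \<mm> p 1"
    using residue_constant[of X p x] X p(3) by (simp add: marked_curve_def emb_X)
qed

lemma fiber_eq_ext:
  assumes y: "y \<in> points Y" shows "fiber X \<phi> y = local_extension.ext \<phi> y"
proof -
  interpret local_extension \<phi> "emb Y" y by (rule local_extension[OF y])
  show ?thesis using cst_y points_dvr by (auto simp: fiber_def ext_def points_def dvr_def emb_X[symmetric])
qed

end

locale covering = finite_cover X Y \<phi>
  for X :: "('k::field, 'z) curve_scheme" and Y :: "('l::field, 'u) curve_scheme" and \<phi> :: "'l \<Rightarrow> 'k" +
  assumes orders: "\<And>y p. y \<in> points Y \<Longrightarrow> p \<in> fiber X \<phi> y \<Longrightarrow> root_order Y y = root_order X p * ram_index \<phi> p"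

text \<open>The hypothesis on the orders is required at the marked points of \<open>Y\<close> only: all points above an unmarked point are
  unramified and unmarked.\<close>

lemma coveringI:
  assumes X: "marked_curve X" and Y: "marked_curve Y" and f: "finite_map X Y \<phi>"
    and preimage: "(\<Union>y\<in>set (marks Y). fiber X \<phi> y) = ram_locus X \<phi> \<union> set (marks X)"
    and orders: "\<And>y p. y \<in> set (marks Y) \<Longrightarrow> p \<in> fiber X \<phi> y \<Longrightarrow> root_order Y y = root_order X p * ram_index \<phi> p"
  shows "covering X Y \<phi>"
proof -
  interpret finite_cover X Y \<phi> by unfold_locales (fact X Y f)+
  show ?thesis
  proof
    fix y p assume yY: "y \<in> points Y" and p: "p \<in> fiber X \<phi> y"
    interpret local_extension \<phi> "emb Y" y by (rule local_extension[OF yY])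
    show "root_order Y y = root_order X p * ram_index \<phi> p"
    proof (cases "y \<in> set (marks Y)")
      case False
      then have np: "p \<notin> ram_locus X \<phi>" "p \<notin> set (marks X)" using p preimage by (auto simp: fiber_def)
      have "0 < ram_index \<phi> p" using e_pos p fiber_eq_ext[OF yY] by simp
      moreover have "\<not> 1 < ram_index \<phi> p" using np(1) p by (auto simp: ram_locus_def fiber_def)
      ultimately show ?thesis using root_order_unmarked[OF False] root_order_unmarked[OF np(2)] by simp
    qed (use orders p in blast)
  qed
qed

locale covering_bundle = covering X Y \<phi>
  for X :: "('k::field, 'z) curve_scheme" and Y :: "('l::field, 'u) curve_scheme" and \<phi> :: "'l \<Rightarrow> 'k" +
  fixes E :: "('k, 'v::ab_group_add) par_bundle"
  assumes E: "parabolic_bundle X E"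
begin

declare L.scale_scale [simp del]

sublocale V: vector_space "scal E" by (rule parabolic_vector_space[OF E])

sublocale W: vector_space "\<lambda>a. scal E (\<phi> a)"
  by unfold_locales (auto simp: V.scale_right_distrib V.scale_left_distrib ring_map_add[OF hom] ring_map_mult[OF hom] ring_map_1[OF hom])

abbreviation F :: "('l, 'v) par_bundle" where "F \<equiv> par_direct_image X \<phi> E"

lemma F_simps: "scal F = (\<lambda>a. scal E (\<phi> a))" "gen F = gen E"
  by (simp_all add: par_direct_image_def)

lemma gen_E: "V.subspace (gen E)"
proof -
  obtain B where "basis_of (scal E) (gen E) B" using E unfolding parabolic_bundle_def vector_bundle_def by blast
  then show ?thesis using V.subspace_span[of B] by (simp add: basis_of_def)
qed

end

locale covering_point = covering_bundle X Y \<phi> E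
  for X :: "('k::field, 'z) curve_scheme" and Y :: "('l::field, 'u) curve_scheme" and \<phi> :: "'l \<Rightarrow> 'k"
    and E :: "('k, 'v::ab_group_add) par_bundle" +
  fixes y :: "'l set"
  assumes yY: "y \<in> points Y"

sublocale covering_point \<subseteq> P: local_extension \<phi> "emb Y" y
  by (rule local_extension[OF yY])

context covering_point
begin

declare L.scale_scale [simp del]

abbreviation s :: nat where "s \<equiv> root_order Y y"

lemma fiber: "fiber X \<phi> y = P.ext" by (rule fiber_eq_ext[OF yY])

lemma s_eq: "p \<in> P.ext \<Longrightarrow> s = root_order X p * ram_index \<phi> p"
  using orders[OF yY] by (simp add: fiber)

lemma s_pos: "0 < s" by (rule root_order_pos[OF Y])

lemma point: "p \<in> P.ext \<Longrightarrow> parabolic_point X E p"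
  using X E fiber by unfold_locales (auto simp: fiber_def)

definition FZ :: "int \<Rightarrow> 'v set" where "FZ n = (\<Inter>p\<in>P.ext. filZ X E p n)"

lemma fil_F: "fil F y j = FZ (int j)"
proof -
  have "twist (scal E) p (int (j div root_order X p)) (fil E p (j mod root_order X p)) = filZ X E p (int j)" for p
    by (simp add: filZ_def zdiv_int zmod_int nat_mod_as_int)
  then show ?thesis by (simp add: par_direct_image_def FZ_def fiber)
qed

lemma twist_FZ: "twist (scal F) y q (FZ n) = FZ (n + q * int s)"
proof -
  have "v \<in> twist (scal F) y q (FZ n) \<longleftrightarrow> v \<in> FZ (n + q * int s)" for v
  proof -
    let ?c = "\<phi> (unif y powi (- q))"
    have c: "?c \<noteq> 0" using P.unif_y(2) by (simp add: phi_simps)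
    have "v \<in> twist (scal F) y q (FZ n) \<longleftrightarrow> (\<forall>p\<in>P.ext. scal E ?c v \<in> filZ X E p n)"
      by (simp add: F_simps W.mem_twist[OF P.y] FZ_def)
    also have "\<dots> \<longleftrightarrow> (\<forall>p\<in>P.ext. v \<in> filZ X E p (n + q * int s))"
    proof (rule ball_cong[OF refl])
      fix p assume p: "p \<in> P.ext"
      interpret Q: parabolic_point X E p by (rule point[OF p])
      have "unif y powi (- q) \<noteq> 0" using P.unif_y(2) by simp
      then have "val p ?c = - (int (ram_index \<phi> p) * q)"
        using P.val_phi[OF p] by (simp add: val_powi[OF P.y P.unif_y(2)] val_unif[OF P.y])
      then have "scal E ?c v \<in> filZ X E p n \<longleftrightarrow> v \<in> twist (scal E) p (int (ram_index \<phi> p) * q) (filZ X E p n)"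
        using V.mem_twist_val[OF Q.d Q.filZ_submodule c] by simp
      then show "scal E ?c v \<in> filZ X E p n \<longleftrightarrow> v \<in> filZ X E p (n + q * int s)"
        using Q.filZ_shift[of n "int (ram_index \<phi> p) * q"] s_eq[OF p] by (simp add: mult_ac)
    qed
    finally show ?thesis by (simp add: FZ_def)
  qed
  then show ?thesis by blast
qed

lemma filZ_F: "filZ Y F y n = FZ n"
proof -
  define q j where "q = n div int s" and "j = nat (n mod int s)"
  have n: "n = int j + q * int s" using s_pos by (simp add: q_def j_def)
  have "filZ Y F y n = twist (scal F) y q (FZ (int j))"
    by (simp only: filZ_def q_def[symmetric] j_def[symmetric] fil_F)
  then show ?thesis by (simp only: twist_FZ n)
qed

lemma FZ_gen: "v \<in> FZ n \<Longrightarrow> v \<in> gen E"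
proof -
  assume v: "v \<in> FZ n"
  obtain p where p: "p \<in> P.ext" using P.ext_nonempty by blast
  interpret Q: parabolic_point X E p by (rule point[OF p])
  show ?thesis using v p Q.filZ_gen by (auto simp: FZ_def)
qed

lemma FZ_submodule: "submodule_of (scal F) y (FZ n)"
  unfolding submodule_of_def
proof (intro conjI ballI)
  have S: "submodule_of (scal E) p (filZ X E p n)" if p: "p \<in> P.ext" for p
  proof -
    interpret Q: parabolic_point X E p by (rule point[OF p])
    show ?thesis by (rule Q.filZ_submodule)
  qed
  show "0 \<in> FZ n" using S by (auto simp: FZ_def submodule_of_def)
  show "u + v \<in> FZ n" if "u \<in> FZ n" "v \<in> FZ n" for u v using S that by (auto simp: FZ_def submodule_of_def)
  show "scal F a v \<in> FZ n" if "a \<in> y" "v \<in> FZ n" for a v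
    using S that P.phi_mem_ext by (auto simp: FZ_def F_simps submodule_of_def)
qed

lemma FZ_antimono: "a \<le> b \<Longrightarrow> FZ b \<subseteq> FZ a"
proof -
  assume ab: "a \<le> b"
  have "filZ X E p b \<subseteq> filZ X E p a" if p: "p \<in> P.ext" for p
  proof -
    interpret Q: parabolic_point X E p by (rule point[OF p])
    show ?thesis by (rule Q.filZ_antimono[OF ab])
  qed
  then show ?thesis unfolding FZ_def by blast
qed

lemma FZ_full:
  assumes v: "v \<in> gen E" shows "\<exists>a. a \<noteq> 0 \<and> scal F a v \<in> FZ n"
proof -
  have "\<forall>p\<in>P.ext. \<exists>N. \<forall>x\<in>\<mm> p N. scal E x v \<in> filZ X E p n"
  proof
    fix p assume p: "p \<in> P.ext"
    interpret Q: parabolic_point X E p by (rule point[OF p])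
    show "\<exists>N. \<forall>x\<in>\<mm> p N. scal E x v \<in> filZ X E p n" by (rule Q.filZ_full[OF v])
  qed
  from bchoice[OF this] obtain N where N: "\<forall>p\<in>P.ext. \<forall>x\<in>\<mm> p (N p). scal E x v \<in> filZ X E p n" by (elim exE)
  obtain k where "\<forall>p\<in>P.ext. \<phi> (unif y) ^ k \<in> \<mm> p (N p)" using P.ext_power[of N] by (elim exE)
  then have "scal F (unif y ^ k) v \<in> FZ n" using N by (simp add: FZ_def F_simps phi_simps)
  then show ?thesis using P.unif_y(2) by (intro exI[of _ "unif y ^ k"]) simp
qed

lemma fil_coordinates_bounded:
  assumes C: "finite C" "V.independent C" "V.span C = gen E" and p: "p \<in> P.ext"
  shows "\<exists>N. \<forall>v\<in>fil E p 0. \<forall>c\<in>C. V.representation C v c \<in> \<mm> p N"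
proof -
  interpret Q: parabolic_point X E p by (rule point[OF p])
  obtain Cp where Cp: "finite Cp" "V.independent Cp" "V.span Cp = gen E" "fil E p 0 = submodule_gen (scal E) p Cp"
    by (rule Q.stalk_basis)
  obtain N where N: "\<forall>z\<in>(\<lambda>(v, c). V.representation C v c) ` (Cp \<times> C). z \<in> \<mm> p N"
    using common_bound[OF Q.d, of "(\<lambda>(v, c). V.representation C v c) ` (Cp \<times> C)"] Cp(1) C(1) by blast
  let ?M = "{v\<in>gen E. \<forall>c\<in>C. V.representation C v c \<in> \<mm> p N}"
  have "submodule_of (scal E) p ?M"
    unfolding submodule_of_def C(3)[symmetric] using C(2)
    by (auto simp: V.span_zero V.span_add V.span_scale V.representation_zero V.representation_add
        V.representation_scale zero_mm[OF Q.d] intro!: mm_add[OF Q.d] mm_mult_ring[OF Q.d])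
  moreover have "Cp \<subseteq> ?M" using N Cp(3) V.span_superset[of Cp] by auto
  ultimately have "fil E p 0 \<subseteq> ?M" unfolding Cp(4) by (rule submodule_gen_least)
  then show ?thesis by blast
qed

text \<open>
  The coordinates in a basis \<open>C\<close> of the generic stalk have bounded poles on the stalks of \<open>E\<close> at the points above \<open>y\<close>, and so have the coordinates
  of regular functions in a basis \<open>D\<close> of the function field.  Hence the intersection of the stalks is a lattice.
\<close>

lemma stalk_F_free: "\<exists>B. basis_of (scal F) (gen F) B \<and> fil F y 0 = submodule_gen (scal F) y B"
proof -
  obtain C where "basis_of (scal E) (gen E) C" using E unfolding parabolic_bundle_def vector_bundle_def by blast
  then have C: "finite C" "V.independent C" "V.span C = gen E" by (auto simp: basis_of_def)
  obtain D where D: "finite D" "L.independent D" "L.span D = UNIV" using exists_basis by (elim exE conjE)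
  interpret T: tower \<phi> "emb Y" "scal E" C D by unfold_locales (use C D in auto)
  have "\<forall>p\<in>P.ext. \<exists>N. \<forall>v\<in>fil E p 0. \<forall>c\<in>C. V.representation C v c \<in> \<mm> p N"
    using fil_coordinates_bounded[OF C] by (intro ballI)
  from bchoice[OF this] obtain N where N: "\<forall>p\<in>P.ext. \<forall>v\<in>fil E p 0. \<forall>c\<in>C. V.representation C v c \<in> \<mm> p (N p)" by (elim exE)
  obtain k where k: "\<forall>p\<in>P.ext. \<phi> (unif y) ^ k \<in> \<mm> p (- N p)" using P.ext_power[of "\<lambda>p. - N p"] by (elim exE)
  obtain M where M: "\<forall>x\<in>P.regular. \<forall>d\<in>D. L.representation D x d \<in> \<mm> y M" using P.regular_bounded[OF D(2,3)] by (elim exE)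
  have bound: "W.representation T.prods v w \<in> \<mm> y (M - int k)" if v: "v \<in> FZ 0" and w: "w \<in> T.prods" for v w
  proof -
    obtain d c where dc: "w = scal E d c" "d \<in> D" "c \<in> C" using w by (auto simp: T.prods_def)
    define x where "x = V.representation C v c"
    have "\<phi> (unif y) ^ k * x \<in> p" if p: "p \<in> P.ext" for p
    proof -
      interpret Q: parabolic_point X E p by (rule point[OF p])
      have "v \<in> fil E p 0" using v p Q.filZ_fil[of 0] by (auto simp: FZ_def)
      then have "x \<in> \<mm> p (N p)" using N p dc(3) by (simp add: x_def)
      then have "\<phi> (unif y) ^ k * x \<in> \<mm> p (- N p + N p)" using k p mm_mult[OF Q.d] by blast
      then show ?thesis by (simp add: mm_0[OF Q.d])
    qed
    then have "\<phi> (unif y ^ k) * x \<in> P.regular" by (simp add: P.regular_def phi_simps)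
    then have "L.representation D (\<phi> (unif y ^ k) * x) d \<in> \<mm> y M" using M dc(2) by blast
    then have "unif y ^ k * L.representation D x d \<in> \<mm> y M" using D by (simp add: L.representation_scale)
    then have "L.representation D x d \<in> \<mm> y (M - int k)"
      using P.unif_y(2) by (simp add: mm_scale_iff[OF P.y] val_power[OF P.y] val_unif[OF P.y])
    then show ?thesis using T.representation_prods[of v c d] FZ_gen[OF v] C(3) dc by (simp add: x_def)
  qed
  have "\<exists>B. basis_of (\<lambda>a. scal E (\<phi> a)) (W.span T.prods) B \<and> FZ 0 = submodule_gen (\<lambda>a. scal E (\<phi> a)) y B"
  proof (rule W.lattice_free[OF P.y T.finite_prods T.independent_prods])
    show "submodule_of (\<lambda>a. scal E (\<phi> a)) y (FZ 0)" using FZ_submodule by (simp add: F_simps)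
    show "FZ 0 \<subseteq> W.span T.prods" using FZ_gen C(3) T.span_prods by auto
    show "\<exists>a. a \<noteq> 0 \<and> scal E (\<phi> a) v \<in> FZ 0" if "v \<in> W.span T.prods" for v
      using FZ_full[of v 0] that C(3) T.span_prods by (simp add: F_simps)
    show "W.representation T.prods v w \<in> \<mm> y (M - int k)" if "v \<in> FZ 0" "w \<in> T.prods" for v w
      by (rule bound[OF that])
  qed
  then show ?thesis using C(3) T.span_prods fil_F[of 0] by (simp add: F_simps)
qed

text \<open>
  The coordinates of a regular element are the traces of its products with the regular elements of the dual basis.
\<close>

lemma regular_eq_gen:
  assumes D: "finite D" "L.independent D" "L.span D = UNIV" "\<And>z. z = (\<Sum>b\<in>D. \<phi> (field_trace \<phi> (D' b * z)) * b)"
    and reg: "D \<subseteq> P.regular" "D' ` D \<subseteq> P.regular"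
  shows "P.regular = submodule_gen sc y D"
proof
  have mult: "a * b \<in> P.regular" if "a \<in> P.regular" "b \<in> P.regular" for a b
    using that subring_mult[OF dvr_subring[OF P.ext_dvr]] by (simp add: P.regular_def)
  have add: "a + b \<in> P.regular" if "a \<in> P.regular" "b \<in> P.regular" for a b
    using that subring_add[OF dvr_subring[OF P.ext_dvr]] by (simp add: P.regular_def)
  have base: "\<phi> a \<in> P.regular" if "a \<in> y" for a using that P.phi_mem_ext by (simp add: P.regular_def)
  have zero: "0 \<in> P.regular" using subring_0[OF dvr_subring[OF P.ext_dvr]] by (simp add: P.regular_def)
  show "submodule_gen sc y D \<subseteq> P.regular"
    by (rule submodule_gen_least[OF _ reg(1)]) (auto simp: submodule_of_def intro: mult add base zero)
  show "P.regular \<subseteq> submodule_gen sc y D"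
  proof
    fix x assume x: "x \<in> P.regular"
    have "L.representation D x d \<in> y" if d: "d \<in> D" for d
    proof -
      have "L.representation D x d = L.representation D (\<Sum>b\<in>D. \<phi> (field_trace \<phi> (D' b * x)) * b) d"
        by (rule arg_cong[OF D(4)])
      also have "\<dots> = field_trace \<phi> (D' d * x)" by (rule L.representation_sum_basis[OF D(1,2) d])
      finally show ?thesis using P.trace_regular[of "D' d * x"] mult x reg(2) d by auto
    qed
    then show "x \<in> submodule_gen sc y D"
      unfolding L.submodule_gen_iff[OF P.Ry D(1,2)] using D(3) by simp
  qed
qed

end

context covering_bundle
begin

lemma point_intro: "y \<in> points Y \<Longrightarrow> covering_point X Y \<phi> E y"
  by unfold_locales

text \<open>
  At almost all points of \<open>Y\<close> the basis \<open>C\<close> generates the stalks of \<open>E\<close> above the point, and the bases \<open>D\<close> and \<open>D'\<close> of the function field are regular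
  there, so that the products of \<open>C\<close> and \<open>D\<close> generate the stalk of the direct image.
\<close>

lemma F_generic_basis:
  "\<exists>B. basis_of (scal F) (gen F) B \<and> finite {y\<in>points Y. fil F y 0 \<noteq> submodule_gen (scal F) y B}"
proof -
  obtain C where "basis_of (scal E) (gen E) C"
    and finC: "finite {p\<in>points X. fil E p 0 \<noteq> submodule_gen (scal E) p C}"
    using E unfolding parabolic_bundle_def vector_bundle_def by blast
  then have C: "finite C" "V.independent C" "V.span C = gen E" by (auto simp: basis_of_def)
  obtain D where D: "finite D" "L.independent D" "L.span D = UNIV" using exists_basis by (elim exE conjE)
  obtain D' where D': "\<forall>z. z = (\<Sum>b\<in>D. \<phi> (field_trace \<phi> (D' b * z)) * b)" using dual_basis[OF D(2,3)] by (elim exE)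
  interpret T: tower \<phi> "emb Y" "scal E" C D by unfold_locales (use C D in auto)
  define bad where "bad = {p\<in>points X. fil E p 0 \<noteq> submodule_gen (scal E) p C} \<union> (\<Union>z\<in>D \<union> D' ` D. {p\<in>points X. z \<notin> p})"
  have "finite {p\<in>points X. z \<notin> p}" for z
    by (rule finite_poles) (use X in \<open>simp add: marked_curve_def\<close>)
  then have "finite bad" unfolding bad_def using finC D(1) by blast
  have good: "fil F y 0 = submodule_gen (scal F) y T.prods" if y: "y \<in> points Y" and nb: "y \<notin> (\<lambda>p. \<phi> -` p) ` bad" for y
  proof -
    interpret Q: covering_point X Y \<phi> E y by (rule point_intro[OF y])
    have p: "p \<in> points X \<and> p \<notin> bad" if "p \<in> Q.P.ext" for p
      using nb that Q.fiber by (auto simp: fiber_def)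
    have reg: "D \<subseteq> Q.P.regular" "D' ` D \<subseteq> Q.P.regular" using p by (auto simp: Q.P.regular_def bad_def)
    note R = Q.regular_eq_gen[OF D D'[rule_format] reg]
    have "v \<in> fil F y 0 \<longleftrightarrow> v \<in> submodule_gen (scal F) y T.prods" for v
    proof -
      have "v \<in> filZ X E p 0 \<longleftrightarrow> v \<in> gen E \<and> (\<forall>c\<in>C. V.representation C v c \<in> p)" if "p \<in> Q.P.ext" for p
      proof -
        interpret PP: parabolic_point X E p by (rule Q.point[OF that])
        have "filZ X E p 0 = submodule_gen (scal E) p C" using PP.filZ_fil[of 0] p[OF that] by (simp add: bad_def)
        then show ?thesis using V.submodule_gen_iff[OF dvr_subring[OF PP.d] C(1,2)] C(3) by simp
      qed
      then have "v \<in> fil F y 0 \<longleftrightarrow> v \<in> gen E \<and> (\<forall>c\<in>C. V.representation C v c \<in> Q.P.regular)"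
        unfolding Q.fil_F Q.FZ_def Q.P.regular_def using Q.P.ext_nonempty by auto
      then show ?thesis unfolding F_simps T.submodule_gen_prods[OF Q.P.Ry] C(3) R .
    qed
    then show ?thesis by blast
  qed
  then have "{y\<in>points Y. fil F y 0 \<noteq> submodule_gen (scal F) y T.prods} \<subseteq> (\<lambda>p. \<phi> -` p) ` bad" by blast
  then have "finite {y\<in>points Y. fil F y 0 \<noteq> submodule_gen (scal F) y T.prods}"
    using \<open>finite bad\<close> finite_subset by blast
  moreover have "basis_of (scal F) (gen F) T.prods" using T.basis_prods C(3) by (simp add: F_simps)
  ultimately show ?thesis by blast
qed

lemma parabolic_direct_image: "parabolic_bundle Y F"
proof -
  have "\<exists>C. basis_of (scal F) (gen F) C \<and> fil F y 0 = submodule_gen (scal F) y C" if "y \<in> points Y" for y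
  proof -
    interpret Q: covering_point X Y \<phi> E y by (rule point_intro[OF that])
    show ?thesis by (rule Q.stalk_F_free)
  qed
  moreover have "(\<forall>j\<le>root_order Y y. submodule_of (scal F) y (fil F y j)) \<and>
      (\<forall>j<root_order Y y. fil F y (Suc j) \<subseteq> fil F y j) \<and>
      fil F y (root_order Y y) = twist (scal F) y 1 (fil F y 0)" if "y \<in> points Y" for y
  proof -
    interpret Q: covering_point X Y \<phi> E y by (rule point_intro[OF that])
    show ?thesis using Q.FZ_submodule Q.FZ_antimono[of "int j" "int (Suc j)" for j] Q.twist_FZ[of 1 0] by (simp add: Q.fil_F)
  qed
  moreover have "vector_space (scal F)" using W.vector_space_axioms by (simp add: F_simps)
  ultimately show ?thesis unfolding parabolic_bundle_def vector_bundle_def using F_generic_basis by blast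
qed

end

section \<open>Parabolic line bundles\<close>

lemma submodule_gen_line:
  assumes t: "vector_space t" and p: "dvr p" and u: "u \<noteq> 0"
  shows "submodule_gen t p {t u l} = {t a l | a. a \<in> \<mm> p (val p u)}"
proof
  interpret vector_space t by fact
  have "submodule_of t p {t a l | a. a \<in> \<mm> p (val p u)}"
    unfolding submodule_of_def
  proof (intro conjI ballI)
    show "0 \<in> {t a l | a. a \<in> \<mm> p (val p u)}" using zero_mm[OF p] by (auto intro!: exI[of _ 0])
    fix x y assume "x \<in> {t a l | a. a \<in> \<mm> p (val p u)}" "y \<in> {t a l | a. a \<in> \<mm> p (val p u)}"
    then show "x + y \<in> {t a l | a. a \<in> \<mm> p (val p u)}"
      using mm_add[OF p] by (auto simp: scale_left_distrib[symmetric])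
  next
    fix c x assume "c \<in> p" "x \<in> {t a l | a. a \<in> \<mm> p (val p u)}"
    then show "t c x \<in> {t a l | a. a \<in> \<mm> p (val p u)}" using mm_mult_ring[OF p] by auto
  qed
  moreover have "t u l \<in> {t a l | a. a \<in> \<mm> p (val p u)}" by (auto simp: mm_iff[OF p])
  ultimately show "submodule_gen t p {t u l} \<subseteq> {t a l | a. a \<in> \<mm> p (val p u)}"
    by (intro submodule_gen_least) auto
  show "{t a l | a. a \<in> \<mm> p (val p u)} \<subseteq> submodule_gen t p {t u l}"
  proof
    fix x assume "x \<in> {t a l | a. a \<in> \<mm> p (val p u)}"
    then obtain a where a: "x = t a l" "a \<in> \<mm> p (val p u)" by blast
    have "inverse u * a \<in> \<mm> p 0" using a(2) u by (simp add: mm_scale_iff[OF p] val_inverse[OF p])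
    then have "inverse u * a \<in> p" by (simp only: mm_0[OF p])
    then have "t (inverse u * a) (t u l) \<in> submodule_gen t p {t u l}"
      using submodule_gen_submodule[OF dvr_subring[OF p], of "{t u l}"] submodule_gen_base[OF dvr_subring[OF p], of "t u l"]
      unfolding submodule_of_def by blast
    moreover have "inverse u * a * u = a" using u by (simp add: field_simps)
    ultimately show "x \<in> submodule_gen t p {t u l}" using a(1) by simp
  qed
qed

lemma twist_line:
  assumes t: "vector_space t" and p: "dvr p"
  shows "twist t p q {t a l | a. a \<in> \<mm> p n} = {t a l | a. a \<in> \<mm> p (n + q)}"
proof -
  interpret vector_space t by fact
  have w: "unif p powi q \<noteq> 0" "val p (unif p powi q) = q"
    using unif_nonzero[OF p] by (simp_all add: val_powi[OF p] val_unif[OF p])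
  show ?thesis
  proof (intro set_eqI iffI)
    fix x assume "x \<in> twist t p q {t a l | a. a \<in> \<mm> p n}"
    then obtain a where "a \<in> \<mm> p n" "x = t (unif p powi q * a) l" by (auto simp: twist_def)
    then show "x \<in> {t a l | a. a \<in> \<mm> p (n + q)}" using w by (auto simp: mm_scale_iff[OF p])
  next
    fix x assume "x \<in> {t a l | a. a \<in> \<mm> p (n + q)}"
    then obtain a where a: "a \<in> \<mm> p (n + q)" "x = t a l" by blast
    define b where "b = inverse (unif p powi q) * a"
    have "b \<in> \<mm> p n" using a(1) w by (simp add: b_def mm_scale_iff[OF p] val_inverse[OF p])
    moreover have "x = t (unif p powi q) (t b l)" using a(2) w(1) by (simp add: b_def mult.assoc[symmetric])
    ultimately show "x \<in> twist t p q {t a l | a. a \<in> \<mm> p n}" unfolding twist_def by blast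
  qed
qed

lemma par_line_bundle_generator:
  assumes "par_line_bundle Y L" shows "\<exists>l. line_generator (scal L) (gen L) l"
proof -
  have L: "parabolic_bundle Y L" using assms by (simp add: par_line_bundle_def)
  interpret vector_space "scal L" by (rule parabolic_vector_space[OF L])
  obtain B where "basis_of (scal L) (gen L) B" using L unfolding parabolic_bundle_def vector_bundle_def by blast
  then have B: "finite B" "independent B" "span B = gen L" by (auto simp: basis_of_def)
  have "card B = 1" using dim_span_eq_card_independent[OF B(2)] assms B(3) by (simp add: par_line_bundle_def)
  then obtain l where l: "B = {l}" by (rule card_1_singletonE)
  then have "l \<noteq> 0" using B(2) dependent_zero by blast
  moreover have "gen L = range (\<lambda>a. scal L a l)" using B(3) l by (simp add: span_singleton)
  ultimately show ?thesis using vector_space_axioms by (auto simp: line_generator_def)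
qed

text \<open>
  The stalk at \<open>y\<close> is generated by a multiple of \<open>l\<close> of order \<open>n\<close>, and the place of the only jump of the filtration can be recovered from it because
  \<open>\<varpi>\<^sub>y\<close> acts injectively, but not surjectively on the stalk.
\<close>

lemma par_line_bundle_local:
  assumes Y: "marked_curve Y" and L: "par_line_bundle Y L" and l: "line_generator (scal L) (gen L) l" and y: "y \<in> points Y"
  shows "\<exists>k n. k < root_order Y y \<and> weight Y L y = real k / real (root_order Y y) \<and>
    (\<forall>j\<le>root_order Y y. fil L y j = {scal L a l | a. a \<in> \<mm> y (n + (if j \<le> k then 0 else 1))})"
proof -
  have Lb: "parabolic_bundle Y L" using L by (simp add: par_line_bundle_def)
  interpret Q: parabolic_point Y L y by unfold_locales (use Y Lb y in auto)
  note d = Q.d and vs = Q.V.vector_space_axioms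
  obtain k where k: "k < Q.r" "\<And>j. j \<le> k \<Longrightarrow> fil L y j = fil L y 0"
    "\<And>j. k < j \<Longrightarrow> j \<le> Q.r \<Longrightarrow> fil L y j = twist (scal L) y 1 (fil L y 0)"
    using L y unfolding par_line_bundle_def by blast
  obtain C where C: "finite C" "Q.V.independent C" "Q.V.span C = gen L" "fil L y 0 = submodule_gen (scal L) y C"
    by (rule Q.stalk_basis)
  have "card C = 1" using Q.V.dim_span_eq_card_independent[OF C(2)] L C(3) by (simp add: par_line_bundle_def)
  then obtain c where c: "C = {c}" by (rule card_1_singletonE)
  have "c \<in> gen L" using C(3) Q.V.span_base[of c C] c by simp
  then obtain u where u: "c = scal L u l" using l by (auto simp: line_generator_def)
  have "c \<noteq> 0" using C(2) c Q.V.dependent_zero by blast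
  then have u0: "u \<noteq> 0" using u by auto
  define n where "n = val y u"
  have f0: "fil L y 0 = {scal L a l | a. a \<in> \<mm> y n}"
    unfolding C(4) c u n_def by (rule submodule_gen_line[OF vs d u0])
  have f1: "twist (scal L) y 1 (fil L y 0) = {scal L a l | a. a \<in> \<mm> y (n + 1)}"
    unfolding f0 by (rule twist_line[OF vs d])
  have ne: "twist (scal L) y 1 (fil L y 0) \<noteq> fil L y 0"
  proof
    assume "twist (scal L) y 1 (fil L y 0) = fil L y 0"
    moreover have "scal L u l \<in> fil L y 0" unfolding f0 by (auto simp: mm_iff[OF d] n_def)
    ultimately obtain a where a: "scal L u l = scal L a l" "a \<in> \<mm> y (n + 1)" unfolding f1 by blast
    have "l \<noteq> 0" using l by (simp add: line_generator_def)
    then have "u = a" using a(1) Q.V.scale_right_imp_eq by blast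
    then show False using a(2) u0 by (simp add: mm_iff[OF d] n_def)
  qed
  have "(GREATEST j. j < Q.r \<and> fil L y j = fil L y 0) = k"
  proof (rule Greatest_equality)
    show "k < Q.r \<and> fil L y k = fil L y 0" using k(1) k(2)[of k] by simp
    fix j assume j: "j < Q.r \<and> fil L y j = fil L y 0"
    show "j \<le> k"
    proof (rule ccontr)
      assume "\<not> j \<le> k"
      then have "fil L y j = twist (scal L) y 1 (fil L y 0)" using k(3)[of j] j by simp
      then show False using ne j by simp
    qed
  qed
  then have "weight Y L y = real k / real Q.r" by (simp add: weight_def)
  moreover have "fil L y j = {scal L a l | a. a \<in> \<mm> y (n + (if j \<le> k then 0 else 1))}" if "j \<le> Q.r" for j
    using k(2)[of j] k(3)[of j] that f0 f1 by auto
  ultimately show ?thesis using k(1) by (intro exI[of _ k] exI[of _ n]) auto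
qed

lemma ceil_div_step:
  assumes "k < s" "j \<le> s" shows "ceil_div (int j - int k) s = (if j \<le> k then 0 else 1)"
proof (rule antisym)
  have s: "0 < s" using assms(1) by simp
  show "ceil_div (int j - int k) s \<le> (if j \<le> k then 0 else 1)" using assms by (auto simp: ceil_div_le_iff[OF s])
  show "(if j \<le> k then 0 else 1) \<le> ceil_div (int j - int k) s"
    using ceil_div_le_iff[OF s, of "int j - int k" "(if j \<le> k then 0 else 1) - 1"] assms by (auto split: if_splits)
qed

context covering
begin

lemma base_change_line:
  assumes l: "line_generator t W l"
  shows "line_generator fscale (base_change \<phi> t W) (bctens \<phi> t 1 l)"
    and "bctens \<phi> t c (t a w) = fscale (c * \<phi> a) (bctens \<phi> t 1 w)"
proof -
  interpret t: vector_space t using l by (simp add: line_generator_def)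
  interpret B: vector_space "fscale :: 'k \<Rightarrow> (('c \<Rightarrow> 'k) \<Rightarrow> 'k) \<Rightarrow> _" by (rule vector_space_fscale)
  show bc: "bctens \<phi> t c (t a w) = fscale (c * \<phi> a) (bctens \<phi> t 1 w)" for c a w
    by (rule ext) (auto simp: bctens_def fscale_def Vector_Spaces.linear_iff mult.assoc)
  have l0: "l \<noteq> 0" and W: "W = range (\<lambda>a. t a l)" using l by (auto simp: line_generator_def)
  obtain m where m: "Vector_Spaces.linear t (*) m" "m l = 1" using line_functional[OF t.vector_space_axioms l0] by blast
  have "Vector_Spaces.linear t sc (\<lambda>w. \<phi> (m w))"
    using m(1) L.vector_space_axioms unfolding Vector_Spaces.linear_iff by (simp add: ring_map_add[OF hom] ring_map_mult[OF hom])
  then have "bctens \<phi> t 1 l (\<lambda>w. \<phi> (m w)) = 1" using m(2) by (simp add: bctens_def ring_map_1[OF hom])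
  then have nz: "bctens \<phi> t 1 l \<noteq> 0" by auto
  have "base_change \<phi> t W = range (\<lambda>a. fscale a (bctens \<phi> t 1 l))"
  proof
    have "{bctens \<phi> t 1 w | w. w \<in> W} \<subseteq> B.span {bctens \<phi> t 1 l}"
      using bc[of 1] by (auto simp: W B.span_singleton)
    then show "base_change \<phi> t W \<subseteq> range (\<lambda>a. fscale a (bctens \<phi> t 1 l))"
      unfolding base_change_def B.span_singleton[symmetric] by (intro B.span_minimal B.subspace_span)
    have "l \<in> W" unfolding W by (rule image_eqI[of _ _ 1]) auto
    then show "range (\<lambda>a. fscale a (bctens \<phi> t 1 l)) \<subseteq> base_change \<phi> t W"
      unfolding base_change_def
      by (intro image_subsetI B.span_scale B.span_base) blast
  qed
  then show "line_generator fscale (base_change \<phi> t W) (bctens \<phi> t 1 l)"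
    using nz B.vector_space_axioms by (simp add: line_generator_def)
qed

end

context covering_point
begin

text \<open>
  The weight \<open>k/s\<close> is multiplied by \<open>e = s/r\<close> and becomes \<open>k/r\<close>.  Its integral part modifies the stalk and its fractional part is the
  weight of the pullback, and only their sum enters in \<open>line_fil\<close>.
\<close>

lemma line_fil_pullback:
  fixes L :: "('l, 'w::ab_group_add) par_bundle"
  assumes L: "par_line_bundle Y L" and l: "line_generator (scal L) (gen L) l"
  shows "\<exists>k. parabolic_point.line_fil Y y L l k \<and>
    (\<forall>p\<in>P.ext. parabolic_point.line_fil X p (par_pullback X Y \<phi> L) (bctens \<phi> (scal L) 1 l) k)"
proof -
  obtain k n where k: "k < s" "weight Y L y = real k / real s"
    and fil: "\<And>j. j \<le> s \<Longrightarrow> fil L y j = {scal L a l | a. a \<in> \<mm> y (n + (if j \<le> k then 0 else 1))}"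
    using par_line_bundle_local[OF Y L l yY] by blast
  define k' where "k' = int k - n * int s"
  have Lb: "parabolic_bundle Y L" using L by (simp add: par_line_bundle_def)
  interpret QY: parabolic_point Y L y by unfold_locales (use Y Lb yY in auto)
  have "fil L y j = {scal L a l | a. a \<in> \<mm> y (ceil_div (int j - k') s)}" if j: "j \<le> s" for j
  proof -
    have "int j - k' = (int j - int k) + n * int s" by (simp add: k'_def)
    then have "ceil_div (int j - k') s = ceil_div (int j - int k) s + n"
      by (simp only: ceil_div_add_multiple[OF s_pos])
    then have "ceil_div (int j - k') s = n + (if j \<le> k then 0 else 1)"
      using ceil_div_step[OF k(1) j] by simp
    then show ?thesis using fil[OF j] by simp
  qed
  then have "QY.line_fil L l k'" using l by (simp add: QY.line_fil_def)
  moreover have "parabolic_point.line_fil X p (par_pullback X Y \<phi> L) (bctens \<phi> (scal L) 1 l) k'" if p: "p \<in> P.ext" for p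
  proof -
    interpret Q: parabolic_point X E p by (rule point[OF p])
    define e where "e = ram_index \<phi> p"
    define l' where "l' = bctens \<phi> (scal L) 1 l"
    have py: "\<phi> -` p = y" using p by (simp add: P.ext_def)
    have s: "s = Q.r * e" using s_eq[OF p] by (simp add: e_def)
    have e: "0 < e" using P.e_pos[OF p] by (simp add: e_def)
    note bc = base_change_line[OF l]
    define \<alpha>e where "\<alpha>e = weight Y L y * real e"
    have \<alpha>e: "\<alpha>e = real k / real Q.r" using e by (simp add: \<alpha>e_def k(2) s)
    have fl: "\<lfloor>\<alpha>e\<rfloor> = int (k div Q.r)" unfolding \<alpha>e by (simp add: floor_divide_of_nat_eq)
    have fr: "real Q.r * frac \<alpha>e = real (k mod Q.r)"
    proof -
      have "real k = real (k div Q.r) * real Q.r + real (k mod Q.r)"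
        by (metis div_mult_mod_eq of_nat_add of_nat_mult)
      moreover have "real Q.r * frac \<alpha>e = real k - real Q.r * real (k div Q.r)"
        using Q.r_pos fl by (simp add: frac_def \<alpha>e right_diff_distrib)
      ultimately show ?thesis by (simp add: mult.commute)
    qed
    define pb where "pb = submodule_gen fscale p (bctens \<phi> (scal L) 1 ` fil L y 0)"
    have pb: "pb = {fscale a l' | a. a \<in> \<mm> p (int e * n)}"
    proof
      interpret B: vector_space "fscale :: 'k \<Rightarrow> (('w \<Rightarrow> 'k) \<Rightarrow> 'k) \<Rightarrow> _" by (rule vector_space_fscale)
      define u where "u = \<phi> (unif y powi n)"
      have "unif y powi n \<noteq> 0" using P.unif_y(2) by simp
      then have u: "u \<noteq> 0" "val p u = int e * n"
        using P.val_phi[OF p, of "unif y powi n"] ring_map_eq_0[OF hom]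
        by (simp_all add: u_def e_def val_powi[OF P.y P.unif_y(2)] val_unif[OF P.y])
      have G: "submodule_gen fscale p {fscale u l'} = {fscale a l' | a. a \<in> \<mm> p (int e * n)}"
        using submodule_gen_line[OF B.vector_space_axioms Q.d u(1), of l'] u(2) by simp
      have f0: "fil L y 0 = {scal L a l | a. a \<in> \<mm> y n}" using fil[of 0] by simp
      have "bctens \<phi> (scal L) 1 w \<in> submodule_gen fscale p {fscale u l'}" if w: "w \<in> fil L y 0" for w
      proof -
        obtain a where a: "w = scal L a l" "a \<in> \<mm> y n" using w f0 by blast
        then have "\<phi> a \<in> \<mm> p (int e * n)" using P.phi_mm[OF p] by (simp add: e_def)
        then show ?thesis using a(1) bc(2)[of 1 a l] unfolding G by (auto simp: l'_def)
      qed
      then show "pb \<subseteq> {fscale a l' | a. a \<in> \<mm> p (int e * n)}"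
        unfolding pb_def G[symmetric]
        by (intro submodule_gen_least B.submodule_gen_submodule dvr_subring[OF Q.d]) auto
      have "unif y powi n \<in> \<mm> y n" using P.unif_y(2) by (simp add: mm_iff[OF P.y] val_powi[OF P.y] val_unif[OF P.y])
      then have "fscale u l' \<in> bctens \<phi> (scal L) 1 ` fil L y 0"
        using f0 bc(2)[of 1 "unif y powi n" l] by (auto simp: u_def l'_def image_iff)
      then show "{fscale a l' | a. a \<in> \<mm> p (int e * n)} \<subseteq> pb"
        unfolding pb_def G[symmetric]
        by (intro submodule_gen_least B.submodule_gen_submodule dvr_subring[OF Q.d]) (auto intro: B.submodule_gen_base[OF dvr_subring[OF Q.d]])
    qed
    have "fil (par_pullback X Y \<phi> L) p j = {fscale a l' | a. a \<in> \<mm> p (ceil_div (int j - k') Q.r)}" if j: "j \<le> Q.r" for j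
    proof -
      have St: "twist fscale p (- \<lfloor>\<alpha>e\<rfloor>) pb = {fscale a l' | a. a \<in> \<mm> p (int e * n - int (k div Q.r))}"
        unfolding pb using twist_line[OF vector_space_fscale Q.d, of "- \<lfloor>\<alpha>e\<rfloor>" l' "int e * n"] fl by simp
      have St1: "twist fscale p 1 (twist fscale p (- \<lfloor>\<alpha>e\<rfloor>) pb) = {fscale a l' | a. a \<in> \<mm> p (int e * n - int (k div Q.r) + 1)}"
        unfolding St by (rule twist_line[OF vector_space_fscale Q.d])
      have "fil (par_pullback X Y \<phi> L) p j = (if real j \<le> real Q.r * frac \<alpha>e then twist fscale p (- \<lfloor>\<alpha>e\<rfloor>) pb
          else twist fscale p 1 (twist fscale p (- \<lfloor>\<alpha>e\<rfloor>) pb))"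
        by (simp add: par_pullback_def Let_def py pb_def \<alpha>e_def e_def)
      also have "\<dots> = {fscale a l' | a. a \<in> \<mm> p (int e * n - int (k div Q.r) + (if j \<le> k mod Q.r then 0 else 1))}"
        unfolding fr St1 unfolding St by simp
      also have "int e * n - int (k div Q.r) + (if j \<le> k mod Q.r then 0 else 1) = ceil_div (int j - k') Q.r"
      proof -
        have "int k = int (k mod Q.r) + int (k div Q.r) * int Q.r"
          by (metis div_mult_mod_eq add.commute of_nat_add of_nat_mult)
        then have "int j - k' = (int j - int (k mod Q.r)) + (int e * n - int (k div Q.r)) * int Q.r"
          by (simp add: k'_def s algebra_simps)
        then have "ceil_div (int j - k') Q.r = ceil_div (int j - int (k mod Q.r)) Q.r + (int e * n - int (k div Q.r))"
          by (simp only: ceil_div_add_multiple[OF Q.r_pos])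
        then show ?thesis using ceil_div_step[of "k mod Q.r" Q.r j] j Q.r_pos by simp
      qed
      finally show ?thesis .
    qed
    then show ?thesis using bc(1) unfolding Q.line_fil_def by (simp add: par_pullback_def l'_def)
  qed
  ultimately show ?thesis by blast
qed

section \<open>Duality for the direct image\<close>

text \<open>
  If the filtrations at the points above \<open>y\<close> are their own annihilators with respect to \<open>b\<close>, then so is the filtration of the
  direct image with respect to the trace of \<open>b\<close>.  One implication is the bound on the inverse different.  For the other
  one, a vector \<open>w\<close> at one point \<open>p\<close> is multiplied by \<open>x / b(v, w)\<close>, with \<open>x\<close> a unit at \<open>p\<close>, small at the other points and
  of trace a unit; then \<open>b\<close> takes the value \<open>x\<close>, and the hypothesis on its trace bounds the order of \<open>b(v, w)\<close>.
\<close>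

lemma FZ_perp:
  assumes bil: "bilinear_on (scal E) (gen E) b"
    and perp: "\<And>p j v. p \<in> P.ext \<Longrightarrow> j \<le> root_order X p \<Longrightarrow> v \<in> gen E \<Longrightarrow>
      v \<in> fil E p j \<longleftrightarrow> (\<forall>a. \<forall>w\<in>filZ X E p a. b v w \<in> \<mm> p (ceil_div (a + int j - k) (root_order X p)))"
    and v: "v \<in> gen E"
  shows "v \<in> FZ n \<longleftrightarrow> (\<forall>a. \<forall>w\<in>FZ a. field_trace \<phi> (b v w) \<in> \<mm> y (ceil_div (a + n - k) s))"
proof -
  have perpZ: "v \<in> filZ X E p n \<longleftrightarrow> (\<forall>a. \<forall>w\<in>filZ X E p a. b v w \<in> \<mm> p (ceil_div (a + n - k) (root_order X p)))"
    if p: "p \<in> P.ext" for p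
  proof -
    interpret Q: parabolic_point X E p by (rule point[OF p])
    show ?thesis by (rule Q.filZ_perp[OF _ perp[OF p] v]) (use bil in \<open>auto simp: bilinear_on_def\<close>)
  qed
  show ?thesis
  proof
    assume vF: "v \<in> FZ n"
    show "\<forall>a. \<forall>w\<in>FZ a. field_trace \<phi> (b v w) \<in> \<mm> y (ceil_div (a + n - k) s)"
    proof (intro allI ballI)
      fix a w assume w: "w \<in> FZ a"
      define N m where "N = a + n - k" and "m = ceil_div N s"
      have "\<phi> (unif y powi (- m)) * b v w \<in> \<mm> p (1 - int (ram_index \<phi> p))" if p: "p \<in> P.ext" for p
      proof -
        interpret Q: parabolic_point X E p by (rule point[OF p])
        have b: "b v w \<in> \<mm> p (ceil_div N Q.r)" using perpZ[OF p] vF w p by (auto simp: FZ_def N_def)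
        have "unif y powi (- m) \<noteq> 0" using P.unif_y(2) by simp
        then have c: "\<phi> (unif y powi (- m)) \<noteq> 0" "val p (\<phi> (unif y powi (- m))) = - (int (ram_index \<phi> p) * m)"
          using P.val_phi[OF p] ring_map_eq_0[OF hom]
          by (simp_all add: val_powi[OF P.y P.unif_y(2)] val_unif[OF P.y])
        have "(m - 1) * int s < N" using ceil_div_le_iff[OF s_pos, of N "m - 1"] by (simp add: m_def not_le)
        then have "((m - 1) * int (ram_index \<phi> p)) * int Q.r < N" using s_eq[OF p] by (simp add: mult_ac)
        then have "(m - 1) * int (ram_index \<phi> p) < ceil_div N Q.r"
          using ceil_div_le_iff[OF Q.r_pos, of N "(m - 1) * int (ram_index \<phi> p)"] by (simp add: not_le)
        then have "1 - int (ram_index \<phi> p) + int (ram_index \<phi> p) * m \<le> ceil_div N Q.r" by (simp add: algebra_simps)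
        then show ?thesis using mm_antimono[OF Q.d b] by (simp add: mm_scale_iff[OF Q.d c(1)] c(2))
      qed
      then have "field_trace \<phi> (\<phi> (unif y powi (- m)) * b v w) \<in> y" by (rule P.trace_inverse_different)
      then have "unif y powi (- m) * field_trace \<phi> (b v w) \<in> \<mm> y 0" by (simp add: trace_scale mm_0[OF P.y])
      then show "field_trace \<phi> (b v w) \<in> \<mm> y (ceil_div (a + n - k) s)"
        using P.unif_y(2) by (simp add: mm_scale_iff[OF P.y] val_powi[OF P.y] val_unif[OF P.y] m_def N_def)
    qed
  next
    assume tr: "\<forall>a. \<forall>w\<in>FZ a. field_trace \<phi> (b v w) \<in> \<mm> y (ceil_div (a + n - k) s)"
    have "v \<in> filZ X E p n" if p: "p \<in> P.ext" for p
      unfolding perpZ[OF p]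
    proof (intro allI ballI)
      interpret Q: parabolic_point X E p by (rule point[OF p])
      fix a w assume w: "w \<in> filZ X E p a"
      have wg: "w \<in> gen E" by (rule Q.filZ_gen[OF w])
      show "b v w \<in> \<mm> p (ceil_div (a + n - k) Q.r)"
      proof (cases "b v w = 0")
        case True then show ?thesis by (simp add: zero_mm[OF Q.d])
      next
        case False
        define c where "c = b v w"
        have c: "c \<noteq> 0" using False by (simp add: c_def)
        \<comment> \<open>the index of the step that contains \<open>c\<^sup>-\<^sup>1 w\<close> at \<open>p\<close>\<close>
        define a' where "a' = a + (- val p c) * int Q.r"
        have "\<forall>q\<in>P.ext. \<exists>N. \<forall>x\<in>\<mm> q N. scal E x w \<in> filZ X E q a'"
        proof
          fix q assume q: "q \<in> P.ext"
          interpret Q': parabolic_point X E q by (rule point[OF q])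
          show "\<exists>N. \<forall>x\<in>\<mm> q N. scal E x w \<in> filZ X E q a'" by (rule Q'.filZ_full[OF wg])
        qed
        from bchoice[OF this] obtain N where N: "\<forall>q\<in>P.ext. \<forall>x\<in>\<mm> q (N q). scal E x w \<in> filZ X E q a'" by (elim exE)
        define M where "M = Max (insert 0 ((\<lambda>q. N q + val q c) ` P.ext))"
        have M: "N q + val q c \<le> M" if "q \<in> P.ext" for q using that P.finite_ext by (auto simp: M_def intro!: Max_ge)
        obtain x where x: "x \<noteq> 0" "val p x = 0" "\<forall>q\<in>P.ext - {p}. x \<in> \<mm> q M" "unit_of y (field_trace \<phi> x)"
          using P.trace_unit[OF p, of M] by blast
        define w' where "w' = scal E (inverse c * x) w"
        have "w' \<in> filZ X E q a'" if q: "q \<in> P.ext" for q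
        proof (cases "q = p")
          case True
          have "inverse c * x \<noteq> 0" "val p (inverse c * x) = - val p c"
            using c x(1,2) by (auto simp: val_mult[OF Q.d] val_inverse[OF Q.d])
          then have "w' \<in> twist (scal E) p (- val p c) (filZ X E p a)"
            unfolding V.mem_twist[OF Q.d] w'_def
            using V.mem_twist_val[OF Q.d Q.filZ_submodule, of "unif p powi val p c * (inverse c * x)" w a] w unif_nonzero[OF Q.d]
            by (simp add: val_mult[OF Q.d] val_powi[OF Q.d] val_unif[OF Q.d] V.twist_0)
          then show ?thesis using True Q.filZ_shift[of a "- val p c"] by (simp add: a'_def)
        next
          case False
          then have "x \<in> \<mm> q (N q + val q c)" using mm_antimono[OF P.ext_dvr[OF q] _ M[OF q]] x(3) q by blast
          then have "inverse c * x \<in> \<mm> q (N q)"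
            using c by (simp add: mm_scale_iff[OF P.ext_dvr[OF q]] val_inverse[OF P.ext_dvr[OF q]])
          then show ?thesis using N q by (simp add: w'_def)
        qed
        then have "w' \<in> FZ a'" by (simp add: FZ_def)
        then have "field_trace \<phi> (b v w') \<in> \<mm> y (ceil_div (a' + n - k) s)" using tr by blast
        moreover have "b v w' = x" using bil v wg c by (simp add: w'_def bilinear_on_def c_def mult.commute mult.assoc)
        ultimately have "ceil_div (a' + n - k) s \<le> 0" using x(4) by (auto simp: unit_of_iff_val[OF P.y] mm_iff[OF P.y])
        then have "a' + n - k \<le> 0" by (simp add: ceil_div_le_iff[OF s_pos])
        then have "a + n - k \<le> val p c * int Q.r" by (simp add: a'_def)
        then have "ceil_div (a + n - k) Q.r \<le> val p c" by (simp add: ceil_div_le_iff[OF Q.r_pos])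
        then show ?thesis by (simp add: mm_iff[OF Q.d] c_def)
      qed
    qed
    then show "v \<in> FZ n" by (simp add: FZ_def)
  qed
qed

end

section \<open>The direct image of a form\<close>

lemma (in finite_extension) trace_nondegenerate:
  assumes "\<And>c. field_trace \<phi> (c * x) = 0" shows "x = 0"
proof (rule ccontr)
  assume "x \<noteq> 0"
  then show False using assms[of "inverse x"] trace_1 by simp
qed

context covering
begin

text \<open>
  All tensors have the form \<open>g \<otimes> (1 \<otimes> l)\<close> for a unique \<open>g\<close>, so a map with the required properties exists, and its value is prescribed.
\<close>

lemma projection_formula_line:
  fixes E :: "('k, 'v::ab_group_add, 'x) generic_bundle_scheme" and L :: "('l, 'w::ab_group_add, 'y) generic_bundle_scheme"
  assumes l: "line_generator (scal L) (gen L) l" and g: "g \<in> dual_space (scal E) (gen E)"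
  shows "projection_formula \<phi> E L (tens fscale fscale g (bctens \<phi> (scal L) 1 l)) = tens (\<lambda>a. fscale (\<phi> a)) (scal L) g l"
proof -
  let ?T = "tensor_space fscale (dual_space (scal E) (gen E)) fscale (base_change \<phi> (scal L) (gen L))"
  define l' where "l' = bctens \<phi> (scal L) 1 l"
  note bc = base_change_line[OF l]
  have l': "line_generator fscale (base_change \<phi> (scal L) (gen L)) l'" using bc(1) by (simp add: l'_def)
  then have l'0: "vector_space (fscale :: 'k \<Rightarrow> (('w \<Rightarrow> 'k) \<Rightarrow> 'k) \<Rightarrow> _)" "l' \<noteq> 0"
    using vector_space_fscale by (auto simp: line_generator_def)
  have T: "?T = {tens fscale fscale g l' | g. g \<in> dual_space (scal E) (gen E)}"
    by (rule tensor_space_dual_line[OF l'])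
  have Tex: "\<exists>g. u = tens fscale fscale g l'" if "u \<in> ?T" for u
  proof -
    have "u \<in> {tens fscale fscale g l' | g. g \<in> dual_space (scal E) (gen E)}" using that by (simp only: T)
    then show ?thesis by (elim CollectE exE conjE) (rule exI)
  qed
  let ?t = "tens (\<lambda>a. fscale (\<phi> a)) (scal L)"
  define h where "h t = ?t (THE g. t = tens fscale fscale g l') l" for t :: "(('v \<Rightarrow> 'k) \<Rightarrow> (('w \<Rightarrow> 'k) \<Rightarrow> 'k) \<Rightarrow> 'k) \<Rightarrow> 'k"
  have h: "h (tens fscale fscale g l') = ?t g l" for g
  proof -
    have "(THE g'. tens fscale fscale g l' = tens fscale fscale g' l') = g"
    proof (rule the_equality)
      show "tens fscale fscale g l' = tens fscale fscale g l'" by (rule refl)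
      fix g' assume "tens fscale fscale g l' = tens fscale fscale g' l'"
      from tens_line_inj[OF l'0 this] show "g' = g" by (rule sym)
    qed
    then show ?thesis by (simp only: h_def)
  qed
  define spec where "spec h \<longleftrightarrow> linear_on (\<lambda>a. fscale (\<phi> a)) ?T fscale h \<and>
     (\<forall>g\<in>dual_space (scal E) (gen E). \<forall>c. \<forall>w\<in>gen L.
        h (tens fscale fscale g (bctens \<phi> (scal L) c w)) = ?t (fscale c g) w)" for h
  have "spec h" unfolding spec_def
  proof (intro conjI ballI allI)
    show "linear_on (\<lambda>a. fscale (\<phi> a)) ?T fscale h"
      unfolding linear_on_def
    proof (intro conjI ballI allI)
      fix u v assume u: "u \<in> ?T" and v: "v \<in> ?T"
      obtain g where g: "u = tens fscale fscale g l'" using Tex[OF u] by (elim exE)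
      obtain g' where g': "v = tens fscale fscale g' l'" using Tex[OF v] by (elim exE)
      note uv = g g'
      have "u + v = tens fscale fscale (g + g') l'" by (simp only: uv tens_add_left)
      then have "h (u + v) = ?t (g + g') l" by (simp only: h)
      then show "h (u + v) = h u + h v" by (simp only: tens_add_left h uv(1)) (simp only: h uv(2))
    next
      fix a v assume v: "v \<in> ?T"
      obtain g where v: "v = tens fscale fscale g l'" using Tex[OF v] by (elim exE)
      have "fscale (\<phi> a) v = tens fscale fscale (fscale (\<phi> a) g) l'" by (simp only: v tens_scale_left)
      then have "h (fscale (\<phi> a) v) = ?t (fscale (\<phi> a) g) l" by (simp only: h)
      also have "\<dots> = fscale a (?t g l)" by (rule tens_scale_left)
      finally show "h (fscale (\<phi> a) v) = fscale a (h v)" by (simp only: v h)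
    qed
    fix g c w assume "g \<in> dual_space (scal E) (gen E)" "w \<in> gen L"
    then obtain a where w: "w = scal L a l" using l by (auto simp: line_generator_def)
    have "tens fscale fscale g (bctens \<phi> (scal L) c w) = tens fscale fscale (fscale (c * \<phi> a) g) l'"
      unfolding w bc(2) l'_def[symmetric] tens_scale_right by (rule tens_scale_left[symmetric])
    then have "h (tens fscale fscale g (bctens \<phi> (scal L) c w)) = ?t (fscale (c * \<phi> a) g) l" by (simp only: h)
    also have "fscale (c * \<phi> a) g = fscale (\<phi> a) (fscale c g)" by (simp add: fscale_def mult_ac)
    also have "?t (fscale (\<phi> a) (fscale c g)) l = fscale a (?t (fscale c g) l)" by (rule tens_scale_left)
    also have "\<dots> = ?t (fscale c g) w" unfolding w by (rule tens_scale_right[symmetric])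
    finally show "h (tens fscale fscale g (bctens \<phi> (scal L) c w)) = ?t (fscale c g) w" .
  qed
  then have "spec (projection_formula \<phi> E L)"
    unfolding projection_formula_def spec_def[symmetric] by (rule someI[where P = spec])
  moreover have "l \<in> gen L"
  proof -
    interpret L': vector_space "scal L" using l by (simp add: line_generator_def)
    show ?thesis using l by (auto simp: line_generator_def intro!: image_eqI[of _ _ 1])
  qed
  ultimately have "projection_formula \<phi> E L (tens fscale fscale g l') = ?t (fscale 1 g) l"
    using g unfolding spec_def l'_def by blast
  then show ?thesis by (simp add: l'_def fscale_def)
qed

lemma trace_dual_tensor_line:
  fixes g :: "'v \<Rightarrow> 'k" and L :: "('l, 'w::ab_group_add, 'y) generic_bundle_scheme"
  shows "trace_dual_tensor \<phi> L (tens (\<lambda>a. fscale (\<phi> a)) (scal L) g l) = tens fscale (scal L) (trace_dual \<phi> g) l"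
proof
  fix b :: "('v \<Rightarrow> 'l) \<Rightarrow> 'w \<Rightarrow> 'l"
  have vs: "vector_space (\<lambda>a. fscale (\<phi> a) :: ('v \<Rightarrow> 'k) \<Rightarrow> _)"
    by unfold_locales (auto simp: fscale_def fun_eq_iff algebra_simps ring_map_add[OF hom] ring_map_mult[OF hom] ring_map_1[OF hom])
  have add: "trace_dual \<phi> (g + h) = trace_dual \<phi> g + trace_dual \<phi> h" for g h :: "'v \<Rightarrow> 'k"
    by (rule ext) (simp add: trace_dual_def trace_add)
  have scl: "trace_dual \<phi> (fscale (\<phi> a) g) = fscale a (trace_dual \<phi> g)" for a and g :: "'v \<Rightarrow> 'k"
    by (rule ext) (simp add: trace_dual_def fscale_def trace_scale)
  have "bilinear_form (\<lambda>a. fscale (\<phi> a)) (scal L) (\<lambda>g w. b (trace_dual \<phi> g) w)" if b: "bilinear_form fscale (scal L) b"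
    unfolding bilinear_form_def
  proof (intro conjI allI)
    show "Vector_Spaces.linear (\<lambda>a. fscale (\<phi> a)) (*) (\<lambda>g. b (trace_dual \<phi> g) w)" for w
      unfolding Vector_Spaces.linear_iff using vs vector_space_field bilinear_formD[OF b] by (simp add: add scl)
    show "Vector_Spaces.linear (scal L) (*) (b (trace_dual \<phi> g))" for g
      using b by (simp add: bilinear_form_def)
  qed
  then show "trace_dual_tensor \<phi> L (tens (\<lambda>a. fscale (\<phi> a)) (scal L) g l) b = tens fscale (scal L) (trace_dual \<phi> g) l b"
    by (simp add: trace_dual_tensor_def tens_def)
qed

end

lemma direct_image_form_cong:
  assumes "scal E = scal E'" "gen E = gen E'" "scal L = scal L'" "gen L = gen L'" "\<theta> v = \<theta>' v"
  shows "direct_image_form \<phi> E L \<theta> v = direct_image_form \<phi> E' L' \<theta>' v"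
  using assms by (simp add: direct_image_form_def trace_dual_tensor_def projection_formula_def)

lemma parabolic_bundle_cong:
  assumes "scal G = scal F" "gen G = gen F" "\<And>p j. p \<in> points X \<Longrightarrow> j \<le> root_order X p \<Longrightarrow> fil G p j = fil F p j"
    and "parabolic_bundle X F"
  shows "parabolic_bundle X G"
proof -
  have 0: "fil G p 0 = fil F p 0" if "p \<in> points X" for p using assms(3)[OF that, of 0] by simp
  have "vector_bundle X (scal G) (gen G) (\<lambda>p. fil G p 0)"
    using assms(4) 0 unfolding parabolic_bundle_def vector_bundle_def assms(1,2) by (simp cong: conj_cong)
  moreover have "\<forall>p\<in>points X. (\<forall>j\<le>root_order X p. submodule_of (scal G) p (fil G p j)) \<and>
        (\<forall>j<root_order X p. fil G p (Suc j) \<subseteq> fil G p j) \<and>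
        fil G p (root_order X p) = twist (scal G) p 1 (fil G p 0)"
    using assms(4) 0 unfolding parabolic_bundle_def assms(1) by (simp add: assms(3))
  ultimately show ?thesis by (simp add: parabolic_bundle_def)
qed

context covering_bundle
begin

text \<open>
  The form on the direct image has coefficient function \<open>Tr b(v, w)\<close>, where \<open>b\<close> is the coefficient function of the given form.  The
  bundle \<open>G\<close> is left free because the direct image from the root stack agrees with the parabolic one only at points of \<open>Y\<close> and steps up to
  the root order.
\<close>

lemma par_form_direct_image:
  assumes L: "par_line_bundle Y L" and form: "par_form X \<kappa> (par_pullback X Y \<phi> L) E \<psi>"
    and \<theta>: "\<And>v. v \<in> gen E \<Longrightarrow> \<theta> v = direct_image_form \<phi> E L (induced_map E (par_pullback X Y \<phi> L) \<psi>) v"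
    and G: "scal G = scal F" "gen G = gen F"
      "\<And>y j. y \<in> points Y \<Longrightarrow> j \<le> root_order Y y \<Longrightarrow> fil G y j = fil F y j"
  shows "par_form_bundle Y \<kappa> L G \<theta>"
proof -
  obtain l where l: "line_generator (scal L) (gen L) l" using par_line_bundle_generator[OF L] by blast
  define l' where "l' = bctens \<phi> (scal L) 1 l"
  let ?L' = "par_pullback X Y \<phi> L"
  have l': "line_generator (scal ?L') (gen ?L') l'" using base_change_line(1)[OF l] by (simp add: par_pullback_def l'_def)
  have vs': "vector_space (scal ?L')" using l' by (simp add: line_generator_def)
  obtain b where b: "\<And>v w. v \<in> gen E \<Longrightarrow> w \<in> gen E \<Longrightarrow> \<psi> (tens (scal E) (scal E) v w) = scal ?L' (b v w) l'"
    and bil: "bilinear_on (scal E) (gen E) b"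
    and sign: "\<And>v w. v \<in> gen E \<Longrightarrow> w \<in> gen E \<Longrightarrow> b v w = form_sign \<kappa> (b w v)"
    using par_form_coefficients[OF form V.vector_space_axioms vs' gen_E l'] by blast
  have surj: "\<exists>v\<in>gen E. \<forall>w\<in>gen E. g w = b v w" if "g \<in> dual_space (scal E) (gen E)" for g
    by (rule par_form_nondegenerate(1)[OF form l' b bil gen_E that])
  have inj: "v = 0" if "v \<in> gen E" "\<And>w. w \<in> gen E \<Longrightarrow> b v w = 0" for v
    by (rule par_form_nondegenerate(2)[OF form l' b bil gen_E that])
  have "\<forall>y\<in>points Y. \<exists>k. parabolic_point.line_fil Y y L l k \<and>
    (\<forall>p\<in>fiber X \<phi> y. parabolic_point.line_fil X p ?L' l' k)"
  proof
    fix y assume y: "y \<in> points Y"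
    interpret Q: covering_point X Y \<phi> E y by (rule point_intro[OF y])
    show "\<exists>k. parabolic_point.line_fil Y y L l k \<and> (\<forall>p\<in>fiber X \<phi> y. parabolic_point.line_fil X p ?L' l' k)"
      using Q.line_fil_pullback[OF L l] by (simp add: l'_def Q.fiber)
  qed
  from bchoice[OF this] obtain k where k: "\<And>y. y \<in> points Y \<Longrightarrow> parabolic_point.line_fil Y y L l (k y)"
    "\<And>y p. y \<in> points Y \<Longrightarrow> p \<in> fiber X \<phi> y \<Longrightarrow> parabolic_point.line_fil X p ?L' l' (k y)" by blast
  define B where "B v w = field_trace \<phi> (b v w)" for v w
  have bilB: "bilinear_on (scal F) (gen F) B"
    using bil by (auto simp: bilinear_on_def F_simps B_def trace_add trace_scale)
  have signB: "B v w = form_sign \<kappa> (B w v)" if "v \<in> gen F" "w \<in> gen F" for v w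
  proof (cases \<kappa>)
    case Symplectic
    have "b v w = - b w v" using sign[of v w] that Symplectic by (simp add: F_simps)
    then show ?thesis using Symplectic by (simp add: B_def trace_minus)
  next
    case Orthogonal
    have "b v w = b w v" using sign[of v w] that Orthogonal by (simp add: F_simps)
    then show ?thesis using Orthogonal by (simp add: B_def)
  qed
  have injB: "v = 0" if v: "v \<in> gen F" "\<And>w. w \<in> gen F \<Longrightarrow> B v w = 0" for v
  proof (rule inj)
    show "v \<in> gen E" using v(1) by (simp add: F_simps)
    fix w assume w: "w \<in> gen E"
    have "field_trace \<phi> (c * b v w) = 0" for c
      using v(2)[of "scal E c w"] bil v(1) w V.subspace_scale[OF gen_E w]
      by (simp add: B_def F_simps bilinear_on_def)
    then show "b v w = 0" by (rule trace_nondegenerate)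
  qed
  have surjB: "\<exists>v\<in>gen F. \<forall>w\<in>gen F. g w = B v w" if g: "g \<in> dual_space (scal F) (gen F)" for g
  proof -
    have g_add: "g (u + w) = g u + g w" and g_scale: "g (scal E (\<phi> a) u) = a * g u" if "u \<in> gen E" "w \<in> gen E" for u w a
      using g that by (auto simp: dual_space_def linear_on_def F_simps)
    have "\<exists>x. \<forall>c. g (scal E c w) = field_trace \<phi> (x * c)" if w: "w \<in> gen E" for w
    proof (rule functional_eq_trace)
      note sw = V.subspace_scale[OF gen_E w]
      show "g (scal E (u + v) w) = g (scal E u w) + g (scal E v w)" for u v
        using g_add[OF sw sw] by (simp add: V.scale_left_distrib)
      show "g (scal E (\<phi> a * u) w) = a * g (scal E u w)" for a u
        using g_scale[OF sw sw, of a u] by simp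
    qed
    then obtain h where h: "\<And>w c. w \<in> gen E \<Longrightarrow> g (scal E c w) = field_trace \<phi> (h w * c)" by metis
    have h_eq: "h w = x" if w: "w \<in> gen E" and x: "\<And>c. g (scal E c w) = field_trace \<phi> (x * c)" for w x
    proof -
      have "field_trace \<phi> (c * (h w + - x)) = 0" for c
        using h[OF w, of c] x[of c] trace_add[of "h w * c" "- (x * c)"] by (simp add: trace_minus algebra_simps)
      then have "h w + - x = 0" by (rule trace_nondegenerate)
      then show ?thesis by simp
    qed
    have "restrict0 (gen E) h \<in> dual_space (scal E) (gen E)"
    proof -
      have "h (u + w) = h u + h w" if uw: "u \<in> gen E" "w \<in> gen E" for u w
      proof (rule h_eq)
        show "u + w \<in> gen E" using V.subspace_add[OF gen_E uw] .
        show "g (scal E c (u + w)) = field_trace \<phi> ((h u + h w) * c)" for c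
          using g_add[OF V.subspace_scale[OF gen_E uw(1)] V.subspace_scale[OF gen_E uw(2)], of c c] h[OF uw(1)] h[OF uw(2)]
          by (simp add: V.scale_right_distrib distrib_right trace_add)
      qed
      moreover have "h (scal E a u) = a * h u" if u: "u \<in> gen E" for a u
      proof (rule h_eq)
        show "scal E a u \<in> gen E" using V.subspace_scale[OF gen_E u] .
        show "g (scal E c (scal E a u)) = field_trace \<phi> (a * h u * c)" for c
          using h[OF u, of "c * a"] by (simp add: mult_ac)
      qed
      ultimately show ?thesis
        using V.subspace_add[OF gen_E] V.subspace_scale[OF gen_E]
        by (auto simp: dual_space_def linear_on_def restrict0_def)
    qed
    then obtain v where v: "v \<in> gen E" "\<forall>w\<in>gen E. restrict0 (gen E) h w = b v w" using surj by blast
    have "g w = B v w" if w: "w \<in> gen E" for w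
      using h[OF w, of 1] v(2) w by (simp add: B_def restrict0_def)
    then show ?thesis using v(1) by (auto simp: F_simps)
  qed
  have perpB: "v \<in> fil F y j \<longleftrightarrow> (\<forall>a. \<forall>w\<in>filZ Y F y a. B v w \<in> \<mm> y (ceil_div (a + int j - k y) (root_order Y y)))"
    if y: "y \<in> points Y" and v: "v \<in> gen F" for y j v
  proof -
    interpret Q: covering_point X Y \<phi> E y by (rule point_intro[OF y])
    have "v \<in> Q.FZ (int j) \<longleftrightarrow> (\<forall>a. \<forall>w\<in>Q.FZ a. field_trace \<phi> (b v w) \<in> \<mm> y (ceil_div (a + int j - k y) Q.s))"
    proof (rule Q.FZ_perp[OF bil])
      fix p j v assume p: "p \<in> Q.P.ext" and j: "j \<le> root_order X p" and v: "v \<in> gen E"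
      have pX: "p \<in> points X" "p \<in> fiber X \<phi> y" using p Q.fiber by (auto simp: fiber_def)
      show "v \<in> fil E p j \<longleftrightarrow> (\<forall>a. \<forall>w\<in>filZ X E p a. b v w \<in> \<mm> p (ceil_div (a + int j - k y) (root_order X p)))"
        by (rule par_form_perp[OF form X pX(1) k(2)[OF y pX(2)] b bil j v])
    qed (use v in \<open>simp add: F_simps\<close>)
    then show ?thesis by (simp only: Q.fil_F Q.filZ_F B_def)
  qed
  have filZ_G: "filZ Y G y a = filZ Y F y a" if y: "y \<in> points Y" for y a
  proof -
    have "nat (a mod int (root_order Y y)) \<le> root_order Y y"
      using root_order_pos[OF Y, of y] pos_mod_bound[of "int (root_order Y y)" a] by linarith
    then show ?thesis using G(3)[OF y] by (simp add: filZ_def G(1))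
  qed
  have "\<exists>\<beta>. par_form Y \<kappa> L G \<beta> \<and>
    (\<forall>v\<in>gen G. induced_map G L \<beta> v = tens fscale (scal L) (restrict0 (gen G) (B v)) l)"
  proof (rule par_form_intro[OF Y parabolic_bundle_cong[OF G parabolic_direct_image] l k(1)])
    show "bilinear_on (scal G) (gen G) B" using bilB by (simp only: G)
    show "B v w = form_sign \<kappa> (B w v)" if "v \<in> gen G" "w \<in> gen G" for v w
      by (rule signB) (use that in \<open>simp_all only: G(2)\<close>)
    show "v \<in> fil G y j \<longleftrightarrow> (\<forall>a. \<forall>w\<in>filZ Y G y a. B v w \<in> \<mm> y (ceil_div (a + int j - k y) (root_order Y y)))"
      if "y \<in> points Y" "j \<le> root_order Y y" "v \<in> gen G" for y j v
      using perpB[OF that(1), of v j] that by (simp only: G filZ_G)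
    show "\<exists>v\<in>gen G. \<forall>w\<in>gen G. g w = B v w" if "g \<in> dual_space (scal G) (gen G)" for g
      using surjB[of g] that unfolding G(1,2) by blast
    show "v = 0" if "v \<in> gen G" "\<And>w. w \<in> gen G \<Longrightarrow> B v w = 0" for v
      by (rule injB) (use that in \<open>simp_all only: G(2)\<close>)
  qed
  then obtain \<beta> where \<beta>: "par_form Y \<kappa> L G \<beta>"
    "\<And>v. v \<in> gen G \<Longrightarrow> induced_map G L \<beta> v = tens fscale (scal L) (restrict0 (gen G) (B v)) l" by blast
  have "\<theta> v = induced_map G L \<beta> v" if v: "v \<in> gen G" for v
  proof -
    have vE: "v \<in> gen E" using v by (simp add: G F_simps)
    have "induced_map E ?L' \<psi> v = tens fscale (scal ?L') (restrict0 (gen E) (b v)) l'"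
      and dual: "restrict0 (gen E) (b v) \<in> dual_space (scal E) (gen E)"
      using par_form_map[OF form l' b bil gen_E vE] by blast+
    then have "induced_map E ?L' \<psi> v = tens fscale fscale (restrict0 (gen E) (b v)) (bctens \<phi> (scal L) 1 l)"
      by (simp add: par_pullback_def l'_def)
    then have "direct_image_form \<phi> E L (induced_map E ?L' \<psi>) v = tens fscale (scal L) (trace_dual \<phi> (restrict0 (gen E) (b v))) l"
      by (simp add: direct_image_form_def projection_formula_line[OF l dual] trace_dual_tensor_line)
    also have "trace_dual \<phi> (restrict0 (gen E) (b v)) = restrict0 (gen G) (B v)"
      by (rule ext) (simp add: trace_dual_def restrict0_def B_def G F_simps trace_0)
    finally show ?thesis using \<theta>[OF vE] \<beta>(2)[OF v] by simp
  qed
  then show ?thesis unfolding par_form_bundle_def using \<beta>(1) by blast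
qed

end

section \<open>Modules over the atlas of a root stack\<close>

lemma periodic_sum:
  fixes f :: "int \<Rightarrow> 'a::ab_group_add"
  assumes "\<And>i. f (i + int r) = f i"
  shows "(\<Sum>i<r. f (int i + n)) = (\<Sum>i<r. f (int i))"
proof -
  have step: "(\<Sum>i<r. f (int i + (n + 1))) = (\<Sum>i<r. f (int i + n))" for n
  proof -
    have "(\<Sum>i<Suc r. f (int i + n)) = f n + (\<Sum>i<r. f (int i + (n + 1)))"
      by (subst sum.lessThan_Suc_shift) (simp add: algebra_simps)
    moreover have "(\<Sum>i<Suc r. f (int i + n)) = (\<Sum>i<r. f (int i + n)) + f n"
      using assms[of n] by (simp add: add.commute)
    ultimately show ?thesis by (simp add: add.commute)
  qed
  show ?thesis
  proof (induction n rule: int_induct[where k = 0])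
    case (step1 i) then show ?case using step[of i] by simp
  next
    case (step2 i) then show ?case using step[of "i - 1"] by simp
  qed simp
qed

text \<open>
  The coefficient of an element of \<open>V[T]/(T\<^sup>r - \<varpi>)\<close> at \<open>T\<^sup>i\<close> for an arbitrary integer \<open>i\<close>, and multiplication by the invertible
  element \<open>T\<^sup>n\<close>.  In terms of these the product is a convolution over a period.
\<close>

definition coeff_at :: "'k::field set \<Rightarrow> nat \<Rightarrow> ('k \<Rightarrow> 'v \<Rightarrow> 'v) \<Rightarrow> (nat \<Rightarrow> 'v) \<Rightarrow> int \<Rightarrow> 'v" where
  "coeff_at p r s m i = s (unif p powi (- (i div int r))) (m (nat (i mod int r)))"

definition shift :: "'k::field set \<Rightarrow> nat \<Rightarrow> ('k \<Rightarrow> 'v \<Rightarrow> 'v::zero) \<Rightarrow> int \<Rightarrow> (nat \<Rightarrow> 'v) \<Rightarrow> nat \<Rightarrow> 'v" where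
  "shift p r s n m = (\<lambda>j. if j < r then coeff_at p r s m (int j - n) else 0)"

locale atlas = vector_space s for s :: "'k::field \<Rightarrow> 'v \<Rightarrow> 'v::ab_group_add" +
  fixes p :: "'k set" and r :: nat
  assumes d: "dvr p" and r: "0 < r"
begin

abbreviation "w \<equiv> unif p"

lemma w0: "w \<noteq> 0" by (rule unif_nonzero[OF d])

abbreviation co :: "(nat \<Rightarrow> 'v) \<Rightarrow> int \<Rightarrow> 'v" where "co \<equiv> coeff_at p r s"
abbreviation act :: "(nat \<Rightarrow> 'k) \<Rightarrow> (nat \<Rightarrow> 'v) \<Rightarrow> nat \<Rightarrow> 'v" where "act \<equiv> gprod p r s s"
abbreviation sh :: "int \<Rightarrow> (nat \<Rightarrow> 'v) \<Rightarrow> nat \<Rightarrow> 'v" where "sh \<equiv> shift p r s"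

lemma co_nat: "j < r \<Longrightarrow> co m (int j) = m j"
  by (simp add: coeff_at_def)

lemma co_period: "co m (i + q * int r) = s (w powi (- q)) (co m i)"
proof -
  have "(i + q * int r) div int r = i div int r + q" "(i + q * int r) mod int r = i mod int r"
    using r by simp_all
  then show ?thesis using w0 by (simp add: coeff_at_def power_int_add[symmetric] add.commute)
qed

lemma co_eqI:
  assumes "\<And>j. j < r \<Longrightarrow> f (int j) = m j" "\<And>i q. f (i + q * int r) = s (w powi (- q)) (f i)"
  shows "co m i = f i"
proof -
  have "0 \<le> i mod int r" "i mod int r < int r" using r by simp_all
  then have j: "nat (i mod int r) < r" "int (nat (i mod int r)) = i mod int r" by (simp_all add: nat_less_iff)
  have "f (i mod int r + (i div int r) * int r) = s (w powi (- (i div int r))) (f (i mod int r))" by (rule assms(2))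
  then have "f i = s (w powi (- (i div int r))) (f (i mod int r))" by simp
  also have "f (i mod int r) = m (nat (i mod int r))" using assms(1)[OF j(1)] j(2) by simp
  finally show ?thesis by (simp add: coeff_at_def)
qed

lemma co_shift: "co (sh n m) i = co m (i - n)"
proof (rule co_eqI)
  show "co m (int j - n) = sh n m j" if "j < r" for j using that by (simp add: shift_def)
  show "co m (i + q * int r - n) = s (w powi (- q)) (co m (i - n))" for i q
    using co_period[of m "i - n" q] by (simp add: algebra_simps)
qed

lemma shift_shift: "sh a (sh b m) = sh (a + b) m"
proof
  fix j show "sh a (sh b m) j = sh (a + b) m j"
    using co_shift[of b m "int j - a"] by (simp add: shift_def[of p r s a] shift_def[of p r s "a + b"] algebra_simps)
qed

lemma shift_0: "m \<in> trunc r V \<Longrightarrow> sh 0 m = m"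
  by (rule ext) (auto simp: shift_def co_nat trunc_def not_less)

lemma shift_zero: "sh n 0 = 0"
  by (rule ext) (simp add: shift_def coeff_at_def)

lemma shift_add: "sh n (u + v) = sh n u + sh n v"
  by (rule ext) (simp add: shift_def coeff_at_def scale_right_distrib)

lemma shift_scale: "sh n (\<lambda>j. s c (m j)) = (\<lambda>j. s c (sh n m j))"
  by (rule ext) (simp add: shift_def coeff_at_def mult.commute)

lemma shift_multiple:
  assumes "m \<in> trunc r V" shows "sh (q * int r) m = (\<lambda>j. s (w powi q) (m j))"
proof
  fix j
  show "sh (q * int r) m j = s (w powi q) (m j)"
    using co_period[of m "int j" "- q"] assms by (auto simp: shift_def co_nat trunc_def)
qed

lemma shift_trunc: "sh n m j = 0" if "r \<le> j"
  using that by (simp add: shift_def)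

lemma act_eq: "j < r \<Longrightarrow> act a m j = (\<Sum>i<r. s (a i) (co m (int j - int i)))"
proof -
  assume j: "j < r"
  have "(\<Sum>k<r. if (i + k) mod r = j then s (w ^ ((i + k) div r)) (s (a i) (m k)) else 0) = s (a i) (co m (int j - int i))"
    if i: "i < r" for i
  proof -
    define k where "k = nat ((int j - int i) mod int r)"
    have k: "int k = (int j - int i) mod int r" "k < r" using r by (simp_all add: k_def nat_less_iff)
    have iff: "(i + k') mod r = j \<longleftrightarrow> k' = k" if k': "k' < r" for k'
    proof
      assume "(i + k') mod r = j"
      then have "int j = (int i + int k') mod int r" by (metis of_nat_add of_nat_mod)
      then have "(int j - int i) mod int r = (int i + int k' - int i) mod int r"
        using mod_diff_left_eq by metis
      then show "k' = k" using k k' by simp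
    next
      assume "k' = k"
      then have "(int i + int k') mod int r = (int i + (int j - int i)) mod int r"
        using k(1) mod_add_right_eq by metis
      then have "int ((i + k') mod r) = int j" using j by (simp add: zmod_int)
      then show "(i + k') mod r = j" by simp
    qed
    have div: "int ((i + k) div r) = - ((int j - int i) div int r)"
    proof -
      have "(i + k) mod r = j" using iff k(2) by simp
      then have "int i + int k = int ((i + k) div r) * int r + int j"
        by (metis div_mult_mod_eq of_nat_add of_nat_mult)
      moreover have "int j - int i = (int j - int i) div int r * int r + int k" using k(1) by simp
      ultimately have "int ((i + k) div r) * int r = - ((int j - int i) div int r) * int r" by (simp add: algebra_simps)
      moreover have "int r \<noteq> 0" using r by simp
      ultimately show ?thesis by (simp only: mult_right_cancel not_False_eq_True)
    qed
    have "(\<Sum>k'<r. if (i + k') mod r = j then s (w ^ ((i + k') div r)) (s (a i) (m k')) else 0) =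
        (\<Sum>k'<r. if k' = k then s (w ^ ((i + k) div r)) (s (a i) (m k)) else 0)"
      using iff by (intro sum.cong) auto
    also have "\<dots> = s (w ^ ((i + k) div r)) (s (a i) (m k))" using k(2) by simp
    also have "w ^ ((i + k) div r) = w powi (- ((int j - int i) div int r))"
      by (simp only: power_int_of_nat[symmetric] div)
    finally show ?thesis by (simp add: coeff_at_def k_def mult.commute)
  qed
  then show ?thesis using j by (simp add: gprod_def)
qed

lemma act_trunc: "r \<le> j \<Longrightarrow> act a m j = 0"
  by (simp add: gprod_def)

lemma co_act: "co (act a m) j = (\<Sum>i<r. s (a i) (co m (j - int i)))"
proof (rule co_eqI)
  show "(\<Sum>i<r. s (a i) (co m (int j - int i))) = act a m j" if "j < r" for j using act_eq[OF that] by simp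
  show "(\<Sum>i<r. s (a i) (co m (j + q * int r - int i))) = s (w powi (- q)) (\<Sum>i<r. s (a i) (co m (j - int i)))" for j q
  proof -
    have "co m (j + q * int r - int i) = s (w powi (- q)) (co m (j - int i))" for i
      using co_period[of m "j - int i" q] by (simp add: algebra_simps)
    then show ?thesis by (simp add: scale_sum_right mult.commute)
  qed
qed

lemma act_shift_right: "act a (sh n m) = sh n (act a m)"
proof
  fix j show "act a (sh n m) j = sh n (act a m) j"
    by (cases "j < r") (simp_all add: act_eq act_trunc shift_def[of p r s n "act a m"] co_act co_shift algebra_simps)
qed

lemma act_add_right: "act a (u + v) = act a u + act a v"
proof
  fix j show "act a (u + v) j = (act a u + act a v) j"
    by (cases "j < r") (simp_all add: act_eq act_trunc coeff_at_def scale_right_distrib sum.distrib)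
qed

lemma act_scale_right: "act a (\<lambda>j. s c (m j)) = (\<lambda>j. s c (act a m j))"
proof
  fix j show "act a (\<lambda>j. s c (m j)) j = s c (act a m j)"
    by (cases "j < r") (simp_all add: act_eq act_trunc coeff_at_def scale_sum_right mult_ac)
qed

lemma act_add_left: "act (a + b) m = act a m + act b m"
proof
  fix j show "act (a + b) m j = (act a m + act b m) j"
    by (cases "j < r") (simp_all add: act_eq act_trunc scale_left_distrib sum.distrib)
qed

lemma act_scale_left: "act (\<lambda>j. c * a j) m = (\<lambda>j. s c (act a m j))"
proof
  fix j show "act (\<lambda>j. c * a j) m j = s c (act a m j)"
    by (cases "j < r") (simp_all add: act_eq act_trunc scale_sum_right)
qed

lemma act_zero_right: "act a 0 = 0"
proof
  fix j show "act a 0 j = 0 j"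
    by (cases "j < r") (simp_all add: act_eq act_trunc coeff_at_def)
qed

lemma act_sum_right: "act a (sum f I) = (\<Sum>i\<in>I. act a (f i))"
proof (induction I rule: infinite_finite_induct)
  case (insert i I) show ?case unfolding sum.insert[OF insert(1,2)] act_add_right insert(3) ..
qed (simp_all only: sum.infinite sum.empty act_zero_right not_False_eq_True)

lemma act_Tpow: "act (Tpow p r n) m = sh (int n) m"
proof
  fix j
  show "act (Tpow p r n) m j = sh (int n) m j"
  proof (cases "j < r")
    case True
    have "act (Tpow p r n) m j = (\<Sum>i<r. if i = n mod r then s (w ^ (n div r)) (co m (int j - int (n mod r))) else 0)"
      unfolding act_eq[OF True] Tpow_def by (intro sum.cong) auto
    also have "\<dots> = s (w ^ (n div r)) (co m (int j - int (n mod r)))" using r by simp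
    also have "\<dots> = co m (int j - int n)"
    proof -
      have "int n = int (n mod r) + int (n div r) * int r"
        by (metis add.commute div_mult_mod_eq of_nat_add of_nat_mult)
      then have "int j - int n = (int j - int (n mod r)) + (- int (n div r)) * int r" by simp
      then have "co m (int j - int n) = s (w powi (- (- int (n div r)))) (co m (int j - int (n mod r)))"
        by (simp only: co_period)
      then show ?thesis by (simp add: power_int_of_nat)
    qed
    finally show ?thesis using True by (simp add: shift_def)
  qed (simp add: act_trunc shift_def)
qed

lemma act_deg_zero: "m \<in> trunc r V \<Longrightarrow> act (deg_zero c) m = (\<lambda>j. s c (m j))"
proof
  fix j assume m: "m \<in> trunc r V"
  show "act (deg_zero c) m j = s c (m j)"
  proof (cases "j < r")
    case True
    have "act (deg_zero c) m j = (\<Sum>i<r. if i = 0 then s c (m j) else 0)"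
      unfolding act_eq[OF True] using True by (intro sum.cong) (auto simp: deg_zero_def co_nat)
    then show ?thesis using r by simp
  next
    case False then show ?thesis using m by (simp add: act_trunc trunc_def)
  qed
qed

lemma act_deg_zero_right: "a \<in> trunc r V \<Longrightarrow> act a (deg_zero v) = (\<lambda>j. s (a j) v)"
proof
  fix j assume a: "a \<in> trunc r V"
  show "act a (deg_zero v) j = s (a j) v"
  proof (cases "j < r")
    case True
    have "s (a i) (co (deg_zero v) (int j - int i)) = (if i = j then s (a j) v else 0)" if i: "i < r" for i
    proof (cases "i = j")
      case True then show ?thesis by (simp add: coeff_at_def deg_zero_def)
    next
      case False
      have "(int j - int i) mod int r \<noteq> 0"
      proof
        assume "(int j - int i) mod int r = 0"
        then have "int j mod int r = int i mod int r" by (simp add: mod_eq_dvd_iff mod_0_imp_dvd)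
        then show False using i \<open>j < r\<close> False by simp
      qed
      moreover have "0 \<le> (int j - int i) mod int r" using r by simp
      ultimately have "nat ((int j - int i) mod int r) \<noteq> 0" by simp
      then show ?thesis using False by (simp add: coeff_at_def deg_zero_def)
    qed
    then have "act a (deg_zero v) j = (\<Sum>i<r. if i = j then s (a j) v else 0)"
      unfolding act_eq[OF True] by (intro sum.cong) auto
    then show ?thesis using True by simp
  next
    case False then show ?thesis using a by (simp add: act_trunc trunc_def)
  qed
qed

lemma deg_zero_scale: "deg_zero (s c v) = (\<lambda>j. s c (deg_zero v j))"
  by (rule ext) (simp add: deg_zero_def)

lemma deg_zero_trunc: "v \<in> V \<Longrightarrow> 0 \<in> V \<Longrightarrow> deg_zero v \<in> trunc r V"
  using r by (auto simp: deg_zero_def trunc_def)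

end

lemma atlas_field: "dvr p \<Longrightarrow> 0 < r \<Longrightarrow> atlas ((*) :: 'k::field \<Rightarrow> 'k \<Rightarrow> 'k) p r"
  using vector_space_field by (simp add: atlas_def atlas_axioms_def)

sublocale atlas \<subseteq> K: atlas "(*) :: 'k \<Rightarrow> 'k \<Rightarrow> 'k" p r
  by (rule atlas_field[OF d r])

context atlas
begin

lemma act_shift_left: "act (K.sh n a) m = sh n (act a m)"
proof
  fix j
  show "act (K.sh n a) m j = sh n (act a m) j"
  proof (cases "j < r")
    case True
    define f where "f i = s (K.co a (i - n)) (co m (int j - i))" for i
    \<comment> \<open>a shift by \<open>r\<close> multiplies one factor by a power of the uniformizer and the other one by its inverse\<close>
    have "f (i + int r) = f i" for i
    proof -
      have "K.co a (i + int r - n) = w powi (- 1) * K.co a (i - n)"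
        using K.co_period[of a "i - n" 1] by (simp add: algebra_simps)
      moreover have "co m (int j - (i + int r)) = s (w powi 1) (co m (int j - i))"
        using co_period[of m "int j - i" "- 1"] by (simp add: algebra_simps)
      ultimately show ?thesis using w0 by (simp add: f_def power_int_minus)
    qed
    then have per: "(\<Sum>i<r. f (int i + n)) = (\<Sum>i<r. f (int i))" by (rule periodic_sum)
    have "act (K.sh n a) m j = (\<Sum>i<r. f (int i))"
      unfolding act_eq[OF True] f_def by (intro sum.cong) (auto simp: shift_def)
    also have "\<dots> = (\<Sum>i<r. s (a i) (co m (int j - n - int i)))"
      unfolding per[symmetric]
    proof (rule sum.cong[OF refl])
      fix i assume "i \<in> {..<r}"
      moreover have "int j - (int i + n) = int j - n - int i" by simp
      ultimately show "f (int i + n) = s (a i) (co m (int j - n - int i))"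
        by (simp only: f_def add_diff_cancel_right' K.co_nat lessThan_iff)
    qed
    also have "\<dots> = sh n (act a m) j" using True by (simp add: shift_def co_act)
    finally show ?thesis .
  qed (simp add: act_trunc shift_def)
qed

lemma act_act: "act a (act b m) = act (K.act a b) m"
proof
  fix j
  show "act a (act b m) j = act (K.act a b) m j"
  proof (cases "j < r")
    case True
    have "act (K.act a b) m j = (\<Sum>i<r. s (\<Sum>k<r. a k * K.co b (int i - int k)) (co m (int j - int i)))"
      unfolding act_eq[OF True] by (intro sum.cong) (auto simp: K.act_eq)
    also have "\<dots> = (\<Sum>k<r. s (a k) (\<Sum>i<r. s (K.co b (int i - int k)) (co m (int j - int i))))"
      unfolding scale_sum_left scale_sum_right by (subst sum.swap) simp
    also have "\<dots> = (\<Sum>k<r. s (a k) (co (act b m) (int j - int k)))"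
    proof (rule sum.cong[OF refl])
      fix k
      have "(\<Sum>i<r. s (K.co b (int i - int k)) (co m (int j - int i))) = act (K.sh (int k) b) m j"
        unfolding act_eq[OF True] by (intro sum.cong) (auto simp: shift_def)
      also have "\<dots> = co (act b m) (int j - int k)" unfolding act_shift_left using True by (simp add: shift_def)
      finally show "s (a k) (\<Sum>i<r. s (K.co b (int i - int k)) (co m (int j - int i))) = s (a k) (co (act b m) (int j - int k))"
        by simp
    qed
    finally show ?thesis by (simp add: act_eq[OF True])
  qed (simp add: act_trunc)
qed

end

lemma trunc_ring_mult:
  assumes "dvr p" "0 < r" "a \<in> trunc r p" "b \<in> trunc r p" shows "gprod p r (*) (*) a b \<in> trunc r p"
proof -
  note R = dvr_subring[OF assms(1)]
  have w: "unif p \<in> p" using dvr_unif[OF assms(1)] by (simp add: uniformizer_def)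
  have "gprod p r (*) (*) a b j \<in> p" if "j < r" for j
    using assms(3,4) that subring_0[OF R] subring_power[OF R w]
    by (auto simp: gprod_def trunc_def intro!: subring_sum[OF R] subring_mult[OF R])
  then show ?thesis by (auto simp: trunc_def gprod_def)
qed

locale atlas_module = atlas s p r
  for s :: "'k::field \<Rightarrow> 'v \<Rightarrow> 'v::ab_group_add" and p :: "'k set" and r :: nat +
  fixes V :: "'v set" and M :: "(nat \<Rightarrow> 'v) set"
  assumes trunc: "M \<subseteq> trunc r V" and zero: "0 \<in> M"
    and add: "\<And>u v. u \<in> M \<Longrightarrow> v \<in> M \<Longrightarrow> u + v \<in> M"
    and mult: "\<And>a m. a \<in> trunc r p \<Longrightarrow> m \<in> M \<Longrightarrow> act a m \<in> M"
begin

lemma scale_mem: "c \<in> p \<Longrightarrow> m \<in> M \<Longrightarrow> (\<lambda>j. s c (m j)) \<in> M"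
  using mult[of "deg_zero c" m] K.deg_zero_trunc[of c p] subring_0[OF dvr_subring[OF d]] act_deg_zero[of m V c] trunc by auto

lemma scale_unit_iff:
  assumes "unit_of p c" shows "(\<lambda>j. s c (m j)) \<in> M \<longleftrightarrow> m \<in> M"
proof
  assume "(\<lambda>j. s c (m j)) \<in> M"
  then have "(\<lambda>j. s (inverse c) (s c (m j))) \<in> M" using assms by (intro scale_mem[of "inverse c" "\<lambda>j. s c (m j)"]) (auto simp: unit_of_def)
  moreover have "s (inverse c) (s c (m j)) = m j" for j using assms by (simp add: unit_of_def)
  ultimately show "m \<in> M" by simp
qed (use assms in \<open>auto simp: unit_of_def intro: scale_mem\<close>)

lemma shift_shift_mem: "m \<in> M \<Longrightarrow> sh (- n) (sh n m) = m"
  using trunc shift_shift[of "- n" n m] shift_0[of m V] by auto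

lemma twisted_module: "atlas_module s p r UNIV {sh (- a) (\<lambda>j. s P (m j)) | m. m \<in> M}"
proof
  show "{sh (- a) (\<lambda>j. s P (m j)) | m. m \<in> M} \<subseteq> trunc r UNIV" by (auto simp: trunc_def shift_trunc)
  have "sh (- a) (\<lambda>j. s P (0 j)) = 0" using shift_zero by (simp add: zero_fun_def)
  then show "0 \<in> {sh (- a) (\<lambda>j. s P (m j)) | m. m \<in> M}" using zero by (intro CollectI exI[of _ 0]) simp
next
  fix x z assume "x \<in> {sh (- a) (\<lambda>j. s P (m j)) | m. m \<in> M}" "z \<in> {sh (- a) (\<lambda>j. s P (m j)) | m. m \<in> M}"
  then obtain m n where mn: "m \<in> M" "n \<in> M" "x = sh (- a) (\<lambda>j. s P (m j))" "z = sh (- a) (\<lambda>j. s P (n j))" by blast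
  have "x + z = sh (- a) ((\<lambda>j. s P (m j)) + (\<lambda>j. s P (n j)))" by (simp only: mn shift_add)
  also have "(\<lambda>j. s P (m j)) + (\<lambda>j. s P (n j)) = (\<lambda>j. s P ((m + n) j))" by (rule ext) (simp add: scale_right_distrib)
  finally show "x + z \<in> {sh (- a) (\<lambda>j. s P (m j)) | m. m \<in> M}" using add[OF mn(1,2)] by blast
next
  fix b x assume b: "b \<in> trunc r p" and "x \<in> {sh (- a) (\<lambda>j. s P (m j)) | m. m \<in> M}"
  then obtain m where m: "m \<in> M" "x = sh (- a) (\<lambda>j. s P (m j))" by blast
  have "act b x = sh (- a) (\<lambda>j. s P (act b m j))" by (simp add: m(2) act_shift_right act_scale_right)
  then show "act b x \<in> {sh (- a) (\<lambda>j. s P (m j)) | m. m \<in> M}" using mult[OF b m(1)] by blast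
qed

text \<open>The fractional ideal \<open>T\<^sup>-\<^sup>a P A\<^sub>p\<close> is principal, so its product with \<open>M\<close> is \<open>T\<^sup>-\<^sup>a P M\<close>.\<close>

lemma twisted_product:
  "addspan {act n e | n e. n \<in> {K.sh (- a) (\<lambda>j. P * c j) | c. c \<in> trunc r p} \<and> e \<in> M} = {sh (- a) (\<lambda>j. s P (m j)) | m. m \<in> M}"
    (is "addspan ?S = ?R")
proof
  have eq: "act (K.sh (- a) (\<lambda>j. P * c j)) e = sh (- a) (\<lambda>j. s P (act c e j))" for c e
    by (simp add: act_shift_left act_scale_left)
  show "addspan ?S \<subseteq> ?R"
  proof (rule addspan_least)
    show "?S \<subseteq> ?R" using mult by (auto simp: eq)
    interpret R: atlas_module s p r UNIV ?R by (rule twisted_module)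
    show "0 \<in> ?R" by (rule R.zero)
    show "x + z \<in> ?R" if "x \<in> ?R" "z \<in> ?R" for x z by (rule R.add[OF that])
  qed
  show "?R \<subseteq> addspan ?S"
  proof
    fix x assume "x \<in> ?R"
    then obtain m where m: "m \<in> M" "x = sh (- a) (\<lambda>j. s P (m j))" by blast
    note R = dvr_subring[OF d]
    have one: "deg_zero 1 \<in> trunc r p" using K.deg_zero_trunc[of 1 p] subring_0[OF R] subring_1[OF R] by simp
    have "act (deg_zero 1) m = m" using act_deg_zero[of m V 1] trunc m(1) by auto
    then have "x = act (K.sh (- a) (\<lambda>j. P * deg_zero 1 j)) m" using m(2) by (simp add: eq)
    then show "x \<in> addspan ?S" using one m(1) by (intro addspan_base) blast
  qed
qed

lemma deg_zero_twisted:
  assumes "P \<noteq> 0" shows "deg_zero (s P v) \<in> {sh (- a) (\<lambda>j. s P (m j)) | m. m \<in> M} \<longleftrightarrow> sh a (deg_zero v) \<in> M"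
proof -
  have D: "deg_zero v \<in> trunc r UNIV" by (rule deg_zero_trunc) auto
  show ?thesis
  proof
    assume "deg_zero (s P v) \<in> {sh (- a) (\<lambda>j. s P (m j)) | m. m \<in> M}"
    then obtain m where m: "m \<in> M" "(\<lambda>j. s P (deg_zero v j)) = sh (- a) (\<lambda>j. s P (m j))"
      unfolding deg_zero_scale by blast
    then have "(\<lambda>j. s P (deg_zero v j)) = (\<lambda>j. s P (sh (- a) m j))" by (simp only: shift_scale)
    then have "deg_zero v = sh (- a) m" using assms by (simp add: fun_eq_iff)
    then have "sh a (deg_zero v) = m" using shift_shift_mem[OF m(1), of "- a"] by simp
    then show "sh a (deg_zero v) \<in> M" using m(1) by simp
  next
    assume M: "sh a (deg_zero v) \<in> M"
    have "sh (- a) (\<lambda>j. s P (sh a (deg_zero v) j)) = (\<lambda>j. s P (deg_zero v j))"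
      using shift_shift[of "- a" a "deg_zero v"] shift_0[OF D] by (simp add: shift_scale)
    then show "deg_zero (s P v) \<in> {sh (- a) (\<lambda>j. s P (m j)) | m. m \<in> M}"
      unfolding deg_zero_scale using M by (intro CollectI exI[of _ "sh a (deg_zero v)"]) simp
  qed
qed

end

lemma atlas_module_ring:
  assumes "dvr p" "0 < r" shows "atlas_module (*) p r p (trunc r p)"
proof -
  interpret atlas "(*)" p r by (rule atlas_field[OF assms])
  note R = dvr_subring[OF assms(1)]
  show ?thesis
    by unfold_locales (use subring_0[OF R] subring_add[OF R] trunc_ring_mult[OF assms] in \<open>auto simp: trunc_def\<close>)
qed

lemma atlas_module_lattice:
  assumes "vector_space s" "dvr p" "0 < r" "atlas_lattice p r s V M"
  shows "atlas_module s p r V M"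
proof -
  interpret atlas s p r using assms by (simp add: atlas_def atlas_axioms_def)
  note R = dvr_subring[OF d]
  obtain n e where bij: "bij_betw (frame_sum p r s n e) (trunc n (trunc r UNIV)) (trunc r V)"
    and M: "M = frame_sum p r s n e ` trunc n (trunc r p)" using assms(4) unfolding atlas_lattice_def by blast
  let ?f = "frame_sum p r s n e"
  show ?thesis
  proof
    have "trunc n (trunc r p) \<subseteq> trunc n (trunc r UNIV)" by (auto simp: trunc_def)
    then show "M \<subseteq> trunc r V" unfolding M using bij by (auto simp: bij_betw_def)
    have act0: "act 0 m = 0" for m
    proof
      fix j show "act 0 m j = 0 j" by (cases "j < r") (simp_all add: act_eq act_trunc)
    qed
    have "?f 0 = 0" by (simp add: frame_sum_def act0)
    moreover have "0 \<in> trunc n (trunc r p)" using subring_0[OF R] by (auto simp: trunc_def)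
    ultimately show "0 \<in> M" unfolding M by (metis image_eqI)
    fix u v assume "u \<in> M" "v \<in> M"
    then obtain c c' where c: "c \<in> trunc n (trunc r p)" "c' \<in> trunc n (trunc r p)" "u = ?f c" "v = ?f c'" unfolding M by blast
    have "?f (c + c') = u + v" by (simp add: c frame_sum_def act_add_left sum.distrib)
    moreover have "c + c' \<in> trunc n (trunc r p)" using c subring_add[OF R] by (auto simp: trunc_def)
    ultimately show "u + v \<in> M" unfolding M by (metis image_eqI)
  next
    fix a m assume a: "a \<in> trunc r p" and "m \<in> M"
    then obtain c where c: "c \<in> trunc n (trunc r p)" "m = ?f c" unfolding M by blast
    define c' where "c' i = (if i < n then K.act a (c i) else 0)" for i
    have "?f c' = act a m" by (simp add: c frame_sum_def act_sum_right act_act c'_def)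
    moreover have "c' \<in> trunc n (trunc r p)"
      using c(1) trunc_ring_mult[OF d r a] by (simp add: c'_def trunc_def[of n])
    ultimately show "act a m \<in> M" unfolding M by (metis image_eqI)
  qed
qed

section \<open>Borne's functor\<close>

lemma zeta_power_inj: "i < r \<Longrightarrow> j < r \<Longrightarrow> zeta r ^ i = zeta r ^ j \<Longrightarrow> i = j"
proof -
  assume ij: "i < r" "j < r" "zeta r ^ i = zeta r ^ j"
  have z: "zeta r ^ k = cis (2 * pi * real k / real r)" for k
  proof -
    have "zeta r = cis (2 * pi / real r)" by (simp add: zeta_def cis_conv_exp mult_ac)
    then show ?thesis by (simp add: DeMoivre mult_ac)
  qed
  have "inj_on (\<lambda>k. cis (2 * pi * real k / real r)) {..<r}"
    using bij_betw_roots_unity[of r] ij(1) by (simp add: bij_betw_def)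
  then show ?thesis using ij by (auto simp: inj_on_def z)
qed

text \<open>
  The pieces of \<open>M\<close> are the eigenspaces of the action of \<open>\<mu>\<^sub>r\<close>, so an element of a piece is homogeneous.  Multiplication by \<open>T\<^sup>j\<close> maps
  those of degree \<open>r - j\<close> to elements of degree zero, and is reversed by \<open>T\<^sup>-\<^sup>j\<close>.
\<close>

lemma borne_fil:
  assumes vs: "vector_space (scal E)" and p: "dvr p" and r: "0 < root_order X p" and emb: "ring_map (emb X)"
    and trunc: "atl E p \<subseteq> trunc (root_order X p) V" and j: "j \<le> root_order X p"
  shows "fil (borne X E) p j = {v. shift p (root_order X p) (scal E) (- int j) (deg_zero v) \<in> atl E p}"
proof -
  define r where "r = root_order X p"
  interpret atlas "scal E" p r using vs p assms(3) by (simp add: atlas_def atlas_axioms_def r_def)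
  define a where "a = (r - j) mod r"
  have a: "a < r" using assms(3) by (simp add: a_def r_def)
  have aj: "i = a" if "i < r" "(int i + int j) mod int r = 0" for i
  proof -
    have "int a = (int r - int j) mod int r" using j by (simp add: a_def r_def zmod_int of_nat_diff)
    also have "\<dots> = (int r - int j + (int i + int j)) mod int r" using that(2) by (metis add.right_neutral mod_add_right_eq)
    also have "\<dots> = int i" using that(1) by simp
    finally show ?thesis by simp
  qed
  have piece: "m \<in> piece X E p a \<longleftrightarrow> m \<in> atl E p \<and> (\<forall>i. i \<noteq> a \<longrightarrow> m i = 0)" for m
  proof
    assume m: "m \<in> piece X E p a"
    then have mM: "m \<in> atl E p" and ev: "\<And>i. scal E (emb X (zeta r ^ i)) (m i) = scal E (emb X (zeta r ^ a)) (m i)"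
      unfolding piece_def mu_action_def r_def by (auto simp: fun_eq_iff)
    have "m i = 0" if "i \<noteq> a" for i
    proof (cases "i < r")
      case True
      then have "emb X (zeta r ^ i) \<noteq> emb X (zeta r ^ a)" using zeta_power_inj[OF True a] that ring_map_eq[OF emb] by blast
      then show ?thesis using ev[of i] scale_right_imp_eq by (metis scale_cancel_right)
    next
      case False then show ?thesis using mM trunc by (auto simp: trunc_def r_def)
    qed
    then show "m \<in> atl E p \<and> (\<forall>i. i \<noteq> a \<longrightarrow> m i = 0)" using mM by blast
  next
    assume m: "m \<in> atl E p \<and> (\<forall>i. i \<noteq> a \<longrightarrow> m i = 0)"
    have "scal E (emb X (zeta r ^ i)) (m i) = scal E (emb X (zeta r ^ a)) (m i)" for i
      using m by (cases "i = a") auto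
    then show "m \<in> piece X E p a" using m unfolding piece_def mu_action_def r_def by auto
  qed
  have "fil (borne X E) p j = {act (Tpow p r j) m 0 | m. m \<in> piece X E p a}"
    by (simp add: borne_def Let_def r_def a_def)
  also have "\<dots> = {v. sh (- int j) (deg_zero v) \<in> atl E p}"
  proof (intro set_eqI iffI)
    fix v assume "v \<in> {act (Tpow p r j) m 0 | m. m \<in> piece X E p a}"
    then obtain m where m: "v = sh (int j) m 0" "m \<in> atl E p" "\<And>i. i \<noteq> a \<Longrightarrow> m i = 0" unfolding act_Tpow piece by blast
    have "sh (int j) m = deg_zero v"
    proof
      fix i
      show "sh (int j) m i = deg_zero v i"
      proof (cases "i = 0 \<or> r \<le> i")
        case True then show ?thesis using m(1) r by (auto simp: deg_zero_def shift_def)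
      next
        case False
        have "nat ((int i - int j) mod int r) \<noteq> a"
        proof
          assume e: "nat ((int i - int j) mod int r) = a"
          have "int a = (int i - int j) mod int r" using e assms(3) by (metis int_nat_eq pos_mod_sign of_nat_0_less_iff r_def)
          moreover have "int a = (- int j) mod int r"
          proof -
            have "int a = (int r - int j) mod int r" using j by (simp add: a_def r_def zmod_int of_nat_diff)
            then show ?thesis by (metis add.commute mod_add_self1 uminus_add_conv_diff)
          qed
          ultimately have "(int i - int j - (- int j)) mod int r = 0" by (metis mod_eq_dvd_iff dvd_imp_mod_0)
          then show False using False by simp
        qed
        then show ?thesis using False m(3) by (simp add: shift_def coeff_at_def deg_zero_def)
      qed
    qed
    then have "sh (- int j) (deg_zero v) = m"
      using shift_shift[of "- int j" "int j" m] shift_0[of m V] m(2) trunc by (auto simp: r_def)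
    then show "v \<in> {v. sh (- int j) (deg_zero v) \<in> atl E p}" using m(2) by simp
  next
    fix v assume v: "v \<in> {v. sh (- int j) (deg_zero v) \<in> atl E p}"
    define m where "m = sh (- int j) (deg_zero v)"
    have "m i = 0" if "i \<noteq> a" for i
    proof (cases "i < r")
      case True
      then have "(int i + int j) mod int r \<noteq> 0" using aj[of i] that by auto
      moreover have "0 \<le> (int i + int j) mod int r" using assms(3) by (simp add: r_def)
      ultimately have "nat ((int i + int j) mod int r) \<noteq> 0" by simp
      then show ?thesis by (simp add: m_def shift_def coeff_at_def deg_zero_def)
    qed (simp add: m_def shift_def)
    then have "m \<in> piece X E p a" using v by (simp add: piece m_def)
    moreover have "sh (int j) m = deg_zero v"
      using shift_shift[of "int j" "- int j" "deg_zero v"] shift_0[OF deg_zero_trunc[of v UNIV]] by (simp add: m_def)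
    then have "act (Tpow p r j) m 0 = v" by (simp add: act_Tpow deg_zero_def)
    ultimately show "v \<in> {act (Tpow p r j) m 0 | m. m \<in> piece X E p a}" by blast
  qed
  finally show ?thesis by (simp add: r_def)
qed

section \<open>The direct image along the root stack morphism\<close>

text \<open>For an etale morphism the section \<open>P\<close> generates \<open>T N\<close>, and \<open>T\<close> is invertible in \<open>K[T]/(T\<^sup>r - \<varpi>)\<close>.\<close>

lemma etale_line:
  fixes P :: "'k::field"
  assumes "dvr p" "0 < r" "N \<subseteq> trunc r UNIV"
    and eq: "{gprod p r (*) (*) a (deg_zero P) | a. a \<in> trunc r p} = gprod p r (*) (*) (Tpow p r 1) ` N"
  shows "N = {shift p r (*) (- 1) (\<lambda>j. P * c j) | c. c \<in> trunc r p}"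
proof -
  interpret atlas "(*) :: 'k \<Rightarrow> 'k \<Rightarrow> 'k" p r by (rule atlas_field[OF assms(1,2)])
  note scale_scale [simp del]
  have "{act a (deg_zero P) | a. a \<in> trunc r p} = {\<lambda>j. P * a j | a. a \<in> trunc r p}"
    unfolding Setcompr_eq_image by (rule image_cong[OF refl]) (simp add: act_deg_zero_right[of _ p] mult.commute)
  then have eq': "{\<lambda>j. P * a j | a. a \<in> trunc r p} = sh 1 ` N" using eq by (simp add: act_Tpow)
  have "N = sh (- 1) ` sh 1 ` N"
  proof -
    have "sh (- 1) (sh 1 n) = n" if "n \<in> N" for n
      using shift_shift[of "- 1" 1 n] shift_0[of n UNIV] assms(3) that by auto
    then have "(\<lambda>n. sh (- 1) (sh 1 n)) ` N = (\<lambda>n. n) ` N" by (intro image_cong) auto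
    then show ?thesis by (simp add: image_image)
  qed
  then show ?thesis unfolding eq'[symmetric] by blast
qed

lemma atlas_power_etale:
  fixes P :: "'k::field"
  assumes p: "dvr p" "0 < root_order X p"
    and N: "atl N p = {shift p (root_order X p) (*) (- 1) (\<lambda>j. P * c j) | c. c \<in> trunc (root_order X p) p}"
  shows "atlas_power X N p a = {shift p (root_order X p) (*) (- int a) (\<lambda>j. P ^ a * c j) | c. c \<in> trunc (root_order X p) p}"
proof (induction a)
  case 0
  interpret atlas "(*) :: 'k \<Rightarrow> 'k \<Rightarrow> 'k" p "root_order X p" by (rule atlas_field[OF p])
  have "sh 0 c = c" if "c \<in> trunc (root_order X p) p" for c by (rule shift_0[OF that])
  then show ?case by (force simp: atlas_power_def)
next
  case (Suc a)
  let ?r = "root_order X p"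
  interpret R: atlas_module "(*) :: 'k \<Rightarrow> 'k \<Rightarrow> 'k" p ?r p "trunc ?r p" by (rule atlas_module_ring[OF p])
  interpret I: atlas_module "(*) :: 'k \<Rightarrow> 'k \<Rightarrow> 'k" p ?r UNIV "atlas_power X N p a"
    unfolding Suc by (rule R.twisted_module)
  note R.scale_scale [simp del]
  have "atlas_power X N p (Suc a) = {R.sh (- 1) (\<lambda>j. P * m j) | m. m \<in> atlas_power X N p a}"
    using I.twisted_product[of 1 P] by (simp add: atlas_power_def N)
  also have "\<dots> = {R.sh (- 1) (\<lambda>j. P * R.sh (- int a) (\<lambda>j. P ^ a * c j) j) | c. c \<in> trunc ?r p}"
    unfolding Suc by blast
  also have "\<dots> = {R.sh (- int (Suc a)) (\<lambda>j. P ^ Suc a * c j) | c. c \<in> trunc ?r p}"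
  proof -
    have "R.sh (- 1) (\<lambda>j. P * R.sh (- int a) (\<lambda>j. P ^ a * c j) j) = R.sh (- int (Suc a)) (\<lambda>j. P ^ Suc a * c j)" for c
      using R.shift_shift[of "- 1" "- int a" "\<lambda>j. P ^ Suc a * c j"]
      by (simp add: R.shift_scale[symmetric] mult_ac)
    then show ?thesis by simp
  qed
  finally show ?case .
qed

locale covering_stack = covering_bundle X Y \<phi> E
  for X :: "('k::field, 'z) curve_scheme" and Y :: "('l::field, 'u) curve_scheme" and \<phi> :: "'l \<Rightarrow> 'k"
    and E :: "('k, 'v::ab_group_add) par_bundle" +
  fixes h :: "('l, 'k) root_map" and \<E> :: "('k, 'v) root_bundle"
  assumes h: "root_stack_map X Y \<phi> h" "root_map_etale X Y \<phi> h"
    and \<E>: "root_vector_bundle X \<E>" "borne_corresponds X \<E> E"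
begin

declare L.scale_scale [simp del]

lemma \<E>_simps: "scal \<E> = scal E" "gen \<E> = gen E"
  using \<E>(2) by (simp_all add: borne_corresponds_def)

lemma module: "p \<in> points X \<Longrightarrow> atlas_module (scal E) p (root_order X p) (gen E) (atl \<E> p)"
  using \<E>(1) V.vector_space_axioms
  by (intro atlas_module_lattice points_dvr root_order_pos[OF X]) (auto simp: root_vector_bundle_def \<E>_simps)

text \<open>The extension of the filtration to all integers by \<open>E\<^sup>n\<^sup>+\<^sup>r = \<varpi> E\<^sup>n\<close> corresponds to \<open>T\<^sup>r = \<varpi>\<close>.\<close>

lemma filZ_atlas:
  assumes p: "p \<in> points X"
  shows "v \<in> filZ X E p n \<longleftrightarrow> shift p (root_order X p) (scal E) (- n) (deg_zero v) \<in> atl \<E> p"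
proof -
  interpret M: atlas_module "scal E" p "root_order X p" "gen E" "atl \<E> p" by (rule module[OF p])
  let ?r = "root_order X p"
  define q j where "q = n div int ?r" and "j = nat (n mod int ?r)"
  have n: "n = int j + q * int ?r" and j: "j \<le> ?r"
    using M.r pos_mod_bound[of "int ?r" n] by (auto simp: q_def j_def nat_le_iff order.strict_implies_order)
  have fil: "fil E p j = {v. M.sh (- int j) (deg_zero v) \<in> atl \<E> p}"
  proof -
    have "fil E p j = fil (borne X \<E>) p j" using \<E>(2) p j by (simp add: borne_corresponds_def)
    also have "\<dots> = {v. M.sh (- int j) (deg_zero v) \<in> atl \<E> p}"
      using borne_fil[of \<E> p X "gen E" j] V.vector_space_axioms M.d M.r M.trunc j X
      by (simp add: \<E>_simps marked_curve_def function_field_def)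
    finally show ?thesis .
  qed
  have "v \<in> filZ X E p n \<longleftrightarrow> M.sh (- int j) (deg_zero (scal E (unif p powi (- q)) v)) \<in> atl \<E> p"
    unfolding filZ_def q_def[symmetric] j_def[symmetric] V.mem_twist[OF M.d] fil by simp
  also have "M.sh (- int j) (deg_zero (scal E (unif p powi (- q)) v)) = M.sh (- n) (deg_zero v)"
  proof -
    have "deg_zero v \<in> trunc ?r UNIV" by (rule M.deg_zero_trunc) auto
    then have "deg_zero (scal E (unif p powi (- q)) v) = M.sh (- q * int ?r) (deg_zero v)"
      by (simp only: M.deg_zero_scale M.shift_multiple)
    then have "M.sh (- int j) (deg_zero (scal E (unif p powi (- q)) v)) = M.sh (- int j + - q * int ?r) (deg_zero v)"
      by (simp only: M.shift_shift)
    also have "- int j + - q * int ?r = - n" unfolding n by simp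
    finally show ?thesis .
  qed
  finally show ?thesis .
qed

abbreviation D :: "('l, 'v) root_bundle" where "D \<equiv> root_direct_image X Y \<phi> h \<E>"

text \<open>
  The power \<open>N\<^sup>a\<close> is \<open>T\<^sup>-\<^sup>a P\<^sup>a A\<^sub>p\<close>, and the factor \<open>P\<^sup>a\<close> cancels.  At an unmarked point \<open>y\<close> only \<open>a = 0\<close> occurs.
\<close>

lemma direct_image_section:
  assumes y: "y \<in> points Y" and p: "p \<in> fiber X \<phi> y" and a: "a < root_order Y y"
  shows "deg_zero (scal E (rsec h y ^ a) v) \<in>
      addspan {gprod p (root_order X p) (scal E) (scal E) n e | n e. n \<in> atlas_power X (rline h y) p a \<and> e \<in> atl \<E> p}
    \<longleftrightarrow> shift p (root_order X p) (scal E) (int a) (deg_zero v) \<in> atl \<E> p"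
proof -
  have pX: "p \<in> points X" "\<phi> -` p = y" using p by (auto simp: fiber_def)
  interpret M: atlas_module "scal E" p "root_order X p" "gen E" "atl \<E> p" by (rule module[OF pX(1)])
  note M.K.scale_scale [simp del]
  let ?r = "root_order X p"
  have power: "atlas_power X (rline h y) p a = {M.K.sh (- int a) (\<lambda>j. rsec h y ^ a * c j) | c. c \<in> trunc ?r p} \<and> rsec h y ^ a \<noteq> 0"
  proof (cases "y \<in> set (marks Y)")
    case True
    have N: "root_vector_bundle X (rline h y)" "scal (rline h y) = (*)" "gen (rline h y) = UNIV"
      and iso: "riso h y * rsec h y ^ root_order Y y = 1"
      using h(1) True by (auto simp: root_stack_map_def)
    have "atlas_module (*) p ?r UNIV (atl (rline h y) p)"
      using N pX(1) vector_space_field M.d M.r by (intro atlas_module_lattice) (auto simp: root_vector_bundle_def)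
    then have "atl (rline h y) p \<subseteq> trunc ?r UNIV" by (rule atlas_module.trunc)
    moreover have "{gprod p ?r (*) (*) a (deg_zero (rsec h y)) | a. a \<in> trunc ?r p} = gprod p ?r (*) (*) (Tpow p ?r 1) ` atl (rline h y) p"
      using h(2)[unfolded root_map_etale_def Let_def, rule_format, OF pX(1)] True by (simp only: pX(2) if_True)
    ultimately have "atl (rline h y) p = {M.K.sh (- 1) (\<lambda>j. rsec h y * c j) | c. c \<in> trunc ?r p}"
      by (rule etale_line[OF M.d M.r])
    moreover have "rsec h y \<noteq> 0" using iso a by (auto simp: power_0_left)
    ultimately show ?thesis using atlas_power_etale[OF M.d M.r] by simp
  next
    case False
    then have a0: "a = 0" using a root_order_unmarked[OF False] by linarith
    have "M.K.sh 0 c = c" if "c \<in> trunc ?r p" for c by (rule M.K.shift_0[OF that])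
    then show ?thesis unfolding a0 by (force simp: atlas_power_def)
  qed
  show ?thesis
    unfolding conjunct1[OF power] M.twisted_product by (rule M.deg_zero_twisted[OF conjunct2[OF power]])
qed

lemma atl_direct_image:
  assumes y: "y \<in> points Y"
  shows "m \<in> atl D y \<longleftrightarrow> m \<in> trunc (root_order Y y) (gen E) \<and>
    (\<forall>a<root_order Y y. \<forall>p\<in>fiber X \<phi> y. shift p (root_order X p) (scal E) (int a) (deg_zero (m a)) \<in> atl \<E> p)"
  using direct_image_section[OF y] by (simp add: root_direct_image_def \<E>_simps)

text \<open>
  The element \<open>S\<^sup>-\<^sup>j v\<close> is homogeneous of the degree \<open>a\<close> with \<open>a + j = q s\<close>, and equal to \<open>\<varpi>\<^sub>y\<^sup>-\<^sup>q v S\<^sup>a\<close>.  As \<open>\<varpi>\<^sub>y\<close> is a unit times \<open>\<varpi>\<^sub>p\<^sup>e = T\<^sup>s\<close>, it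
  belongs to the direct image if and only if \<open>T\<^sup>a\<^sup>-\<^sup>q\<^sup>s v = T\<^sup>-\<^sup>j v\<close> belongs to the module of \<open>\<E>\<close> at all \<open>p\<close> above \<open>y\<close>.
\<close>

lemma fil_borne_direct_image:
  assumes y: "y \<in> points Y" and j: "j \<le> root_order Y y"
  shows "fil (borne Y D) y j = fil F y j"
proof -
  interpret Q: covering_point X Y \<phi> E y by (rule point_intro[OF y])
  interpret B: atlas "\<lambda>a. scal E (\<phi> a)" y Q.s
    using W.vector_space_axioms Q.P.y Q.s_pos by (simp add: atlas_def atlas_axioms_def)
  have "fil (borne Y D) y j = {v. shift y Q.s (scal D) (- int j) (deg_zero v) \<in> atl D y}"
  proof (rule borne_fil[where V = "gen E"])
    show "vector_space (scal D)" using W.vector_space_axioms by (simp add: root_direct_image_def \<E>_simps)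
    show "ring_map (emb Y)" using Y by (simp add: marked_curve_def function_field_def)
    show "atl D y \<subseteq> trunc Q.s (gen E)" using atl_direct_image[OF y] by blast
  qed (use Q.P.y Q.s_pos j in auto)
  also have "\<dots> = {v. B.sh (- int j) (deg_zero v) \<in> atl D y}" by (simp add: root_direct_image_def \<E>_simps)
  also have "\<dots> = Q.FZ (int j)"
  proof -
    \<comment> \<open>the degree of \<open>S\<^sup>-\<^sup>j v\<close>\<close>
    define a where "a = nat ((- int j) mod int Q.s)"
    define q where "q = (int a + int j) div int Q.s"
    have a: "a < Q.s" "(int a + int j) mod int Q.s = 0"
      using Q.s_pos by (simp_all add: a_def nat_less_iff mod_add_left_eq)
    have aq: "int a + int j = q * int Q.s" using a(2) by (simp add: q_def mod_0_imp_dvd)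
    have B0: "B.sh (- int j) (deg_zero v) i = 0" if "i \<noteq> a" for v i
    proof (cases "i < Q.s")
      case True
      have "(int i + int j) mod int Q.s \<noteq> 0"
      proof
        assume "(int i + int j) mod int Q.s = 0"
        then have "(int i + int j) mod int Q.s = (int a + int j) mod int Q.s" using a(2) by simp
        then have "int i mod int Q.s = int a mod int Q.s" by (simp add: mod_eq_dvd_iff)
        then show False using True a(1) that by simp
      qed
      moreover have "0 \<le> (int i + int j) mod int Q.s" using Q.s_pos by simp
      ultimately have "nat ((int i + int j) mod int Q.s) \<noteq> 0" by simp
      then show ?thesis by (simp add: shift_def coeff_at_def deg_zero_def)
    qed (simp add: shift_def)
    have Ba: "B.sh (- int j) (deg_zero v) a = scal E (\<phi> (unif y powi (- q))) v" for v
      using a by (simp add: shift_def coeff_at_def deg_zero_def q_def)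
    have mem: "shift p (root_order X p) (scal E) (int a) (deg_zero (scal E (\<phi> (unif y powi (- q))) v)) \<in> atl \<E> p
        \<longleftrightarrow> v \<in> filZ X E p (int j)" if p: "p \<in> Q.P.ext" for p v
    proof -
      have pX: "p \<in> points X" using p Q.fiber by (auto simp: fiber_def)
      interpret M: atlas_module "scal E" p "root_order X p" "gen E" "atl \<E> p" by (rule module[OF pX])
      let ?r = "root_order X p" and ?e = "int (ram_index \<phi> p)"
      \<comment> \<open>the unit by which the two uniformizers differ, to the power \<open>- q\<close>\<close>
      define c where "c = \<phi> (unif y powi (- q)) * unif p powi (?e * q)"
      have nz: "\<phi> (unif y powi (- q)) \<noteq> 0" "unif p \<noteq> 0" using Q.P.unif_y(2) M.w0 by (simp_all add: phi_simps)
      have "val p (\<phi> (unif y powi (- q))) = - (?e * q)"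
        using Q.P.val_phi[OF p] Q.P.unif_y(2) by (simp add: val_powi[OF Q.P.y Q.P.unif_y(2)] val_unif[OF Q.P.y])
      then have u: "unit_of p c"
        using nz by (simp add: unit_of_iff_val[OF M.d] c_def val_mult[OF M.d] val_powi[OF M.d] val_unif[OF M.d])
      have "\<phi> (unif y powi (- q)) = c * unif p powi (- (?e * q))" using nz by (simp add: c_def power_int_minus)
      then have "deg_zero (scal E (\<phi> (unif y powi (- q))) v) = (\<lambda>i. scal E c (scal E (unif p powi (- (?e * q))) (deg_zero v i)))"
        by (simp add: M.deg_zero_scale)
      also have "(\<lambda>i. scal E (unif p powi (- (?e * q))) (deg_zero v i)) = M.sh (- (?e * q) * int ?r) (deg_zero v)"
        by (rule M.shift_multiple[symmetric, of _ UNIV], rule M.deg_zero_trunc) auto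
      then have "(\<lambda>i. scal E c (scal E (unif p powi (- (?e * q))) (deg_zero v i))) = (\<lambda>i. scal E c (M.sh (- (?e * q) * int ?r) (deg_zero v) i))"
        by metis
      finally have "M.sh (int a) (deg_zero (scal E (\<phi> (unif y powi (- q))) v)) =
          (\<lambda>i. scal E c (M.sh (int a + - (?e * q) * int ?r) (deg_zero v) i))"
        by (simp only: M.shift_scale M.shift_shift)
      also have "int a + - (?e * q) * int ?r = - int j" using aq Q.s_eq[OF p] by (simp add: algebra_simps)
      finally show ?thesis by (simp only: M.scale_unit_iff[OF u] filZ_atlas[OF pX])
    qed
    have zero: "shift p (root_order X p) (scal E) n (deg_zero 0) \<in> atl \<E> p" if p: "p \<in> Q.P.ext" for p n
    proof -
      have pX: "p \<in> points X" using p Q.fiber by (auto simp: fiber_def)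
      interpret M: atlas_module "scal E" p "root_order X p" "gen E" "atl \<E> p" by (rule module[OF pX])
      have "deg_zero (0 :: 'v) = 0" by (simp add: deg_zero_def fun_eq_iff)
      then show ?thesis using M.zero M.shift_zero by simp
    qed
    have "B.sh (- int j) (deg_zero v) \<in> atl D y \<longleftrightarrow> v \<in> Q.FZ (int j)" for v
    proof -
      let ?m = "B.sh (- int j) (deg_zero v)"
      have "(\<forall>i<Q.s. \<forall>p\<in>Q.P.ext. shift p (root_order X p) (scal E) (int i) (deg_zero (?m i)) \<in> atl \<E> p) \<longleftrightarrow>
          (\<forall>p\<in>Q.P.ext. shift p (root_order X p) (scal E) (int a) (deg_zero (?m a)) \<in> atl \<E> p)"
      proof
        assume A: "\<forall>p\<in>Q.P.ext. shift p (root_order X p) (scal E) (int a) (deg_zero (?m a)) \<in> atl \<E> p"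
        show "\<forall>i<Q.s. \<forall>p\<in>Q.P.ext. shift p (root_order X p) (scal E) (int i) (deg_zero (?m i)) \<in> atl \<E> p"
        proof (intro allI impI ballI)
          fix i p assume "p \<in> Q.P.ext"
          then show "shift p (root_order X p) (scal E) (int i) (deg_zero (?m i)) \<in> atl \<E> p"
            using A zero B0[of i v] by (cases "i = a") auto
        qed
      qed (use a(1) in blast)
      also have "\<dots> \<longleftrightarrow> v \<in> Q.FZ (int j)" unfolding Ba Q.FZ_def using mem by simp
      finally have iff: "(\<forall>i<Q.s. \<forall>p\<in>Q.P.ext. shift p (root_order X p) (scal E) (int i) (deg_zero (?m i)) \<in> atl \<E> p)
        \<longleftrightarrow> v \<in> Q.FZ (int j)" .
      have "?m \<in> trunc Q.s (gen E)" if "v \<in> Q.FZ (int j)"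
      proof -
        have v: "v \<in> gen E" by (rule Q.FZ_gen[OF that])
        have "?m i \<in> gen E" for i
          using B0[of i v] Ba[of v] V.subspace_0[OF gen_E] V.subspace_scale[OF gen_E v] by (cases "i = a") auto
        then show ?thesis by (auto simp: trunc_def B.shift_trunc)
      qed
      then show ?thesis unfolding atl_direct_image[OF y] Q.fiber iff by blast
    qed
    then show ?thesis by blast
  qed
  also have "\<dots> = fil F y j" by (rule Q.fil_F[symmetric])
  finally show ?thesis .
qed

end

theorem corollary3p4:
  fixes X :: "'k::field curve" and Y :: "'l::field curve" and \<phi> :: "'l \<Rightarrow> 'k"
    and ftilde :: "('l, 'k) root_map"
    and \<L> :: "('l, 'w::ab_group_add) root_bundle" and L :: "('l, 'w) par_bundle"
    and \<E> :: "('k, 'v::ab_group_add) root_bundle" and E :: "('k, 'v) par_bundle"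
    and \<kappa> :: form_kind
    and \<psi> :: "(('v \<Rightarrow> 'v \<Rightarrow> 'k) \<Rightarrow> 'k) \<Rightarrow> ('w \<Rightarrow> 'k) \<Rightarrow> 'k"
    and \<psi>hat' \<psi>' :: "'v \<Rightarrow> (('v \<Rightarrow> 'k) \<Rightarrow> (('w \<Rightarrow> 'k) \<Rightarrow> 'k) \<Rightarrow> 'k) \<Rightarrow> 'k"
  assumes X: "marked_curve X" and Y: "marked_curve Y"
    and f: "finite_map X Y \<phi>"
    and preimage: "(\<Union>y\<in>set (marks Y). fiber X \<phi> y) = ram_locus X \<phi> \<union> set (marks X)"
    and orders: "\<And>y p. y \<in> set (marks Y) \<Longrightarrow> p \<in> fiber X \<phi> y \<Longrightarrow>
                   root_order Y y = root_order X p * ram_index \<phi> p"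
    and ftilde: "root_stack_map X Y \<phi> ftilde" "root_map_etale X Y \<phi> ftilde"
    and L: "par_line_bundle Y L" "par_degree Y L = 0"
    and \<L>: "root_vector_bundle Y \<L>" "borne_corresponds Y \<L> L"
    and \<E>: "root_vector_bundle X \<E>" "borne_corresponds X \<E> E"
    and \<psi>: "par_form X \<kappa> (par_pullback X Y \<phi> L) E \<psi>"
    and \<psi>hat': "\<And>v. v \<in> gen E \<Longrightarrow> \<psi>hat' v = induced_map E (par_pullback X Y \<phi> L) \<psi> v"
    and \<psi>': "root_iso X \<E> (root_tensor X (root_dual X \<E>) (root_pullback X Y \<phi> ftilde \<L>)) \<psi>'"
    and corr: "\<And>v. v \<in> gen E \<Longrightarrow> \<psi>' v = \<psi>hat' v"
  shows "par_form_bundle Y \<kappa> L (par_direct_image X \<phi> E) (direct_image_form \<phi> E L \<psi>hat') \<and>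
    par_form_bundle Y \<kappa> L (borne Y (root_direct_image X Y \<phi> ftilde \<E>))
      (direct_image_form \<phi> \<E> \<L> \<psi>') \<and>
    (\<exists>\<alpha>. par_form_iso Y L
       (par_direct_image X \<phi> E) (direct_image_form \<phi> E L \<psi>hat')
       (borne Y (root_direct_image X Y \<phi> ftilde \<E>)) (direct_image_form \<phi> \<E> \<L> \<psi>') \<alpha>)"
proof -
  interpret covering X Y \<phi> by (rule coveringI[OF X Y f preimage orders])
  have "parabolic_bundle X E" using \<psi> by (simp add: par_form_def)
  then interpret covering_stack X Y \<phi> E ftilde \<E> by unfold_locales (use ftilde \<E> in auto)
  let ?G = "borne Y D"
  have G: "scal ?G = scal F" "gen ?G = gen F"
    by (simp_all add: borne_def root_direct_image_def par_direct_image_def \<E>_simps)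
  note G = G fil_borne_direct_image
  have \<theta>: "direct_image_form \<phi> E L \<psi>hat' v = direct_image_form \<phi> E L (induced_map E (par_pullback X Y \<phi> L) \<psi>) v"
    if "v \<in> gen E" for v
    by (rule direct_image_form_cong) (use \<psi>hat'[OF that] in auto)
  have \<theta>': "direct_image_form \<phi> \<E> \<L> \<psi>' v = direct_image_form \<phi> E L \<psi>hat' v" if "v \<in> gen E" for v
    by (rule direct_image_form_cong) (use corr[OF that] \<E>(2) \<L>(2) in \<open>auto simp: borne_corresponds_def\<close>)
  have "par_form_iso Y L F (direct_image_form \<phi> E L \<psi>hat') ?G (direct_image_form \<phi> \<E> \<L> \<psi>') id"
  proof -
    have "par_morphism Y F ?G id" "par_morphism Y ?G F id"
      using G by (auto simp: par_morphism_def linear_on_def)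
    then have "par_iso Y F ?G id" unfolding par_iso_def by auto
    then show ?thesis unfolding par_form_iso_def using \<theta>' by (simp add: F_simps)
  qed
  moreover have "par_form_bundle Y \<kappa> L F (direct_image_form \<phi> E L \<psi>hat')"
    by (rule par_form_direct_image[OF L(1) \<psi> \<theta>]) auto
  moreover have "par_form_bundle Y \<kappa> L ?G (direct_image_form \<phi> \<E> \<L> \<psi>')"
    by (rule par_form_direct_image[OF L(1) \<psi> _ G]) (use \<theta> \<theta>' in auto)
  ultimately show ?thesis by blast
qed

end
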